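(* Let $K$ be a $\sigma$-field and let $L$ be a finitely $\sigma$-generated $\sigma$-field extension of $K$ such that the field extension $L|K$ is Galois. Then there exist an integer $n\geq 0$ and a chain of intermediate $\sigma$-fields $$K\subset L_0\subset L_1\subset\cdots\subset L_{n-1}\subset L_n\subset L$$ such that $L_0=\pi_0^\sigma(L|K)$, $L_i$ is benign over $L_{i-1}$ for $i=1,\ldots,n$, and $L$ is $\sigma$-radicial over $L_n$.
   Context: All rings are commutative. A $\sigma$-ring is a ring $R$ with a ring endomorphism $\sigma\colon R\to R$ (not assumed injective); a $\sigma$-field is a $\sigma$-ring whose underlying ring is a field. A $\sigma$-field extension $L|K$ is a field extension of $\sigma$-fields such that $\sigma$ on $L$ restricts to $\sigma$ on $K$; an intermediate $\sigma$-field is an intermediate field stable under $\sigma$. For a subset $F\subset L$, $K\langle F\rangle$ denotes the smallest $\sigma$-subfield of $L$ containing $K$ and $F$, i.e. the field generated over $K$ by all $\sigma^i(f)$, $i\in\mathbb{N}$, $f\in F$. $L|K$ is finitely $\sigma$-generated if $L=K\langle F\rangle$ for some finite $F$. Galois extensions are not assumed finite. For a $\sigma$-field $K$, a $K$-$\sigma$-algebra is a $\sigma$-ring $R$ with a $\sigma$-equivariant ring morphism $K\to R$. $R$ is $\sigma$-separable over $K$ if $\sigma$ is injective on $R\otimes_K K'$ (with $\sigma(r\otimes a)=\sigma(r)\otimes\sigma(a)$) for every $\sigma$-field extension $K'|K$. $R$ is strongly $\sigma$-étale over $K$ if it is $\sigma$-separable over $K$ and étale as a $K$-algebra (i.e.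 $R\otimes_K\overline{K}$ is isomorphic to a finite product of copies of $\overline{K}$). The strong core $\pi_0^\sigma(L|K)$ is the union of all strongly $\sigma$-étale $K$-$\sigma$-subalgebras of $L$ (it is an intermediate $\sigma$-field of $L|K$). Limit degree: if $L=K\langle F\rangle$ with $F$ finite, let $d_i=[K(F,\sigma(F),\ldots,\sigma^i(F)):K(F,\sigma(F),\ldots,\sigma^{i-1}(F))]$. The sequence $(d_i)$ is non-increasing, and its eventual value $\operatorname{ld}(L|K)=\lim_{i\to\infty}d_i$ does not depend on $F$. An extension of $\sigma$-fields $L|K$ is benign if there is an intermediate field $K\subset M\subset L$ such that $M|K$ is finite Galois, $L=K\langle M\rangle$ and $\operatorname{ld}(L|K)=[M:K]$. An extension of $\sigma$-fields $L|K$ is $\sigma$-radicial if for every $a\in L$ there exists $n\in\mathbb{N}$ with $\sigma^n(a)\in K$. *)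

theory Defs
  imports "HOL-Algebra.Algebra" "HOL-Library.Extended_Nat"
begin

section \<open>Tensor products of commutative algebras\<close>

text \<open>
  For ring homomorphisms \<open>f : K \<rightarrow> R\<close> and \<open>g : K \<rightarrow> S\<close>, the tensor product of \<open>R\<close> and \<open>S\<close> over \<open>K\<close>
  consists of the classes of formal sums of pure tensors (multisets of pairs) under the least
  additive congruence that makes pairs biadditive and \<open>K\<close>-balanced.  The two rules for zero are
  needed because a multiset has no negative.
\<close>

inductive tensor_eq ::
    "('k, 'm) ring_scheme \<Rightarrow> ('k \<Rightarrow> 'r) \<Rightarrow> ('r, 'n) ring_scheme \<Rightarrow> ('k \<Rightarrow> 's) \<Rightarrow> ('s, 'p) ring_scheme
      \<Rightarrow> ('r \<times> 's) multiset \<Rightarrow> ('r \<times> 's) multiset \<Rightarrow> bool"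
  for K f R g S where
    refl: "set_mset M \<subseteq> carrier R \<times> carrier S \<Longrightarrow> tensor_eq K f R g S M M"
  | sym: "tensor_eq K f R g S M N \<Longrightarrow> tensor_eq K f R g S N M"
  | trans: "tensor_eq K f R g S M N \<Longrightarrow> tensor_eq K f R g S N P \<Longrightarrow> tensor_eq K f R g S M P"
  | add: "tensor_eq K f R g S M M' \<Longrightarrow> tensor_eq K f R g S N N'
          \<Longrightarrow> tensor_eq K f R g S (M + N) (M' + N')"
  | zero_left: "b \<in> carrier S \<Longrightarrow> tensor_eq K f R g S {# (\<zero>\<^bsub>R\<^esub>, b) #} {#}"
  | zero_right: "a \<in> carrier R \<Longrightarrow> tensor_eq K f R g S {# (a, \<zero>\<^bsub>S\<^esub>) #} {#}"
  | add_left: "a \<in> carrier R \<Longrightarrow> a' \<in> carrier R \<Longrightarrow> b \<in> carrier S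
          \<Longrightarrow> tensor_eq K f R g S {# (a \<oplus>\<^bsub>R\<^esub> a', b) #} {# (a, b), (a', b) #}"
  | add_right: "a \<in> carrier R \<Longrightarrow> b \<in> carrier S \<Longrightarrow> b' \<in> carrier S
          \<Longrightarrow> tensor_eq K f R g S {# (a, b \<oplus>\<^bsub>S\<^esub> b') #} {# (a, b), (a, b') #}"
  | balanced: "c \<in> carrier K \<Longrightarrow> a \<in> carrier R \<Longrightarrow> b \<in> carrier S
          \<Longrightarrow> tensor_eq K f R g S {# (f c \<otimes>\<^bsub>R\<^esub> a, b) #} {# (a, g c \<otimes>\<^bsub>S\<^esub> b) #}"

definition tensor_class ::
    "('k, 'm) ring_scheme \<Rightarrow> ('k \<Rightarrow> 'r) \<Rightarrow> ('r, 'n) ring_scheme \<Rightarrow> ('k \<Rightarrow> 's) \<Rightarrow> ('s, 'p) ring_scheme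
      \<Rightarrow> ('r \<times> 's) multiset \<Rightarrow> ('r \<times> 's) multiset set"
  where "tensor_class K f R g S M = {N. tensor_eq K f R g S M N}"

definition formal_mult ::
    "('r, 'n) ring_scheme \<Rightarrow> ('s, 'p) ring_scheme
      \<Rightarrow> ('r \<times> 's) multiset \<Rightarrow> ('r \<times> 's) multiset \<Rightarrow> ('r \<times> 's) multiset"
  where "formal_mult R S M N =
    (\<Sum>p\<in>#M. image_mset (\<lambda>q. (fst p \<otimes>\<^bsub>R\<^esub> fst q, snd p \<otimes>\<^bsub>S\<^esub> snd q)) N)"

definition tensor ::
    "('k, 'm) ring_scheme \<Rightarrow> ('k \<Rightarrow> 'r) \<Rightarrow> ('r, 'n) ring_scheme \<Rightarrow> ('k \<Rightarrow> 's) \<Rightarrow> ('s, 'p) ring_scheme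
      \<Rightarrow> (('r \<times> 's) multiset set) ring"
  where "tensor K f R g S =
    \<lparr> carrier = tensor_class K f R g S ` {M. set_mset M \<subseteq> carrier R \<times> carrier S},
      monoid.mult = (\<lambda>U V. \<Union>M\<in>U. \<Union>N\<in>V. tensor_class K f R g S (formal_mult R S M N)),
      one = tensor_class K f R g S {# (\<one>\<^bsub>R\<^esub>, \<one>\<^bsub>S\<^esub>) #},
      ring.zero = tensor_class K f R g S {#},
      add = (\<lambda>U V. \<Union>M\<in>U. \<Union>N\<in>V. tensor_class K f R g S (M + N)) \<rparr>"

text \<open>The map \<open>r \<otimes> s \<mapsto> \<phi> r \<otimes> \<psi> s\<close> on classes.\<close>

definition tensor_map ::
    "('k, 'm) ring_scheme \<Rightarrow> ('k \<Rightarrow> 'r) \<Rightarrow> ('r, 'n) ring_scheme \<Rightarrow> ('k \<Rightarrow> 's) \<Rightarrow> ('s, 'p) ring_scheme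
      \<Rightarrow> ('r \<Rightarrow> 'r) \<Rightarrow> ('s \<Rightarrow> 's) \<Rightarrow> ('r \<times> 's) multiset set \<Rightarrow> ('r \<times> 's) multiset set"
  where "tensor_map K f R g S \<phi> \<psi> U =
    (\<Union>M\<in>U. tensor_class K f R g S (image_mset (map_prod \<phi> \<psi>) M))"


section \<open>Difference rings and fields\<close>

definition sigma_ring :: "('a, 'm) ring_scheme \<Rightarrow> ('a \<Rightarrow> 'a) \<Rightarrow> bool"
  where "sigma_ring R \<phi> \<longleftrightarrow> cring R \<and> \<phi> \<in> ring_hom R R"

definition sigma_field :: "('a, 'm) ring_scheme \<Rightarrow> ('a \<Rightarrow> 'a) \<Rightarrow> bool"
  where "sigma_field R \<phi> \<longleftrightarrow> sigma_ring R \<phi> \<and> field R"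

definition sigma_hom ::
    "('a, 'm) ring_scheme \<Rightarrow> ('a \<Rightarrow> 'a) \<Rightarrow> ('b, 'n) ring_scheme \<Rightarrow> ('b \<Rightarrow> 'b) \<Rightarrow> ('a \<Rightarrow> 'b) set"
  where "sigma_hom R \<phi> S \<psi> = {h \<in> ring_hom R S. \<forall>x\<in>carrier R. h (\<phi> x) = \<psi> (h x)}"

definition sigma_subfield :: "('a, 'm) ring_scheme \<Rightarrow> ('a \<Rightarrow> 'a) \<Rightarrow> 'a set \<Rightarrow> bool"
  where "sigma_subfield L \<phi> K \<longleftrightarrow> subfield K L \<and> \<phi> ` K \<subseteq> K"

text \<open>\<open>sigma_gen L \<phi> K F\<close> is the difference field generated by \<open>F\<close> over \<open>K\<close> inside \<open>L\<close>.\<close>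

definition sigma_gen :: "('a, 'm) ring_scheme \<Rightarrow> ('a \<Rightarrow> 'a) \<Rightarrow> 'a set \<Rightarrow> 'a set \<Rightarrow> 'a set"
  where "sigma_gen L \<phi> K F = generate_field L (K \<union> (\<Union>i. (\<phi> ^^ i) ` F))"

definition finitely_sigma_generated ::
    "('a, 'm) ring_scheme \<Rightarrow> ('a \<Rightarrow> 'a) \<Rightarrow> 'a set \<Rightarrow> 'a set \<Rightarrow> bool"
  where "finitely_sigma_generated L \<phi> K E \<longleftrightarrow>
    (\<exists>F. finite F \<and> F \<subseteq> E \<and> E = sigma_gen L \<phi> K F)"


section \<open>Strongly sigma-etale algebras and the strong core\<close>

text \<open>
  Difference field extensions \<open>(K', \<kappa>')\<close> of \<open>(K, \<kappa>)\<close> are given by equivariant homomorphisms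
  \<open>K \<rightarrow> K'\<close>.  As HOL cannot quantify over types inside a definition, \<open>K'\<close> is carried by the type
  \<open>'k list\<close>, which is infinite and at least as large as \<open>K\<close>.  This loses nothing: lemma
  \<open>sigma_separable_any_type\<close> below derives injectivity for extensions \<open>K'\<close> in an arbitrary type.
\<close>

definition sigma_separable ::
    "('k, 'm) ring_scheme \<Rightarrow> ('k \<Rightarrow> 'k) \<Rightarrow> ('k \<Rightarrow> 'r) \<Rightarrow> ('r, 'n) ring_scheme \<Rightarrow> ('r \<Rightarrow> 'r) \<Rightarrow> bool"
  where "sigma_separable K \<kappa> f R \<phi> \<longleftrightarrow>
    (\<forall>(K' :: 'k list ring) \<kappa>' g. sigma_field K' \<kappa>' \<and> g \<in> sigma_hom K \<kappa> K' \<kappa>' \<longrightarrow>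
       inj_on (tensor_map K f R g K' \<phi> \<kappa>') (carrier (tensor K f R g K')))"

text \<open>
  The isomorphism is one of algebras over the algebraic closure \<open>C\<close>: it sends \<open>1 \<otimes> a\<close> to
  \<open>(a, \<dots>, a)\<close>.  A mere ring isomorphism would be too weak, as \<open>C\<close> may be isomorphic to a proper
  extension field of itself.
\<close>

definition etale_algebra ::
    "('k, 'm) ring_scheme \<Rightarrow> ('k \<Rightarrow> 'r) \<Rightarrow> ('r, 'n) ring_scheme \<Rightarrow> bool"
  where "etale_algebra K f R \<longleftrightarrow>
    (let C = field.alg_closure K; c = ring.indexed_const K in
     \<exists>n h. h \<in> ring_iso (tensor K f R c C) (RDirProd_list (replicate n C)) \<and>
       (\<forall>a\<in>carrier C. h (tensor_class K f R c C {# (\<one>\<^bsub>R\<^esub>, a) #}) = replicate n a))"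

definition strongly_sigma_etale ::
    "('k, 'm) ring_scheme \<Rightarrow> ('k \<Rightarrow> 'k) \<Rightarrow> ('k \<Rightarrow> 'r) \<Rightarrow> ('r, 'n) ring_scheme \<Rightarrow> ('r \<Rightarrow> 'r) \<Rightarrow> bool"
  where "strongly_sigma_etale K \<kappa> f R \<phi> \<longleftrightarrow> sigma_separable K \<kappa> f R \<phi> \<and> etale_algebra K f R"

definition strong_core :: "('a, 'm) ring_scheme \<Rightarrow> ('a \<Rightarrow> 'a) \<Rightarrow> 'a set \<Rightarrow> 'a set \<Rightarrow> 'a set"
  where "strong_core L \<phi> K E =
    \<Union>{A. subring A L \<and> K \<subseteq> A \<and> A \<subseteq> E \<and> \<phi> ` A \<subseteq> A \<and>
         strongly_sigma_etale (L\<lparr>carrier := K\<rparr>) \<phi> id (L\<lparr>carrier := A\<rparr>) \<phi>}"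


section \<open>Galois, benign and sigma-radicial extensions\<close>

text \<open>
  Algebraic, normal (minimal polynomials of elements of \<open>E\<close> split over \<open>E\<close>) and separable (these
  polynomials have no multiple root; all their roots are in \<open>E\<close> by normality).
\<close>

definition galois_extension :: "('a, 'm) ring_scheme \<Rightarrow> 'a set \<Rightarrow> 'a set \<Rightarrow> bool"
  where "galois_extension L K E \<longleftrightarrow>
    (\<forall>x\<in>E. ring.algebraic L K x \<and>
       ring.splitted (L\<lparr>carrier := E\<rparr>) (ring.Irr L K x) \<and>
       (\<forall>y. count (ring.roots (L\<lparr>carrier := E\<rparr>) (ring.Irr L K x)) y \<le> 1))"

definition ext_degree :: "('a, 'm) ring_scheme \<Rightarrow> 'a set \<Rightarrow> 'a set \<Rightarrow> enat"
  where "ext_degree L K E = (if ring.finite_dimension L K E then enat (ring.dim L K E) else \<infinity>)"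

definition partial_gen :: "('a, 'm) ring_scheme \<Rightarrow> ('a \<Rightarrow> 'a) \<Rightarrow> 'a set \<Rightarrow> 'a set \<Rightarrow> nat \<Rightarrow> 'a set"
  where "partial_gen L \<phi> K F i = generate_field L (K \<union> (\<Union>j<i. (\<phi> ^^ j) ` F))"

text \<open>
  The number \<open>d\<^sub>i\<close> is the degree of \<open>partial_gen L \<phi> K F (i + 1)\<close> over \<open>partial_gen L \<phi> K F i\<close>.
  The eventual value of this sequence is the same for all finite generating sets \<open>F\<close>.
\<close>

definition limit_degree :: "('a, 'm) ring_scheme \<Rightarrow> ('a \<Rightarrow> 'a) \<Rightarrow> 'a set \<Rightarrow> 'a set \<Rightarrow> enat"
  where "limit_degree L \<phi> K E =
    (THE d. \<exists>F. finite F \<and> F \<subseteq> E \<and> E = sigma_gen L \<phi> K F \<and>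
       (\<forall>\<^sub>F i in sequentially.
          ext_degree L (partial_gen L \<phi> K F i) (partial_gen L \<phi> K F (Suc i)) = d))"

definition benign :: "('a, 'm) ring_scheme \<Rightarrow> ('a \<Rightarrow> 'a) \<Rightarrow> 'a set \<Rightarrow> 'a set \<Rightarrow> bool"
  where "benign L \<phi> K E \<longleftrightarrow>
    (\<exists>M. subfield M L \<and> K \<subseteq> M \<and> M \<subseteq> E \<and>
       ring.finite_dimension L K M \<and> galois_extension L K M \<and>
       E = sigma_gen L \<phi> K M \<and> limit_degree L \<phi> K E = ext_degree L K M)"

definition sigma_radicial :: "('a \<Rightarrow> 'a) \<Rightarrow> 'a set \<Rightarrow> 'a set \<Rightarrow> bool"
  where "sigma_radicial \<phi> K E \<longleftrightarrow> (\<forall>a\<in>E. \<exists>n. (\<phi> ^^ n) a \<in> K)"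


section \<open>Separability does not depend on the type carrying the extensions\<close>

lemma tensor_class_eq_iff:
  assumes "set_mset M \<subseteq> carrier R \<times> carrier S"
  shows "tensor_class K f R g S M = tensor_class K f R g S N \<longleftrightarrow> tensor_eq K f R g S M N"
  unfolding tensor_class_def set_eq_iff mem_Collect_eq
  using assms tensor_eq.refl tensor_eq.sym tensor_eq.trans by metis

text \<open>Functoriality in \<open>R\<close>, \<open>S\<close> and semilinearly in \<open>K\<close>.\<close>

lemma tensor_eq_image:
  assumes "tensor_eq K f R g S M N" "ring R" "ring S"
    "f \<in> carrier K \<rightarrow> carrier R" "g \<in> carrier K \<rightarrow> carrier S"
    and "\<kappa> \<in> carrier K \<rightarrow> carrier K'" "p \<in> ring_hom R R'" "q \<in> ring_hom S S'"
    and "p \<zero>\<^bsub>R\<^esub> = \<zero>\<^bsub>R'\<^esub>" "q \<zero>\<^bsub>S\<^esub> = \<zero>\<^bsub>S'\<^esub>"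
    and "\<And>c. c \<in> carrier K \<Longrightarrow> p (f c) = f' (\<kappa> c)" "\<And>c. c \<in> carrier K \<Longrightarrow> q (g c) = g' (\<kappa> c)"
  shows "tensor_eq K' f' R' g' S' (image_mset (map_prod p q) M) (image_mset (map_prod p q) N)"
  using assms(1)
proof induction
  case (refl M)
  then show ?case
    by (intro tensor_eq.refl)
      (use assms(7,8) in \<open>auto simp: ring_hom_def dest!: subsetD\<close>)
next
  case (balanced c a b)
  have fg: "f c \<in> carrier R" "g c \<in> carrier S" "\<kappa> c \<in> carrier K'"
    using assms(4-6) balanced(1) by auto
  have "p (f c \<otimes>\<^bsub>R\<^esub> a) = f' (\<kappa> c) \<otimes>\<^bsub>R'\<^esub> p a" "q (g c \<otimes>\<^bsub>S\<^esub> b) = g' (\<kappa> c) \<otimes>\<^bsub>S'\<^esub> q b"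
    using assms(7,8,11,12) fg balanced by (auto simp: ring_hom_mult)
  then show ?case
    using tensor_eq.balanced[of "\<kappa> c" K' "p a" R' "q b" S' f' g'] fg balanced assms(7,8)
    by (auto simp: ring_hom_def)
next
  case (add_left a a' b)
  then show ?case
    using tensor_eq.add_left[of "p a" R' "p a'" "q b" S' K' f' g'] assms(7,8)
    by (auto simp: ring_hom_def)
next
  case (add_right a b b')
  then show ?case
    using tensor_eq.add_right[of "p a" R' "q b" S' "q b'" K' f' g'] assms(7,8)
    by (auto simp: ring_hom_def)
qed (use assms(7-10) in \<open>auto simp: ring_hom_def intro: tensor_eq.intros dest!: funcset_mem\<close>)

lemma tensor_map_class:
  assumes "ring R" "ring S" "f \<in> ring_hom K R" "g \<in> ring_hom K S"
    and "\<kappa> \<in> ring_hom K K" "\<phi> \<in> ring_hom R R" "\<psi> \<in> ring_hom S S"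
    and "\<forall>c\<in>carrier K. \<phi> (f c) = f (\<kappa> c)" "\<forall>c\<in>carrier K. \<psi> (g c) = g (\<kappa> c)"
    and "set_mset M \<subseteq> carrier R \<times> carrier S"
  shows "tensor_map K f R g S \<phi> \<psi> (tensor_class K f R g S M) =
    tensor_class K f R g S (image_mset (map_prod \<phi> \<psi>) M)"
proof -
  have zero: "\<phi> \<zero>\<^bsub>R\<^esub> = \<zero>\<^bsub>R\<^esub>" "\<psi> \<zero>\<^bsub>S\<^esub> = \<zero>\<^bsub>S\<^esub>"
    using assms by (auto intro!: ring_hom_zero)
  have im: "tensor_eq K f R g S (image_mset (map_prod \<phi> \<psi>) M) (image_mset (map_prod \<phi> \<psi>) N)"
    if "tensor_eq K f R g S M N" for N
    by (rule tensor_eq_image[OF that])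
      (use assms(1-9) zero in \<open>auto simp: ring_hom_def\<close>)
  have "tensor_class K f R g S (image_mset (map_prod \<phi> \<psi>) N)
      = tensor_class K f R g S (image_mset (map_prod \<phi> \<psi>) M)"
    if "N \<in> tensor_class K f R g S M" for N
    using im[of N] that unfolding tensor_class_def
    by (auto intro: tensor_eq.trans tensor_eq.sym)
  moreover have "M \<in> tensor_class K f R g S M"
    using assms(10) by (auto simp: tensor_class_def intro: tensor_eq.refl)
  ultimately show ?thesis
    unfolding tensor_map_def by blast
qed

lemma inj_on_tensor_map_iff:
  assumes "ring R" "ring S" "f \<in> ring_hom K R" "g \<in> ring_hom K S"
    and "\<kappa> \<in> ring_hom K K" "\<phi> \<in> ring_hom R R" "\<psi> \<in> ring_hom S S"
    and "\<forall>c\<in>carrier K. \<phi> (f c) = f (\<kappa> c)" "\<forall>c\<in>carrier K. \<psi> (g c) = g (\<kappa> c)"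
  shows "inj_on (tensor_map K f R g S \<phi> \<psi>) (carrier (tensor K f R g S)) \<longleftrightarrow>
    (\<forall>M N. set_mset M \<subseteq> carrier R \<times> carrier S \<longrightarrow> set_mset N \<subseteq> carrier R \<times> carrier S \<longrightarrow>
       tensor_eq K f R g S (image_mset (map_prod \<phi> \<psi>) M) (image_mset (map_prod \<phi> \<psi>) N) \<longrightarrow>
       tensor_eq K f R g S M N)" (is "?L \<longleftrightarrow> ?R")
proof -
  have cl: "set_mset (image_mset (map_prod \<phi> \<psi>) M) \<subseteq> carrier R \<times> carrier S"
    if "set_mset M \<subseteq> carrier R \<times> carrier S" for M
    using that assms(6,7) by (fastforce simp: ring_hom_def)
  have "?L \<longleftrightarrow> (\<forall>M N. set_mset M \<subseteq> carrier R \<times> carrier S \<longrightarrow> set_mset N \<subseteq> carrier R \<times> carrier S \<longrightarrow>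
       tensor_class K f R g S (image_mset (map_prod \<phi> \<psi>) M) =
       tensor_class K f R g S (image_mset (map_prod \<phi> \<psi>) N) \<longrightarrow>
       tensor_class K f R g S M = tensor_class K f R g S N)"
    unfolding inj_on_def tensor_def ring.simps partial_object.simps
    by (auto simp: tensor_map_class[OF assms])
  also have "\<dots> \<longleftrightarrow> ?R"
    using tensor_class_eq_iff[OF cl] tensor_class_eq_iff by metis
  finally show ?thesis .
qed

lemma tensor_eq_finite_support:
  assumes "tensor_eq K f R g S M N"
  shows "\<exists>Z. finite Z \<and> Z \<subseteq> carrier S \<and>
    (\<forall>T. Z \<subseteq> T \<longrightarrow> tensor_eq K f R g (S\<lparr>carrier := T\<rparr>) M N)"
  using assms
proof induction
  case (refl M)
  then show ?case
    by (intro exI[of _ "snd ` set_mset M"]) (auto intro!: tensor_eq.refl)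
next
  case (sym M N)
  then show ?case by (meson tensor_eq.sym)
next
  case (trans M N P)
  then obtain Z Y where "finite Z" "Z \<subseteq> carrier S" "finite Y" "Y \<subseteq> carrier S"
    "\<forall>T. Z \<subseteq> T \<longrightarrow> tensor_eq K f R g (S\<lparr>carrier := T\<rparr>) M N"
    "\<forall>T. Y \<subseteq> T \<longrightarrow> tensor_eq K f R g (S\<lparr>carrier := T\<rparr>) N P" by auto
  then show ?case
    using tensor_eq.trans[of K f R g "S\<lparr>carrier := T\<rparr>" M N P for T]
    by (intro exI[of _ "Z \<union> Y"]) auto
next
  case (add M M' N N')
  then obtain Z Y where "finite Z" "Z \<subseteq> carrier S" "finite Y" "Y \<subseteq> carrier S"
    "\<forall>T. Z \<subseteq> T \<longrightarrow> tensor_eq K f R g (S\<lparr>carrier := T\<rparr>) M M'"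
    "\<forall>T. Y \<subseteq> T \<longrightarrow> tensor_eq K f R g (S\<lparr>carrier := T\<rparr>) N N'" by auto
  then show ?case
    using tensor_eq.add[of K f R g "S\<lparr>carrier := T\<rparr>" M M' N N' for T]
    by (intro exI[of _ "Z \<union> Y"]) auto
next
  case (zero_left b)
  then show ?case
    by (intro exI[of _ "{b}"]) (auto intro!: tensor_eq.zero_left)
next
  case (zero_right a)
  then show ?case
    using tensor_eq.zero_right[of a R K f g "S\<lparr>carrier := T\<rparr>" for T]
    by (intro exI[of _ "{}"]) auto
next
  case (add_left a a' b)
  then show ?case
    by (intro exI[of _ "{b}"]) (auto intro!: tensor_eq.add_left)
next
  case (add_right a b b')
  then show ?case
    using tensor_eq.add_right[of a R b "S\<lparr>carrier := T\<rparr>" b' K f g for T]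
    by (intro exI[of _ "{b, b'}"]) auto
next
  case (balanced c a b)
  then show ?case
    using tensor_eq.balanced[of c K a R b "S\<lparr>carrier := T\<rparr>" f g for T]
    by (intro exI[of _ "{b}"]) auto
qed

context
  includes cardinal_syntax
begin

lemma small_sigma_subfield:
  fixes S :: "('b, 'm) ring_scheme" and \<kappa> :: "'b \<Rightarrow> 'b" and r :: "'c set"
  assumes "field S" "\<kappa> \<in> ring_hom S S" "B \<subseteq> carrier S" "infinite r" "|B| \<le>o |r|"
  shows "\<exists>T. B \<subseteq> T \<and> sigma_subfield S \<kappa> T \<and> |T| \<le>o |r|"
proof -
  interpret field S by fact
  define st where "st T = T \<union> insert \<one>\<^bsub>S\<^esub> (\<kappa> ` T \<union> (\<lambda>x. \<ominus>\<^bsub>S\<^esub> x) ` T \<union> (\<lambda>x. inv\<^bsub>S\<^esub> x) ` (T - {\<zero>\<^bsub>S\<^esub>})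
      \<union> (\<lambda>(x, y). x \<oplus>\<^bsub>S\<^esub> y) ` (T \<times> T) \<union> (\<lambda>(x, y). x \<otimes>\<^bsub>S\<^esub> y) ` (T \<times> T))" for T
  define U where "U n = (st ^^ n) B" for n
  define T where "T = (\<Union>n. U n)"
  have USuc: "U (Suc n) = st (U n)" for n by (simp add: U_def)
  have mono: "U m \<subseteq> U n" if "m \<le> n" for m n
    using that by (induction rule: dec_induct) (auto simp: USuc st_def)
  have sub: "U n \<subseteq> carrier S" for n
  proof (induction n)
    case 0 then show ?case using assms(3) by (simp add: U_def)
  next
    case (Suc n)
    have "inv\<^bsub>S\<^esub> x \<in> carrier S" if "x \<in> U n" "x \<noteq> \<zero>\<^bsub>S\<^esub>" for x
      using that Suc field_Units by auto
    then show ?case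
      using Suc assms(2) by (auto simp: USuc st_def ring_hom_def)
  qed
  have card: "|U n| \<le>o |r|" for n
  proof (induction n)
    case 0 then show ?case using assms(5) by (simp add: U_def)
  next
    case (Suc n)
    have t: "|U n \<times> U n| \<le>o |r|"
      by (rule card_of_Sigma_ordLeq_infinite[OF assms(4) Suc]) (use Suc in blast)
    have im: "|h ` A| \<le>o |r|" if "|A| \<le>o |r|" for h :: "'x \<Rightarrow> 'b" and A
      using card_of_image ordLeq_transitive that by blast
    have d: "|U n - {\<zero>\<^bsub>S\<^esub>}| \<le>o |r|"
      using card_of_mono1[of "U n - {\<zero>\<^bsub>S\<^esub>}" "U n"] Suc ordLeq_transitive by blast
    have un: "|A \<union> C| \<le>o |r|" if "|A| \<le>o |r|" "|C| \<le>o |r|" for A C :: "'b set"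
      using card_of_Un_ordLeq_infinite_Field[of "|r|" A C] that assms(4)
      by (simp add: card_of_Card_order)
    have one: "|{\<one>\<^bsub>S\<^esub>}| \<le>o |r|"
      by (rule ordLess_imp_ordLeq[OF finite_ordLess_infinite2]) (use assms(4) in auto)
    show ?case
      unfolding USuc st_def insert_is_Un[of "\<one>\<^bsub>S\<^esub>" "_ \<union> _"]
      by (intro un im t d one Suc)
  qed
  have "|T| \<le>o |r|"
    unfolding T_def using card assms(4)
    by (intro card_of_UNION_ordLeq_infinite[OF assms(4)]) (auto simp: infinite_iff_card_of_nat)
  moreover have "B \<subseteq> T" unfolding T_def U_def by (auto intro!: exI[of _ 0])
  moreover have "\<kappa> ` T \<subseteq> T"
  proof
    fix y assume "y \<in> \<kappa> ` T"
    then obtain n where "y \<in> \<kappa> ` U n" by (auto simp: T_def)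
    then have "y \<in> U (Suc n)" by (auto simp: USuc st_def)
    then show "y \<in> T" by (auto simp: T_def)
  qed
  moreover have "subfield T S"
  proof (rule subfieldI')
    have pair: "\<exists>n. x \<in> U n \<and> y \<in> U n" if "x \<in> T" "y \<in> T" for x y
      using that mono unfolding T_def by (metis UN_E nat_le_linear subsetD)
    show "subring T S"
    proof (rule subringI)
      show "T \<subseteq> carrier S" using sub by (auto simp: T_def)
      have "\<one>\<^bsub>S\<^esub> \<in> U (Suc 0)" by (simp add: USuc st_def)
      then show "\<one>\<^bsub>S\<^esub> \<in> T" by (auto simp: T_def)
    next
      fix h assume "h \<in> T"
      then obtain n where "h \<in> U n" by (auto simp: T_def)
      then have "\<ominus>\<^bsub>S\<^esub> h \<in> U (Suc n)" by (auto simp: USuc st_def)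
      then show "\<ominus>\<^bsub>S\<^esub> h \<in> T" by (auto simp: T_def)
    next
      fix x y assume "x \<in> T" "y \<in> T"
      then obtain n where "x \<in> U n" "y \<in> U n" using pair by blast
      then have "x \<otimes>\<^bsub>S\<^esub> y \<in> U (Suc n)" "x \<oplus>\<^bsub>S\<^esub> y \<in> U (Suc n)"
        by (force simp: USuc st_def)+
      then show "x \<otimes>\<^bsub>S\<^esub> y \<in> T" "x \<oplus>\<^bsub>S\<^esub> y \<in> T" by (auto simp: T_def)
    qed
  next
    fix k assume "k \<in> T - {\<zero>\<^bsub>S\<^esub>}"
    then obtain n where "k \<in> U n - {\<zero>\<^bsub>S\<^esub>}" by (auto simp: T_def)
    then have "inv\<^bsub>S\<^esub> k \<in> U (Suc n)" by (auto simp: USuc st_def)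
    then show "inv\<^bsub>S\<^esub> k \<in> T" by (auto simp: T_def)
  qed
  ultimately show ?thesis unfolding sigma_subfield_def by blast
qed

theorem sigma_separable_any_type:
  fixes K :: "('k, 'm) ring_scheme" and R :: "('r, 'n) ring_scheme" and S :: "('b, 'p) ring_scheme"
  assumes sep: "sigma_separable K \<kappa> f R \<phi>"
    and K: "sigma_field K \<kappa>" and R: "sigma_ring R \<phi>" and f: "f \<in> sigma_hom K \<kappa> R \<phi>"
    and S: "sigma_field S \<psi>" and g: "g \<in> sigma_hom K \<kappa> S \<psi>"
  shows "inj_on (tensor_map K f R g S \<phi> \<psi>) (carrier (tensor K f R g S))"
proof -
  have rings: "ring K" "ring R" "ring S" "field S" and homs: "\<kappa> \<in> ring_hom K K" "\<phi> \<in> ring_hom R R"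
      "\<psi> \<in> ring_hom S S" "f \<in> ring_hom K R" "g \<in> ring_hom K S"
    and equi: "\<forall>c\<in>carrier K. \<phi> (f c) = f (\<kappa> c)" "\<forall>c\<in>carrier K. \<psi> (g c) = g (\<kappa> c)"
    using K R S f g by (auto simp: sigma_field_def sigma_ring_def sigma_hom_def cring_def)
  have fc: "f \<in> carrier K \<rightarrow> carrier R" and gc: "g \<in> carrier K \<rightarrow> carrier S"
    using homs by (auto simp: ring_hom_def)
  show ?thesis
    unfolding inj_on_tensor_map_iff[OF rings(2,3) homs(4,5,1-3) equi]
  proof (intro allI impI)
    fix M N
    assume M: "set_mset M \<subseteq> carrier R \<times> carrier S" and N: "set_mset N \<subseteq> carrier R \<times> carrier S"
      and eq: "tensor_eq K f R g S (image_mset (map_prod \<phi> \<psi>) M) (image_mset (map_prod \<phi> \<psi>) N)"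
    obtain Z where Z: "finite Z" "Z \<subseteq> carrier S" and Zeq: "\<And>T. Z \<subseteq> T \<Longrightarrow>
        tensor_eq K f R g (S\<lparr>carrier := T\<rparr>) (image_mset (map_prod \<phi> \<psi>) M) (image_mset (map_prod \<phi> \<psi>) N)"
      using tensor_eq_finite_support[OF eq] by blast
    define B where "B = g ` carrier K \<union> (Z \<union> snd ` set_mset (M + N))"
    have B: "B \<subseteq> carrier S" using gc Z M N by (auto simp: B_def)
    have "|carrier K| \<le>o |UNIV :: 'k list set|"
      by (rule card_of_ordLeqI[of "\<lambda>x. [x]"]) (auto simp: inj_on_def)
    then have "|g ` carrier K| \<le>o |UNIV :: 'k list set|"
      using card_of_image ordLeq_transitive by blast
    moreover have "|Z \<union> snd ` set_mset (M + N)| \<le>o |UNIV :: 'k list set|"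
      by (rule ordLess_imp_ordLeq[OF finite_ordLess_infinite2]) (use Z infinite_UNIV_listI in auto)
    ultimately have "|B| \<le>o |UNIV :: 'k list set|"
      unfolding B_def using card_of_Un_ordLeq_infinite_Field[of "|UNIV :: 'k list set|"]
      by (simp add: infinite_UNIV_listI)
    from small_sigma_subfield[OF rings(4) homs(3) B infinite_UNIV_listI this]
    obtain T where T: "B \<subseteq> T" "sigma_subfield S \<psi> T" "|T| \<le>o |UNIV :: 'k list set|" by blast
    then obtain e :: "'b \<Rightarrow> 'k list" where e: "inj_on e T"
      unfolding card_of_ordLeq[symmetric] by blast
    let ?T = "S\<lparr>carrier := T\<rparr>"
    have subT: "subfield T S" "\<psi> ` T \<subseteq> T" "T \<subseteq> carrier S"
      using T(2) subfieldE(3) unfolding sigma_subfield_def by auto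
    have fieldT: "field ?T" using ring.subfield_iff(2)[OF rings(3) subT(1)] .
    have ringT: "ring ?T" using fieldT by (simp add: field_def domain_def cring_def)
    define K' where "K' = image_ring e ?T"
    have e': "inj_on e (carrier ?T)" using e by simp
    have fieldK': "field K'"
      unfolding K'_def by (rule field.inj_imp_image_ring_is_field[OF fieldT e'])
    have ringK': "ring K'" using fieldK' by (simp add: field_def domain_def cring_def)
    have iso: "e \<in> ring_iso ?T K'"
      unfolding K'_def by (rule inj_imp_image_ring_iso[OF e'])
    define i where "i = inv_into T e"
    have i: "i \<in> ring_iso K' ?T"
      using ring_iso_set_sym[OF ringT iso] by (simp add: i_def)
    have ie: "i (e x) = x" if "x \<in> T" for x using e that by (simp add: i_def)
    have eh: "e \<in> ring_hom ?T K'" and ih: "i \<in> ring_hom K' ?T" using iso i by (auto simp: ring_iso_def)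
    have carrK': "carrier K' = e ` T" using iso by (auto simp: ring_iso_def bij_betw_def)
    define \<kappa>' where "\<kappa>' = e \<circ> \<psi> \<circ> i"
    have psiT: "\<psi> \<in> ring_hom ?T ?T"
      using homs(3) subT by (auto simp: ring_hom_def subset_iff)
    have k'h: "\<kappa>' \<in> ring_hom K' K'"
      unfolding \<kappa>'_def using ring_hom_trans[OF ring_hom_trans[OF ih psiT] eh] by (simp add: comp_assoc)
    have gT: "g c \<in> T" if "c \<in> carrier K" for c using that T(1) by (auto simp: B_def)
    have ghT: "g \<in> ring_hom K ?T" using homs(5) gT by (auto simp: ring_hom_def)
    have egh: "e \<circ> g \<in> ring_hom K K'" using ring_hom_trans[OF ghT eh] .
    have eg_equi: "\<forall>c\<in>carrier K. \<kappa>' ((e \<circ> g) c) = (e \<circ> g) (\<kappa> c)"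
      using gT equi(2) by (simp add: \<kappa>'_def ie)
    have sf: "sigma_field K' \<kappa>'"
      using fieldK' k'h by (simp add: sigma_field_def sigma_ring_def field_def domain_def)
    have sh: "e \<circ> g \<in> sigma_hom K \<kappa> K' \<kappa>'"
      using egh eg_equi by (simp add: sigma_hom_def)
    have inj: "inj_on (tensor_map K f R (e \<circ> g) K' \<phi> \<kappa>') (carrier (tensor K f R (e \<circ> g) K'))"
      using sep sf sh unfolding sigma_separable_def by blast
    have zero: "e \<zero>\<^bsub>?T\<^esub> = \<zero>\<^bsub>K'\<^esub>" "i \<zero>\<^bsub>K'\<^esub> = \<zero>\<^bsub>S\<^esub>"
      using ring_hom_zero[OF eh ringT ringK'] ring_hom_zero[OF ih ringK' ringT] by auto
    have MT: "set_mset M \<subseteq> carrier R \<times> T" and NT: "set_mset N \<subseteq> carrier R \<times> T"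
      using M N T(1) by (force simp: B_def subset_iff)+
    have comm: "image_mset (map_prod id e) (image_mset (map_prod \<phi> \<psi>) P)
        = image_mset (map_prod \<phi> \<kappa>') (image_mset (map_prod id e) P)"
      if "set_mset P \<subseteq> carrier R \<times> T" for P
      unfolding image_mset.compositionality
      by (rule image_mset_cong) (use that in \<open>auto simp: \<kappa>'_def ie subset_iff\<close>)
    have idR: "id \<in> ring_hom R R" by (auto simp: ring_hom_def)
    have gcT: "g \<in> carrier K \<rightarrow> carrier ?T" using gT by simp
    have "tensor_eq K f R g ?T (image_mset (map_prod \<phi> \<psi>) M) (image_mset (map_prod \<phi> \<psi>) N)"
      using Zeq[of T] T(1) by (simp add: B_def)
    then have "tensor_eq K f R (e \<circ> g) K' (image_mset (map_prod id e) (image_mset (map_prod \<phi> \<psi>) M))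
        (image_mset (map_prod id e) (image_mset (map_prod \<phi> \<psi>) N))"
      by (rule tensor_eq_image[where \<kappa> = id, OF _ rings(2) ringT fc gcT _ idR eh])
        (use zero in auto)
    then have eqK': "tensor_eq K f R (e \<circ> g) K' (image_mset (map_prod \<phi> \<kappa>') (image_mset (map_prod id e) M))
        (image_mset (map_prod \<phi> \<kappa>') (image_mset (map_prod id e) N))"
      by (simp only: comm[OF MT] comm[OF NT])
    have cM: "set_mset (image_mset (map_prod id e) M) \<subseteq> carrier R \<times> carrier K'"
      "set_mset (image_mset (map_prod id e) N) \<subseteq> carrier R \<times> carrier K'"
      using MT NT by (auto simp: carrK' subset_iff)
    have "tensor_eq K f R (e \<circ> g) K' (image_mset (map_prod id e) M) (image_mset (map_prod id e) N)"
      using inj eqK' cM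
      unfolding inj_on_tensor_map_iff[OF rings(2) ringK' homs(4) egh homs(1,2) k'h equi(1) eg_equi]
      by blast
    then have "tensor_eq K f R g S (image_mset (map_prod id i) (image_mset (map_prod id e) M))
        (image_mset (map_prod id i) (image_mset (map_prod id e) N))"
      by (rule tensor_eq_image[where \<kappa> = id, OF _ rings(2) ringK' fc])
        (use idR egh ih zero subT(3) ie gT in \<open>auto simp: ring_hom_def\<close>)
    moreover have "image_mset (map_prod id i) (image_mset (map_prod id e) P) = P"
      if "set_mset P \<subseteq> carrier R \<times> T" for P
    proof -
      have "image_mset (map_prod id i) (image_mset (map_prod id e) P) = image_mset (\<lambda>x. x) P"
        unfolding image_mset.compositionality
        by (rule image_mset_cong) (use that in \<open>auto simp: ie subset_iff\<close>)
      then show ?thesis by simp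
    qed
    ultimately show "tensor_eq K f R g S M N" using MT NT by simp
  qed
qed

end

end

theory Submission
  imports Defs
begin

text \<open>
  Everything is done with degrees of composita inside \<open>L\<close>; no Galois group is used.  Over a base \<open>K\<close>,
  the strong core is the union of the finite extensions \<open>A\<close> with \<open>K(\<phi> A) = A\<close>, and over the core no
  such extension is left.  So if \<open>L\<close> is generated by a finite normal extension \<open>M\<close> of the core \<open>K\<close>,
  enlarged until the degrees \<open>[K(M, \<dots>, \<phi>\<^sup>n M) : K(M, \<dots>, \<phi>\<^sup>n\<^sup>-\<^sup>1 M)]\<close> are constant, then induction
  on \<open>[M : K]\<close> applies as follows.  If \<open>[K(\<phi> M) : K] < [M : K]\<close>, replace \<open>M\<close> by \<open>K(\<phi> M)\<close>: \<open>L\<close> is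
  radicial over the difference field that it generates.  Otherwise put \<open>P = {x \<in> M. \<phi> x \<in> M}\<close> and \<open>N = P(\<phi> P)\<close>.  If \<open>N = M\<close>, replace \<open>M\<close> by \<open>P\<close>,
  which generates the same extension and is smaller because \<open>K\<close> is coreless.  If \<open>N\<close> is smaller
  than \<open>M\<close>, then \<open>K\<langle>N\<rangle>\<close> has a chain by induction, and on top of it \<open>M\<close> contributes one benign layer
  of limit degree \<open>[M : N]\<close>.
\<close>

section \<open>Finite extensions inside a field\<close>

text \<open>Translating an extension by \<open>\<phi>\<close> or enlarging its base only bounds its
  degree from above, so lower bounds are the obstacle. They come by squeezing: a tower of known
  total degree is cut into steps whose upper bounds multiply to that total. The input is
  \<open>[M : P] = d\<close>: as \<open>M\<close> and \<open>K(\<phi> M)\<close> meet exactly in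
  \<open>K(\<phi> P)\<close>, the part of \<open>\<phi> M\<close> that is new over \<open>M\<close>
  has degree \<open>[K(\<phi> M) : K(\<phi> P)] = [M : P]\<close>. The relations between consecutive
  images of \<open>M\<close> thus live in \<open>P\<close> and \<open>\<phi> P\<close>, that is in
  \<open>N\<close>, and over \<open>K\<langle>N\<rangle>\<close> each image
  \<open>\<phi>^i M\<close> contributes its full \<open>[M : N]\<close>.

  The chain given by induction ends in a field \<open>D\<close> over which
  \<open>K\<langle>N\<rangle>\<close> is only radicial, so \<open>N\<close> need not lie in
  \<open>D\<close>. The new layer is therefore generated by \<open>\<phi>^r M\<close> with
  \<open>\<phi>^r N\<close> inside \<open>D\<close>, and its degrees are compared with those over
  \<open>K\<langle>N\<rangle>\<close>.

  The other half concerns tensor products: inside a Galois extension etale means finite over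
  \<open>K\<close>, and sigma-separability, tested on \<open>\<phi> : K \<rightarrow> K\<close>
  alone, already forces \<open>K(\<phi> A) = A\<close>.\<close>

context field
begin

declare Span.simps [simp del]

abbreviation join :: "'a set \<Rightarrow> 'a set \<Rightarrow> 'a set"
  where "join T S \<equiv> generate_field R (T \<union> S)"

definition finite_ext :: "'a set \<Rightarrow> 'a set \<Rightarrow> bool"
  where "finite_ext J E \<longleftrightarrow> subfield J R \<and> subfield E R \<and> J \<subseteq> E \<and> finite_dimension J E"

lemma finite_extD:
  assumes "finite_ext J E"
  shows "subfield J R" "subfield E R" "J \<subseteq> E" "finite_dimension J E" "E \<subseteq> carrier R" "J \<subseteq> carrier R"
  using assms subfieldE(3)[of J R] subfieldE(3)[of E R] unfolding finite_ext_def by auto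

lemma join_subfield:
  assumes "T \<subseteq> carrier R" "S \<subseteq> carrier R"
  shows "subfield (join T S) R"
  by (rule generate_field_is_subfield) (use assms in auto)

lemma join_upper: "T \<subseteq> join T S" "S \<subseteq> join T S"
  by (auto intro: generate_field.incl)

lemma join_least:
  assumes "subfield E R" "T \<subseteq> E" "S \<subseteq> E"
  shows "join T S \<subseteq> E"
proof (rule generate_field_min_subfield1)
  show "T \<union> S \<subseteq> carrier R" "T \<union> S \<subseteq> E"
    using assms(2,3) subfieldE(3)[OF assms(1)] by auto
qed (rule assms(1))

lemma join_absorb:
  assumes "subfield E R" "T \<subseteq> E"
  shows "join E T = E" "join T E = E"
  using join_least[OF assms(1), of E T] join_least[OF assms(1), of T E]
    join_upper(1)[where T = E and S = T] join_upper(2)[where T = T and S = E] assms(2)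
  by (simp_all add: subset_antisym)

lemma generate_field_mono: "S \<subseteq> T \<Longrightarrow> generate_field R S \<subseteq> generate_field R T"
proof
  fix x assume ST: "S \<subseteq> T" and "x \<in> generate_field R S"
  from this(2) show "x \<in> generate_field R T"
    by induction (use ST in \<open>auto intro: generate_field.intros\<close>)
qed

lemma generate_field_eqI:
  assumes "S \<subseteq> carrier R" "T \<subseteq> carrier R" "S \<subseteq> generate_field R T" "T \<subseteq> generate_field R S"
  shows "generate_field R S = generate_field R T"
proof
  show "generate_field R S \<subseteq> generate_field R T"
    by (rule generate_field_min_subfield1[OF assms(1) generate_field_is_subfield[OF assms(2)] assms(3)])
  show "generate_field R T \<subseteq> generate_field R S"
    by (rule generate_field_min_subfield1[OF assms(2) generate_field_is_subfield[OF assms(1)] assms(4)])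
qed

lemma generate_field_finitary:
  assumes "x \<in> generate_field R S"
  shows "\<exists>S0. finite S0 \<and> S0 \<subseteq> S \<and> x \<in> generate_field R S0"
  using assms
proof induction
  case one
  then show ?case by (intro exI[of _ "{}"]) (auto intro: generate_field.one)
next
  case (incl h)
  then show ?case by (intro exI[of _ "{h}"]) (auto intro: generate_field.incl)
next
  case (eng_add h1 h2)
  then obtain A B where "finite A" "A \<subseteq> S" "h1 \<in> generate_field R A" "finite B" "B \<subseteq> S" "h2 \<in> generate_field R B"
    by blast
  then show ?case
    using generate_field_mono[of A "A \<union> B"] generate_field_mono[of B "A \<union> B"]
    by (intro exI[of _ "A \<union> B"]) (auto intro!: generate_field.eng_add)
next
  case (eng_mult h1 h2)
  then obtain A B where "finite A" "A \<subseteq> S" "h1 \<in> generate_field R A" "finite B" "B \<subseteq> S" "h2 \<in> generate_field R B"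
    by blast
  then show ?case
    using generate_field_mono[of A "A \<union> B"] generate_field_mono[of B "A \<union> B"]
    by (intro exI[of _ "A \<union> B"]) (auto intro!: generate_field.eng_mult)
next
  case (a_inv h)
  then show ?case using generate_field.a_inv by meson
next
  case (m_inv h)
  then show ?case using generate_field.m_inv by meson
qed

lemma hom_facts:
  assumes "h \<in> ring_hom R R"
  shows "ring_hom_ring R R h" "inj_on h (carrier R)" "\<one> \<noteq> \<zero>"
proof -
  show "ring_hom_ring R R h" by (rule ring_hom_ringI2[OF ring_axioms ring_axioms assms])
  show "inj_on h (carrier R)" by (rule non_trivial_field_hom_is_inj[OF assms field_axioms field_axioms])
  show "\<one> \<noteq> \<zero>" by simp
qed

lemma hom_image_subfield:
  assumes "h \<in> ring_hom R R" "subfield E R"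
  shows "subfield (h ` E) R"
  using ring_hom_ring.img_is_subfield(2)[OF hom_facts(1)[OF assms(1)] assms(2)] hom_facts(3)[OF assms(1)] by simp

lemma hom_preimage_subfield:
  assumes "h \<in> ring_hom R R" "subfield E R"
  shows "subfield {x \<in> carrier R. h x \<in> E} R"
proof (rule subfieldI')
  interpret h: ring_hom_ring R R h by (rule hom_facts[OF assms(1)])
  note E = subringE[OF subfieldE(1)[OF assms(2)]]
  show "subring {x \<in> carrier R. h x \<in> E} R"
    by (rule subringI) (use E in auto)
  fix k assume k: "k \<in> {x \<in> carrier R. h x \<in> E} - {\<zero>}"
  then have kU: "k \<in> Units R" by (simp add: field_Units)
  have "h k \<noteq> \<zero>"
    using k inj_onD[OF hom_facts(2)[OF assms(1)], of k \<zero>] by force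
  then have "inv (h k) \<in> E" using subfield_m_inv(1)[OF assms(2), of "h k"] k by simp
  moreover have "h k \<otimes> h (inv k) = \<one>"
    using h.hom_mult[of k "inv k"] kU k by simp
  then have "h (inv k) = inv (h k)"
    using comm_inv_char[of "h k" "h (inv k)"] k kU by simp
  ultimately show "inv k \<in> {x \<in> carrier R. h x \<in> E}" using kU by auto
qed

lemma hom_generate_field:
  assumes "h \<in> ring_hom R R" "S \<subseteq> carrier R"
  shows "h ` generate_field R S = generate_field R (h ` S)"
proof
  interpret h: ring_hom_ring R R h by (rule hom_facts[OF assms(1)])
  have hS: "h ` S \<subseteq> carrier R" using assms(2) by auto
  have "generate_field R S \<subseteq> {x \<in> carrier R. h x \<in> generate_field R (h ` S)}"
    using assms hom_preimage_subfield[OF assms(1) generate_field_is_subfield[OF hS]]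
    by (intro generate_field_min_subfield1) (auto intro: generate_field.incl)
  then show "h ` generate_field R S \<subseteq> generate_field R (h ` S)" by auto
  show "generate_field R (h ` S) \<subseteq> h ` generate_field R S"
    using hom_image_subfield[OF assms(1) generate_field_is_subfield[OF assms(2)]] hS
    by (intro generate_field_min_subfield1) (auto intro: generate_field.incl)
qed

lemma finite_ext_refl:
  assumes "subfield K R"
  shows "finite_ext K K" "dim K K = 1"
proof -
  show "finite_ext K K"
    using assms finite_dimensionI[OF dimension_one[OF assms]] by (simp add: finite_ext_def)
  show "dim K K = 1"
    using dimI[OF assms dimension_one[OF assms]] by (simp only: over_def)
qed

lemma finite_ext_trans:
  assumes "finite_ext J F" "finite_ext F E"
  shows "finite_ext J E" "dim J E = dim J F * dim F E"
proof -
  note 1 = finite_extD[OF assms(1)] and 2 = finite_extD[OF assms(2)]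
  note * = telescopic_base_dim[OF 1(1) 2(1) 1(4) 2(4)]
  show "finite_ext J E" using 1 2 *(1) by (simp add: finite_ext_def)
  show "dim J E = dim J F * dim F E" using *(2) by (simp only: over_def)
qed

lemma finite_ext_subfields:
  assumes "finite_ext J E" "subfield F R" "J \<subseteq> F" "F \<subseteq> E"
  shows "finite_ext J F" "finite_ext F E" "dim J E = dim J F * dim F E"
proof -
  note JE = finite_extD[OF assms(1)]
  note F = subringE[OF subfieldE(1)[OF assms(2)]] and E = subringE[OF subfieldE(1)[OF JE(2)]]
  have subalg: "subalgebra T V R" if "subfield V R" "T \<subseteq> V" for T V
    using subringE[OF subfieldE(1)[OF that(1)]] that(2) subfieldE(1)[OF that(1)]
    by (auto simp: subalgebra_def subalgebra_axioms_def subring_def)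
  show 1: "finite_ext J F"
    using subalbegra_incl_imp_finite_dimension[OF JE(1,4) subalg[OF assms(2,3)] assms(4)] assms JE
    by (simp add: finite_ext_def)
  obtain Us where Us: "set Us \<subseteq> carrier R" "Span J Us = E"
    using JE(4) exists_base[OF JE(1)] unfolding finite_dimension_def by blast
  have UsE: "set Us \<subseteq> E" using Span_base_incl[OF JE(1) Us(1)] Us(2) by simp
  have "Span F Us \<subseteq> E"
    by (rule subalgebra_Span_incl[OF assms(2) subalg[OF JE(2) assms(4)] UsE])
  moreover have "E \<subseteq> Span F Us"
    unfolding Us(2)[symmetric] Span_eq_combine_set[OF JE(1) Us(1)] Span_eq_combine_set[OF assms(2) Us(1)]
    using assms(3) by blast
  ultimately have "finite_dimension F E"
    using Span_finite_dimension[OF assms(2) Us(1)] by simp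
  then show 2: "finite_ext F E" using assms JE by (simp add: finite_ext_def)
  show "dim J E = dim J F * dim F E" by (rule finite_ext_trans(2)[OF 1 2])
qed

lemma finite_ext_dim_pos:
  assumes "finite_ext J E"
  shows "dim J E > 0"
proof (rule ccontr)
  note JE = finite_extD[OF assms]
  assume "\<not> dim J E > 0"
  then have "dimension 0 J E" using finite_dimensionE[OF JE(1,4)] by (simp add: over_def)
  then have "E = {\<zero>}" using dimension_zero[OF JE(1)] by simp
  then show False using subringE(3)[OF subfieldE(1)[OF JE(2)]] by simp
qed

lemma finite_ext_dim_one:
  assumes "finite_ext J E" "dim J E = 1"
  shows "E = J"
proof -
  note JE = finite_extD[OF assms(1)]
  have ind: "independent J [\<one>]" by (rule li_Cons) (simp_all add: Span.simps)
  have "dimension 1 J E" using finite_dimensionE[OF JE(1,4)] assms(2) by (simp add: over_def)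
  then have "Span J [\<one>] = E"
    using independent_length_eq_dimension[OF JE(1) _ ind, of 1 E] subringE(3)[OF subfieldE(1)[OF JE(2)]]
    by simp
  moreover have "Span J [\<one>] = J"
    using independent_length_eq_dimension[OF JE(1) dimension_one[OF JE(1)] ind]
      subringE(3)[OF subfieldE(1)[OF JE(1)]]
    by simp
  ultimately show ?thesis by simp
qed

lemma finite_ext_eq_top:
  assumes "finite_ext J E" "subfield F R" "J \<subseteq> F" "F \<subseteq> E" "dim J E \<le> dim J F"
  shows "F = E"
proof -
  note * = finite_ext_subfields[OF assms(1-4)]
  have "dim F E = 1"
    using *(3) assms(5) finite_ext_dim_pos[OF *(1)] finite_ext_dim_pos[OF *(2)]
      mult_le_cancel1[of "dim J F" "dim F E" 1] by linarith
  then show ?thesis using finite_ext_dim_one[OF *(2)] by simp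
qed

lemma finite_ext_eq_bot:
  assumes "finite_ext J E" "subfield F R" "J \<subseteq> F" "F \<subseteq> E" "dim J E \<le> dim F E"
  shows "F = J"
proof -
  note * = finite_ext_subfields[OF assms(1-4)]
  have "dim J F = 1"
    using *(3) assms(5) finite_ext_dim_pos[OF *(1)] finite_ext_dim_pos[OF *(2)]
      mult_le_cancel2[of "dim J F" "dim F E" 1] by linarith
  then show ?thesis using finite_ext_dim_one[OF *(1)] by simp
qed

lemma dim_Span_le:
  assumes "subfield K R" "set us \<subseteq> carrier R"
  shows "dim K (Span K us) \<le> length us"
proof -
  have "\<exists>n \<le> length us. dimension n K (Span K us)" using assms(2)
  proof (induction us)
    case Nil
    then show ?case by (auto simp: Span.simps)
  next
    case (Cons u us)
    then obtain n where n: "n \<le> length us" "dimension n K (Span K us)" by auto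
    have us: "set us \<subseteq> carrier R" and u: "u \<in> carrier R" using Cons.prems by auto
    show ?case
    proof (cases "u \<in> Span K us")
      case True
      have "set (u # us) \<subseteq> Span K us"
        using Span_base_incl[OF assms(1) us] True by auto
      then have "Span K (u # us) = Span K us"
        using mono_Span_subset[OF assms(1) _ us] mono_Span[OF assms(1) us u] by blast
      then show ?thesis using n by (auto intro: le_SucI)
    next
      case False
      then have "dimension (Suc n) K (Span K (u # us))"
        using Suc_dim[OF u False n(2)] by (simp add: Span.simps)
      then show ?thesis using n(1) by (metis length_Cons Suc_le_mono)
    qed
  qed
  then show ?thesis using dimI[OF assms(1)] by (auto simp: over_def)
qed

text \<open>A nonzero \<open>k\<close> in \<open>D\<close> is algebraic, so \<open>K[k]\<close> is a
  field; it contains the inverse of \<open>k\<close> and lies in \<open>D\<close>.\<close>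

lemma finite_dimension_subring_is_subfield:
  assumes "subfield K R" "subring D R" "K \<subseteq> D" "finite_dimension K D"
  shows "subfield D R"
proof (rule subfieldI'[OF assms(2)])
  fix k assume k: "k \<in> D - {\<zero>}"
  have kR: "k \<in> carrier R" using k subringE(1)[OF assms(2)] by auto
  have "(algebraic over K) k" using finite_dimension_imp_algebraic[OF assms(1,2,4)] k by simp
  then have "subfield (simple_extension K k) R"
    using simple_extension_is_subfield[OF assms(1) kR] by simp
  moreover have "k \<in> simple_extension K k"
    by (rule simple_extension_mem[OF subfieldE(1)[OF assms(1)] kR])
  ultimately have "inv k \<in> simple_extension K k" using subfield_m_inv(1) k by blast
  then show "inv k \<in> D"
    using simple_extension_subring_incl[OF assms(2,3), of k] k by auto
qed

text \<open>The span on the right contains \<open>h E\<close> and is closed under products because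
  \<open>h E\<close> is; as a finite-dimensional ring over the field \<open>T\<close> it is a field.
  So the compositum needs no more spanning vectors than \<open>E\<close> does, which is the source
  of all upper bounds on degrees.\<close>

lemma translate_Span:
  assumes "finite_ext J E" "h \<in> ring_hom R R" "subfield T R" "h ` J \<subseteq> T"
    and us: "set us \<subseteq> carrier R" "Span J us = E"
  shows "join T (h ` E) = Span T (map h us)"
proof -
  interpret h: ring_hom_ring R R h by (rule hom_facts[OF assms(2)])
  note JE = finite_extD[OF assms(1)]
  define V where "V = Span T (map h us)"
  have hus: "set (map h us) \<subseteq> carrier R" using us by auto
  have TR: "T \<subseteq> carrier R" using subfieldE(3)[OF assms(3)] .
  have VR: "V \<subseteq> carrier R" unfolding V_def by (rule Span_in_carrier[OF TR hus])
  have Valg: "subalgebra T V R" unfolding V_def by (rule Span_is_subalgebra[OF assms(3) hus])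
  have hE: "h ` E \<subseteq> V"
  proof
    fix y assume "y \<in> h ` E"
    then obtain x where x: "x \<in> Span J us" "y = h x" using us(2) by blast
    then obtain Ks where "set Ks \<subseteq> J" "y = h (combine Ks us)"
      unfolding Span_eq_combine_set[OF JE(1) us(1)] by blast
    moreover from this(1) have "set (map h Ks) \<subseteq> T" using assms(4) by auto
    ultimately have "y = combine (map h Ks) (map h us)" "set (map h Ks) \<subseteq> T"
      using h.combine_hom[of Ks us] us(1) JE(6) by auto
    then show "y \<in> V" unfolding V_def Span_eq_combine_set[OF assms(3) hus] by blast
  qed
  have smult: "t \<otimes> v \<in> V" if "t \<in> T" "v \<in> V" for t v
    using subalgebra.smult_closed[OF Valg] that .
  have add_sub: "subgroup V (add_monoid R)" using Valg by (simp add: subalgebra_def)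
  note Vadd = subgroup.m_closed[OF add_sub, simplified] and V0 = subgroup.one_closed[OF add_sub, simplified]
  have Vneg: "\<ominus> v \<in> V" if "v \<in> V" for v
    using subgroup.m_inv_closed[OF add_sub that] that VR by (simp add: a_inv_def)
  \<comment> \<open>The elements that multiply \<open>w\<close> into \<open>V\<close> form a
    \<open>T\<close>-subspace, so closure under products need only be checked on the spanning
    vectors, once in each factor.\<close>
  have alg: "subalgebra T {v \<in> carrier R. v \<otimes> w \<in> V} R" if "w \<in> carrier R" for w
  proof -
    have "subgroup {v \<in> carrier R. v \<otimes> w \<in> V} (add_monoid R)"
      using that Vadd V0 Vneg by (intro add.subgroupI) (auto simp: l_distr l_minus simp flip: a_inv_def)
    moreover have "t \<otimes> v \<in> {v \<in> carrier R. v \<otimes> w \<in> V}" if "t \<in> T" "v \<in> {v \<in> carrier R. v \<otimes> w \<in> V}" for t v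
      using that \<open>w \<in> carrier R\<close> TR smult by (auto simp: m_assoc subset_iff)
    ultimately show ?thesis by (simp add: subalgebra_def subalgebra_axioms_def)
  qed
  have hEmult: "v \<otimes> w \<in> V" if "v \<in> V" "w \<in> h ` E" for v w
  proof -
    have wR: "w \<in> carrier R" using that(2) JE(5) by auto
    have usE: "set us \<subseteq> E" using Span_base_incl[OF JE(1) us(1)] us(2) by simp
    have "h u \<otimes> w \<in> V" if "u \<in> set us" for u
    proof -
      obtain e where "e \<in> E" "w = h e" using \<open>w \<in> h ` E\<close> by auto
      then have "h u \<otimes> w = h (u \<otimes> e)" "u \<otimes> e \<in> E"
        using that usE JE(5) subringE(6)[OF subfieldE(1)[OF JE(2)]] us(1) h.hom_mult[of u e]
        by (auto simp: subset_iff)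
      then show ?thesis using hE by auto
    qed
    then have "set (map h us) \<subseteq> {v \<in> carrier R. v \<otimes> w \<in> V}" using us(1) by auto
    then have "V \<subseteq> {v \<in> carrier R. v \<otimes> w \<in> V}"
      unfolding V_def using subalgebra_Span_incl[OF assms(3) alg[OF wR, unfolded V_def]] by blast
    then show ?thesis using that by auto
  qed
  have Vmult: "v \<otimes> w \<in> V" if "v \<in> V" "w \<in> V" for v w
  proof -
    have "set (map h us) \<subseteq> {w \<in> carrier R. w \<otimes> v \<in> V}"
      using hEmult[OF that(1)] Span_base_incl[OF JE(1) us(1)] us VR that(1)
      by (auto simp: m_comm subset_iff)
    then have "V \<subseteq> {w \<in> carrier R. w \<otimes> v \<in> V}"
      using subalgebra_Span_incl[OF assms(3) alg, of v "map h us"] VR that(1) unfolding V_def by blast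
    then have "w \<otimes> v \<in> V" using that by blast
    moreover have "w \<otimes> v = v \<otimes> w" using that VR by (intro m_comm) auto
    ultimately show ?thesis by simp
  qed
  have "h \<one> \<in> h ` E" using subringE(3)[OF subfieldE(1)[OF JE(2)]] by blast
  then have one: "\<one> \<in> V" using hE by auto
  have Vring: "subring V R" using VR one Vneg Vmult Vadd by (intro subringI) auto
  have TV: "T \<subseteq> V"
  proof
    fix t assume "t \<in> T"
    then show "t \<in> V" using smult[OF _ one, of t] TR by auto
  qed
  have Vfield: "subfield V R"
    by (rule finite_dimension_subring_is_subfield[OF assms(3) Vring TV])
      (simp add: V_def Span_finite_dimension[OF assms(3) hus])
  have le: "join T (h ` E) \<subseteq> V" by (rule join_least[OF Vfield TV hE])
  have jf: "subfield (join T (h ` E)) R" using TR JE(5) by (intro join_subfield) auto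
  have "subalgebra T (join T (h ` E)) R"
    using subringE[OF subfieldE(1)[OF jf]] subfieldE(1)[OF jf] join_upper(1)[of T "h ` E"]
    by (auto simp: subalgebra_def subalgebra_axioms_def subring_def)
  then have "V \<subseteq> join T (h ` E)"
    unfolding V_def
    using Span_base_incl[OF JE(1) us(1)] us(2) join_upper(2)[where T = T and S = "h ` E"]
    by (intro subalgebra_Span_incl[OF assms(3)]) (auto simp: subset_iff)
  then show ?thesis using le by (auto simp: V_def)
qed

text \<open>Used with powers of \<open>\<phi>\<close> and, through \<open>id_hom\<close>, for a mere
  enlargement of the base. The inequality can be strict, so lower bounds need separate
  arguments.\<close>

lemma finite_ext_translate:
  assumes "finite_ext J E" "h \<in> ring_hom R R" "subfield T R" "h ` J \<subseteq> T"
  shows "finite_ext T (join T (h ` E))" "dim T (join T (h ` E)) \<le> dim J E"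
proof -
  note JE = finite_extD[OF assms(1)]
  interpret h: ring_hom_ring R R h by (rule hom_facts[OF assms(2)])
  obtain us where us: "set us \<subseteq> carrier R" "length us = dim J E" "Span J us = E"
    using exists_base[OF JE(1) finite_dimensionE[OF JE(1,4)]] by (auto simp: over_def)
  have hus: "set (map h us) \<subseteq> carrier R" using us by auto
  note eq = translate_Span[OF assms us(1,3)]
  have TR: "T \<subseteq> carrier R" using subfieldE(3)[OF assms(3)] .
  have jf: "subfield (join T (h ` E)) R" using TR JE(5) by (intro join_subfield) auto
  show "finite_ext T (join T (h ` E))"
    using jf assms(3) join_upper(1)[of T "h ` E"] eq Span_finite_dimension[OF assms(3) hus]
    by (simp add: finite_ext_def)
  show "dim T (join T (h ` E)) \<le> dim J E"
    using dim_Span_le[OF assms(3) hus] us(2) eq by simp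
qed

lemma id_hom: "id \<in> ring_hom R R" by (auto simp: ring_hom_def)

lemma finite_ext_join:
  assumes "finite_ext J E" "subfield T R" "J \<subseteq> T"
  shows "finite_ext T (join T E)" "dim T (join T E) \<le> dim J E"
  using finite_ext_translate[OF assms(1) id_hom assms(2)] assms(3) by auto

lemma finite_ext_adjoin:
  assumes "subfield K R" "finite S" "S \<subseteq> carrier R" "\<And>x. x \<in> S \<Longrightarrow> (algebraic over K) x"
  shows "finite_ext K (join K S)"
proof -
  obtain xs where xs: "set xs = S" using finite_list[OF assms(2)] by blast
  have KR: "K \<subseteq> carrier R" using subfieldE(3)[OF assms(1)] .
  have sub: "subfield (finite_extension K xs) R"
    and fin: "finite_dimension K (finite_extension K xs)"
    using finite_extension_is_subfield[OF assms(1), of xs]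
      finite_extension_finite_dimension[OF assms(1), of xs] assms(3,4) xs by auto
  have incl: "K \<subseteq> finite_extension K xs" "S \<subseteq> finite_extension K xs"
    using finite_extension_incl[OF KR, of xs] finite_extension_mem[OF subfieldE(1)[OF assms(1)], of xs]
      xs assms(3) by auto
  have "finite_extension K xs \<subseteq> join K S"
    using finite_extension_subring_incl[OF subfieldE(1)[OF join_subfield[OF KR assms(3)]], of K xs]
      join_upper[of K S] join_upper(2)[of S K] xs by simp
  then have "finite_extension K xs = join K S" using join_least[OF sub incl] by blast
  then show ?thesis
    using assms(1) sub fin incl by (simp add: finite_ext_def)
qed

lemma simple_extension_eq_join:
  assumes "subfield K R" "x \<in> carrier R" "(algebraic over K) x"
  shows "simple_extension K x = join K {x}"
proof -
  have sub: "subfield (simple_extension K x) R"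
    using simple_extension_is_subfield[OF assms(1,2)] assms(3) by simp
  have KR: "K \<subseteq> carrier R" using subfieldE(3)[OF assms(1)] .
  show ?thesis
  proof
    show "join K {x} \<subseteq> simple_extension K x"
      using sub simple_extension_incl[OF KR assms(2)] simple_extension_mem[OF subfieldE(1)[OF assms(1)] assms(2)]
      by (intro join_least) auto
    show "simple_extension K x \<subseteq> join K {x}"
      using join_upper[of K "{x}"] join_upper(2)[of "{x}" K] KR assms(2)
      by (intro simple_extension_subring_incl[OF subfieldE(1)[OF join_subfield]]) auto
  qed
qed

lemma dim_join_simple:
  assumes "subfield K R" "x \<in> carrier R" "(algebraic over K) x"
  shows "finite_ext K (join K {x})" "dim K (join K {x}) = degree (Irr K x)"
  using finite_ext_adjoin[OF assms(1), of "{x}"] simple_extension_dim[OF assms]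
    simple_extension_eq_join[OF assms] assms by (auto simp: over_def)

lemma finite_ext_generators:
  assumes "finite_ext K E"
  obtains S where "finite S" "S \<subseteq> E" "join K S = E"
proof -
  note KE = finite_extD[OF assms]
  obtain us where us: "set us \<subseteq> carrier R" "Span K us = E"
    using KE(4) exists_base[OF KE(1)] unfolding finite_dimension_def by blast
  have usE: "set us \<subseteq> E" using Span_base_incl[OF KE(1) us(1)] us(2) by simp
  have jf: "subfield (join K (set us)) R" using KE us(1) by (intro join_subfield) auto
  have "subalgebra K (join K (set us)) R"
    using subringE[OF subfieldE(1)[OF jf]] subfieldE(1)[OF jf] join_upper(1)[of K "set us"]
    by (auto simp: subalgebra_def subalgebra_axioms_def subring_def)
  then have "E \<subseteq> join K (set us)"
    using subalgebra_Span_incl[OF KE(1) _ join_upper(2)[where T = K and S = "set us"]] us(2) by simp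
  then have "join K (set us) = E" using join_least[OF KE(2,3) usE] by blast
  then show ?thesis using that usE by blast
qed

end

section \<open>Conjugates and normal extensions\<close>

context field
begin

text \<open>Conjugates are sought in the ambient field \<open>R\<close> only;
  \<open>galois_over\<close> says by counting that none is missing there.\<close>

definition conj :: "'a set \<Rightarrow> 'a \<Rightarrow> 'a set"
  where "conj J x = {y \<in> carrier R. eval (Irr J x) y = \<zero>}"

text \<open>The Galois property of \<open>R\<close> over \<open>K\<close> as a count: as many roots
  in \<open>R\<close> as the degree means split without multiple roots. In this form it can be
  compared with the number of roots of image polynomials.\<close>

definition galois_over :: "'a set \<Rightarrow> bool"
  where "galois_over K \<longleftrightarrow> subfield K R \<and>
    (\<forall>x\<in>carrier R. (algebraic over K) x \<and> card (conj K x) = degree (Irr K x))"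

lemma poly_carrier_set:
  assumes "subring K R" "p \<in> carrier (K[X])"
  shows "set p \<subseteq> K" "set p \<subseteq> carrier R"
  using assms subringE(1)[OF assms(1)] polynomial_incl[of K p] by (auto simp: univ_poly_carrier)

lemma poly_eval_mult:
  assumes "subring K R" "p \<in> carrier (K[X])" "q \<in> carrier (K[X])" "a \<in> carrier R"
  shows "eval (p \<otimes>\<^bsub>K[X]\<^esub> q) a = eval p a \<otimes> eval q a"
  using eval_poly_mult[OF poly_carrier_set(2)[OF assms(1,2)] poly_carrier_set(2)[OF assms(1,3)] assms(4)]
  by (simp add: univ_poly_mult)

lemma Irr_props:
  assumes "subfield K R" "x \<in> carrier R" "(algebraic over K) x"
  shows "Irr K x \<in> carrier (K[X])" "Irr K x \<in> carrier (poly_ring R)" "Irr K x \<noteq> []"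
    "eval (Irr K x) x = \<zero>" "degree (Irr K x) \<ge> 1" "lead_coeff (Irr K x) = \<one>"
  using IrrE[OF assms] carrier_polynomial_shell[OF subfieldE(1)[OF assms(1)]]
    pirreducibleE(1)[OF subfieldE(1)[OF assms(1)]] pirreducible_degree[OF assms(1)] by auto

lemma card_set_mset_le: "card (set_mset M) \<le> size M"
proof -
  have "(\<Sum>y\<in>set_mset M. 1) \<le> (\<Sum>y\<in>set_mset M. count M y)"
    by (rule sum_mono) (simp add: Suc_le_eq)
  then show ?thesis by (simp add: size_multiset_overloaded_eq)
qed

lemma finite_roots:
  assumes "p \<in> carrier (poly_ring R)" "p \<noteq> []"
  shows "finite {y \<in> carrier R. eval p y = \<zero>}" "card {y \<in> carrier R. eval p y = \<zero>} \<le> degree p"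
proof -
  have eq: "{y \<in> carrier R. eval p y = \<zero>} = set_mset (roots p)"
    using roots_mem_iff_is_root[OF assms(1)] assms(2) by (auto simp: is_root_def)
  show "finite {y \<in> carrier R. eval p y = \<zero>}" unfolding eq by simp
  show "card {y \<in> carrier R. eval p y = \<zero>} \<le> degree p"
    unfolding eq using size_roots_le_degree[OF assms(1)] card_set_mset_le[of "roots p"] by simp
qed

text \<open>The number of distinct roots is at most the number of roots with multiplicity, which is
  at most the degree; equality of the extremes forces both equalities.\<close>

lemma card_roots_eq_degree_iff:
  assumes "p \<in> carrier (poly_ring R)" "p \<noteq> []"
  shows "card {y \<in> carrier R. eval p y = \<zero>} = degree p \<longleftrightarrow> splitted p \<and> (\<forall>y. count (roots p) y \<le> 1)"
proof -
  have eq: "{y \<in> carrier R. eval p y = \<zero>} = set_mset (roots p)"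
    using roots_mem_iff_is_root[OF assms(1)] assms(2) by (auto simp: is_root_def)
  note le = card_set_mset_le[of "roots p"]
  have iff: "card (set_mset (roots p)) = size (roots p) \<longleftrightarrow> (\<forall>y. count (roots p) y \<le> 1)"
  proof
    assume "card (set_mset (roots p)) = size (roots p)"
    then have "(\<Sum>y\<in>set_mset (roots p). count (roots p) y) = (\<Sum>y\<in>set_mset (roots p). 1)"
      by (simp add: size_multiset_overloaded_eq)
    then have "(\<Sum>y\<in>set_mset (roots p). count (roots p) y - 1) = 0"
      by (subst sum_subtractf_nat) auto
    then show "\<forall>y. count (roots p) y \<le> 1"
      by (metis (no_types, lifting) count_eq_zero_iff diff_is_0_eq finite_set_mset le0 sum_eq_0_iff)
  next
    assume "\<forall>y. count (roots p) y \<le> 1"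
    then have "(\<Sum>y\<in>set_mset (roots p). count (roots p) y) = (\<Sum>y\<in>set_mset (roots p). 1)"
      by (intro sum.cong) (auto intro!: le_antisym simp: Suc_le_eq)
    then show "card (set_mset (roots p)) = size (roots p)"
      by (simp add: size_multiset_overloaded_eq)
  qed
  have "(c = d) = (s = d \<and> c = s)" if "c \<le> s" "s \<le> d" for c s d :: nat
    using that by auto
  then show ?thesis
    unfolding eq splitted_def iff[symmetric] using le size_roots_le_degree[OF assms(1)] by blast
qed

lemma conj_finite:
  assumes "subfield K R" "x \<in> carrier R" "(algebraic over K) x"
  shows "finite (conj K x)" "card (conj K x) \<le> degree (Irr K x)" "x \<in> conj K x" "conj K x \<subseteq> carrier R"
  using finite_roots[OF Irr_props(2,3)[OF assms]] Irr_props(4)[OF assms] assms(2) by (auto simp: conj_def)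

lemma galois_overD:
  assumes "galois_over K"
  shows "subfield K R" "K \<subseteq> carrier R" "x \<in> carrier R \<Longrightarrow> (algebraic over K) x"
    "x \<in> carrier R \<Longrightarrow> card (conj K x) = degree (Irr K x)"
    "x \<in> carrier R \<Longrightarrow> card (conj K x) = dim K (join K {x})"
    "x \<in> carrier R \<Longrightarrow> finite_ext K (join K {x})"
  using assms dim_join_simple[of K x] subfieldE(3)[of K R] unfolding galois_over_def by auto

lemma Irr_divides:
  assumes "subfield J R" "x \<in> carrier R" "(algebraic over J) x" "p \<in> carrier (J[X])" "eval p x = \<zero>"
  obtains r where "r \<in> carrier (J[X])" "p = Irr J x \<otimes>\<^bsub>J[X]\<^esub> r"
proof -
  have "Irr J x divides\<^bsub>J[X]\<^esub> p"
    using Irr_minimal[OF assms] pdivides_iff_shell[OF assms(1) Irr_props(1)[OF assms(1-3)] assms(4)] by simp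
  then show ?thesis using that unfolding factor_def by blast
qed

lemma conj_root:
  assumes "subfield J R" "x \<in> carrier R" "(algebraic over J) x" "p \<in> carrier (J[X])" "eval p x = \<zero>"
    "y \<in> conj J x"
  shows "eval p y = \<zero>"
proof -
  obtain r where r: "r \<in> carrier (J[X])" "p = Irr J x \<otimes>\<^bsub>J[X]\<^esub> r" by (rule Irr_divides[OF assms(1-5)])
  have "eval p y = eval (Irr J x) y \<otimes> eval r y"
    unfolding r(2) using assms(6)
    by (intro poly_eval_mult[OF subfieldE(1)[OF assms(1)] Irr_props(1)[OF assms(1-3)] r(1)]) (auto simp: conj_def)
  moreover have "eval r y \<in> carrier R"
    using poly_carrier_set(2)[OF subfieldE(1)[OF assms(1)] r(1)] assms(6) by (auto simp: conj_def intro!: eval_in_carrier)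
  ultimately show ?thesis using assms(6) by (simp add: conj_def)
qed

lemma poly_ring_mono:
  assumes "K \<subseteq> J" "p \<in> carrier (K[X])"
  shows "p \<in> carrier (J[X])"
  using assms unfolding univ_poly_def polynomial_def by auto

lemma conj_mono:
  assumes "subfield K R" "subfield J R" "K \<subseteq> J" "x \<in> carrier R" "(algebraic over K) x"
  shows "conj J x \<subseteq> conj K x"
proof
  fix y assume y: "y \<in> conj J x"
  have "eval (Irr K x) y = \<zero>"
    using conj_root[OF assms(2,4) algebraic_mono[OF assms(3)] poly_ring_mono[OF assms(3)] _ y]
      Irr_props(1,4)[OF assms(1,4,5)] assms(5) by (auto simp: over_def)
  then show "y \<in> conj K x" using y by (simp add: conj_def)
qed

text \<open>The minimal polynomial over the larger field divides the one over \<open>K\<close>, and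
  both splitting and the absence of multiple roots pass to divisors.\<close>

lemma galois_over_mono:
  assumes "galois_over K" "subfield J R" "K \<subseteq> J"
  shows "galois_over J"
  unfolding galois_over_def
proof (intro conjI ballI)
  show "subfield J R" by fact
  fix x assume x: "x \<in> carrier R"
  note K = galois_overD[OF assms(1)]
  have alg: "(algebraic over K) x" using K(3)[OF x] .
  then show algJ: "(algebraic over J) x" using algebraic_mono[OF assms(3)] by (simp add: over_def)
  note IK = Irr_props[OF K(1) x alg] and IJ = Irr_props[OF assms(2) x algJ]
  have dv: "Irr J x pdivides Irr K x"
    by (rule Irr_minimal[OF assms(2) x algJ poly_ring_mono[OF assms(3) IK(1)] IK(4)])
  have "splitted (Irr K x)" "\<forall>y. count (roots (Irr K x)) y \<le> 1"
    using card_roots_eq_degree_iff[OF IK(2,3)] K(4)[OF x] by (auto simp: conj_def)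
  then have "splitted (Irr J x)" "\<forall>y. count (roots (Irr J x)) y \<le> 1"
    using pdivides_imp_splitted[OF IJ(2) IK(2,3) _ dv] pdivides_imp_roots_incl[OF IJ(2) IK(2,3) dv]
    by (auto simp: subseteq_mset_def intro: order_trans)
  then show "card (conj J x) = degree (Irr J x)"
    using card_roots_eq_degree_iff[OF IJ(2,3)] by (auto simp: conj_def)
qed

text \<open>Peel off one linear factor at a time: its root lies in \<open>T\<close>, and the
  cofactor has the same leading coefficient and satisfies the same assumptions.\<close>

lemma splitted_poly_coeffs:
  assumes "subfield T R" "p \<in> carrier (poly_ring R)" "p \<noteq> []" "lead_coeff p \<in> T" "splitted p"
    "{y \<in> carrier R. eval p y = \<zero>} \<subseteq> T"
  shows "p \<in> carrier (T[X])"
  using assms(2-)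
proof (induction "degree p" arbitrary: p)
  case 0
  then obtain a where "p = [a]" by (cases p) auto
  moreover have "a \<noteq> \<zero>" using 0(2) \<open>p = [a]\<close> by (simp add: univ_poly_def polynomial_def)
  ultimately show ?case using 0 by (simp add: univ_poly_def polynomial_def)
next
  case (Suc n)
  have "roots p \<noteq> {#}" using Suc.hyps Suc.prems(4) by (auto simp: splitted_def)
  then obtain a where a: "a \<in> carrier R" "a \<in># roots p" "[\<one>, \<ominus> a] \<in> carrier (poly_ring R)" "[\<one>, \<ominus> a] pdivides p"
    using not_empty_rootsE[OF Suc.prems(1)] by blast
  then obtain q where q: "q \<in> carrier (poly_ring R)" "p = [\<one>, \<ominus> a] \<otimes>\<^bsub>poly_ring R\<^esub> q"
    unfolding pdivides_def factor_def by blast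
  have qn: "q \<noteq> []"
    using Suc.prems(2) q(2) poly_mult_zero(2)[of "[\<one>, \<ominus> a]"] a(1)
    by (auto simp: univ_poly_mult simp del: poly_mult.simps poly_add.simps)
  have aT: "a \<in> T"
    using a roots_mem_iff_is_root[OF Suc.prems(1)] Suc.prems(5) by (auto simp: is_root_def)
  have pa: "polynomial (carrier R) [\<one>, \<ominus> a]" and pq: "polynomial (carrier R) q"
    using a(3) q(1) by (auto simp: univ_poly_carrier)
  have "lead_coeff q \<in> carrier R" using pq qn by (cases q) (auto simp: polynomial_def)
  then have lead: "lead_coeff p = lead_coeff q"
    using poly_mult_lead_coeff[OF carrier_is_subring pa pq _ qn]
    by (simp add: q(2) univ_poly_mult del: poly_mult.simps poly_add.simps)
  have deg: "degree p = Suc (degree q)"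
    using poly_mult_degree_eq[OF carrier_is_subring pa pq] qn
    by (cases q) (simp_all add: q(2) univ_poly_mult del: poly_mult.simps poly_add.simps)
  interpret UP: cring "poly_ring R" by (rule univ_poly_is_cring[OF carrier_is_subring])
  have "q pdivides p"
    unfolding pdivides_def factor_def using a(3) q UP.m_comm[OF a(3) q(1)] by blast
  then have split: "splitted q" using pdivides_imp_splitted[OF q(1) Suc.prems(1,2,4)] by simp
  have rts: "{y \<in> carrier R. eval q y = \<zero>} \<subseteq> T"
  proof
    fix y assume y: "y \<in> {y \<in> carrier R. eval q y = \<zero>}"
    then have "eval p y = eval [\<one>, \<ominus> a] y \<otimes> \<zero>"
      unfolding q(2) using poly_eval_mult[OF carrier_is_subring a(3) q(1)] by simp
    also have "\<dots> = \<zero>" using y a(1) by simp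
    finally show "y \<in> T" using y Suc.prems(5) by blast
  qed
  have qT: "q \<in> carrier (T[X])"
    using Suc.hyps(1)[of q] q(1) qn lead Suc.prems(3) split rts deg Suc.hyps(2) by simp
  have "[\<one>, \<ominus> a] \<in> carrier (T[X])"
    using aT subringE(3,5)[OF subfieldE(1)[OF assms(1)]] by (simp add: univ_poly_def polynomial_def)
  then show ?case
    using poly_mult_closed[OF subfieldE(1)[OF assms(1)]] qT
    by (simp add: q(2) univ_poly_carrier[symmetric] univ_poly_mult del: poly_mult.simps poly_add.simps)
qed

text \<open>
  All conjugates of \<open>x\<close> over \<open>J\<close> lie in \<open>T\<close>, so the minimal polynomial of \<open>x\<close> over \<open>J\<close> is defined
  over \<open>T \<inter> J\<close>.
\<close>

lemma dim_inter_le: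
  assumes "galois_over J" "subfield T R" "x \<in> carrier R" "conj J x \<subseteq> T"
  shows "finite_ext (T \<inter> J) (join (T \<inter> J) {x})" "dim (T \<inter> J) (join (T \<inter> J) {x}) \<le> dim J (join J {x})"
proof -
  note J = galois_overD[OF assms(1)]
  note I = Irr_props[OF J(1) assms(3) J(3)[OF assms(3)]]
  have sub: "subfield (T \<inter> J) R"
  proof (rule subfieldI')
    show "subring (T \<inter> J) R" by (rule subring_inter[OF subfieldE(1)[OF assms(2)] subfieldE(1)[OF J(1)]])
    show "inv k \<in> T \<inter> J" if "k \<in> T \<inter> J - {\<zero>}" for k
      using subfield_m_inv(1)[OF assms(2), of k] subfield_m_inv(1)[OF J(1), of k] that by auto
  qed
  have "splitted (Irr J x)"
    using card_roots_eq_degree_iff[OF I(2,3)] J(4)[OF assms(3)] by (auto simp: conj_def)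
  then have "Irr J x \<in> carrier (T[X])"
    using splitted_poly_coeffs[OF assms(2) I(2,3)] I(6) assms(4) subringE(3)[OF subfieldE(1)[OF assms(2)]]
    by (auto simp: conj_def)
  then have p: "Irr J x \<in> carrier ((T \<inter> J)[X])"
    using I(1) unfolding univ_poly_def polynomial_def by auto
  have alg: "(algebraic over (T \<inter> J)) x"
    using algebraicI[OF p I(3,4)] by (simp add: over_def)
  show "finite_ext (T \<inter> J) (join (T \<inter> J) {x})" by (rule dim_join_simple(1)[OF sub assms(3) alg])
  have "degree (Irr (T \<inter> J) x) \<le> degree (Irr J x)"
    using pdivides_imp_degree_le[OF subfieldE(1)[OF sub] Irr_props(1)[OF sub assms(3) alg] p I(3)]
      Irr_minimal[OF sub assms(3) alg p I(4)] by simp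
  then show "dim (T \<inter> J) (join (T \<inter> J) {x}) \<le> dim J (join J {x})"
    using dim_join_simple(2)[OF sub assms(3) alg] dim_join_simple(2)[OF J(1) assms(3) J(3)[OF assms(3)]] by simp
qed

text \<open>\<open>h\<close> carries the conjugates of \<open>x\<close> injectively to roots of the
  image polynomial, and their number is already its degree. So these are all of its roots, and the
  minimal polynomial of \<open>h x\<close> over \<open>J'\<close> divides it.\<close>

lemma conj_hom:
  assumes "galois_over J" "h \<in> ring_hom R R" "subfield J' R" "h ` J \<subseteq> J'" "x \<in> carrier R"
  shows "conj J' (h x) \<subseteq> h ` conj J x"
proof
  interpret h: ring_hom_ring R R h by (rule hom_facts[OF assms(2)])
  note J = galois_overD[OF assms(1)]
  note I = Irr_props[OF J(1) assms(5) J(3)[OF assms(5)]]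
  let ?p = "map h (Irr J x)"
  have hx: "h x \<in> carrier R" using assms(5) by simp
  have "?p \<in> carrier ((h ` J)[X])" using h.subfield_polynomial_hom[OF J(1) _ I(1)] by simp
  then have p: "?p \<in> carrier (J'[X])" using poly_ring_mono[OF assms(4)] by simp
  then have pR: "?p \<in> carrier (poly_ring R)"
    using carrier_polynomial_shell[OF subfieldE(1)[OF assms(3)]] by simp
  have ev: "eval ?p (h y) = h (eval (Irr J x) y)" if "y \<in> carrier R" for y
    using h.eval_hom[OF subfieldE(1)[OF J(1)] that I(1)] by simp
  have alg: "(algebraic over J') (h x)"
    using algebraicI[OF p] ev[OF assms(5)] I(3,4) by (simp add: over_def)
  have sub: "h ` conj J x \<subseteq> {y \<in> carrier R. eval ?p y = \<zero>}"
    using ev by (auto simp: conj_def)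
  have "card (h ` conj J x) = degree ?p"
    using J(4)[OF assms(5)] card_image[OF inj_on_subset[OF hom_facts(2)[OF assms(2)]]]
    by (simp add: conj_def)
  then have all: "h ` conj J x = {y \<in> carrier R. eval ?p y = \<zero>}"
    using card_seteq[OF _ sub] finite_roots[OF pR] I(3) by simp
  fix y assume "y \<in> conj J' (h x)"
  then show "y \<in> h ` conj J x"
    unfolding all using conj_root[OF assms(3) hx alg p] ev[OF assms(5)] I(4) by (auto simp: conj_def)
qed

lemma hom_restrict_generate:
  assumes "subfield E R" "h \<in> ring_hom (R\<lparr>carrier := E\<rparr>) R" "A \<subseteq> E" "subfield F R" "h ` A \<subseteq> F"
    and "z \<in> generate_field R A"
  shows "h z \<in> F"
  using assms(6)
proof induction
  have AR: "A \<subseteq> carrier R" using assms(3) subfieldE(3)[OF assms(1)] by auto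
  have AE: "generate_field R A \<subseteq> E" by (rule generate_field_min_subfield1[OF AR assms(1,3)])
  interpret E: field "R\<lparr>carrier := E\<rparr>" by (rule subfield_iff(2)[OF assms(1)])
  interpret h: ring_hom_ring "R\<lparr>carrier := E\<rparr>" R h
    by (rule ring_hom_ringI2[OF E.ring_axioms ring_axioms assms(2)])
  note F = subringE[OF subfieldE(1)[OF assms(4)]] and ER = subfieldE(3)[OF assms(1)]
  {
    case one
    then show ?case using h.hom_one F(3) by simp
  next
    case (incl h)
    then show ?case using assms(5) by auto
  next
    case (a_inv x)
    then have "x \<in> E" using AE by auto
    then have "h (\<ominus>\<^bsub>R\<lparr>carrier := E\<rparr>\<^esub> x) = \<ominus> h x" using h.hom_a_inv by simp
    moreover have "\<ominus>\<^bsub>R\<lparr>carrier := E\<rparr>\<^esub> x = \<ominus> x"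
      using \<open>x \<in> E\<close> subringE(5)[OF subfieldE(1)[OF assms(1)]] ER
      by (intro E.minus_equality[symmetric, symmetric]) (auto simp: l_neg)
    ultimately show ?case using a_inv F(5) by simp
  next
    case (m_inv x)
    then have x: "x \<in> E" "x \<in> carrier R" using AE ER by auto
    then have ix: "inv x \<in> E" using subfield_m_inv(1)[OF assms(1), of x] m_inv by auto
    have "h x \<otimes> h (inv x) = \<one>"
      using h.hom_mult[of x "inv x"] x ix m_inv(2) h.hom_one by (simp add: field_Units)
    then have "h x \<noteq> \<zero>" and "inv (h x) = h (inv x)"
      using comm_inv_char[of "h x" "h (inv x)"] x ix h.hom_closed by auto
    then show ?case using m_inv subfield_m_inv(1)[OF assms(4), of "h x"] by auto
  next
    case (eng_add h1 h2)
    then have "h1 \<in> E" "h2 \<in> E" using AE by auto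
    then show ?case using h.hom_add[of h1 h2] eng_add F(7) by simp
  next
    case (eng_mult h1 h2)
    then have "h1 \<in> E" "h2 \<in> E" using AE by auto
    then show ?case using h.hom_mult[of h1 h2] eng_mult F(6) by simp
  }
qed

lemma poly_hom_facts:
  fixes S :: "('s, 't) ring_scheme"
  assumes "subfield J R" "\<theta> \<in> ring_hom (R\<lparr>carrier := J\<rparr>) S" "field S" "y \<in> carrier S"
    and "p \<in> carrier (J[X])" "q \<in> carrier (J[X])"
  shows "ring.eval S (map \<theta> (p \<oplus>\<^bsub>J[X]\<^esub> q)) y = ring.eval S (map \<theta> p) y \<oplus>\<^bsub>S\<^esub> ring.eval S (map \<theta> q) y"
    "ring.eval S (map \<theta> (p \<otimes>\<^bsub>J[X]\<^esub> q)) y = ring.eval S (map \<theta> p) y \<otimes>\<^bsub>S\<^esub> ring.eval S (map \<theta> q) y"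
    "ring.eval S (map \<theta> p) y \<in> carrier S"
proof -
  interpret J: field "R\<lparr>carrier := J\<rparr>" by (rule subfield_iff(2)[OF assms(1)])
  interpret S: field S by fact
  interpret h: ring_hom_ring "R\<lparr>carrier := J\<rparr>" S \<theta>
    by (rule ring_hom_ringI2[OF J.ring_axioms S.ring_axioms assms(2)])
  have set: "set p \<subseteq> carrier (R\<lparr>carrier := J\<rparr>)" "set q \<subseteq> carrier (R\<lparr>carrier := J\<rparr>)"
    using poly_carrier_set(1)[OF subfieldE(1)[OF assms(1)]] assms(5,6) by auto
  then have Sset: "set (map \<theta> p) \<subseteq> carrier S" "set (map \<theta> q) \<subseteq> carrier S" using h.hom_closed by auto
  have add: "p \<oplus>\<^bsub>J[X]\<^esub> q = J.poly_add p q" and mult: "p \<otimes>\<^bsub>J[X]\<^esub> q = J.poly_mult p q"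
    unfolding univ_poly_consistent[OF subfieldE(1)[OF assms(1)], symmetric]
    by (simp_all add: univ_poly_add univ_poly_mult)
  have cl: "set (map \<theta> (J.poly_add p q)) \<subseteq> carrier S" "set (map \<theta> (J.poly_mult p q)) \<subseteq> carrier S"
    using J.poly_add_in_carrier[OF set] J.poly_mult_in_carrier[OF set] h.hom_closed by auto
  show "ring.eval S (map \<theta> (p \<oplus>\<^bsub>J[X]\<^esub> q)) y = ring.eval S (map \<theta> p) y \<oplus>\<^bsub>S\<^esub> ring.eval S (map \<theta> q) y"
    using h.poly_add_hom'[OF set] S.eval_normalize[OF cl(1) assms(4)] S.eval_poly_add[OF Sset assms(4)]
    unfolding add by simp
  show "ring.eval S (map \<theta> (p \<otimes>\<^bsub>J[X]\<^esub> q)) y = ring.eval S (map \<theta> p) y \<otimes>\<^bsub>S\<^esub> ring.eval S (map \<theta> q) y"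
    using h.poly_mult_hom'[OF set] S.eval_normalize[OF cl(2) assms(4)] S.eval_poly_mult[OF Sset assms(4)]
    unfolding mult by simp
  show "ring.eval S (map \<theta> p) y \<in> carrier S" by (rule S.eval_in_carrier[OF Sset(1) assms(4)])
qed

text \<open>This is \<open>J(x) = J[X]/(Irr J x)\<close> phrased with evaluations:
  \<open>eval p x\<close> is sent to the value of the image polynomial at \<open>y\<close>, and two
  polynomials that agree at \<open>x\<close> differ by a multiple of \<open>Irr J x\<close>, which
  vanishes at \<open>y\<close>. The target has its own type since it is \<open>R\<close> in some
  uses and an algebraic closure of the base in others.\<close>

lemma hom_extend:
  fixes S :: "('s, 't) ring_scheme"
  assumes "subfield J R" "\<theta> \<in> ring_hom (R\<lparr>carrier := J\<rparr>) S" "field S"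
    and "x \<in> carrier R" "(algebraic over J) x"
    and "y \<in> carrier S" "ring.eval S (map \<theta> (Irr J x)) y = \<zero>\<^bsub>S\<^esub>"
  obtains \<eta> where "\<eta> \<in> ring_hom (R\<lparr>carrier := join J {x}\<rparr>) S" "\<eta> x = y" "\<And>a. a \<in> J \<Longrightarrow> \<eta> a = \<theta> a"
    "\<And>p. p \<in> carrier (J[X]) \<Longrightarrow> \<eta> (eval p x) = ring.eval S (map \<theta> p) y"
proof -
  interpret S: field S by fact
  interpret J: field "R\<lparr>carrier := J\<rparr>" by (rule subfield_iff(2)[OF assms(1)])
  interpret h: ring_hom_ring "R\<lparr>carrier := J\<rparr>" S \<theta>
    by (rule ring_hom_ringI2[OF J.ring_axioms S.ring_axioms assms(2)])
  note sJ = subfieldE(1)[OF assms(1)] and JR = subfieldE(3)[OF assms(1)]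
  interpret UP: cring "J[X]" by (rule univ_poly_is_cring[OF sJ])
  note PA = poly_hom_facts[OF assms(1-3,6)]
  define \<Psi> where "\<Psi> p = ring.eval S (map \<theta> p) y" for p
  have ev_hom: "ring_hom_ring (J[X]) R (\<lambda>p. eval p x)" by (rule eval_ring_hom[OF sJ assms(4)])
  interpret ev: ring_hom_ring "J[X]" R "\<lambda>p. eval p x" by (rule ev_hom)
  have wd: "\<Psi> p = \<Psi> q" if p: "p \<in> carrier (J[X])" and q: "q \<in> carrier (J[X])" and eq: "eval p x = eval q x" for p q
  proof -
    define d where "d = p \<ominus>\<^bsub>J[X]\<^esub> q"
    have d: "d \<in> carrier (J[X])" using p q by (simp add: d_def)
    have "eval d x = eval p x \<oplus> \<ominus> eval q x"
      using p q unfolding d_def a_minus_def by (simp add: ev.hom_add ev.hom_a_inv del: univ_poly_a_inv_def')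
    then have "eval d x = \<zero>" using eq q by (simp add: r_neg)
    then obtain r where r: "r \<in> carrier (J[X])" "d = Irr J x \<otimes>\<^bsub>J[X]\<^esub> r"
      using Irr_divides[OF assms(1,4,5) d] by blast
    have "\<Psi> d = \<zero>\<^bsub>S\<^esub>"
      unfolding r(2) \<Psi>_def using PA(2)[OF Irr_props(1)[OF assms(1,4,5)] r(1)] PA(3)[OF r(1) r(1)] assms(7) by simp
    moreover have "p = d \<oplus>\<^bsub>J[X]\<^esub> q" using p q unfolding d_def by (simp add: UP.minus_eq UP.a_assoc UP.l_neg)
    ultimately show ?thesis
      using PA(1)[OF d q] PA(3)[OF q q] unfolding \<Psi>_def by simp
  qed
  have join: "join J {x} = (\<lambda>p. eval p x) ` carrier (J[X])"
    using simple_extension_eq_join[OF assms(1,4,5)] simple_extension_as_eval_img[OF JR assms(4)] by simp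
  define \<eta> where "\<eta> z = \<Psi> (SOME p. p \<in> carrier (J[X]) \<and> eval p x = z)" for z
  have \<eta>: "\<eta> (eval p x) = \<Psi> p" if "p \<in> carrier (J[X])" for p
  proof -
    have "(SOME q. q \<in> carrier (J[X]) \<and> eval q x = eval p x) \<in> carrier (J[X]) \<and>
        eval (SOME q. q \<in> carrier (J[X]) \<and> eval q x = eval p x) x = eval p x"
      by (rule someI_ex) (use that in blast)
    then show ?thesis unfolding \<eta>_def using wd that by blast
  qed
  have const: "\<eta> a = \<theta> a" if "a \<in> J" for a
  proof (cases "a = \<zero>")
    case True
    then show ?thesis
      using \<eta>[of "[]"] h.hom_zero by (simp add: \<Psi>_def univ_poly_def polynomial_def)
  next
    case False
    then show ?thesis
      using \<eta>[of "[a]"] that JR h.hom_closed[of a] assms(4,6) by (auto simp: \<Psi>_def univ_poly_def polynomial_def)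
  qed
  show ?thesis
  proof (rule that)
    show "\<eta> \<in> ring_hom (R\<lparr>carrier := join J {x}\<rparr>) S"
    proof (rule ring_hom_memI)
      fix u assume "u \<in> carrier (R\<lparr>carrier := join J {x}\<rparr>)"
      then obtain p where "p \<in> carrier (J[X])" "u = eval p x" using join by auto
      then show "\<eta> u \<in> carrier S" using \<eta> PA(3) by (simp add: \<Psi>_def)
      fix v assume "v \<in> carrier (R\<lparr>carrier := join J {x}\<rparr>)"
      then obtain q where "q \<in> carrier (J[X])" "v = eval q x" using join by auto
      note pq = \<open>p \<in> _\<close> \<open>u = _\<close> this
      show "\<eta> (u \<otimes>\<^bsub>R\<lparr>carrier := join J {x}\<rparr>\<^esub> v) = \<eta> u \<otimes>\<^bsub>S\<^esub> \<eta> v"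
        using \<eta>[of "p \<otimes>\<^bsub>J[X]\<^esub> q"] \<eta>[of p] \<eta>[of q] PA(2)[of p q] pq by (simp add: \<Psi>_def ev.hom_mult)
      show "\<eta> (u \<oplus>\<^bsub>R\<lparr>carrier := join J {x}\<rparr>\<^esub> v) = \<eta> u \<oplus>\<^bsub>S\<^esub> \<eta> v"
        using \<eta>[of "p \<oplus>\<^bsub>J[X]\<^esub> q"] \<eta>[of p] \<eta>[of q] PA(1)[of p q] pq by (simp add: \<Psi>_def ev.hom_add)
    next
      show "\<eta> \<one>\<^bsub>R\<lparr>carrier := join J {x}\<rparr>\<^esub> = \<one>\<^bsub>S\<^esub>"
        using const[of \<one>] subringE(3)[OF sJ] h.hom_one by simp
    qed
    show "\<eta> a = \<theta> a" if "a \<in> J" for a using const[OF that] .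
    show "\<eta> (eval p x) = ring.eval S (map \<theta> p) y" if "p \<in> carrier (J[X])" for p
      using \<eta>[OF that] by (simp add: \<Psi>_def)
    have "X \<in> carrier (J[X])" using var_closed(1)[OF sJ] .
    then show "\<eta> x = y"
      using \<eta>[of X] eval_var[OF assms(4)] assms(6) h.hom_one h.hom_zero by (simp add: \<Psi>_def var_def)
  qed
qed

definition normal_ext :: "'a set \<Rightarrow> 'a set \<Rightarrow> bool"
  where "normal_ext K E \<longleftrightarrow> subfield E R \<and> K \<subseteq> E \<and> (\<forall>x\<in>E. conj K x \<subseteq> E)"

lemma join_join:
  assumes "J \<subseteq> carrier R" "S \<subseteq> carrier R" "T \<subseteq> carrier R"
  shows "join (join J S) T = join J (S \<union> T)"
proof (rule generate_field_eqI)
  show "join J S \<union> T \<subseteq> carrier R" using assms subfieldE(3)[OF join_subfield[OF assms(1,2)]] by auto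
  show "J \<union> (S \<union> T) \<subseteq> carrier R" using assms by auto
  show "join J S \<union> T \<subseteq> join J (S \<union> T)"
    using generate_field_mono[of "J \<union> S" "J \<union> (S \<union> T)"] by (auto intro: generate_field.incl)
  show "J \<union> (S \<union> T) \<subseteq> join (join J S) T"
    by (auto intro: generate_field.incl)
qed

lemma hom_fix_conj:
  assumes "subfield E R" "h \<in> ring_hom (R\<lparr>carrier := E\<rparr>) R" "subfield K R" "K \<subseteq> E" "\<And>a. a \<in> K \<Longrightarrow> h a = a"
    and "s \<in> E" "(algebraic over K) s"
  shows "h s \<in> conj K s"
proof -
  interpret E: field "R\<lparr>carrier := E\<rparr>" by (rule subfield_iff(2)[OF assms(1)])
  interpret h: ring_hom_ring "R\<lparr>carrier := E\<rparr>" R h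
    by (rule ring_hom_ringI2[OF E.ring_axioms ring_axioms assms(2)])
  have sR: "s \<in> carrier R" using assms(6) subfieldE(3)[OF assms(1)] by auto
  note I = Irr_props[OF assms(3) sR assms(7)]
  have set: "set (Irr K s) \<subseteq> K" by (rule poly_carrier_set(1)[OF subfieldE(1)[OF assms(3)] I(1)])
  then have "map h (Irr K s) = Irr K s" using assms(5) by (intro map_idI) auto
  then have "eval (Irr K s) (h s) = h (eval (Irr K s) s)"
    using h.eval_hom'[of s "Irr K s"] assms(4,6) set eval_consistent[OF subfieldE(1)[OF assms(1)]] by auto
  also have "\<dots> = \<zero>" using I(4) h.hom_zero by simp
  finally show ?thesis using h.hom_closed[of s] assms(6) by (simp add: conj_def)
qed

text \<open>Adjoin one element at a time. \<open>Irr K s\<close> factors over the current field as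
  \<open>Irr J2 s\<close> times \<open>r\<close>. If the image of the first factor had no root in
  \<open>R\<close>, every conjugate of \<open>s\<close> over \<open>K\<close> would be a root of the
  image of \<open>r\<close>, whose degree is too small. The count takes the place of an
  algebraically closed target.\<close>

lemma hom_extend_finite:
  assumes "galois_over K" "subfield J R" "K \<subseteq> J" "\<theta> \<in> ring_hom (R\<lparr>carrier := J\<rparr>) R" "\<And>a. a \<in> K \<Longrightarrow> \<theta> a = a"
    and "finite S" "S \<subseteq> carrier R"
  shows "\<exists>\<eta>. \<eta> \<in> ring_hom (R\<lparr>carrier := join J S\<rparr>) R \<and> (\<forall>a\<in>J. \<eta> a = \<theta> a)"
  using assms(6,7)
proof (induction S)
  case empty
  have "join J {} = J" using join_absorb(1)[OF assms(2), of "{}"] by simp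
  then show ?case using assms(4) by auto
next
  case (insert s S)
  note K = galois_overD[OF assms(1)] and JR = subfieldE(3)[OF assms(2)]
  have s: "s \<in> carrier R" and S: "S \<subseteq> carrier R" using insert.prems by auto
  obtain \<eta> where \<eta>: "\<eta> \<in> ring_hom (R\<lparr>carrier := join J S\<rparr>) R" "\<forall>a\<in>J. \<eta> a = \<theta> a"
    using insert.IH S by blast
  define J2 where "J2 = join J S"
  have J2: "subfield J2 R" unfolding J2_def by (rule join_subfield[OF JR S])
  have KJ2: "K \<subseteq> J2" using assms(3) join_upper(1)[of J S] by (simp add: J2_def)
  have algK: "(algebraic over K) s" using K(3)[OF s] .
  then have alg: "(algebraic over J2) s" using algebraic_mono[OF KJ2] by (simp add: over_def)
  note IK = Irr_props[OF K(1) s algK] and IJ = Irr_props[OF J2 s alg]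
  obtain r where r: "r \<in> carrier (J2[X])" "Irr K s = Irr J2 s \<otimes>\<^bsub>J2[X]\<^esub> r"
    using Irr_divides[OF J2 s alg poly_ring_mono[OF KJ2 IK(1)] IK(4)] by blast
  have rn: "r \<noteq> []"
    using IK(3) r(2) poly_mult_zero(2)[OF poly_carrier_set(2)[OF subfieldE(1)[OF J2] IJ(1)]]
    by (auto simp: univ_poly_mult)
  have deg: "degree (Irr K s) = degree (Irr J2 s) + degree r"
    using poly_mult_degree_eq[OF subfieldE(1)[OF J2], of "Irr J2 s" r] IJ(1,3) r rn
    by (simp add: univ_poly_carrier univ_poly_mult)
  have \<eta>2: "\<eta> \<in> ring_hom (R\<lparr>carrier := J2\<rparr>) R" using \<eta>(1) by (simp add: J2_def)
  have "r \<in> carrier (poly_ring (R\<lparr>carrier := J2\<rparr>))"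
    using r(1) univ_poly_consistent[OF subfieldE(1)[OF J2]] by simp
  then have mr: "map \<eta> r \<in> carrier (poly_ring R)" "map \<eta> r \<noteq> []"
    using polynomial_hom[OF \<eta>2 subfield_iff(2)[OF J2] field_axioms] rn by auto
  have fixK: "\<eta> a = a" if "a \<in> K" for a using that \<eta>(2) assms(3,5) by auto
  have mK: "map \<eta> (Irr K s) = Irr K s"
    using poly_carrier_set(1)[OF subfieldE(1)[OF K(1)] IK(1)] fixK by (intro map_idI) auto
  have "\<exists>z\<in>carrier R. eval (map \<eta> (Irr J2 s)) z = \<zero>"
  proof (rule ccontr)
    assume no: "\<not> ?thesis"
    have "conj K s \<subseteq> {z \<in> carrier R. eval (map \<eta> r) z = \<zero>}"
    proof
      fix z assume "z \<in> conj K s"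
      then have z: "z \<in> carrier R" "eval (Irr K s) z = \<zero>" by (auto simp: conj_def)
      note ph = poly_hom_facts[OF J2 \<eta>2 field_axioms z(1)]
      have "eval (map \<eta> (Irr J2 s)) z \<otimes> eval (map \<eta> r) z = \<zero>"
        using ph(2)[OF IJ(1) r(1)] z(2) mK r(2) by simp
      then show "z \<in> {z \<in> carrier R. eval (map \<eta> r) z = \<zero>}"
        using no z(1) integral[OF _ ph(3)[OF IJ(1) r(1)] ph(3)[OF r(1) r(1)]] by auto
    qed
    then have "card (conj K s) \<le> degree (map \<eta> r)"
      by (rule order_trans[OF card_mono[OF finite_roots(1)[OF mr]] finite_roots(2)[OF mr]])
    then show False using K(4)[OF s] deg IJ(5) unfolding length_map by linarith
  qed
  then obtain z where z: "z \<in> carrier R" "eval (map \<eta> (Irr J2 s)) z = \<zero>" by blast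
  obtain \<eta>' where \<eta>': "\<eta>' \<in> ring_hom (R\<lparr>carrier := join J2 {s}\<rparr>) R" "\<And>a. a \<in> J2 \<Longrightarrow> \<eta>' a = \<eta> a"
    by (rule hom_extend[OF J2 \<eta>2 field_axioms s alg z]) blast
  have "join J2 {s} = join J (insert s S)"
    unfolding J2_def using join_join[OF JR S, of "{s}"] s by simp
  then show ?case
    using \<eta>' \<eta>(2) join_upper(1)[of J S] by (intro exI[of _ \<eta>']) (auto simp: J2_def)
qed

text \<open>A conjugate \<open>y\<close> of \<open>x\<close> is the image of \<open>x\<close> under
  a homomorphism over \<open>K\<close>, which extends to all of \<open>S\<close>. It maps
  \<open>S\<close> into itself, hence also \<open>K(S)\<close>, so \<open>y\<close> lies in
  \<open>K(S)\<close>.\<close>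

lemma normal_join:
  assumes "galois_over K" "finite S" "S \<subseteq> carrier R" "\<And>s. s \<in> S \<Longrightarrow> conj K s \<subseteq> S"
  shows "normal_ext K (join K S)"
  unfolding normal_ext_def
proof (intro conjI ballI subsetI)
  note K = galois_overD[OF assms(1)]
  show sub: "subfield (join K S) R" by (rule join_subfield[OF K(2) assms(3)])
  show "x \<in> join K S" if "x \<in> K" for x using that by (auto intro: generate_field.incl)
  fix x y assume x: "x \<in> join K S" and y: "y \<in> conj K x"
  have xR: "x \<in> carrier R" using x subfieldE(3)[OF sub] by auto
  have yR: "y \<in> carrier R" "eval (Irr K x) y = \<zero>" using y by (auto simp: conj_def)
  have idh: "id \<in> ring_hom (R\<lparr>carrier := K\<rparr>) R" using K(2) by (auto simp: ring_hom_def)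
  obtain \<theta> where \<theta>: "\<theta> \<in> ring_hom (R\<lparr>carrier := join K {x}\<rparr>) R" "\<theta> x = y" "\<And>a. a \<in> K \<Longrightarrow> \<theta> a = id a"
    using hom_extend[OF K(1) idh field_axioms xR K(3)[OF xR] yR(1)] yR(2) by (auto simp: map_idI)
  have Jsub: "subfield (join K {x}) R" by (rule join_subfield[OF K(2)]) (use xR in simp)
  obtain \<eta> where \<eta>: "\<eta> \<in> ring_hom (R\<lparr>carrier := join (join K {x}) S\<rparr>) R" "\<forall>a\<in>join K {x}. \<eta> a = \<theta> a"
    using hom_extend_finite[OF assms(1) Jsub join_upper(1) \<theta>(1) _ assms(2,3)] \<theta>(3) by auto
  have Dsub: "subfield (join (join K {x}) S) R"
    using subfieldE(3)[OF Jsub] assms(3) by (rule join_subfield)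
  have KD: "K \<subseteq> join (join K {x}) S" and SD: "S \<subseteq> join (join K {x}) S"
    by (auto intro: generate_field.incl)
  have fixK: "\<eta> a = a" if "a \<in> K" for a
    using that \<theta>(3) \<eta>(2) join_upper(1)[of K "{x}"] by auto
  have "\<eta> s \<in> S" if "s \<in> S" for s
    using hom_fix_conj[OF Dsub \<eta>(1) K(1) KD fixK, of s] K(3)[of s] that assms(3,4) SD by blast
  then have "\<eta> ` (K \<union> S) \<subseteq> join K S"
    using fixK join_upper[of K S] join_upper(2)[where T = K and S = S] by auto
  then have "\<eta> x \<in> join K S"
    using hom_restrict_generate[OF Dsub \<eta>(1) _ sub _ x] KD SD by simp
  moreover have "\<eta> x = y" using \<eta>(2) \<theta>(2) join_upper(2)[where T = K and S = "{x}"] by simp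
  ultimately show "y \<in> join K S" by simp
qed

lemma finite_ext_finite_field:
  assumes "finite_ext K E" "finite K"
  shows "finite E"
proof -
  note KE = finite_extD[OF assms(1)]
  obtain us where us: "set us \<subseteq> carrier R" "Span K us = E"
    using KE(4) exists_base[OF KE(1)] unfolding finite_dimension_def by blast
  have "E \<subseteq> (\<lambda>ks. combine ks us) ` {ks. set ks \<subseteq> K \<and> length ks = length us}"
    unfolding us(2)[symmetric] Span_eq_combine_set_length_version[OF KE(1) us(1)] by auto
  then show ?thesis
    using finite_lists_length_eq[OF assms(2)] finite_surj by blast
qed

text \<open>\<open>E\<close> is a finite field, so its multiplicative group is cyclic, and a
  generator of the group generates the extension.\<close>

lemma primitive_element_finite:
  assumes "finite_ext K E" "finite K"
  shows "\<exists>e\<in>E. join K {e} = E"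
proof -
  note KE = finite_extD[OF assms(1)]
  interpret E: field "R\<lparr>carrier := E\<rparr>" by (rule subfield_iff(2)[OF KE(2)])
  obtain a where a: "a \<in> carrier (mult_of (R\<lparr>carrier := E\<rparr>))"
    "carrier (mult_of (R\<lparr>carrier := E\<rparr>)) = {a [^]\<^bsub>R\<lparr>carrier := E\<rparr>\<^esub> i | i::nat. i \<in> UNIV}"
    using E.finite_field_mult_group_has_gen finite_ext_finite_field[OF assms] by auto
  have aE: "a \<in> E" using a(1) by (simp add: mult_of_def)
  have sub: "subfield (join K {a}) R" by (rule join_subfield[OF KE(6)]) (use aE KE(5) in auto)
  have pow: "a [^]\<^bsub>R\<lparr>carrier := E\<rparr>\<^esub> (i::nat) \<in> join K {a}" for i
  proof (induction i)
    case 0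
    then show ?case using subringE(3)[OF subfieldE(1)[OF sub]] by simp
  next
    case (Suc i)
    then show ?case
      using subringE(6)[OF subfieldE(1)[OF sub]] join_upper(2)[where T = K and S = "{a}"] by simp
  qed
  have "E \<subseteq> join K {a}"
  proof
    fix x assume x: "x \<in> E"
    show "x \<in> join K {a}"
    proof (cases "x = \<zero>")
      case True
      then show ?thesis using subringE(2)[OF subfieldE(1)[OF sub]] by simp
    next
      case False
      then have "x \<in> carrier (mult_of (R\<lparr>carrier := E\<rparr>))" using x by (simp add: mult_of_def)
      then obtain i :: nat where "x = a [^]\<^bsub>R\<lparr>carrier := E\<rparr>\<^esub> i" unfolding a(2) by blast
      then show ?thesis using pow[of i] by (simp only:)
    qed
  qed
  moreover have "join K {a} \<subseteq> E" by (rule join_least[OF KE(2,3)]) (use aE in simp)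
  ultimately show ?thesis using aE by blast
qed

text \<open>
  For all but finitely many \<open>l \<in> K\<close> the element \<open>a + l b\<close> is primitive: a conjugate \<open>y \<noteq> b\<close> of \<open>b\<close>
  over \<open>K(a + l b)\<close> would make \<open>a + l (b - y)\<close> a conjugate of \<open>a\<close>.
\<close>

lemma primitive_element_two:
  assumes "galois_over K" "infinite K" "a \<in> carrier R" "b \<in> carrier R"
  shows "\<exists>c\<in>carrier R. join K {a, b} = join K {c}"
proof -
  note K = galois_overD[OF assms(1)]
  define B where "B = (\<lambda>(a', b'). (a' \<ominus> a) \<otimes> inv (b \<ominus> b')) ` (conj K a \<times> (conj K b - {b}))"
  have "finite B"
    unfolding B_def using conj_finite(1)[OF K(1) _ K(3)] assms(3,4) by auto
  then obtain l where l: "l \<in> K" "l \<notin> B" using assms(2) by (meson finite_subset subsetI)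
  have lR: "l \<in> carrier R" using l K(2) by auto
  define c where "c = a \<oplus> l \<otimes> b"
  have c: "c \<in> carrier R" using assms lR by (simp add: c_def)
  define J where "J = join K {c}"
  have J: "subfield J R" "K \<subseteq> J" "c \<in> J"
    using join_subfield[OF K(2), of "{c}"] c by (auto simp: J_def intro: generate_field.incl)
  note GJ = galois_overD[OF galois_over_mono[OF assms(1) J(1,2)]]
  have "conj J b = {b}"
  proof
    show "{b} \<subseteq> conj J b" using conj_finite(3)[OF J(1) assms(4) GJ(3)[OF assms(4)]] by simp
    show "conj J b \<subseteq> {b}"
    proof
      fix y assume y: "y \<in> conj J b"
      then have yR: "y \<in> carrier R" "eval (Irr J b) y = \<zero>" by (auto simp: conj_def)
      have idh: "id \<in> ring_hom (R\<lparr>carrier := J\<rparr>) R" using GJ(2) by (auto simp: ring_hom_def)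
      obtain \<theta> where \<theta>: "\<theta> \<in> ring_hom (R\<lparr>carrier := join J {b}\<rparr>) R" "\<theta> b = y" "\<And>a. a \<in> J \<Longrightarrow> \<theta> a = id a"
        using hom_extend[OF J(1) idh field_axioms assms(4) GJ(3)[OF assms(4)] yR(1)] yR(2) by (auto simp: map_idI)
      have Jb: "subfield (join J {b}) R" by (rule join_subfield[OF GJ(2)]) (use assms(4) in simp)
      note Jbr = subringE[OF subfieldE(1)[OF Jb]]
      have mem: "b \<in> join J {b}" "c \<in> join J {b}" "l \<in> join J {b}"
        using J l by (auto intro: generate_field.incl)
      have a_eq: "a = c \<oplus> (\<ominus> l) \<otimes> b"
        using assms lR by (simp add: c_def l_minus a_assoc r_neg)
      have amem: "a \<in> join J {b}" unfolding a_eq using mem Jbr by auto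
      have "\<theta> c = \<theta> a \<oplus> \<theta> l \<otimes> \<theta> b"
        using ring_hom_add[OF \<theta>(1), of a "l \<otimes> b"] ring_hom_mult[OF \<theta>(1), of l b] mem amem Jbr
        by (simp add: c_def)
      then have ceq: "c = \<theta> a \<oplus> l \<otimes> y" using \<theta>(2,3) J l by auto
      have ta: "\<theta> a \<in> conj K a"
        using hom_fix_conj[OF Jb \<theta>(1) K(1) _ _ amem K(3)[OF assms(3)]] \<theta>(3) J(2) join_upper(1)[of J "{b}"]
        by auto
      then have taR: "\<theta> a \<in> carrier R" by (simp add: conj_def)
      have "y \<in> conj K b" using y conj_mono[OF K(1) J(1,2) assms(4) K(3)[OF assms(4)]] by auto
      show "y \<in> {b}"
      proof (rule ccontr)
        assume "y \<notin> {b}"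
        then have yb: "b \<ominus> y \<noteq> \<zero>" using yR(1) assms(4) by simp
        have "a \<oplus> l \<otimes> b = \<theta> a \<oplus> l \<otimes> y" using ceq by (simp add: c_def)
        have "\<theta> a = (\<theta> a \<oplus> l \<otimes> y) \<ominus> l \<otimes> y"
          using lR yR(1) taR by algebra
        also have "\<dots> \<ominus> a = l \<otimes> (b \<ominus> y)"
          unfolding \<open>a \<oplus> l \<otimes> b = \<theta> a \<oplus> l \<otimes> y\<close>[symmetric]
          using assms(3,4) lR yR(1) by algebra
        finally have "l \<otimes> (b \<ominus> y) = \<theta> a \<ominus> a" by simp
        then have "(\<theta> a \<ominus> a) \<otimes> inv (b \<ominus> y) = l"
          using yb assms(4) yR(1) lR by (metis (no_types, lifting) field_Units Diff_iff Units_inv_closed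
              Units_r_inv m_assoc minus_closed r_one singletonD)
        then have "l \<in> B" using ta \<open>y \<in> conj K b\<close> \<open>y \<notin> {b}\<close> by (force simp: B_def)
        then show False using l(2) by simp
      qed
    qed
  qed
  then have "dim J (join J {b}) = 1" using GJ(5)[OF assms(4)] by simp
  then have "join J {b} = J" using finite_ext_dim_one[OF GJ(6)[OF assms(4)]] by simp
  then have bJ: "b \<in> J" using join_upper(2)[where T = J and S = "{b}"] by simp
  have "a = c \<oplus> (\<ominus> l) \<otimes> b"
    using assms lR by (simp add: c_def l_minus a_assoc r_neg)
  then have aJ: "a \<in> J" using bJ J l subringE(5,6,7)[OF subfieldE(1)[OF J(1)]] by auto
  have "join K {a, b} \<subseteq> J" using aJ bJ J by (intro join_least) auto
  moreover have "J \<subseteq> join K {a, b}"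
  proof -
    have s: "subfield (join K {a, b}) R" using K(2) assms by (intro join_subfield) auto
    have "c \<in> join K {a, b}"
      unfolding c_def using l
      by (intro generate_field.eng_add generate_field.eng_mult generate_field.incl) auto
    then show ?thesis unfolding J_def using s join_upper(1)[of K "{a, b}"] by (intro join_least) auto
  qed
  ultimately show ?thesis using c by (auto simp: J_def)
qed

theorem primitive_element:
  assumes "galois_over K" "finite_ext K E"
  obtains e where "e \<in> E" "join K {e} = E"
proof (cases "finite K")
  case True
  then show ?thesis using primitive_element_finite[OF assms(2)] that by blast
next
  case False
  note K = galois_overD[OF assms(1)]
  obtain S where S: "finite S" "S \<subseteq> E" "join K S = E" by (rule finite_ext_generators[OF assms(2)])
  have "\<exists>c\<in>carrier R. join K S = join K {c}" if "finite S" "S \<subseteq> carrier R" for S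
    using that
  proof (induction S)
    case empty
    have "join K {} = join K {\<zero>}"
      using join_absorb(1)[OF K(1), of "{}"] join_absorb(1)[OF K(1), of "{\<zero>}"]
        subringE(2)[OF subfieldE(1)[OF K(1)]] by simp
    then show ?case by blast
  next
    case (insert s S)
    then obtain c where c: "c \<in> carrier R" "join K S = join K {c}" by auto
    have "join K (insert s S) = join (join K S) {s}"
      using join_join[OF K(2), of S "{s}"] insert.prems by simp
    also have "\<dots> = join K {c, s}"
      unfolding c(2) using join_join[OF K(2), of "{c}" "{s}"] insert.prems c(1)
      by (simp add: insert_commute)
    finally show ?case using primitive_element_two[OF assms(1) False c(1), of s] insert.prems by auto
  qed
  then obtain c where "c \<in> carrier R" "join K S = join K {c}"
    using S(1,2) finite_extD(5)[OF assms(2)] by blast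
  then show ?thesis using that[of c] S(3) join_upper(2)[where T = K and S = "{c}"] by auto
qed

end

section \<open>Normal extensions under a ring endomorphism\<close>

context field
begin

lemma join_hom_generate:
  assumes "subfield T R" "h \<in> ring_hom R R" "S \<subseteq> carrier R"
  shows "join T (h ` generate_field R S) = join T (h ` S)"
proof (rule generate_field_eqI)
  interpret h: ring_hom_ring R R h by (rule hom_facts[OF assms(2)])
  have TR: "T \<subseteq> carrier R" by (rule subfieldE(3)[OF assms(1)])
  have SR: "h ` S \<subseteq> carrier R" using assms(3) by auto
  show "T \<union> h ` S \<subseteq> carrier R" using TR SR by auto
  show "T \<union> h ` generate_field R S \<subseteq> carrier R"
    using TR generate_field_incl[OF SR] by (auto simp: hom_generate_field[OF assms(2,3)])
  show "T \<union> h ` generate_field R S \<subseteq> join T (h ` S)"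
    using generate_field_mono[of "h ` S" "T \<union> h ` S"]
    by (auto simp: hom_generate_field[OF assms(2,3)] intro: generate_field.incl)
  show "T \<union> h ` S \<subseteq> join T (h ` generate_field R S)"
    by (auto intro: generate_field.incl)
qed

lemma join_hom_join:
  assumes "subfield T R" "h \<in> ring_hom R R" "h ` K \<subseteq> T" "K \<subseteq> carrier R" "S \<subseteq> carrier R"
  shows "join T (h ` join K S) = join T (h ` S)"
proof -
  have "T \<union> h ` (K \<union> S) = T \<union> h ` S" using assms(3) by auto
  then show ?thesis using join_hom_generate[OF assms(1,2), of "K \<union> S"] assms(4,5) by simp
qed

lemma conj_conj:
  assumes "galois_over K" "x \<in> carrier R" "y \<in> conj K x"
  shows "conj K y \<subseteq> conj K x"
proof
  fix z assume z: "z \<in> conj K y"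
  note K = galois_overD[OF assms(1)]
  have y: "y \<in> carrier R" "eval (Irr K x) y = \<zero>" using assms(3) by (auto simp: conj_def)
  have "eval (Irr K x) z = \<zero>"
    by (rule conj_root[OF K(1) y(1) K(3)[OF y(1)] Irr_props(1)[OF K(1) assms(2) K(3)[OF assms(2)]] y(2) z])
  then show "z \<in> conj K x" using z by (simp add: conj_def)
qed

text \<open>The conjugates of a primitive element serve. Conjugation-stable generators are the form
  in which normality is carried through composita and through \<open>\<phi>\<close>.\<close>

lemma normal_ext_generators:
  assumes "galois_over K" "finite_ext K M" "normal_ext K M"
  obtains S where "finite S" "S \<subseteq> M" "\<And>s. s \<in> S \<Longrightarrow> conj K s \<subseteq> S" "join K S = M"
proof -
  note K = galois_overD[OF assms(1)] and KM = finite_extD[OF assms(2)]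
  obtain e where e: "e \<in> M" "join K {e} = M" by (rule primitive_element[OF assms(1,2)])
  have eR: "e \<in> carrier R" using e(1) KM(5) by auto
  note c = conj_finite[OF K(1) eR K(3)[OF eR]]
  have sub: "conj K e \<subseteq> M" using assms(3) e(1) by (auto simp: normal_ext_def)
  have "join K (conj K e) = M"
  proof
    show "join K (conj K e) \<subseteq> M" by (rule join_least[OF KM(2,3) sub])
    show "M \<subseteq> join K (conj K e)"
      unfolding e(2)[symmetric] using c(3) by (intro generate_field_mono) auto
  qed
  then show ?thesis using that[OF c(1) sub] conj_conj[OF assms(1) eR] by blast
qed

text \<open>By \<open>conj_hom\<close> the \<open>h\<close>-image of a conjugation-stable set over
  \<open>K\<close> is conjugation-stable over \<open>T\<close>, and the images of such generators of
  \<open>M\<close> generate the compositum.\<close>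

lemma normal_ext_translate:
  assumes "galois_over K" "galois_over T" "h \<in> ring_hom R R" "h ` K \<subseteq> T"
    and "finite_ext K M" "normal_ext K M"
  shows "normal_ext T (join T (h ` M))"
proof -
  note K = galois_overD[OF assms(1)] and T = galois_overD[OF assms(2)] and KM = finite_extD[OF assms(5)]
  interpret h: ring_hom_ring R R h by (rule hom_facts[OF assms(3)])
  obtain S where S: "finite S" "S \<subseteq> M" "\<And>s. s \<in> S \<Longrightarrow> conj K s \<subseteq> S" "join K S = M"
    using normal_ext_generators[OF assms(1,5,6)] by blast
  have SR: "S \<subseteq> carrier R" using S(2) KM(5) by auto
  have "join T (h ` M) = join T (h ` S)"
    unfolding S(4)[symmetric] by (rule join_hom_join[OF T(1) assms(3,4) K(2) SR])
  moreover have "normal_ext T (join T (h ` S))"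
  proof (rule normal_join[OF assms(2)])
    show "finite (h ` S)" using S(1) by simp
    show "h ` S \<subseteq> carrier R" using SR by auto
    fix s' assume "s' \<in> h ` S"
    then obtain s where s: "s \<in> S" "s' = h s" by auto
    then show "conj T s' \<subseteq> h ` S"
      using conj_hom[OF assms(1,3) T(1) assms(4), of s] S(3)[OF s(1)] SR by blast
  qed
  ultimately show ?thesis by simp
qed

lemma normal_ext_join:
  assumes "galois_over K" "finite_ext K M" "normal_ext K M" "finite_ext K N" "normal_ext K N"
  shows "normal_ext K (join M N)"
proof -
  note K = galois_overD[OF assms(1)]
  obtain S where S: "finite S" "S \<subseteq> M" "\<And>s. s \<in> S \<Longrightarrow> conj K s \<subseteq> S" "join K S = M"
    using normal_ext_generators[OF assms(1-3)] by blast
  obtain T where T: "finite T" "T \<subseteq> N" "\<And>s. s \<in> T \<Longrightarrow> conj K s \<subseteq> T" "join K T = N"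
    using normal_ext_generators[OF assms(1,4,5)] by blast
  have SR: "S \<subseteq> carrier R" "T \<subseteq> carrier R"
    using S(2) T(2) finite_extD(5)[OF assms(2)] finite_extD(5)[OF assms(4)] by auto
  have "join M N = join K (S \<union> T)"
  proof (rule generate_field_eqI)
    show "M \<union> N \<subseteq> carrier R" using finite_extD(5)[OF assms(2)] finite_extD(5)[OF assms(4)] by auto
    show "K \<union> (S \<union> T) \<subseteq> carrier R" using K(2) SR by auto
    show "M \<union> N \<subseteq> join K (S \<union> T)"
      using generate_field_mono[of "K \<union> S" "K \<union> (S \<union> T)"] generate_field_mono[of "K \<union> T" "K \<union> (S \<union> T)"]
        S(4) T(4) by auto
    show "K \<union> (S \<union> T) \<subseteq> join M N"
      using S(2) T(2) finite_extD(3)[OF assms(2)] by (auto intro: generate_field.incl)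
  qed
  moreover have "normal_ext K (join K (S \<union> T))"
    using S(1,3) T(1,3) SR by (intro normal_join[OF assms(1)]) auto
  ultimately show ?thesis by simp
qed

lemma inter_subfield:
  assumes "subfield T R" "subfield J R"
  shows "subfield (T \<inter> J) R"
proof (rule subfieldI')
  show "subring (T \<inter> J) R" by (rule subring_inter[OF subfieldE(1)[OF assms(1)] subfieldE(1)[OF assms(2)]])
  show "inv k \<in> T \<inter> J" if "k \<in> T \<inter> J - {\<zero>}" for k
    using subfield_m_inv(1)[OF assms(1), of k] subfield_m_inv(1)[OF assms(2), of k] that by auto
qed

text \<open>The conjugates over \<open>T\<close> of a primitive element of \<open>M\<close> stay in
  \<open>M\<close> by normality, so its minimal polynomial over \<open>T\<close> already has
  coefficients in \<open>M \<inter> T\<close>. This gives the inequality that translation does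
  not.\<close>

lemma natural_irrationalities:
  assumes "galois_over K" "finite_ext K M" "normal_ext K M" "subfield T R" "K \<subseteq> T"
  shows "dim (M \<inter> T) M = dim T (join T M)"
proof -
  note K = galois_overD[OF assms(1)] and KM = finite_extD[OF assms(2)]
  have MT: "subfield (M \<inter> T) R" by (rule inter_subfield[OF KM(2) assms(4)])
  have fM: "finite_ext (M \<inter> T) M"
    using finite_ext_subfields(2)[OF assms(2) MT] KM(3) assms(5) by auto
  have le: "dim T (join T M) \<le> dim (M \<inter> T) M" by (rule finite_ext_join(2)[OF fM assms(4)]) auto
  obtain e where e: "e \<in> M" "join K {e} = M" by (rule primitive_element[OF assms(1,2)])
  have eR: "e \<in> carrier R" using e(1) KM(5) by auto
  have galT: "galois_over T" by (rule galois_over_mono[OF assms(1,4,5)])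
  have "conj T e \<subseteq> M"
    using conj_mono[OF K(1) assms(4,5) eR K(3)[OF eR]] assms(3) e(1) by (auto simp: normal_ext_def)
  note di = dim_inter_le[OF galT KM(2) eR this]
  have 1: "join (M \<inter> T) {e} = M"
  proof
    show "join (M \<inter> T) {e} \<subseteq> M" by (rule join_least[OF KM(2)]) (use e(1) in auto)
    have "join K {e} \<subseteq> join (M \<inter> T) {e}"
      using KM(3) assms(5) by (intro generate_field_mono) auto
    then show "M \<subseteq> join (M \<inter> T) {e}" using e(2) by simp
  qed
  have "join T {e} \<subseteq> join T M" using e(1) by (intro generate_field_mono) auto
  moreover have "join T M \<subseteq> join T {e}"
  proof (rule join_least)
    show "subfield (join T {e}) R" by (rule join_subfield[OF galois_overD(2)[OF galT]]) (use eR in simp)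
    show "T \<subseteq> join T {e}" by (rule join_upper(1))
    have "join K {e} \<subseteq> join T {e}" using assms(5) by (intro generate_field_mono) auto
    then show "M \<subseteq> join T {e}" using e(2) by simp
  qed
  ultimately have 2: "join T {e} = join T M" by blast
  show ?thesis using di(2) le unfolding 1 2 by simp
qed

end

section \<open>Iterated images of a finite extension\<close>

locale difference_field = field R for R (structure) +
  fixes \<phi> :: "'a \<Rightarrow> 'a"
  assumes phi_hom: "\<phi> \<in> ring_hom R R"
begin

text \<open>The images \<open>\<phi>^j M\<close> with \<open>j < n\<close> are adjoined, so stage 0
  is \<open>K\<close>, and stage 1 is \<open>M\<close> when \<open>M\<close> is a field over
  \<open>K\<close>.\<close>

abbreviation pg :: "'a set \<Rightarrow> 'a set \<Rightarrow> nat \<Rightarrow> 'a set"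
  where "pg \<equiv> partial_gen R \<phi>"

text \<open>The admissible members of the chain: stability under \<open>\<phi>\<close> makes them
  difference fields, and the Galois condition is inherited upwards by
  \<open>galois_over_mono\<close>.\<close>

definition base :: "'a set \<Rightarrow> bool"
  where "base K \<longleftrightarrow> galois_over K \<and> \<phi> ` K \<subseteq> K"

lemma baseD:
  assumes "base K"
  shows "galois_over K" "\<phi> ` K \<subseteq> K" "subfield K R" "K \<subseteq> carrier R"
  using assms galois_overD(1,2)[of K] by (auto simp: base_def)

lemma phi_pow_hom: "\<phi> ^^ n \<in> ring_hom R R"
proof (induction n)
  case 0
  then show ?case by (auto simp: ring_hom_def)
next
  case (Suc n)
  show ?case unfolding funpow.simps by (rule ring_hom_trans[OF Suc phi_hom])
qed

lemma phi_pow_closed: "x \<in> carrier R \<Longrightarrow> (\<phi> ^^ n) x \<in> carrier R"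
  using phi_pow_hom[of n] by (auto simp: ring_hom_def)

lemma phi_closed: "x \<in> carrier R \<Longrightarrow> \<phi> x \<in> carrier R"
  using phi_hom by (auto simp: ring_hom_def)

lemma phi_pow_stable:
  assumes "\<phi> ` K \<subseteq> K"
  shows "(\<phi> ^^ n) ` K \<subseteq> K"
  using assms by (induction n) (auto simp: image_subset_iff)

lemma pg_in_carrier:
  assumes "K \<subseteq> carrier R" "M \<subseteq> carrier R"
  shows "K \<union> (\<Union>j<n. (\<phi> ^^ j) ` M) \<subseteq> carrier R"
  using assms phi_pow_closed by auto

lemma pg_subfield:
  assumes "K \<subseteq> carrier R" "M \<subseteq> carrier R"
  shows "subfield (pg K M n) R"
  unfolding partial_gen_def by (rule generate_field_is_subfield[OF pg_in_carrier[OF assms]])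

lemma pg_0: "subfield K R \<Longrightarrow> pg K M 0 = K"
  unfolding partial_gen_def using join_absorb(1)[of K "{}"] by simp

lemma pg_Suc:
  assumes "K \<subseteq> carrier R" "M \<subseteq> carrier R"
  shows "pg K M (Suc n) = join (pg K M n) ((\<phi> ^^ n) ` M)"
proof -
  have "K \<union> (\<Union>j<Suc n. (\<phi> ^^ j) ` M) = K \<union> ((\<Union>j<n. (\<phi> ^^ j) ` M) \<union> (\<phi> ^^ n) ` M)"
    by (auto simp: lessThan_Suc)
  then show ?thesis
    unfolding partial_gen_def
    using join_join[OF assms(1), of "\<Union>j<n. (\<phi> ^^ j) ` M" "(\<phi> ^^ n) ` M"] assms(2) phi_pow_closed by auto
qed

lemma pg_base: "K \<subseteq> pg K M n"
  unfolding partial_gen_def by (rule join_upper(1))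

lemma pg_image: "j < n \<Longrightarrow> (\<phi> ^^ j) ` M \<subseteq> pg K M n"
  unfolding partial_gen_def by (auto intro!: generate_field.incl)

lemma pg_mono: "n \<le> m \<Longrightarrow> pg K M n \<subseteq> pg K M m"
  unfolding partial_gen_def by (rule generate_field_mono) force

lemma pg_mono_set: "M \<subseteq> M' \<Longrightarrow> pg K M n \<subseteq> pg K M' n"
  unfolding partial_gen_def by (rule generate_field_mono) blast

lemma pg_least:
  assumes "subfield E R" "K \<subseteq> E" "\<And>j. j < n \<Longrightarrow> (\<phi> ^^ j) ` M \<subseteq> E"
  shows "pg K M n \<subseteq> E"
  unfolding partial_gen_def using assms by (intro join_least) auto

lemma pg_1:
  assumes "subfield M R" "K \<subseteq> M"
  shows "pg K M (Suc 0) = M"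
  unfolding partial_gen_def using join_absorb(2)[OF assms] by (simp add: lessThan_Suc)

lemma join_pg_shift:
  assumes "subfield T R" "(\<phi> ^^ r) ` K \<subseteq> T" "K \<subseteq> carrier R" "M \<subseteq> carrier R"
  shows "join T ((\<phi> ^^ r) ` pg K M n) = generate_field R (T \<union> (\<Union>j<n. (\<phi> ^^ (r + j)) ` M))"
proof -
  have "(\<phi> ^^ r) ` (\<Union>j<n. (\<phi> ^^ j) ` M) = (\<Union>j<n. (\<phi> ^^ (r + j)) ` M)"
    by (auto simp: image_UN image_comp funpow_add)
  moreover have "(\<Union>j<n. (\<phi> ^^ j) ` M) \<subseteq> carrier R" using assms(4) phi_pow_closed by auto
  ultimately show ?thesis
    using join_hom_join[OF assms(1) phi_pow_hom assms(2,3), of "\<Union>j<n. (\<phi> ^^ j) ` M"]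
    by (simp add: partial_gen_def)
qed

lemma pg_shift:
  assumes "base K" "M \<subseteq> carrier R"
  shows "pg K (join K ((\<phi> ^^ r) ` M)) n = join K ((\<phi> ^^ r) ` pg K M n)"
proof -
  note K = baseD[OF assms(1)]
  have rM: "(\<phi> ^^ r) ` M \<subseteq> carrier R" using assms(2) phi_pow_closed by auto
  have "join K ((\<phi> ^^ r) ` pg K M n) = generate_field R (K \<union> (\<Union>j<n. (\<phi> ^^ (r + j)) ` M))"
    by (rule join_pg_shift[OF K(3) phi_pow_stable[OF K(2)] K(4) assms(2)])
  also have "\<dots> = pg K (join K ((\<phi> ^^ r) ` M)) n"
  proof
    show "generate_field R (K \<union> (\<Union>j<n. (\<phi> ^^ (r + j)) ` M)) \<subseteq> pg K (join K ((\<phi> ^^ r) ` M)) n"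
    proof -
      have "(\<phi> ^^ (r + j)) ` M \<subseteq> (\<phi> ^^ j) ` join K ((\<phi> ^^ r) ` M)" for j
        using join_upper(2)[where T = K and S = "(\<phi> ^^ r) ` M"]
        by (subst add.commute) (auto simp: funpow_add)
      then show ?thesis unfolding partial_gen_def by (intro generate_field_mono) blast
    qed
    have GR: "K \<union> (\<Union>j<n. (\<phi> ^^ (r + j)) ` M) \<subseteq> carrier R" using K(4) assms(2) phi_pow_closed by auto
    have G: "subfield (generate_field R (K \<union> (\<Union>j<n. (\<phi> ^^ (r + j)) ` M))) R"
      by (rule generate_field_is_subfield[OF GR])
    show "pg K (join K ((\<phi> ^^ r) ` M)) n \<subseteq> generate_field R (K \<union> (\<Union>j<n. (\<phi> ^^ (r + j)) ` M))"
    proof (rule pg_least[OF G])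
      show "K \<subseteq> generate_field R (K \<union> (\<Union>j<n. (\<phi> ^^ (r + j)) ` M))" by (rule join_upper(1))
      fix j assume j: "j < n"
      have "(\<phi> ^^ j) ` join K ((\<phi> ^^ r) ` M) = generate_field R ((\<phi> ^^ j) ` (K \<union> (\<phi> ^^ r) ` M))"
        using K(4) rM by (intro hom_generate_field[OF phi_pow_hom]) auto
      also have "\<dots> \<subseteq> generate_field R (K \<union> (\<Union>j<n. (\<phi> ^^ (r + j)) ` M))"
      proof (rule generate_field_min_subfield1[OF _ G])
        show "(\<phi> ^^ j) ` (K \<union> (\<phi> ^^ r) ` M) \<subseteq> carrier R" using K(4) rM phi_pow_closed by auto
        have "(\<phi> ^^ j) ` (\<phi> ^^ r) ` M = (\<phi> ^^ (r + j)) ` M"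
          by (subst add.commute) (simp add: funpow_add image_comp)
        then show "(\<phi> ^^ j) ` (K \<union> (\<phi> ^^ r) ` M) \<subseteq> generate_field R (K \<union> (\<Union>j<n. (\<phi> ^^ (r + j)) ` M))"
          using phi_pow_stable[OF K(2), of j] j by (auto simp: image_Un intro!: generate_field.incl)
      qed
      finally show "(\<phi> ^^ j) ` join K ((\<phi> ^^ r) ` M) \<subseteq> generate_field R (K \<union> (\<Union>j<n. (\<phi> ^^ (r + j)) ` M))" .
    qed
  qed
  finally show ?thesis by simp
qed

lemma join_pg_pg:
  assumes "base K" "M \<subseteq> carrier R"
  shows "join (pg K M r) ((\<phi> ^^ r) ` pg K M n) = pg K M (r + n)"
proof -
  note K = baseD[OF assms(1)]
  have "(\<phi> ^^ r) ` K \<subseteq> pg K M r" using phi_pow_stable[OF K(2)] pg_base by blast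
  then have "join (pg K M r) ((\<phi> ^^ r) ` pg K M n) = join (pg K M r) (\<Union>j<n. (\<phi> ^^ (r + j)) ` M)"
    using join_pg_shift[OF pg_subfield[OF K(4) assms(2)] _ K(4) assms(2)] by blast
  also have "\<dots> = join K ((\<Union>j<r. (\<phi> ^^ j) ` M) \<union> (\<Union>j<n. (\<phi> ^^ (r + j)) ` M))"
    unfolding partial_gen_def using K(4) assms(2) phi_pow_closed by (intro join_join) auto
  also have "(\<Union>j<r. (\<phi> ^^ j) ` M) \<union> (\<Union>j<n. (\<phi> ^^ (r + j)) ` M) = (\<Union>j<r + n. (\<phi> ^^ j) ` M)"
  proof -
    have "{..<r + n} = {..<r} \<union> (+) r ` {..<n}"
      by (auto simp: lessThan_atLeast0)
    then show ?thesis by (simp only: UN_Un image_UN UN_simps image_image)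
  qed
  finally show ?thesis by (simp add: partial_gen_def)
qed

lemma phi_pg_subset: "base K \<Longrightarrow> M \<subseteq> carrier R \<Longrightarrow> (\<phi> ^^ r) ` pg K M n \<subseteq> pg K M (r + n)"
  unfolding join_pg_pg[of K M r n, symmetric] by (rule join_upper(2))

lemma finite_ext_pg_step:
  assumes "base K" "finite_ext K M"
  shows "finite_ext (pg K M n) (pg K M (Suc n))" "dim (pg K M n) (pg K M (Suc n)) \<le> dim K M"
proof -
  note K = baseD[OF assms(1)] and KM = finite_extD[OF assms(2)]
  have "(\<phi> ^^ n) ` K \<subseteq> pg K M n" using phi_pow_stable[OF K(2)] pg_base by blast
  note * = finite_ext_translate[OF assms(2) phi_pow_hom pg_subfield[OF K(4) KM(5)] this]
  show "finite_ext (pg K M n) (pg K M (Suc n))" "dim (pg K M n) (pg K M (Suc n)) \<le> dim K M"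
    using * unfolding pg_Suc[OF K(4) KM(5)] by auto
qed

lemma finite_ext_pg_le:
  assumes "base K" "finite_ext K M" "n \<le> m"
  shows "finite_ext (pg K M n) (pg K M m)"
  using assms(3)
proof (induction m rule: dec_induct)
  case base
  then show ?case
    using finite_ext_refl(1) pg_subfield baseD(4)[OF assms(1)] finite_extD(5)[OF assms(2)] by blast
next
  case (step m)
  then show ?case using finite_ext_trans(1) finite_ext_pg_step(1)[OF assms(1,2)] by blast
qed

lemma finite_ext_pg:
  assumes "base K" "finite_ext K M"
  shows "finite_ext K (pg K M n)"
  using finite_ext_pg_le[OF assms, of 0 n] pg_0[OF baseD(3)[OF assms(1)]] by simp

text \<open>An element involves only finitely many generators, so it appears at a finite stage of
  the tower.\<close>

lemma sigma_gen_pg: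
  assumes "x \<in> sigma_gen R \<phi> K M"
  shows "\<exists>n. x \<in> pg K M n"
proof -
  obtain S where S: "finite S" "S \<subseteq> K \<union> (\<Union>i. (\<phi> ^^ i) ` M)" "x \<in> generate_field R S"
    using generate_field_finitary assms unfolding sigma_gen_def by metis
  have "\<exists>n. S \<subseteq> K \<union> (\<Union>i<n. (\<phi> ^^ i) ` M)"
    using S(1,2)
  proof (induction S)
    case empty
    then show ?case by auto
  next
    case (insert s S)
    then obtain n where n: "S \<subseteq> K \<union> (\<Union>i<n. (\<phi> ^^ i) ` M)" by auto
    obtain i where "s \<in> K \<or> s \<in> (\<phi> ^^ i) ` M" using insert.prems by auto
    then show ?case using n by (intro exI[of _ "max n (Suc i)"]) fastforce
  qed
  then show ?thesis
    using S(3) generate_field_mono unfolding partial_gen_def by blast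
qed

lemma pg_sigma_gen: "pg K M n \<subseteq> sigma_gen R \<phi> K M"
  unfolding partial_gen_def sigma_gen_def by (rule generate_field_mono) auto

lemma sigma_gen_subfield:
  assumes "K \<subseteq> carrier R" "M \<subseteq> carrier R"
  shows "subfield (sigma_gen R \<phi> K M) R"
  unfolding sigma_gen_def by (rule join_subfield) (use assms phi_pow_closed in auto)

lemma sigma_gen_least:
  assumes "subfield E R" "K \<subseteq> E" "\<And>n. (\<phi> ^^ n) ` M \<subseteq> E"
  shows "sigma_gen R \<phi> K M \<subseteq> E"
  unfolding sigma_gen_def using assms by (intro join_least) auto

lemma sigma_gen_stable:
  assumes "base K" "M \<subseteq> carrier R"
  shows "\<phi> ` sigma_gen R \<phi> K M \<subseteq> sigma_gen R \<phi> K M"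
proof
  fix y assume "y \<in> \<phi> ` sigma_gen R \<phi> K M"
  then obtain x n where "y = \<phi> x" "x \<in> pg K M n" using sigma_gen_pg by blast
  then have "y \<in> pg K M (1 + n)" using phi_pg_subset[OF assms, of 1 n] by auto
  then show "y \<in> sigma_gen R \<phi> K M" using pg_sigma_gen by blast
qed

end

text \<open>This turns upper bounds on the two parts of a tower of known total degree into
  equalities.\<close>

lemma mult_eq_of_le:
  fixes a b c d :: nat
  assumes "a * b = c * d" "a \<le> c" "b \<le> d" "0 < c" "0 < d"
  shows "a = c" "b = d"
proof -
  have "c * d \<le> a * d" using assms(1) mult_le_mono2[OF assms(3), of a] by simp
  then show "a = c" using assms(2,5) by simp
  then show "b = d" using assms(1,4) by simp
qed

section \<open>Towers with constant step degree\<close>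

context difference_field
begin

text \<open>The step from stage 0 is left out: its degree \<open>[M : K]\<close> may exceed
  \<open>d\<close> and is what the induction decreases, while \<open>d\<close> is unchanged by
  passing to \<open>K(\<phi> M)\<close>.\<close>

definition const_deg :: "'a set \<Rightarrow> 'a set \<Rightarrow> nat \<Rightarrow> bool"
  where "const_deg K M d \<longleftrightarrow> (\<forall>n\<ge>1. dim (pg K M n) (pg K M (Suc n)) = d)"

lemma join_join_subset:
  assumes "K \<subseteq> carrier R" "A \<subseteq> B" "B \<subseteq> carrier R"
  shows "join (join K A) B = join K B"
proof -
  have "A \<union> B = B" "A \<subseteq> carrier R" using assms by auto
  then show ?thesis using join_join[OF assms(1), of A B] assms(3) by simp
qed

lemma finite_ext_shift:
  assumes "base K" "finite_ext K M"
  shows "finite_ext K (join K (\<phi> ` M))" "dim K (join K (\<phi> ` M)) \<le> dim K M"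
  using finite_ext_translate[OF assms(2) phi_hom baseD(3,2)[OF assms(1)]] .

text \<open>Let \<open>T n\<close> be stage \<open>n\<close> for \<open>K(\<phi> M)\<close>, which
  is \<open>K(\<phi> (pg K M n))\<close>. Translation by \<open>\<phi>\<close> bounds its steps
  above by step \<open>n\<close> of the tower of \<open>M\<close>, and composition with
  \<open>pg K M (Suc n)\<close> bounds them below by step \<open>n + 1\<close>; both have degree
  \<open>d\<close>.\<close>

lemma const_deg_shift:
  assumes "base K" "finite_ext K M" "const_deg K M d"
  shows "const_deg K (join K (\<phi> ` M)) d"
  unfolding const_deg_def
proof (intro allI impI)
  fix n :: nat assume n: "n \<ge> 1"
  note K = baseD[OF assms(1)] and KM = finite_extD[OF assms(2)]
  define T where "T n = pg K (join K (\<phi> ` M)) n" for n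
  have T: "T n = join K (\<phi> ` pg K M n)" for n
    using pg_shift[OF assms(1) KM(5), of 1 n] by (simp add: T_def)
  have pgR: "pg K M n \<subseteq> carrier R" for n by (rule subfieldE(3)[OF pg_subfield[OF K(4) KM(5)]])
  have phiR: "\<phi> ` pg K M n \<subseteq> carrier R" for n using pgR phi_closed by auto
  have Tsub: "subfield (T n) R" for n unfolding T by (rule join_subfield[OF K(4) phiR])
  have step: "finite_ext (T n) (T (Suc n))"
    unfolding T_def by (rule finite_ext_pg_step(1)[OF assms(1) finite_ext_shift(1)[OF assms(1,2)]])
  have up: "\<phi> ` pg K M n \<subseteq> T n" unfolding T by (rule join_upper(2))
  have "join (T n) (\<phi> ` pg K M (Suc n)) = T (Suc n)"
    unfolding T using pg_mono[of n "Suc n" K M] phiR by (intro join_join_subset[OF K(4)]) auto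
  then have le: "dim (T n) (T (Suc n)) \<le> d"
    using finite_ext_translate(2)[OF finite_ext_pg_step(1)[OF assms(1,2)] phi_hom Tsub up] assms(3) n
    by (simp add: const_deg_def)
  have sh: "\<phi> ` pg K M n \<subseteq> pg K M (Suc n)" for n
    using phi_pg_subset[OF assms(1) KM(5), of 1 n] by simp
  have TT: "T n \<subseteq> pg K M (Suc n)" for n
    unfolding T by (rule join_least[OF pg_subfield[OF K(4) KM(5)] pg_base sh])
  have "pg K M (Suc (Suc n)) = join (pg K M (Suc 0)) (\<phi> ` pg K M (Suc n))"
    using join_pg_pg[OF assms(1) KM(5), of "Suc 0" "Suc n"] by simp
  also have "\<dots> \<subseteq> join (pg K M (Suc n)) (T (Suc n))"
    using pg_mono[of "Suc 0" "Suc n" K M] join_upper(2)[where T = K and S = "\<phi> ` pg K M (Suc n)"]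
    unfolding T by (intro generate_field_mono) auto
  finally have "join (pg K M (Suc n)) (T (Suc n)) = pg K M (Suc (Suc n))"
    using join_least[OF pg_subfield[OF K(4) KM(5)] pg_mono[of "Suc n" "Suc (Suc n)"] TT[of "Suc n"]] by auto
  then have "d \<le> dim (T n) (T (Suc n))"
    using finite_ext_join(2)[OF step pg_subfield[OF K(4) KM(5)] TT] assms(3) n
    by (simp add: const_deg_def)
  then show "dim (pg K (join K (\<phi> ` M)) n) (pg K (join K (\<phi> ` M)) (Suc n)) = d"
    using le by (simp add: T_def)
qed

end

section \<open>The case in which applying \<open>\<phi>\<close> to \<open>M\<close> loses no
  degree\<close>

locale stable_extension = difference_field +
  fixes K M :: "'a set" and d :: nat
  assumes baseK: "base K" and finM: "finite_ext K M" and normM: "normal_ext K M"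
    and const: "const_deg K M d" and shift_dim: "dim K (join K (\<phi> ` M)) = dim K M"
begin

lemmas K = baseD[OF baseK] and KM = finite_extD[OF finM]

text \<open>Each of the steps \<open>K \<subseteq> F\<close> and \<open>F \<subseteq> M\<close> can
  only lose degree under \<open>\<phi>\<close>, but their product keeps it, so neither step loses
  any.\<close>

lemma shift_subextension:
  assumes "subfield F R" "K \<subseteq> F" "F \<subseteq> M"
  shows "dim K (join K (\<phi> ` F)) = dim K F" "dim (join K (\<phi> ` F)) (join K (\<phi> ` M)) = dim F M"
proof -
  note F = finite_ext_subfields[OF finM assms]
  note a = finite_ext_shift[OF baseK F(1)]
  define T where "T = join K (\<phi> ` F)"
  have TF: "\<phi> ` F \<subseteq> T" unfolding T_def by (rule join_upper(2))
  have "join T (\<phi> ` M) = join K (\<phi> ` M)"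
    unfolding T_def using assms(3) KM(5) phi_closed by (intro join_join_subset[OF K(4)]) auto
  then have b: "finite_ext T (join K (\<phi> ` M))" "dim T (join K (\<phi> ` M)) \<le> dim F M"
    using finite_ext_translate[OF F(2) phi_hom finite_extD(2)[OF a(1), folded T_def] TF] by auto
  have "dim K T * dim T (join K (\<phi> ` M)) = dim K F * dim F M"
    using finite_ext_trans(2)[OF a(1)[folded T_def] b(1)] shift_dim F(3) by simp
  from mult_eq_of_le[OF this a(2)[folded T_def] b(2) finite_ext_dim_pos[OF F(1)] finite_ext_dim_pos[OF F(2)]]
  show "dim K (join K (\<phi> ` F)) = dim K F" "dim (join K (\<phi> ` F)) (join K (\<phi> ` M)) = dim F M"
    by (simp_all add: T_def)
qed

definition P :: "'a set" where "P = {x \<in> M. \<phi> x \<in> M}"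

lemma P_facts: "subfield P R" "K \<subseteq> P" "P \<subseteq> M" "\<phi> ` P \<subseteq> M" "finite_ext K P" "finite_ext P M" "P \<subseteq> carrier R"
proof -
  have "P = {x \<in> carrier R. \<phi> x \<in> M} \<inter> M" using KM(5) by (auto simp: P_def)
  then show sub: "subfield P R" using inter_subfield[OF hom_preimage_subfield[OF phi_hom KM(2)] KM(2)] by simp
  show KP: "K \<subseteq> P" using K(2) KM(3) by (auto simp: P_def)
  show PM: "P \<subseteq> M" "\<phi> ` P \<subseteq> M" by (auto simp: P_def)
  show "finite_ext K P" "finite_ext P M" using finite_ext_subfields[OF finM sub KP PM(1)] by auto
  show "P \<subseteq> carrier R" using PM(1) KM(5) by auto
qed

text \<open>For \<open>x\<close> in \<open>P\<close>, the elements \<open>x\<close> and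
  \<open>\<phi> x\<close> have equally many conjugates since no degree is lost on
  \<open>K(x)\<close>. So \<open>\<phi>\<close> maps the conjugates of \<open>x\<close> onto those
  of \<open>\<phi> x\<close>, and the latter stay in \<open>M\<close> because \<open>M\<close> is
  normal.\<close>

lemma P_normal: "normal_ext K P"
  unfolding normal_ext_def
proof (intro conjI ballI subsetI)
  show "subfield P R" by (rule P_facts(1))
  show "x \<in> P" if "x \<in> K" for x using that P_facts(2) by auto
  fix x y assume x: "x \<in> P" and y: "y \<in> conj K x"
  note G = galois_overD[OF K(1)]
  have xR: "x \<in> carrier R" and xM: "x \<in> M" and fx: "\<phi> x \<in> M" using x KM(5) by (auto simp: P_def)
  have fxR: "\<phi> x \<in> carrier R" using xR phi_closed by simp
  have yM: "y \<in> M" using normM xM y by (auto simp: normal_ext_def)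
  have "join K (\<phi> ` join K {x}) = join K (\<phi> ` {x})"
    by (rule join_hom_join[OF K(3) phi_hom K(2,4)]) (use xR in simp)
  moreover have "join K {x} \<subseteq> M" by (rule join_least[OF KM(2,3)]) (use xM in simp)
  moreover have "subfield (join K {x}) R" by (rule join_subfield[OF K(4)]) (use xR in simp)
  ultimately have "dim K (join K {\<phi> x}) = dim K (join K {x})"
    using shift_subextension(1)[of "join K {x}"] join_upper(1)[of K "{x}"] by simp
  then have card: "card (conj K (\<phi> x)) = card (conj K x)"
    using G(5)[OF xR] G(5)[OF fxR] by simp
  have sub: "conj K (\<phi> x) \<subseteq> \<phi> ` conj K x" by (rule conj_hom[OF K(1) phi_hom K(3,2) xR])
  have fin: "finite (conj K x)" "conj K x \<subseteq> carrier R" using conj_finite[OF K(3) xR G(3)[OF xR]] by auto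
  have "card (\<phi> ` conj K x) = card (conj K x)"
    by (rule card_image[OF inj_on_subset[OF hom_facts(2)[OF phi_hom] fin(2)]])
  then have "conj K (\<phi> x) = \<phi> ` conj K x"
    using card_seteq[OF _ sub] fin(1) card by simp
  then have "\<phi> y \<in> conj K (\<phi> x)" using y by simp
  then have "\<phi> y \<in> M" using normM fx by (auto simp: normal_ext_def)
  then show "y \<in> P" using yM by (simp add: P_def)
qed

text \<open>
  The key computation: \<open>M \<inter> K(\<phi> M) = K(\<phi> P)\<close>, because the minimal polynomial of a primitive
  element \<open>\<phi> e\<close> of \<open>K(\<phi> M)\<close> over the intersection splits in \<open>\<phi> M\<close>, hence has coefficients in \<open>\<phi> P\<close>.
\<close>

lemma dim_P: "dim P M = d"
proof -
  define M1 where "M1 = join K (\<phi> ` M)"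
  define J where "J = M \<inter> M1"
  define Q where "Q = join K (\<phi> ` P)"
  have finM1: "finite_ext K M1" unfolding M1_def by (rule finite_ext_shift(1)[OF baseK finM])
  note M1 = finite_extD[OF finM1]
  have J: "subfield J R" unfolding J_def by (rule inter_subfield[OF KM(2) M1(2)])
  have KJ: "K \<subseteq> J" using KM(3) M1(3) by (auto simp: J_def)
  have QR: "\<phi> ` P \<subseteq> carrier R" using P_facts(7) phi_closed by auto
  have Q: "subfield Q R" unfolding Q_def by (rule join_subfield[OF K(4) QR])
  have KQ: "K \<subseteq> Q" unfolding Q_def by (rule join_upper(1))
  have QJ: "Q \<subseteq> J"
    unfolding Q_def using P_facts(3,4) join_upper(2)[where T = K and S = "\<phi> ` M"] KJ
    by (intro join_least[OF J]) (auto simp: J_def M1_def)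
  have JM1: "J \<subseteq> M1" by (simp add: J_def)
  have galJ: "galois_over J" by (rule galois_over_mono[OF K(1) J KJ])
  obtain e where e: "e \<in> M" "join K {e} = M" by (rule primitive_element[OF K(1) finM])
  have eR: "e \<in> carrier R" using e(1) KM(5) by auto
  have feR: "\<phi> e \<in> carrier R" using eR phi_closed by simp
  have M1e: "join K {\<phi> e} = M1"
    unfolding M1_def e(2)[symmetric] using join_hom_join[OF K(3) phi_hom K(2,4), of "{e}"] eR by simp
  have J1: "join J {\<phi> e} = M1"
  proof
    show "join J {\<phi> e} \<subseteq> M1"
      by (rule join_least[OF M1(2) JM1]) (use M1e join_upper(2)[where T = K and S = "{\<phi> e}"] in simp)
    have "join K {\<phi> e} \<subseteq> join J {\<phi> e}" using KJ by (intro generate_field_mono) auto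
    then show "M1 \<subseteq> join J {\<phi> e}" using M1e by simp
  qed
  have "conj J (\<phi> e) \<subseteq> \<phi> ` conj K e"
    by (rule conj_hom[OF K(1) phi_hom J _ eR]) (use K(2) KJ in auto)
  also have "\<dots> \<subseteq> \<phi> ` M" using normM e(1) by (auto simp: normal_ext_def)
  finally have cj: "conj J (\<phi> e) \<subseteq> \<phi> ` M" .
  note di = dim_inter_le[OF galJ hom_image_subfield[OF phi_hom KM(2)] feR cj, unfolded J1]
  \<comment> \<open>An element \<open>\<phi> m\<close> of \<open>J\<close> lies in \<open>M\<close>,
    so \<open>m\<close> is in \<open>P\<close> by definition.\<close>
  have sub: "\<phi> ` M \<inter> J \<subseteq> Q"
    using join_upper(2)[where T = K and S = "\<phi> ` P"] by (auto simp: Q_def J_def P_def)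
  have "join Q (join (\<phi> ` M \<inter> J) {\<phi> e}) = M1"
  proof
    have "join (\<phi> ` M \<inter> J) {\<phi> e} \<subseteq> join J {\<phi> e}" by (rule generate_field_mono) auto
    then show "join Q (join (\<phi> ` M \<inter> J) {\<phi> e}) \<subseteq> M1"
      unfolding J1 by (rule join_least[OF M1(2) subset_trans[OF QJ JM1]])
    have "join K {\<phi> e} \<subseteq> join Q (join (\<phi> ` M \<inter> J) {\<phi> e})"
      using KQ by (intro generate_field_mono) (auto intro: generate_field.incl)
    then have "generate_field R (K \<union> {\<phi> e}) \<subseteq> join Q (join (\<phi> ` M \<inter> J) {\<phi> e})" .
    then show "M1 \<subseteq> join Q (join (\<phi> ` M \<inter> J) {\<phi> e})" using M1e by simp
  qed
  \<comment> \<open>\<open>\<phi> e\<close> has over \<open>Q\<close> at most the degree that it has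
    over \<open>J\<close>, so the inclusion \<open>Q \<subseteq> J\<close> below \<open>M1\<close>
    is an equality.\<close>
  then have "dim Q M1 \<le> dim J M1"
    using finite_ext_join(2)[OF di(1) Q sub] di(2) by simp
  then have "J = Q"
    using finite_ext_eq_bot[OF finite_ext_subfields(2)[OF finM1 Q KQ] J QJ JM1] QJ JM1 by auto
  \<comment> \<open>With the intersection identified as \<open>Q\<close>, natural irrationalities
    turn \<open>[M1 : Q]\<close> into the degree of the step from stage 1 to stage 2, which is
    \<open>d\<close>; \<open>shift_subextension\<close> then pulls it back to
    \<open>[M : P]\<close>.\<close>
  have "dim (M1 \<inter> M) M1 = dim M (join M M1)"
    by (rule natural_irrationalities[OF K(1) finM1 _ KM(2,3)])
      (simp add: M1_def normal_ext_translate[OF K(1,1) phi_hom K(2) finM normM])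
  moreover have "M1 \<inter> M = Q" using \<open>J = Q\<close> by (auto simp: J_def)
  moreover have "join M M1 = join M (\<phi> ` M)"
  proof
    have "M1 \<subseteq> join M (\<phi> ` M)" unfolding M1_def using KM(3) by (intro generate_field_mono) auto
    moreover have "subfield (join M (\<phi> ` M)) R"
      by (rule join_subfield[OF KM(5)]) (use KM(5) phi_closed in auto)
    ultimately show "join M M1 \<subseteq> join M (\<phi> ` M)" by (intro join_least join_upper(1))
    show "join M (\<phi> ` M) \<subseteq> join M M1"
      using join_upper(2)[where T = K and S = "\<phi> ` M"] unfolding M1_def by (intro generate_field_mono) auto
  qed
  moreover have "join M (\<phi> ` M) = pg K M (Suc (Suc 0))" "pg K M (Suc 0) = M"
    using pg_Suc[OF K(4) KM(5), of "Suc 0"] pg_1[OF KM(2,3)] by simp_all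
  moreover have "dim (pg K M (Suc 0)) (pg K M (Suc (Suc 0))) = d"
    using const by (simp add: const_deg_def)
  ultimately have "dim Q M1 = d" by simp
  then show ?thesis
    using shift_subextension(2)[OF P_facts(1-3)] by (simp add: Q_def M1_def)
qed

definition N :: "'a set" where "N = join P (\<phi> ` P)"

lemma N_facts: "subfield N R" "P \<subseteq> N" "\<phi> ` P \<subseteq> N" "N \<subseteq> M" "K \<subseteq> N" "finite_ext K N" "finite_ext N M"
  "finite_ext P N" "N \<subseteq> carrier R"
proof -
  show sub: "subfield N R" unfolding N_def by (rule join_subfield[OF P_facts(7)]) (use P_facts(7) phi_closed in auto)
  show PN: "P \<subseteq> N" unfolding N_def by (rule join_upper(1))
  show "\<phi> ` P \<subseteq> N" unfolding N_def by (rule join_upper(2))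
  show NM: "N \<subseteq> M" unfolding N_def by (rule join_least[OF KM(2) P_facts(3,4)])
  show KN: "K \<subseteq> N" using P_facts(2) PN by simp
  show "finite_ext K N" "finite_ext N M" using finite_ext_subfields[OF finM sub KN NM] by auto
  show "finite_ext P N" using finite_ext_subfields[OF P_facts(6) sub PN NM] by auto
  show "N \<subseteq> carrier R" using NM KM(5) by auto
qed

lemma N_normal: "normal_ext K N"
proof -
  have "N = join P (join K (\<phi> ` P))"
  proof
    have "join P (\<phi> ` P) \<subseteq> join P (join K (\<phi> ` P))"
      using join_upper(2)[where T = K and S = "\<phi> ` P"] by (intro generate_field_mono) auto
    then show "N \<subseteq> join P (join K (\<phi> ` P))" by (simp add: N_def)
    show "join P (join K (\<phi> ` P)) \<subseteq> N"
      by (rule join_least[OF N_facts(1,2) join_least[OF N_facts(1,5,3)]])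
  qed
  then show ?thesis
    using normal_ext_join[OF K(1) P_facts(5) P_normal finite_ext_shift(1)[OF baseK P_facts(5)]]
      normal_ext_translate[OF K(1,1) phi_hom K(2) P_facts(5) P_normal] by simp
qed

lemma pgR: "pg K M n \<subseteq> carrier R" "subfield (pg K M n) R"
  using pg_subfield[OF K(4) KM(5)] subfieldE(3) by auto

lemma phi_Suc_P: "(\<phi> ^^ Suc n) ` P \<subseteq> (\<phi> ^^ n) ` M" "(\<phi> ^^ Suc n) ` P \<subseteq> (\<phi> ^^ n) ` N"
proof -
  have "(\<phi> ^^ Suc n) ` P = (\<phi> ^^ n) ` \<phi> ` P" by (simp only: funpow_Suc_right image_comp)
  then show "(\<phi> ^^ Suc n) ` P \<subseteq> (\<phi> ^^ n) ` M" "(\<phi> ^^ Suc n) ` P \<subseteq> (\<phi> ^^ n) ` N"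
    using P_facts(4) N_facts(3) by auto
qed

text \<open>As \<open>M\<close> is generated by \<open>P\<close> and \<open>\<phi> P\<close>, each
  image of \<open>M\<close> is generated by two consecutive images of \<open>P\<close>, so the
  towers agree up to a shift by one stage.\<close>

lemma pg_P:
  assumes "N = M"
  shows "pg K P (Suc (Suc n)) = pg K M (Suc n)"
proof (induction n)
  case 0
  have "pg K P (Suc (Suc 0)) = join P (\<phi> ` P)"
    using pg_Suc[OF K(4) P_facts(7), of "Suc 0"] pg_1[OF P_facts(1,2)] by simp
  then show ?case using assms pg_1[OF KM(2,3)] by (simp add: N_def)
next
  case (Suc n)
  have sR: "subfield (pg K P (Suc (Suc (Suc n)))) R" by (rule pg_subfield[OF K(4) P_facts(7)])
  show ?case
  proof
    show "pg K P (Suc (Suc (Suc n))) \<subseteq> pg K M (Suc (Suc n))"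
    proof (rule pg_least[OF pgR(2) pg_base])
      fix j assume j: "j < Suc (Suc (Suc n))"
      show "(\<phi> ^^ j) ` P \<subseteq> pg K M (Suc (Suc n))"
      proof (cases j)
        case 0
        then show ?thesis using P_facts(3) pg_image[of 0 "Suc (Suc n)" M K] by auto
      next
        case (Suc i)
        then show ?thesis using phi_Suc_P(1)[of i] pg_image[of i "Suc (Suc n)" M K] j by auto
      qed
    qed
    have "(\<phi> ^^ Suc n) ` M \<subseteq> pg K P (Suc (Suc (Suc n)))"
    proof -
      have PP: "P \<union> \<phi> ` P \<subseteq> carrier R" using P_facts(7) phi_closed by auto
      have "generate_field R (P \<union> \<phi> ` P) = M" using assms unfolding N_def .
      then have "(\<phi> ^^ Suc n) ` M = (\<phi> ^^ Suc n) ` generate_field R (P \<union> \<phi> ` P)" by (simp only:)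
      also have "\<dots> = generate_field R ((\<phi> ^^ Suc n) ` (P \<union> \<phi> ` P))"
        by (rule hom_generate_field[OF phi_pow_hom PP])
      also have "\<dots> \<subseteq> pg K P (Suc (Suc (Suc n)))"
      proof (rule generate_field_min_subfield1[OF _ sR])
        show "(\<phi> ^^ Suc n) ` (P \<union> \<phi> ` P) \<subseteq> carrier R" using PP phi_pow_closed by blast
        have "(\<phi> ^^ Suc n) ` \<phi> ` P = (\<phi> ^^ Suc (Suc n)) ` P"
          by (simp only: funpow_Suc_right image_comp)
        then show "(\<phi> ^^ Suc n) ` (P \<union> \<phi> ` P) \<subseteq> pg K P (Suc (Suc (Suc n)))"
          using pg_image[of "Suc n" "Suc (Suc (Suc n))" P K] pg_image[of "Suc (Suc n)" "Suc (Suc (Suc n))" P K]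
          by (simp add: image_Un)
      qed
      finally show ?thesis .
    qed
    moreover have "pg K M (Suc n) \<subseteq> pg K P (Suc (Suc (Suc n)))"
      using Suc.IH pg_mono[of "Suc (Suc n)" "Suc (Suc (Suc n))" K P] by simp
    ultimately show "pg K M (Suc (Suc n)) \<subseteq> pg K P (Suc (Suc (Suc n)))"
      unfolding pg_Suc[OF K(4) KM(5), of "Suc n"] by (intro join_least[OF sR])
  qed
qed

text \<open>The one new step, from \<open>P\<close> to \<open>M\<close>, has degree \<open>d\<close>
  by \<open>dim_P\<close>; all later ones are steps of the tower of \<open>M\<close>.\<close>

lemma const_deg_P:
  assumes "N = M"
  shows "const_deg K P d"
  unfolding const_deg_def
proof (intro allI impI)
  fix n :: nat assume "n \<ge> 1"
  then consider "n = Suc 0" | m where "n = Suc (Suc m)" by (metis One_nat_def Suc_le_D not0_implies_Suc)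
  then show "dim (pg K P n) (pg K P (Suc n)) = d"
  proof cases
    case 1
    then show ?thesis using pg_P[OF assms, of 0] pg_1[OF P_facts(1,2)] pg_1[OF KM(2,3)] dim_P by simp
  next
    case 2
    then show ?thesis using pg_P[OF assms] const by (simp add: const_deg_def)
  qed
qed

lemma sigma_gen_P:
  assumes "N = M"
  shows "sigma_gen R \<phi> K P = sigma_gen R \<phi> K M"
proof
  show "sigma_gen R \<phi> K P \<subseteq> sigma_gen R \<phi> K M"
    unfolding sigma_gen_def using P_facts(3) by (intro generate_field_mono) auto
  show "sigma_gen R \<phi> K M \<subseteq> sigma_gen R \<phi> K P"
  proof
    fix x assume "x \<in> sigma_gen R \<phi> K M"
    then obtain n where "x \<in> pg K M n" using sigma_gen_pg by blast
    then have "x \<in> pg K M (Suc n)" using pg_mono[of n "Suc n"] by auto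
    then show "x \<in> sigma_gen R \<phi> K P" using pg_P[OF assms, of n] pg_sigma_gen by blast
  qed
qed

section \<open>Independence of the images of \<open>M\<close> over the tower of
  \<open>N\<close>\<close>

abbreviation q :: nat where "q \<equiv> dim N M"

lemma q_facts: "d = dim P N * q" "0 < q" "0 < d" "0 < dim P N"
  using finite_ext_trans(2)[OF N_facts(8,7)] dim_P finite_ext_dim_pos[OF N_facts(7)]
    finite_ext_dim_pos[OF P_facts(6)] finite_ext_dim_pos[OF N_facts(8)] by auto

lemma phi_pow_carrier: "A \<subseteq> carrier R \<Longrightarrow> (\<phi> ^^ n) ` A \<subseteq> carrier R"
  using phi_pow_closed by auto

text \<open>
  \<open>V n j\<close> is generated by \<open>\<phi>\<^sup>i M\<close> for \<open>i \<le> n + j\<close>, \<open>i \<noteq> n\<close>, and by \<open>\<phi>\<^sup>n N\<close>.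
\<close>

primrec V :: "nat \<Rightarrow> nat \<Rightarrow> 'a set" where
  "V n 0 = join (pg K M n) ((\<phi> ^^ n) ` N)"
| "V n (Suc j) = join (V n j) ((\<phi> ^^ (n + Suc j)) ` M)"

lemma V_facts: "subfield (V n j) R" "pg K M n \<subseteq> V n j" "V n j \<subseteq> pg K M (Suc (n + j))"
  "(\<phi> ^^ n) ` N \<subseteq> V n j"
proof -
  have "subfield (V n j) R \<and> pg K M n \<subseteq> V n j \<and> V n j \<subseteq> pg K M (Suc (n + j)) \<and> (\<phi> ^^ n) ` N \<subseteq> V n j"
  proof (induction j)
    case 0
    have "(\<phi> ^^ n) ` N \<subseteq> pg K M (Suc n)" using pg_image[of n "Suc n" M K] N_facts(4) by auto
    from join_least[OF pgR(2) pg_mono[OF le_SucI[OF le_refl]] this]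
    have "V n 0 \<subseteq> pg K M (Suc n)" unfolding V.simps .
    then show ?case
      using join_subfield[OF pgR(1) phi_pow_carrier[OF N_facts(9)]] join_upper[of "pg K M n" "(\<phi> ^^ n) ` N"]
        join_upper(2)[where T = "pg K M n" and S = "(\<phi> ^^ n) ` N"] by simp
  next
    case (Suc j)
    have m: "V n j \<subseteq> pg K M (Suc (n + Suc j))" using Suc pg_mono[of "Suc (n + j)" "Suc (n + Suc j)" K M] by auto
    have "subfield (V n (Suc j)) R"
      unfolding V.simps by (rule join_subfield[OF subfieldE(3)[OF conjunct1[OF Suc.IH]] phi_pow_carrier[OF KM(5)]])
    moreover have "V n (Suc j) \<subseteq> pg K M (Suc (n + Suc j))"
      unfolding V.simps by (rule join_least[OF pgR(2) m pg_image]) simp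
    ultimately show ?case
      using Suc join_upper(1)[of "V n j" "(\<phi> ^^ (n + Suc j)) ` M"] by auto
  qed
  then show "subfield (V n j) R" "pg K M n \<subseteq> V n j" "V n j \<subseteq> pg K M (Suc (n + j))" "(\<phi> ^^ n) ` N \<subseteq> V n j"
    by auto
qed

lemma V_image: "n < i \<Longrightarrow> i \<le> n + j \<Longrightarrow> (\<phi> ^^ i) ` M \<subseteq> V n j"
proof (induction j)
  case (Suc j)
  show ?case
  proof (cases "i = n + Suc j")
    case True
    then show ?thesis using join_upper(2)[where T = "V n j" and S = "(\<phi> ^^ i) ` M"] by simp
  next
    case False
    then show ?thesis using Suc join_upper(1)[of "V n j" "(\<phi> ^^ (n + Suc j)) ` M"] by auto
  qed
qed simp

lemma finite_ext_V: "finite_ext (V n j) (pg K M (Suc (n + j)))"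
  using finite_ext_subfields(2)[OF finite_ext_pg[OF baseK finM] V_facts(1) _ V_facts(3)]
    V_facts(2)[of n j] pg_base by blast

text \<open>For \<open>j = 0\<close> and \<open>n > 0\<close> the field \<open>\<phi>^n P\<close>
  lies in stage \<open>n\<close>, so adjoining \<open>\<phi>^n N\<close> gives degree at most
  \<open>[N : P]\<close> out of \<open>d = [N : P] q\<close>, and at least \<open>q\<close> remains;
  for \<open>n = 0\<close> the degree is \<open>[M : N]\<close>. Adjoining a later image of
  \<open>M\<close> multiplies the degree of the upper field by \<open>d\<close> and that of
  \<open>V\<close> by at most \<open>[M : P] = d\<close>, since the image of \<open>P\<close> is
  already present, so the factor \<open>q\<close> survives.\<close>

lemma dim_V: "q \<le> dim (V n j) (pg K M (Suc (n + j)))"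
proof (induction j)
  case 0
  show ?case
  proof (cases n)
    case 0
    have "V 0 0 = N" using join_absorb(2)[OF N_facts(1,5)] pg_0[OF K(3)] by simp
    then show ?thesis using 0 pg_1[OF KM(2,3)] by simp
  next
    case (Suc m)
    have "(\<phi> ^^ n) ` P \<subseteq> pg K M n"
      using phi_Suc_P(1)[of m] pg_image[of m n M K] Suc by auto
    from finite_ext_translate[OF N_facts(8) phi_pow_hom pgR(2) this]
    have 1: "finite_ext (pg K M n) (V n 0)" "dim (pg K M n) (V n 0) \<le> dim P N" by auto
    have fV: "finite_ext (V n 0) (pg K M (Suc n))" using finite_ext_V[of n 0] by simp
    have "dim (pg K M n) (V n 0) * dim (V n 0) (pg K M (Suc n)) = dim (pg K M n) (pg K M (Suc n))"
      using finite_ext_trans(2)[OF 1(1) fV] by simp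
    also have "\<dots> = dim P N * q" using const q_facts(1) Suc by (simp add: const_deg_def)
    finally have "dim P N * q \<le> dim P N * dim (V n 0) (pg K M (Suc n))"
      using mult_le_mono1[OF 1(2)] by metis
    then show ?thesis using q_facts(4) by simp
  qed
next
  case (Suc j)
  have "(\<phi> ^^ (n + Suc j)) ` P \<subseteq> V n j"
  proof (cases j)
    case 0
    then show ?thesis using phi_Suc_P(2)[of n] V_facts(4)[of n 0] by simp
  next
    case (Suc i)
    then show ?thesis using phi_Suc_P(1)[of "n + j"] V_image[of n "n + j" j] by simp
  qed
  from finite_ext_translate[OF P_facts(6) phi_pow_hom V_facts(1) this]
  have 1: "finite_ext (V n j) (V n (Suc j))" "dim (V n j) (V n (Suc j)) \<le> d"
    using dim_P by auto
  let ?E = "pg K M (Suc (n + j))" and ?F = "pg K M (Suc (n + Suc j))"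
  have "dim ?E ?F = d" using const by (simp add: const_deg_def)
  have "q * d \<le> dim (V n j) ?E * d" by (rule mult_le_mono1[OF Suc])
  also have "\<dots> = dim (V n j) ?E * dim ?E ?F" unfolding \<open>dim ?E ?F = d\<close> ..
  also have "\<dots> = dim (V n j) ?F"
    using finite_ext_trans(2)[OF finite_ext_V[of n j], of ?F] finite_ext_pg_step(1)[OF baseK finM, of "Suc (n + j)"]
    by simp
  also have "\<dots> = dim (V n j) (V n (Suc j)) * dim (V n (Suc j)) ?F"
    by (rule finite_ext_trans(2)[OF 1(1) finite_ext_V[of n "Suc j"]])
  also have "\<dots> \<le> d * dim (V n (Suc j)) ?F" by (rule mult_le_mono1[OF 1(2)])
  finally have "d * q \<le> d * dim (V n (Suc j)) ?F" by (subst mult.commute)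
  then show ?case by (rule mult_left_le_imp_le[OF _ q_facts(3)])
qed

text \<open>
  \<open>W m k\<close> interpolates between \<open>W m 0 = K(M, \<dots>, \<phi>\<^sup>m\<^sup>-\<^sup>1 M)\<close> and \<open>W m m = K(N, \<dots>, \<phi>\<^sup>m\<^sup>-\<^sup>1 N)\<close>.
\<close>

definition W :: "nat \<Rightarrow> nat \<Rightarrow> 'a set"
  where "W m k = generate_field R (K \<union> ((\<Union>i<k. (\<phi> ^^ i) ` N) \<union> (\<Union>i\<in>{k..<m}. (\<phi> ^^ i) ` M)))"

lemma W_in_carrier: "K \<union> ((\<Union>i<k. (\<phi> ^^ i) ` N) \<union> (\<Union>i\<in>{k..<m}. (\<phi> ^^ i) ` M)) \<subseteq> carrier R"
  using K(4) phi_pow_carrier[OF N_facts(9)] phi_pow_carrier[OF KM(5)] by (intro Un_least UN_least) auto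

lemma W_facts: "subfield (W m k) R" "K \<subseteq> W m k" "k \<le> m \<Longrightarrow> W m k \<subseteq> pg K M m"
  "W m 0 = pg K M m" "W m m = pg K N m"
proof -
  show sub: "subfield (W m k) R" unfolding W_def by (rule generate_field_is_subfield[OF W_in_carrier])
  show "K \<subseteq> W m k" unfolding W_def by (rule join_upper(1))
  show "W m 0 = pg K M m" "W m m = pg K N m"
    by (simp_all add: W_def partial_gen_def lessThan_atLeast0)
  assume "k \<le> m"
  then have "(\<phi> ^^ i) ` N \<subseteq> pg K M m" if "i < k" for i
    using pg_image[of i m M K] N_facts(4) that by auto
  moreover have "(\<phi> ^^ i) ` M \<subseteq> pg K M m" if "i \<in> {k..<m}" for i
    using pg_image[of i m M K] that by auto
  ultimately show "W m k \<subseteq> pg K M m"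
    unfolding W_def by (intro generate_field_min_subfield1[OF W_in_carrier pgR(2)] Un_least UN_least pg_base) auto
qed

lemma W_image: "i < k \<Longrightarrow> (\<phi> ^^ i) ` N \<subseteq> W m k" "k \<le> i \<Longrightarrow> i < m \<Longrightarrow> (\<phi> ^^ i) ` M \<subseteq> W m k"
proof -
  have sub: "(\<Union>i<k. (\<phi> ^^ i) ` N) \<union> (\<Union>i\<in>{k..<m}. (\<phi> ^^ i) ` M) \<subseteq> W m k"
    unfolding W_def by (rule join_upper(2))
  show "(\<phi> ^^ i) ` N \<subseteq> W m k" if "i < k"
  proof -
    have "(\<phi> ^^ i) ` N \<subseteq> (\<Union>i<k. (\<phi> ^^ i) ` N)" by (rule UN_upper) (use that in simp)
    then show ?thesis using sub by blast
  qed
  show "(\<phi> ^^ i) ` M \<subseteq> W m k" if "k \<le> i" "i < m"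
  proof -
    have "(\<phi> ^^ i) ` M \<subseteq> (\<Union>i\<in>{k..<m}. (\<phi> ^^ i) ` M)" by (rule UN_upper) (use that in simp)
    then show ?thesis using sub by blast
  qed
qed

text \<open>The upper bound is \<open>[M : N]\<close> translated by \<open>\<phi>^k\<close>. For the
  lower bound enlarge the base to \<open>V k j\<close> with \<open>k + j + 1 = m\<close>: this
  cannot raise the degree, and the result is the extension bounded below in
  \<open>dim_V\<close>.\<close>

lemma dim_W_step:
  assumes "k < m"
  shows "finite_ext (W m (Suc k)) (W m k)" "dim (W m (Suc k)) (W m k) = q"
proof -
  have kN: "(\<phi> ^^ k) ` N \<subseteq> W m (Suc k)" by (intro W_image) auto
  have eq: "join (W m (Suc k)) ((\<phi> ^^ k) ` M) = W m k"
  proof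
    have "W m (Suc k) \<subseteq> W m k"
    proof -
      have a: "(\<phi> ^^ i) ` N \<subseteq> W m k" if "i \<in> {..<Suc k}" for i
      proof (cases "i = k")
        case True
        have "(\<phi> ^^ k) ` M \<subseteq> W m k" using assms by (intro W_image) auto
        then show ?thesis using True N_facts(4) by auto
      next
        case False
        then show ?thesis using that by (intro W_image) auto
      qed
      have b: "(\<phi> ^^ i) ` M \<subseteq> W m k" if "i \<in> {Suc k..<m}" for i
        using that by (intro W_image) auto
      have "K \<union> ((\<Union>i<Suc k. (\<phi> ^^ i) ` N) \<union> (\<Union>i\<in>{Suc k..<m}. (\<phi> ^^ i) ` M)) \<subseteq> W m k"
        by (intro Un_least UN_least a b W_facts(2))
      then show ?thesis
        unfolding W_def[of m "Suc k"] by (rule generate_field_min_subfield1[OF W_in_carrier W_facts(1)])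
    qed
    moreover have "(\<phi> ^^ k) ` M \<subseteq> W m k" using assms by (intro W_image) auto
    ultimately show "join (W m (Suc k)) ((\<phi> ^^ k) ` M) \<subseteq> W m k" by (rule join_least[OF W_facts(1)])
    have "subfield (join (W m (Suc k)) ((\<phi> ^^ k) ` M)) R"
      by (rule join_subfield[OF subfieldE(3)[OF W_facts(1)] phi_pow_carrier[OF KM(5)]])
    moreover have "K \<union> ((\<Union>i<k. (\<phi> ^^ i) ` N) \<union> (\<Union>i\<in>{k..<m}. (\<phi> ^^ i) ` M)) \<subseteq>
        join (W m (Suc k)) ((\<phi> ^^ k) ` M)" (is "_ \<subseteq> ?J")
    proof -
      have W: "W m (Suc k) \<subseteq> ?J" by (rule join_upper(1))
      have a: "(\<phi> ^^ i) ` N \<subseteq> ?J" if "i \<in> {..<k}" for i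
        by (rule subset_trans[OF W_image(1) W]) (use that in simp)
      have b: "(\<phi> ^^ i) ` M \<subseteq> ?J" if "i \<in> {k..<m}" for i
      proof (cases "i = k")
        case True
        then show ?thesis using join_upper(2)[where T = "W m (Suc k)" and S = "(\<phi> ^^ k) ` M"] by simp
      next
        case False
        then have "(\<phi> ^^ i) ` M \<subseteq> W m (Suc k)" using that by (intro W_image) auto
        then show ?thesis using W by simp
      qed
      show ?thesis by (intro Un_least UN_least a b subset_trans[OF W_facts(2) W])
    qed
    ultimately show "W m k \<subseteq> ?J"
      unfolding W_def[of m k] by (intro generate_field_min_subfield1[OF W_in_carrier])
  qed
  from finite_ext_translate[OF N_facts(7) phi_pow_hom W_facts(1) kN]
  have 1: "finite_ext (W m (Suc k)) (W m k)" "dim (W m (Suc k)) (W m k) \<le> q" unfolding eq by auto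
  show "finite_ext (W m (Suc k)) (W m k)" by (rule 1(1))
  define j where "j = m - Suc k"
  have j: "Suc (k + j) = m" using assms by (simp add: j_def)
  have WV: "W m (Suc k) \<subseteq> V k j"
  proof -
    have a: "(\<phi> ^^ i) ` N \<subseteq> V k j" if "i \<in> {..<Suc k}" for i
    proof (cases "i = k")
      case True
      then show ?thesis using V_facts(4) by simp
    next
      case False
      then have "i < k" using that by simp
      then have "(\<phi> ^^ i) ` M \<subseteq> V k j" by (rule subset_trans[OF pg_image V_facts(2)])
      then show ?thesis using N_facts(4) by blast
    qed
    have b: "(\<phi> ^^ i) ` M \<subseteq> V k j" if "i \<in> {Suc k..<m}" for i
      using that j by (intro V_image) auto
    have "K \<union> ((\<Union>i<Suc k. (\<phi> ^^ i) ` N) \<union> (\<Union>i\<in>{Suc k..<m}. (\<phi> ^^ i) ` M)) \<subseteq> V k j"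
      by (intro Un_least UN_least a b subset_trans[OF pg_base V_facts(2)])
    then show ?thesis
      unfolding W_def by (rule generate_field_min_subfield1[OF W_in_carrier V_facts(1)])
  qed
  have "join (V k j) (W m k) = pg K M m"
  proof
    show "join (V k j) (W m k) \<subseteq> pg K M m"
      using V_facts(3)[of k j] W_facts(3)[of k m] j assms by (intro join_least[OF pgR(2)]) auto
    have sub: "subfield (join (V k j) (W m k)) R"
      by (rule join_subfield[OF subfieldE(3)[OF V_facts(1)] subfieldE(3)[OF W_facts(1)]])
    have VJ: "V k j \<subseteq> join (V k j) (W m k)" by (rule join_upper(1))
    show "pg K M m \<subseteq> join (V k j) (W m k)"
    proof (rule pg_least[OF sub])
      show "K \<subseteq> join (V k j) (W m k)" using pg_base[of K M k] V_facts(2)[of k j] VJ by blast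
      fix i assume i: "i < m"
      consider "i < k" | "i = k" | "k < i" by linarith
      then show "(\<phi> ^^ i) ` M \<subseteq> join (V k j) (W m k)"
      proof cases
        case 1
        then show ?thesis using pg_image[of i k M K] V_facts(2)[of k j] VJ by blast
      next
        case 2
        then have "(\<phi> ^^ i) ` M \<subseteq> W m k" using i by (intro W_image) auto
        then show ?thesis using join_upper(2)[where T = "V k j" and S = "W m k"] by blast
      next
        case 3
        then show ?thesis using V_image[of k i j] i j VJ by auto
      qed
    qed
  qed
  then have "dim (V k j) (pg K M m) \<le> dim (W m (Suc k)) (W m k)"
    using finite_ext_join(2)[OF 1(1) V_facts(1) WV] by simp
  then show "dim (W m (Suc k)) (W m k) = q" using 1(2) dim_V[of k j] j by simp
qed

lemma dim_W: "k \<le> m \<Longrightarrow> finite_ext (W m k) (pg K M m) \<and> dim (W m k) (pg K M m) = q ^ k"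
proof (induction k)
  case 0
  then show ?case using W_facts(4) finite_ext_refl[OF pgR(2)] by simp
next
  case (Suc k)
  then show ?case
    using finite_ext_trans[OF dim_W_step(1)[of k m], of "pg K M m"] dim_W_step(2)[of k m] by auto
qed

lemma dim_pg_N: "finite_ext (pg K N m) (pg K M m)" "dim (pg K N m) (pg K M m) = q ^ m"
  using dim_W[of m m] W_facts(5) by auto

text \<open>Compare two paths from \<open>pg K N n\<close> to \<open>pg K M (Suc n)\<close>: one
  step in the tower of \<open>N\<close> and then up, or up first and then one step in the tower of
  \<open>M\<close>. The vertical degrees are \<open>q ^ Suc n\<close> and
  \<open>q ^ n\<close>.\<close>

lemma const_deg_N: "const_deg K N (d div q)"
  unfolding const_deg_def
proof (intro allI impI)
  fix n :: nat assume n: "n \<ge> 1"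
  note f = finite_ext_pg[OF baseK N_facts(6)] and s = finite_ext_pg_step(1)[OF baseK N_facts(6)]
  have "dim (pg K N n) (pg K N (Suc n)) * q ^ Suc n = dim (pg K N n) (pg K M (Suc n))"
    using finite_ext_trans(2)[OF s[of n] dim_pg_N(1)[of "Suc n"]] dim_pg_N(2)[of "Suc n"] by simp
  also have "\<dots> = q ^ n * dim (pg K M n) (pg K M (Suc n))"
    using finite_ext_trans(2)[OF dim_pg_N(1)[of n] finite_ext_pg_step(1)[OF baseK finM, of n]] dim_pg_N(2)[of n] by simp
  also have "\<dots> = q ^ n * d" using const n by (simp add: const_deg_def)
  finally have "q ^ n * (dim (pg K N n) (pg K N (Suc n)) * q) = q ^ n * d" by (simp add: ac_simps)
  then have "dim (pg K N n) (pg K N (Suc n)) * q = d" using q_facts(2) by simp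
  then show "dim (pg K N n) (pg K N (Suc n)) = d div q" using q_facts(2) by auto
qed

lemma pg_N_subset: "pg K N n \<subseteq> pg K M n"
  by (rule pg_mono_set[OF N_facts(4)])

lemma pgN: "subfield (pg K N n) R" "pg K N n \<subseteq> carrier R"
  using pg_subfield[OF K(4) N_facts(9)] subfieldE(3) by auto

text \<open>Each further image \<open>\<phi>^i M\<close> costs at most \<open>q = [M : N]\<close>,
  because \<open>\<phi>^i N\<close> is already in the base as long as \<open>i < j\<close>.\<close>

lemma dim_join_pg_step:
  "n + t \<le> j \<Longrightarrow> finite_ext (join (pg K N j) (pg K M n)) (join (pg K N j) (pg K M (n + t))) \<and>
    dim (join (pg K N j) (pg K M n)) (join (pg K N j) (pg K M (n + t))) \<le> q ^ t"
proof (induction t)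
  case 0
  then show ?case using finite_ext_refl[OF join_subfield[OF pgN(2) pgR(1)]] by simp
next
  case (Suc t)
  define T where "T = join (pg K N j) (pg K M (n + t))"
  have T: "subfield T R" unfolding T_def by (rule join_subfield[OF pgN(2) pgR(1)])
  have "(\<phi> ^^ (n + t)) ` N \<subseteq> pg K N j" using Suc.prems by (intro pg_image) simp
  then have NT: "(\<phi> ^^ (n + t)) ` N \<subseteq> T"
    unfolding T_def using join_upper(1)[of "pg K N j" "pg K M (n + t)"] by blast
  have eq: "join T ((\<phi> ^^ (n + t)) ` M) = join (pg K N j) (pg K M (n + Suc t))"
  proof -
    have "join T ((\<phi> ^^ (n + t)) ` M) = join (pg K N j) (pg K M (n + t) \<union> (\<phi> ^^ (n + t)) ` M)"
      unfolding T_def by (rule join_join[OF pgN(2) pgR(1) phi_pow_carrier[OF KM(5)]])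
    also have "\<dots> = join (pg K N j) (join (pg K M (n + t)) ((\<phi> ^^ (n + t)) ` M))"
    proof -
      have "pg K M (n + t) \<union> (\<phi> ^^ (n + t)) ` M \<subseteq> carrier R"
        using pgR(1) phi_pow_carrier[OF KM(5)] by auto
      then show ?thesis
        using join_hom_generate[OF pgN(1)[of j] id_hom, of "pg K M (n + t) \<union> (\<phi> ^^ (n + t)) ` M"] by simp
    qed
    finally show ?thesis using pg_Suc[OF K(4) KM(5), of "n + t"] by simp
  qed
  from finite_ext_translate[OF N_facts(7) phi_pow_hom T NT]
  have 1: "finite_ext T (join (pg K N j) (pg K M (n + Suc t)))" "dim T (join (pg K N j) (pg K M (n + Suc t))) \<le> q"
    unfolding eq by auto
  have IH: "finite_ext (join (pg K N j) (pg K M n)) T" "dim (join (pg K N j) (pg K M n)) T \<le> q ^ t"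
    using Suc by (auto simp: T_def)
  show ?case
    using finite_ext_trans[OF IH(1) 1(1)] mult_le_mono[OF IH(2) 1(2)] by (simp add: mult.commute)
qed

text \<open>The extension from \<open>pg K N j\<close> to \<open>pg K M j\<close>, of degree
  \<open>q ^ j\<close>, passes through this compositum. The lower part is at most
  \<open>q ^ n\<close> and the upper part at most \<open>q ^ (j - n)\<close>, so both bounds are
  attained. Since \<open>j\<close> is arbitrary above \<open>n\<close>, the result survives the
  union over \<open>j\<close>.\<close>

lemma dim_join_pg:
  assumes "n \<le> j"
  shows "dim (pg K N j) (join (pg K N j) (pg K M n)) = q ^ n"
proof -
  define B where "B = join (pg K N j) (pg K M n)"
  have up: "finite_ext (pg K N j) B" "dim (pg K N j) B \<le> q ^ n"
    unfolding B_def using finite_ext_join[OF dim_pg_N(1)[of n] pgN(1) pg_mono[OF assms]] dim_pg_N(2)[of n] by auto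
  have "join (pg K N j) (pg K M j) = pg K M j" by (rule join_absorb(2)[OF pgR(2) pg_N_subset])
  then have 1: "finite_ext B (pg K M j)" "dim B (pg K M j) \<le> q ^ (j - n)"
    using dim_join_pg_step[of n "j - n" j] assms by (auto simp: B_def)
  have "q ^ n * q ^ (j - n) = q ^ j" using assms by (simp flip: power_add)
  also have "\<dots> = dim (pg K N j) B * dim B (pg K M j)"
    using finite_ext_trans(2)[OF up(1) 1(1)] dim_pg_N(2)[of j] by simp
  finally have "dim (pg K N j) B * dim B (pg K M j) = q ^ n * q ^ (j - n)" by simp
  from mult_eq_of_le(1)[OF this up(2) 1(2)] q_facts(2) show ?thesis by (simp add: B_def)
qed

end

section \<open>Benign extensions\<close>

context field
begin

lemma independent_if_dim_Span:
  assumes "subfield K R" "set us \<subseteq> carrier R" "dim K (Span K us) = length us"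
  shows "independent K us"
  using assms(2,3)
proof (induction us)
  case (Cons u us)
  have us: "set us \<subseteq> carrier R" and u: "u \<in> carrier R" using Cons.prems by auto
  note le = dim_Span_le[OF assms(1) us]
  have fin: "finite_dimension K (Span K us)" by (rule Span_finite_dimension[OF assms(1) us])
  have notin: "u \<notin> Span K us"
  proof
    assume "u \<in> Span K us"
    then have "set (u # us) \<subseteq> Span K us" using Span_base_incl[OF assms(1) us] by auto
    then have "Span K (u # us) = Span K us"
      using mono_Span_subset[OF assms(1) _ us] mono_Span[OF assms(1) us u] by blast
    then show False using Cons.prems(2) le by simp
  qed
  have "dimension (dim K (Span K us)) K (Span K us)"
    using finite_dimensionE[OF assms(1) fin] by (simp add: over_def)
  from Suc_dim[OF u notin this]
  have "dimension (Suc (dim K (Span K us))) K (Span K (u # us))" by (simp add: Span.simps)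
  then have "dim K (Span K (u # us)) = Suc (dim K (Span K us))"
    using dimI[OF assms(1)] by (simp add: over_def)
  then have "independent K us" using Cons us by simp
  then show ?case by (rule li_Cons[OF u notin])
qed simp

lemma join_join_right:
  assumes "subfield E R" "A \<subseteq> carrier R" "B \<subseteq> carrier R"
  shows "join E (join A B) = join E (A \<union> B)"
  using join_hom_generate[OF assms(1) id_hom, of "A \<union> B"] assms(2,3) by simp

lemma galois_extension_if_normal:
  assumes "galois_over D" "normal_ext D M"
  shows "galois_extension R D M"
  unfolding galois_extension_def
proof
  fix x assume x: "x \<in> M"
  have M: "subfield M R" "D \<subseteq> M" and sub: "conj D x \<subseteq> M" using assms(2) x by (auto simp: normal_ext_def)
  note D = galois_overD[OF assms(1)]
  interpret M: field "R\<lparr>carrier := M\<rparr>" by (rule subfield_iff(2)[OF M(1)])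
  have xR: "x \<in> carrier R" using x subfieldE(3)[OF M(1)] by auto
  note I = Irr_props[OF D(1) xR D(3)[OF xR]]
  have p: "Irr D x \<in> carrier (poly_ring (R\<lparr>carrier := M\<rparr>))"
    using poly_ring_mono[OF M(2) I(1)] univ_poly_consistent[OF subfieldE(1)[OF M(1)]] by simp
  have "{y \<in> carrier (R\<lparr>carrier := M\<rparr>). M.eval (Irr D x) y = \<zero>\<^bsub>R\<lparr>carrier := M\<rparr>\<^esub>} = conj D x"
    using sub subfieldE(3)[OF M(1)] eval_consistent[OF subfieldE(1)[OF M(1)]] by (auto simp: conj_def)
  then have "M.splitted (Irr D x) \<and> (\<forall>y. count (M.roots (Irr D x)) y \<le> 1)"
    using M.card_roots_eq_degree_iff[OF p I(3)] D(4)[OF xR] by simp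
  then show "algebraic D x \<and> M.splitted (Irr D x) \<and> (\<forall>y. count (M.roots (Irr D x)) y \<le> 1)"
    using D(3)[OF xR] by (simp add: over_def)
qed

lemma galois_over_if_galois_extension:
  assumes "subfield K R" "galois_extension R K (carrier R)"
  shows "galois_over K"
  unfolding galois_over_def
proof (intro conjI ballI)
  fix x assume x: "x \<in> carrier R"
  then have a: "algebraic K x" "splitted (Irr K x)" "\<forall>y. count (roots (Irr K x)) y \<le> 1"
    using assms(2) unfolding galois_extension_def by auto
  show alg: "(algebraic over K) x" using a(1) by (simp add: over_def)
  show "card (conj K x) = degree (Irr K x)"
    using card_roots_eq_degree_iff[OF Irr_props(2,3)[OF assms(1) x alg]] a(2,3) by (simp add: conj_def)
qed (rule assms(1))

end

text \<open>Otherwise the powers of \<open>x / y\<close> would outgrow the constant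
  \<open>b\<close>. This reads off a limit degree from the growth of a tower.\<close>

lemma exponential_growth_le:
  fixes a b x y :: nat
  assumes "0 < a" "0 < y" "\<And>i. a * x ^ i \<le> b * y ^ i"
  shows "x \<le> y"
proof (rule ccontr)
  assume "\<not> x \<le> y"
  then have "1 < real x / real y" using assms(2) by simp
  then obtain i where "real b < (real x / real y) ^ i" using real_arch_pow by blast
  then have "real b * real y ^ i < real x ^ i" using assms(2) by (simp add: field_simps power_divide)
  then have "b * y ^ i < x ^ i" by (simp flip: of_nat_power of_nat_mult)
  also have "x ^ i \<le> a * x ^ i" using assms(1) by simp
  finally show False using assms(3)[of i] by simp
qed

context difference_field
begin

lemma sigma_gen_pg_finite:
  assumes "finite S" "S \<subseteq> sigma_gen R \<phi> K M"
  shows "\<exists>n\<ge>m. S \<subseteq> pg K M n"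
  using assms
proof (induction S)
  case (insert s S)
  then obtain n where n: "n \<ge> m" "S \<subseteq> pg K M n" by auto
  obtain k where "s \<in> pg K M k" using sigma_gen_pg[of s K M] insert.prems by auto
  then show ?case
    using n pg_mono[of n "max n k" K M] pg_mono[of k "max n k" K M]
    by (intro exI[of _ "max n k"]) auto
qed auto

lemma pg_join:
  assumes "base K" "F \<subseteq> carrier R"
  shows "pg K (join K F) n = pg K F n"
proof -
  have "join K (pg K F n) = pg K F n"
    by (rule join_absorb(2)[OF pg_subfield[OF baseD(4)[OF assms(1)] assms(2)] pg_base])
  then show ?thesis using pg_shift[OF assms, of 0 n] by simp
qed

lemma sigma_gen_eqI:
  assumes "\<And>n. pg K F n = pg K M n"
  shows "sigma_gen R \<phi> K F = sigma_gen R \<phi> K M"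
  using sigma_gen_pg pg_sigma_gen assms by (metis subset_antisym subset_iff)

lemma pg_subset_shift:
  assumes "base K" "M \<subseteq> carrier R" "F \<subseteq> pg K M k"
  shows "pg K F i \<subseteq> pg K M (i + k)"
proof (rule pg_least[OF pg_subfield[OF baseD(4)[OF assms(1)] assms(2)] pg_base])
  fix j assume j: "j < i"
  have "(\<phi> ^^ j) ` F \<subseteq> (\<phi> ^^ j) ` pg K M k" using assms(3) by (rule image_mono)
  also have "\<dots> \<subseteq> pg K M (j + k)" by (rule phi_pg_subset[OF assms(1,2)])
  also have "\<dots> \<subseteq> pg K M (i + k)" using j by (intro pg_mono) simp
  finally show "(\<phi> ^^ j) ` F \<subseteq> pg K M (i + k)" .
qed

text \<open>For a competing finite generating set \<open>F\<close> with eventual degree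
  \<open>x\<close>, the stages grow like \<open>x ^ i\<close> up to a constant factor, those of
  \<open>M\<close> like \<open>q ^ i\<close>. Each tower lies in a shifted copy of the other, so the
  rates agree; this is the uniqueness that the description operator requires.\<close>

lemma limit_degree_eq:
  assumes "base K" "finite_ext K M" "\<And>m. dim K (pg K M m) = q ^ m" "0 < q"
  shows "limit_degree R \<phi> K (sigma_gen R \<phi> K M) = enat q"
proof -
  let ?E = "sigma_gen R \<phi> K M"
  note K = baseD[OF assms(1)] and G = galois_overD[OF baseD(1)[OF assms(1)]] and KM = finite_extD[OF assms(2)]
  \<comment> \<open>\<open>M\<close> is a field and may be infinite, whereas the limit degree is
    defined through finite generating sets.\<close>
  obtain F0 where F0: "finite F0" "F0 \<subseteq> M" "join K F0 = M" by (rule finite_ext_generators[OF assms(2)])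
  have F0R: "F0 \<subseteq> carrier R" using F0(2) KM(5) by auto
  have pgF0: "pg K F0 n = pg K M n" for n using pg_join[OF assms(1) F0R, of n] F0(3) by simp
  have deg: "ext_degree R (pg K M i) (pg K M (Suc i)) = enat q" for i
  proof -
    note s = finite_ext_pg_step(1)[OF assms(1,2), of i]
    have "q ^ i * dim (pg K M i) (pg K M (Suc i)) = q ^ Suc i"
      using finite_ext_trans(2)[OF finite_ext_pg[OF assms(1,2)] s] assms(3) by metis
    then have "dim (pg K M i) (pg K M (Suc i)) = q" using assms(4) by simp
    then show ?thesis using finite_extD(4)[OF s] by (simp add: ext_degree_def)
  qed
  have ex: "\<exists>F. finite F \<and> F \<subseteq> ?E \<and> ?E = sigma_gen R \<phi> K F \<and>
      (\<forall>\<^sub>F i in sequentially. ext_degree R (pg K F i) (pg K F (Suc i)) = enat q)"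
  proof (intro exI conjI)
    show "finite F0" by (rule F0(1))
    show "F0 \<subseteq> ?E" using F0(2) pg_image[of 0 "Suc 0" M K] pg_sigma_gen[of K M "Suc 0"] by auto
    show "?E = sigma_gen R \<phi> K F0" using sigma_gen_eqI[of K F0 M] pgF0 by simp
    show "\<forall>\<^sub>F i in sequentially. ext_degree R (pg K F0 i) (pg K F0 (Suc i)) = enat q"
      using deg pgF0 by simp
  qed
  have uniq: "d = enat q"
    if F: "finite F" "F \<subseteq> ?E" "?E = sigma_gen R \<phi> K F"
      and ev: "\<forall>\<^sub>F i in sequentially. ext_degree R (pg K F i) (pg K F (Suc i)) = d" for d F
  proof -
    have FR: "F \<subseteq> carrier R" using F(2) subfieldE(3)[OF sigma_gen_subfield[OF K(4) KM(5)]] by simp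
    have finF: "finite_ext K (join K F)" using finite_ext_adjoin[OF K(3) F(1) FR] G(3) FR by auto
    have st: "finite_ext (pg K F i) (pg K F (Suc i))" for i
      using finite_ext_pg_step(1)[OF assms(1) finF, of i] pg_join[OF assms(1) FR] by simp
    have KF: "finite_ext K (pg K F i)" for i
      using finite_ext_pg[OF assms(1) finF, of i] pg_join[OF assms(1) FR] by simp
    obtain n0 where n0: "\<And>i. i \<ge> n0 \<Longrightarrow> ext_degree R (pg K F i) (pg K F (Suc i)) = d"
      using ev by (auto simp: eventually_sequentially)
    define x where "x = dim (pg K F n0) (pg K F (Suc n0))"
    have d: "d = enat x" using n0[of n0] finite_extD(4)[OF st] by (simp add: ext_degree_def x_def)
    have dimx: "dim (pg K F i) (pg K F (Suc i)) = x" if "i \<ge> n0" for i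
      using n0[OF that] finite_extD(4)[OF st] d by (simp add: ext_degree_def)
    have x0: "0 < x" unfolding x_def by (rule finite_ext_dim_pos[OF st])
    define a where "a = dim K (pg K F n0)"
    have a0: "0 < a" unfolding a_def by (rule finite_ext_dim_pos[OF KF])
    have grow: "dim K (pg K F (n0 + i)) = a * x ^ i" for i
    proof (induction i)
      case (Suc i)
      then show ?case
        using finite_ext_trans(2)[OF KF[of "n0 + i"] st] dimx[of "n0 + i"] by simp
    qed (simp add: a_def)
    obtain k where k: "F \<subseteq> pg K M k" using sigma_gen_pg_finite[OF F(1,2)] by blast
    obtain l where l: "F0 \<subseteq> pg K F l"
    proof -
      have "F0 \<subseteq> sigma_gen R \<phi> K F"
        using F0(2) pg_image[of 0 "Suc 0" M K] pg_sigma_gen[of K M "Suc 0"] F(3) by auto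
      then show ?thesis using sigma_gen_pg_finite[OF F0(1)] that by blast
    qed
    have mono: "dim K A \<le> dim K B" if "finite_ext K A" "finite_ext K B" "A \<subseteq> B" for A B
      using finite_ext_subfields[OF that(2) finite_extD(2)[OF that(1)] finite_extD(3)[OF that(1)] that(3)]
        finite_ext_dim_pos by (simp add: Suc_le_eq)
    have "a * x ^ i \<le> q ^ (n0 + k) * q ^ i" for i
      using mono[OF KF finite_ext_pg[OF assms(1,2)] pg_subset_shift[OF assms(1) KM(5) k, of "n0 + i"]]
      unfolding grow assms(3) by (simp add: power_add ac_simps)
    then have "x \<le> q" using exponential_growth_le[OF a0 assms(4)] by blast
    moreover have "1 * q ^ i \<le> (a * x ^ l) * x ^ i" for i
    proof -
      have "pg K M i \<subseteq> pg K F (n0 + (l + i))"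
        using pg_subset_shift[OF assms(1) FR l, of i] pgF0[of i] pg_mono[of "i + l" "n0 + (l + i)" K F] by auto
      from mono[OF finite_ext_pg[OF assms(1,2)] KF this]
      show ?thesis unfolding grow assms(3) by (simp add: power_add ac_simps)
    qed
    then have "q \<le> x" by (rule exponential_growth_le[OF zero_less_one x0])
    ultimately show ?thesis using d by simp
  qed
  show ?thesis
    unfolding limit_degree_def
  proof (rule the_equality)
    show "\<exists>F. finite F \<and> F \<subseteq> ?E \<and> ?E = sigma_gen R \<phi> K F \<and>
      (\<forall>\<^sub>F i in sequentially. ext_degree R (pg K F i) (pg K F (Suc i)) = enat q)" by (rule ex)
  qed (use uniq in blast)
qed

text \<open>Stage 1 gives \<open>[M : K] = q\<close>, and quotients of consecutive powers give the
  limit degree \<open>q\<close>.\<close>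

lemma benignI:
  assumes "base K" "finite_ext K M" "normal_ext K M" "\<And>m. dim K (pg K M m) = q ^ m" "0 < q"
  shows "benign R \<phi> K (sigma_gen R \<phi> K M)"
  unfolding benign_def
proof (intro exI conjI)
  note KM = finite_extD[OF assms(2)]
  show "subfield M R" "K \<subseteq> M" "finite_dimension K M" using KM by auto
  show "M \<subseteq> sigma_gen R \<phi> K M"
    using pg_image[of 0 "Suc 0" M K] pg_sigma_gen[of K M "Suc 0"] by auto
  show "galois_extension R K M"
    by (rule galois_extension_if_normal[OF baseD(1)[OF assms(1)] assms(3)])
  have "dim K M = q" using assms(4)[of "Suc 0"] pg_1[OF KM(2,3)] by simp
  then show "limit_degree R \<phi> K (sigma_gen R \<phi> K M) = ext_degree R K M"
    using limit_degree_eq[OF assms(1,2,4,5)] KM(4) by (simp add: ext_degree_def)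
qed simp

end

section \<open>Degrees over the difference field generated by \<open>N\<close> and over its
  subfields\<close>

context stable_extension
begin

abbreviation E :: "'a set" where "E \<equiv> sigma_gen R \<phi> K N"

lemma E_facts: "subfield E R" "pg K N n \<subseteq> E" "E \<subseteq> carrier R"
  using sigma_gen_subfield[OF K(4) N_facts(9)] pg_sigma_gen subfieldE(3) by auto

text \<open>A basis of \<open>pg K M n\<close> over \<open>pg K N n\<close> stays independent over
  every higher \<open>pg K N j\<close> by \<open>dim_join_pg\<close>. A linear relation over
  \<open>E\<close> has finitely many coefficients, so it is a relation over some
  \<open>pg K N j\<close>.\<close>

lemma dim_join_E: "finite_ext E (join E (pg K M n))" "dim E (join E (pg K M n)) = q ^ n"
proof -
  note up = finite_ext_join[OF dim_pg_N(1)[of n] E_facts(1,2)]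
  show fin: "finite_ext E (join E (pg K M n))" by (rule up(1))
  note f = finite_extD[OF dim_pg_N(1)[of n]]
  obtain us where us: "set us \<subseteq> carrier R" "length us = q ^ n" "Span (pg K N n) us = pg K M n"
    using exists_base[OF f(1) finite_dimensionE[OF f(1,4)]] dim_pg_N(2)[of n] by (auto simp: over_def)
  have ind: "independent (pg K N j) us" if "n \<le> j" for j
  proof (rule independent_if_dim_Span[OF pgN(1) us(1)])
    have "join (pg K N j) (id ` pg K M n) = Span (pg K N j) (map id us)"
      by (rule translate_Span[OF dim_pg_N(1) id_hom pgN(1) _ us(1,3)]) (use pg_mono[OF that] in simp)
    then show "dim (pg K N j) (Span (pg K N j) us) = length us"
      using dim_join_pg[OF that] us(2) by simp
  qed
  have "independent E us"
  proof (rule trivial_combine_imp_independent[OF E_facts(1) us(1)])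
    fix Ks assume Ks: "set Ks \<subseteq> E" "combine Ks us = \<zero>"
    obtain j where j: "j \<ge> n" "set Ks \<subseteq> pg K N j" using sigma_gen_pg_finite[OF _ Ks(1)] by blast
    show "set (take (length us) Ks) \<subseteq> {\<zero>}"
      by (rule independent_imp_trivial_combine[OF pgN(1) ind[OF j(1)] j(2) Ks(2)])
  qed
  moreover have "set us \<subseteq> join E (pg K M n)"
    using Span_base_incl[OF f(1) us(1)] us(3) join_upper(2)[where T = E and S = "pg K M n"] by auto
  moreover have "dimension (dim E (join E (pg K M n))) E (join E (pg K M n))"
    using finite_dimensionE[OF E_facts(1) finite_extD(4)[OF fin]] by (simp add: over_def)
  ultimately have "q ^ n \<le> dim E (join E (pg K M n))"
    using independent_length_le_dimension[OF E_facts(1)] us(2) by metis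
  then show "dim E (join E (pg K M n)) = q ^ n" using up(2) dim_pg_N(2)[of n] by simp
qed

text \<open>The bound from above is translation by \<open>\<phi>^r\<close>. From below, enlarge the
  base first to \<open>E\<close> and then to \<open>join E (pg K M r)\<close>: there the extension
  becomes the passage from \<open>r\<close> to \<open>r + m\<close> images, whose degree is
  \<open>q ^ (r + m)\<close> divided by \<open>q ^ r\<close> according to
  \<open>dim_join_E\<close>.\<close>

lemma dim_join_image:
  assumes "subfield D R" "K \<subseteq> D" "\<phi> ` D \<subseteq> D" "D \<subseteq> E" "(\<phi> ^^ r) ` N \<subseteq> D"
  shows "dim D (join D ((\<phi> ^^ r) ` pg K M m)) = q ^ m"
proof -
  have "pg K N m \<subseteq> {x \<in> carrier R. (\<phi> ^^ r) x \<in> D}"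
  proof (rule pg_least[OF hom_preimage_subfield[OF phi_pow_hom assms(1)]])
    show "K \<subseteq> {x \<in> carrier R. (\<phi> ^^ r) x \<in> D}" using K(4) phi_pow_stable[OF K(2), of r] assms(2) by auto
    fix j
    have "(\<phi> ^^ r) ((\<phi> ^^ j) x) \<in> D" if "x \<in> N" for x
    proof -
      have "(\<phi> ^^ r) ((\<phi> ^^ j) x) = (\<phi> ^^ j) ((\<phi> ^^ r) x)"
        by (metis add.commute comp_apply funpow_add)
      then show ?thesis using phi_pow_stable[OF assms(3), of j] assms(5) that by auto
    qed
    then show "(\<phi> ^^ j) ` N \<subseteq> {x \<in> carrier R. (\<phi> ^^ r) x \<in> D}"
      using N_facts(9) phi_pow_closed by auto
  qed
  then have "(\<phi> ^^ r) ` pg K N m \<subseteq> D" by auto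
  from finite_ext_translate[OF dim_pg_N(1) phi_pow_hom assms(1) this]
  have up: "finite_ext D (join D ((\<phi> ^^ r) ` pg K M m))" "dim D (join D ((\<phi> ^^ r) ` pg K M m)) \<le> q ^ m"
    using dim_pg_N(2)[of m] by auto
  define A where "A = (\<phi> ^^ r) ` pg K M m"
  have AR: "A \<subseteq> carrier R" unfolding A_def by (rule phi_pow_carrier[OF pgR(1)])
  have DR: "D \<subseteq> carrier R" by (rule subfieldE(3)[OF assms(1)])
  have "join E (join D A) = join E A"
  proof -
    have "join E (join D A) = join E (D \<union> A)" by (rule join_join_right[OF E_facts(1) DR AR])
    also have "E \<union> (D \<union> A) = E \<union> A" using assms(4) by auto
    finally show ?thesis .
  qed
  then have 1: "finite_ext E (join E A)" "dim E (join E A) \<le> dim D (join D A)"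
    using finite_ext_join[OF up(1) E_facts(1) assms(4)] by (auto simp: A_def)
  define T where "T = join E (pg K M r)"
  have T: "subfield T R" unfolding T_def by (rule join_subfield[OF E_facts(3) pgR(1)])
  have TR: "T \<subseteq> carrier R" by (rule subfieldE(3)[OF T])
  have ET: "E \<subseteq> T" unfolding T_def by (rule join_upper(1))
  have eq: "join T (join E A) = join E (pg K M (r + m))"
  proof -
    have "join T (join E A) = join T (E \<union> A)" by (rule join_join_right[OF T E_facts(3) AR])
    also have "T \<union> (E \<union> A) = T \<union> A" using ET by auto
    also have "join T A = join E (pg K M r \<union> A)" unfolding T_def by (rule join_join[OF E_facts(3) pgR(1) AR])
    also have "\<dots> = join E (join (pg K M r) A)" by (rule join_join_right[OF E_facts(1) pgR(1) AR, symmetric])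
    also have "join (pg K M r) A = pg K M (r + m)" unfolding A_def by (rule join_pg_pg[OF baseK KM(5)])
    finally show ?thesis .
  qed
  from finite_ext_join[OF 1(1) T ET]
  have 2: "finite_ext T (join E (pg K M (r + m)))" "dim T (join E (pg K M (r + m))) \<le> dim E (join E A)"
    unfolding eq by auto
  have "q ^ (r + m) = q ^ r * dim T (join E (pg K M (r + m)))"
    using finite_ext_trans(2)[OF dim_join_E(1)[of r, folded T_def] 2(1)] dim_join_E(2)[of "r + m"]
      dim_join_E(2)[of r] by (simp add: T_def)
  then have "q ^ m = dim T (join E (pg K M (r + m)))" using q_facts(2) by (simp add: power_add)
  then show ?thesis using up(2) 1(2) 2(2) by (simp add: A_def)
qed

end

section \<open>The decomposition over a base without finite core\<close>

context difference_field
begin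

text \<open>Finite extensions with \<open>K(\<phi> M) = M\<close> are those making up the strong
  core; their absence is what makes \<open>P\<close> smaller than \<open>M\<close> in the
  induction.\<close>

definition coreless :: "'a set \<Rightarrow> bool"
  where "coreless K \<longleftrightarrow>
    (\<forall>M. finite_ext K M \<longrightarrow> normal_ext K M \<longrightarrow> join K (\<phi> ` M) = M \<longrightarrow> M = K)"

definition decomposition :: "'a set \<Rightarrow> 'a set \<Rightarrow> nat \<Rightarrow> (nat \<Rightarrow> 'a set) \<Rightarrow> bool"
  where "decomposition K E n F \<longleftrightarrow> F 0 = K \<and> (\<forall>i\<le>n. base (F i) \<and> K \<subseteq> F i) \<and>
    (\<forall>i<n. F i \<subseteq> F (Suc i) \<and> benign R \<phi> (F i) (F (Suc i))) \<and>
    F n \<subseteq> E \<and> sigma_radicial \<phi> (F n) E"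

lemma decomposition_trivial:
  assumes "base K" "K \<subseteq> E" "sigma_radicial \<phi> K E"
  shows "decomposition K E 0 (\<lambda>_. K)"
  using assms by (simp add: decomposition_def)

text \<open>One application of \<open>\<phi>\<close> brings \<open>E'\<close> into \<open>E\<close>,
  so the chain is kept and only the exponents in the radicial part grow by one.\<close>

lemma decomposition_radicial:
  assumes "decomposition K E n F" "E \<subseteq> E'" "\<And>x. x \<in> E' \<Longrightarrow> \<phi> x \<in> E"
  shows "decomposition K E' n F"
proof -
  have "\<exists>m. (\<phi> ^^ m) x \<in> F n" if x: "x \<in> E'" for x
  proof -
    obtain m where "(\<phi> ^^ m) (\<phi> x) \<in> F n"
      using assms(1) assms(3)[OF x] unfolding decomposition_def sigma_radicial_def by blast
    then have "(\<phi> ^^ Suc m) x \<in> F n" by (simp add: funpow_swap1)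
    then show ?thesis by blast
  qed
  then show ?thesis using assms(1,2) by (auto simp: decomposition_def sigma_radicial_def)
qed

lemma radicial_uniform:
  assumes "\<phi> ` D \<subseteq> D" "finite S" "\<And>s. s \<in> S \<Longrightarrow> \<exists>r. (\<phi> ^^ r) s \<in> D"
  shows "\<exists>r. (\<phi> ^^ r) ` S \<subseteq> D"
  using assms(2,3)
proof (induction S)
  case (insert s S)
  obtain a where a: "(\<phi> ^^ a) ` S \<subseteq> D" using insert by auto
  obtain b where b: "(\<phi> ^^ b) s \<in> D" using insert.prems by auto
  have "(\<phi> ^^ (a + b)) x \<in> D" if "x \<in> S" for x
  proof -
    have "(\<phi> ^^ (a + b)) x = (\<phi> ^^ b) ((\<phi> ^^ a) x)" by (metis add.commute comp_apply funpow_add)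
    then show ?thesis using phi_pow_stable[OF assms(1), of b] a that by auto
  qed
  moreover have "(\<phi> ^^ (a + b)) s \<in> D"
    using phi_pow_stable[OF assms(1), of a] b by (auto simp: funpow_add)
  ultimately show ?case by (intro exI[of _ "a + b"]) auto
qed simp

end

context stable_extension
begin

text \<open>Finitely many elements generate \<open>N\<close> over \<open>K\<close>, so the exponents
  that radiciality gives for them can be made uniform.\<close>

lemma N_image_in_radicial_base:
  assumes "base D" "K \<subseteq> D" "sigma_radicial \<phi> D E"
  shows "\<exists>r. (\<phi> ^^ r) ` N \<subseteq> D"
proof -
  note D = baseD[OF assms(1)]
  obtain S where S: "finite S" "S \<subseteq> N" "join K S = N" by (rule finite_ext_generators[OF N_facts(6)])
  have "N \<subseteq> E" using E_facts(2)[of "Suc 0"] pg_1[OF N_facts(1,5)] by simp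
  then have "\<exists>r. (\<phi> ^^ r) s \<in> D" if "s \<in> S" for s
    using assms(3) S(2) that unfolding sigma_radicial_def by blast
  then obtain r where r: "(\<phi> ^^ r) ` S \<subseteq> D" using radicial_uniform[OF D(2) S(1)] by blast
  have "join K S \<subseteq> {x \<in> carrier R. (\<phi> ^^ r) x \<in> D}"
    using phi_pow_stable[OF K(2), of r] assms(2) r K(4) S(2) N_facts(9)
    by (intro join_least[OF hom_preimage_subfield[OF phi_pow_hom D(3)]]) auto
  then show ?thesis using S(3) by auto
qed

text \<open>A decomposition of \<open>K\<langle>N\<rangle>\<close> ending in \<open>D\<close> is extended by the layer generated by \<open>\<phi>\<^sup>r M\<close> over \<open>D\<close>.\<close>

lemma decomposition_extend:
  assumes "decomposition K E n F"
  shows "\<exists>F'. decomposition K (sigma_gen R \<phi> K M) (Suc n) F'"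
proof -
  define D where "D = F n"
  have D': "base D" "K \<subseteq> D" "D \<subseteq> E" "sigma_radicial \<phi> D E"
    using assms by (auto simp: decomposition_def D_def)
  note D = baseD[OF D'(1)]
  \<comment> \<open>\<open>D\<close> need not contain \<open>N\<close>. Since \<open>L\<close> only
    has to be radicial over the top of the chain, \<open>M\<close> may be replaced by
    \<open>\<phi>^r M\<close>, whose part \<open>\<phi>^r N\<close> lies in
    \<open>D\<close>.\<close>
  obtain r where r: "(\<phi> ^^ r) ` N \<subseteq> D" using N_image_in_radicial_base[OF D'(1,2,4)] by blast
  define M' where "M' = join D ((\<phi> ^^ r) ` M)"
  define E' where "E' = sigma_gen R \<phi> D M'"
  have rN: "(\<phi> ^^ r) ` K \<subseteq> D" using phi_pow_stable[OF K(2), of r] D'(2) by auto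
  have finM': "finite_ext D M'"
    unfolding M'_def by (rule finite_ext_translate(1)[OF N_facts(7) phi_pow_hom D(3) r])
  note M' = finite_extD[OF finM']
  have normM': "normal_ext D M'"
    unfolding M'_def by (rule normal_ext_translate[OF K(1) D(1) phi_pow_hom rN finM normM])
  have pgM': "pg D M' m = join D ((\<phi> ^^ r) ` pg K M m)" for m
  proof -
    have "pg D M' m = join D ((\<phi> ^^ r) ` pg D M m)"
      unfolding M'_def by (rule pg_shift[OF D'(1) KM(5)])
    also have "\<dots> = generate_field R (D \<union> (\<Union>j<m. (\<phi> ^^ (r + j)) ` M))"
      by (rule join_pg_shift[OF D(3) phi_pow_stable[OF D(2)] D(4) KM(5)])
    also have "\<dots> = join D ((\<phi> ^^ r) ` pg K M m)"
      by (rule join_pg_shift[OF D(3) rN K(4) KM(5), symmetric])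
    finally show ?thesis .
  qed
  have benign: "benign R \<phi> D E'"
    unfolding E'_def
  proof (rule benignI[OF D'(1) finM' normM' _ q_facts(2)])
    show "dim D (pg D M' m) = q ^ m" for m
      unfolding pgM' by (rule dim_join_image[OF D(3) D'(2) D(2) D'(3) r])
  qed
  have E': "subfield E' R" "D \<subseteq> E'" "\<phi> ` E' \<subseteq> E'"
    unfolding E'_def
    using sigma_gen_subfield[OF D(4) M'(5)] sigma_gen_stable[OF D'(1) M'(5)]
      pg_base[of D M' 0] pg_sigma_gen[of D M' 0] by auto
  have EM: "E \<subseteq> sigma_gen R \<phi> K M"
    unfolding sigma_gen_def using N_facts(4) by (intro generate_field_mono) auto
  have sub: "subfield (sigma_gen R \<phi> K M) R" by (rule sigma_gen_subfield[OF K(4) KM(5)])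
  have rM: "(\<phi> ^^ r) ` M \<subseteq> sigma_gen R \<phi> K M"
    using pg_image[of r "Suc r" M K] pg_sigma_gen[of K M "Suc r"] by auto
  have M'sub: "M' \<subseteq> sigma_gen R \<phi> K M"
    unfolding M'_def by (rule join_least[OF sub subset_trans[OF D'(3) EM] rM])
  have E'sub: "E' \<subseteq> sigma_gen R \<phi> K M"
    unfolding E'_def
    using phi_pow_stable[OF sigma_gen_stable[OF baseK KM(5)]] M'sub D'(3) EM
    by (intro sigma_gen_least[OF sub]) blast+
  \<comment> \<open>Every element enters \<open>E'\<close> after \<open>r\<close> applications of
    \<open>\<phi>\<close>, because \<open>\<phi>^r\<close> carries stage \<open>m\<close> over
    \<open>K\<close> into stage \<open>m\<close> over \<open>D\<close>.\<close>
  have rad: "sigma_radicial \<phi> E' (sigma_gen R \<phi> K M)"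
    unfolding sigma_radicial_def
  proof
    fix x assume "x \<in> sigma_gen R \<phi> K M"
    then obtain m where "x \<in> pg K M m" using sigma_gen_pg by blast
    then have "(\<phi> ^^ r) x \<in> pg D M' m"
      unfolding pgM' using join_upper(2)[where T = D and S = "(\<phi> ^^ r) ` pg K M m"] by auto
    then show "\<exists>n. (\<phi> ^^ n) x \<in> E'" unfolding E'_def using pg_sigma_gen by blast
  qed
  have baseE': "base E'"
    using galois_over_mono[OF D(1) E'(1,2)] E'(3) by (simp add: base_def)
  have "decomposition K (sigma_gen R \<phi> K M) (Suc n) (F(Suc n := E'))"
    using assms benign E' E'sub rad baseE' subset_trans[OF D'(2) E'(2)] unfolding decomposition_def D_def
    by (auto simp: less_Suc_eq le_Suc_eq)
  then show ?thesis by blast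
qed

end

context difference_field
begin

theorem decomposition_exists:
  assumes "base K" "coreless K" "finite_ext K M" "normal_ext K M" "const_deg K M d"
  shows "\<exists>n F. decomposition K (sigma_gen R \<phi> K M) n F"
  using assms(3-)
proof (induction "dim K M" arbitrary: M d rule: less_induct)
  case less
  note K = baseD[OF assms(1)] and KM = finite_extD[OF less.prems(1)]
  define M1 where "M1 = join K (\<phi> ` M)"
  note M1 = finite_ext_shift[OF assms(1) less.prems(1), folded M1_def]
  have smaller: "dim K F < dim K M" if "subfield F R" "K \<subseteq> F" "F \<subseteq> M" "F \<noteq> M" for F
    using finite_ext_eq_top[OF less.prems(1) that(1-3)] that(4) by force
  consider (trivial) "M = K" | (shift) "dim K M1 < dim K M" | (stable) "M \<noteq> K" "dim K M1 = dim K M"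
    using M1(2) by linarith
  then show ?case
  proof cases
    case trivial
    have "sigma_gen R \<phi> K K \<subseteq> K"
      using phi_pow_stable[OF K(2)] by (intro sigma_gen_least[OF K(3)]) auto
    then have "sigma_radicial \<phi> K (sigma_gen R \<phi> K M)"
      unfolding sigma_radicial_def using trivial by (metis funpow_0 subsetD)
    then show ?thesis
      using decomposition_trivial[OF assms(1) subset_trans[OF pg_base pg_sigma_gen]] by blast
  next
    case shift
    have "normal_ext K M1"
      unfolding M1_def by (rule normal_ext_translate[OF K(1,1) phi_hom K(2) less.prems(1,2)])
    then obtain n F where F: "decomposition K (sigma_gen R \<phi> K M1) n F"
      using less.hyps[OF shift M1(1)] const_deg_shift[OF assms(1) less.prems(1,3), folded M1_def] by blast
    have pgM1: "pg K M1 m = join K (\<phi> ` pg K M m)" for m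
      using pg_shift[OF assms(1) KM(5), of 1 m] by (simp add: M1_def)
    have "\<phi> x \<in> sigma_gen R \<phi> K M1" if x: "x \<in> sigma_gen R \<phi> K M" for x
    proof -
      obtain m where "x \<in> pg K M m" using sigma_gen_pg[OF x] by blast
      then have "\<phi> x \<in> pg K M1 m"
        unfolding pgM1 using join_upper(2)[where T = K and S = "\<phi> ` pg K M m"] by auto
      then show ?thesis using pg_sigma_gen by blast
    qed
    moreover have "sigma_gen R \<phi> K M1 \<subseteq> sigma_gen R \<phi> K M"
    proof
      fix x assume "x \<in> sigma_gen R \<phi> K M1"
      then obtain m where "x \<in> pg K M1 m" using sigma_gen_pg by blast
      moreover have "pg K M1 m \<subseteq> pg K M (Suc m)"
        unfolding pgM1 using phi_pg_subset[OF assms(1) KM(5), of "Suc 0" m]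
        by (intro join_least[OF pg_subfield[OF K(4) KM(5)] pg_base]) simp
      ultimately show "x \<in> sigma_gen R \<phi> K M" using pg_sigma_gen by blast
    qed
    ultimately show ?thesis using decomposition_radicial[OF F] by blast
  next
    case stable
    interpret S: stable_extension R \<phi> K M d
      by unfold_locales (use assms(1) less.prems stable(2) in \<open>simp_all add: M1_def\<close>)
    show ?thesis
    proof (cases "S.N = M")
      case True
      \<comment> \<open>If \<open>P = M\<close> then \<open>\<phi> M \<subseteq> M\<close>, and
        equality of degrees gives \<open>K(\<phi> M) = M\<close>, which \<open>coreless\<close>
        allows only for \<open>M = K\<close>.\<close>
      have "S.P \<noteq> M"
      proof
        assume "S.P = M"
        then have "\<phi> ` M \<subseteq> M" using S.P_facts(4) by (simp only:)
        then have "M1 \<subseteq> M" unfolding M1_def by (intro join_least[OF KM(2,3)])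
        then have "M1 = M"
          using finite_ext_eq_top[OF less.prems(1) finite_extD(2,3)[OF M1(1)]] stable(2) by simp
        then show False using assms(2) less.prems(1,2) stable(1) by (auto simp: coreless_def M1_def)
      qed
      then have "dim K S.P < dim K M" by (rule smaller[OF S.P_facts(1-3)])
      from less.hyps[OF this S.P_facts(5) S.P_normal S.const_deg_P[OF True]]
      show ?thesis using S.sigma_gen_P[OF True] by simp
    next
      case False
      then have "dim K S.N < dim K M" by (rule smaller[OF S.N_facts(1,5,4)])
      from less.hyps[OF this S.N_facts(6) S.N_normal S.const_deg_N]
      show ?thesis using S.decomposition_extend by blast
    qed
  qed
qed

text \<open>\<open>\<phi>\<close> carries step \<open>n\<close> of the tower to step
  \<open>n + 1\<close>, so the degrees do not increase and stay at their minimum from some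
  \<open>n0\<close> on. Taking all of stage \<open>n0 + 1\<close> as the new \<open>M\<close> shifts
  the tower so that every step counted by \<open>const_deg\<close> comes after
  \<open>n0\<close>.\<close>

lemma eventually_const_deg:
  assumes "base K" "finite_ext K M"
  shows "\<exists>k\<ge>1. \<exists>d. const_deg K (pg K M k) d"
proof -
  note K = baseD[OF assms(1)] and KM = finite_extD[OF assms(2)]
  define g where "g n = dim (pg K M n) (pg K M (Suc n))" for n
  have step: "g (Suc n) \<le> g n" for n
  proof -
    have "\<phi> ` pg K M n \<subseteq> pg K M (Suc n)" using phi_pg_subset[OF assms(1) KM(5), of "Suc 0" n] by simp
    note t = finite_ext_translate(2)[OF finite_ext_pg_step(1)[OF assms] phi_hom pg_subfield[OF K(4) KM(5)] this]
    have "join (pg K M (Suc n)) (\<phi> ` pg K M (Suc n)) = pg K M (Suc (Suc n))"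
    proof
      show "join (pg K M (Suc n)) (\<phi> ` pg K M (Suc n)) \<subseteq> pg K M (Suc (Suc n))"
        using phi_pg_subset[OF assms(1) KM(5), of "Suc 0" "Suc n"]
        by (intro join_least[OF pg_subfield[OF K(4) KM(5)] pg_mono]) simp_all
      have "(\<phi> ^^ Suc n) ` M \<subseteq> \<phi> ` pg K M (Suc n)"
        using image_mono[OF pg_image[of n "Suc n" M K], of \<phi>] by (simp add: image_comp)
      then show "pg K M (Suc (Suc n)) \<subseteq> join (pg K M (Suc n)) (\<phi> ` pg K M (Suc n))"
        unfolding pg_Suc[OF K(4) KM(5), of "Suc n"] by (intro generate_field_mono) blast
    qed
    then show ?thesis using t by (simp add: g_def)
  qed
  define m where "m = (LEAST v. \<exists>n. g n = v)"
  obtain n0 where n0: "g n0 = m" unfolding m_def using LeastI_ex[of "\<lambda>v. \<exists>n. g n = v"] by blast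
  have "g n = m" if "n0 \<le> n" for n
  proof (rule antisym)
    show "m \<le> g n" unfolding m_def by (rule Least_le) blast
    show "g n \<le> m" using that by (induction n rule: dec_induct) (use n0 step in \<open>auto intro: order_trans\<close>)
  qed
  then have gm: "g n = m" if "n0 \<le> n" for n using that by blast
  have pp: "pg K (pg K M (Suc n0)) (Suc n) = pg K M (Suc n0 + n)" for n
  proof -
    have MR: "pg K M (Suc n0) \<subseteq> carrier R" by (rule subfieldE(3)[OF pg_subfield[OF K(4) KM(5)]])
    show ?thesis
    proof
      show "pg K (pg K M (Suc n0)) (Suc n) \<subseteq> pg K M (Suc n0 + n)"
      proof (rule pg_least[OF pg_subfield[OF K(4) KM(5)] pg_base])
        fix j assume "j < Suc n"
        then have "pg K M (j + Suc n0) \<subseteq> pg K M (Suc n0 + n)" by (intro pg_mono) simp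
        then show "(\<phi> ^^ j) ` pg K M (Suc n0) \<subseteq> pg K M (Suc n0 + n)"
          using phi_pg_subset[OF assms(1) KM(5), of j "Suc n0"] by blast
      qed
      show "pg K M (Suc n0 + n) \<subseteq> pg K (pg K M (Suc n0)) (Suc n)"
      proof (rule pg_least[OF pg_subfield[OF K(4) MR] pg_base])
        fix j assume j: "j < Suc n0 + n"
        show "(\<phi> ^^ j) ` M \<subseteq> pg K (pg K M (Suc n0)) (Suc n)"
        proof (cases "j < Suc n0")
          case True
          then have "(\<phi> ^^ j) ` M \<subseteq> (\<phi> ^^ 0) ` pg K M (Suc n0)" using pg_image[of j "Suc n0" M K] by simp
          also have "\<dots> \<subseteq> pg K (pg K M (Suc n0)) (Suc n)" by (rule pg_image) simp
          finally show ?thesis .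
        next
          case False
          define i where "i = j - n0"
          have i: "j = i + n0" "i < Suc n" using False j by (auto simp: i_def)
          have "(\<phi> ^^ j) ` M \<subseteq> (\<phi> ^^ i) ` pg K M (Suc n0)"
            using image_mono[OF pg_image[of n0 "Suc n0" M K], of "\<phi> ^^ i"]
            by (simp add: i(1) funpow_add image_comp)
          also have "\<dots> \<subseteq> pg K (pg K M (Suc n0)) (Suc n)" by (rule pg_image[OF i(2)])
          finally show ?thesis .
        qed
      qed
    qed
  qed
  have "const_deg K (pg K M (Suc n0)) m"
    unfolding const_deg_def
  proof (intro allI impI)
    fix n :: nat assume "n \<ge> 1"
    then obtain i where i: "n = Suc i" by (cases n) auto
    show "dim (pg K (pg K M (Suc n0)) n) (pg K (pg K M (Suc n0)) (Suc n)) = m"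
      using gm[of "Suc n0 + i"] unfolding i pp g_def by simp
  qed
  then show ?thesis by (intro exI[of _ "Suc n0"]) auto
qed

lemma normal_ext_pg:
  assumes "base K" "finite_ext K M" "normal_ext K M"
  shows "normal_ext K (pg K M n)"
proof (induction n)
  case 0
  \<comment> \<open>An element of the base has degree 1 over it, so it is its only
    conjugate.\<close>
  have "conj K x \<subseteq> K" if "x \<in> K" for x
  proof -
    note G = galois_overD[OF baseD(1)[OF assms(1)]]
    have xR: "x \<in> carrier R" using that G(2) by auto
    have "join K {x} = K" using join_absorb(1)[OF G(1), of "{x}"] that by simp
    then have "card (conj K x) = 1" using G(5)[OF xR] finite_ext_refl(2)[OF G(1)] by simp
    then have "conj K x = {x}"
      using conj_finite(3)[OF G(1) xR G(3)[OF xR]] by (metis card_1_singletonE singletonD)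
    then show ?thesis using that by simp
  qed
  then show ?case using pg_0[OF baseD(3)[OF assms(1)]] baseD(3)[OF assms(1)] by (simp add: normal_ext_def)
next
  case (Suc n)
  note K = baseD[OF assms(1)] and KM = finite_extD[OF assms(2)]
  have nK: "(\<phi> ^^ n) ` K \<subseteq> K" by (rule phi_pow_stable[OF K(2)])
  have MR: "(\<phi> ^^ n) ` M \<subseteq> carrier R" using KM(5) phi_pow_closed by auto
  have pR: "subfield (pg K M n) R" by (rule pg_subfield[OF K(4) KM(5)])
  have "join (pg K M n) (join K ((\<phi> ^^ n) ` M)) = join (pg K M n) (K \<union> (\<phi> ^^ n) ` M)"
    by (rule join_join_right[OF pR K(4) MR])
  also have "pg K M n \<union> (K \<union> (\<phi> ^^ n) ` M) = pg K M n \<union> (\<phi> ^^ n) ` M" using pg_base by blast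
  finally have "pg K M (Suc n) = join (pg K M n) (join K ((\<phi> ^^ n) ` M))"
    using pg_Suc[OF K(4) KM(5)] by simp
  then show ?case
    using normal_ext_join[OF K(1) finite_ext_pg[OF assms(1,2)] Suc
        finite_ext_translate(1)[OF assms(2) phi_pow_hom K(3) nK]
        normal_ext_translate[OF K(1,1) phi_pow_hom nK assms(2,3)]] by simp
qed

text \<open>
  Pass to the normal closure of the generators and
  to a step of the tower after which the degrees are constant.
\<close>

theorem decomposition_of_finitely_generated:
  assumes "base K" "coreless K" "finite F0" "F0 \<subseteq> carrier R" "carrier R \<subseteq> sigma_gen R \<phi> K F0"
  shows "\<exists>n F. decomposition K (carrier R) n F"
proof -
  note K = baseD[OF assms(1)] and G = galois_overD[OF baseD(1)[OF assms(1)]]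
  define S where "S = (\<Union>x\<in>F0. conj K x)"
  have cf: "finite (conj K x)" "x \<in> conj K x" "conj K x \<subseteq> carrier R" if "x \<in> F0" for x
  proof -
    have xR: "x \<in> carrier R" using that assms(4) by auto
    show "finite (conj K x)" "x \<in> conj K x" "conj K x \<subseteq> carrier R"
      using conj_finite[OF K(3) xR G(3)[OF xR]] by auto
  qed
  have S: "finite S" "S \<subseteq> carrier R" "F0 \<subseteq> S"
    unfolding S_def using assms(3) cf by auto
  have Sconj: "conj K s \<subseteq> S" if s: "s \<in> S" for s
  proof -
    obtain x where "x \<in> F0" "s \<in> conj K x" using s by (auto simp: S_def)
    then show ?thesis using conj_conj[OF K(1), of x s] assms(4) by (auto simp: S_def)
  qed
  define M where "M = join K S"
  have finM: "finite_ext K M" unfolding M_def using finite_ext_adjoin[OF K(3) S(1,2)] G(3) S(2) by auto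
  have normM: "normal_ext K M" unfolding M_def by (rule normal_join[OF K(1) S(1,2) Sconj])
  obtain k d where k: "k \<ge> 1" "const_deg K (pg K M k) d" using eventually_const_deg[OF assms(1) finM] by blast
  obtain n F where F: "decomposition K (sigma_gen R \<phi> K (pg K M k)) n F"
    using decomposition_exists[OF assms(1,2) finite_ext_pg[OF assms(1) finM]
        normal_ext_pg[OF assms(1) finM normM] k(2)] by blast
  have "F0 \<subseteq> (\<phi> ^^ 0) ` M" using S(3) join_upper(2)[where T = K and S = S] by (auto simp: M_def)
  also have "\<dots> \<subseteq> pg K M k" by (rule pg_image) (use k(1) in simp)
  finally have "sigma_gen R \<phi> K F0 \<subseteq> sigma_gen R \<phi> K (pg K M k)"
    unfolding sigma_gen_def by (intro generate_field_mono) blast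
  moreover have "sigma_gen R \<phi> K (pg K M k) \<subseteq> carrier R"
    by (rule subfieldE(3)[OF sigma_gen_subfield[OF K(4) finite_extD(5)[OF finite_ext_pg[OF assms(1) finM]]]])
  ultimately have "sigma_gen R \<phi> K (pg K M k) = carrier R" using assms(5) by blast
  then show ?thesis using F by auto
qed

end

section \<open>Computations in tensor products\<close>

text \<open>A sum over a multiset, written as a fold. Addition is known to commute only on the
  carrier, so the step leaves an accumulator outside the carrier untouched; then the step functions
  commute for all arguments.\<close>

definition tsum :: "('t, 'u) ring_scheme \<Rightarrow> ('p \<Rightarrow> 't) \<Rightarrow> 'p multiset \<Rightarrow> 't"
  where "tsum T \<beta> M = fold_mset (\<lambda>p acc. if acc \<in> carrier T then \<beta> p \<oplus>\<^bsub>T\<^esub> acc else acc) \<zero>\<^bsub>T\<^esub> M"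

context ring
begin

context
  fixes \<beta> :: "'p \<Rightarrow> 'a"
  assumes \<beta>: "\<And>p. \<beta> p \<in> carrier R"
begin

lemma tsum_commute: "comp_fun_commute (\<lambda>p acc. if acc \<in> carrier R then \<beta> p \<oplus> acc else acc)"
  by unfold_locales (auto simp: fun_eq_iff \<beta> a_lcomm)

lemma tsum_empty [simp]: "tsum R \<beta> {#} = \<zero>"
  by (simp add: tsum_def)

lemma tsum_closed [simp]: "tsum R \<beta> M \<in> carrier R"
  by (induction M) (simp_all add: tsum_def comp_fun_commute.fold_mset_add_mset[OF tsum_commute] \<beta>)

lemma tsum_add_mset [simp]: "tsum R \<beta> (add_mset p M) = \<beta> p \<oplus> tsum R \<beta> M"
  using tsum_closed[of M] by (simp add: tsum_def comp_fun_commute.fold_mset_add_mset[OF tsum_commute])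

lemma tsum_union: "tsum R \<beta> (M + N) = tsum R \<beta> M \<oplus> tsum R \<beta> N"
  by (induction M) (simp_all add: \<beta> a_assoc)

lemma tsum_zero: "(\<And>p. p \<in># M \<Longrightarrow> \<beta> p = \<zero>) \<Longrightarrow> tsum R \<beta> M = \<zero>"
  by (induction M) simp_all

end

lemma tsum_image_mult:
  assumes "\<And>p. \<beta> p \<in> carrier R" "x \<in> carrier R" "\<And>q. q \<in># N \<Longrightarrow> \<beta> (h q) = x \<otimes> \<beta> q"
  shows "tsum R \<beta> (image_mset h N) = x \<otimes> tsum R \<beta> N"
  using assms(3)
proof (induction N)
  case empty
  then show ?case using assms(1,2) by simp
next
  case (add q N)
  then show ?case using assms(1,2) tsum_closed[of \<beta> N] by (simp add: r_distr)
qed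

end

lemma formal_mult_simps [simp]:
  "formal_mult R S {#} N = {#}"
  "formal_mult R S (add_mset p M) N =
    image_mset (\<lambda>q. (fst p \<otimes>\<^bsub>R\<^esub> fst q, snd p \<otimes>\<^bsub>S\<^esub> snd q)) N + formal_mult R S M N"
  by (simp_all add: formal_mult_def)

lemma formal_mult_union: "formal_mult R S (M + M') N = formal_mult R S M N + formal_mult R S M' N"
  by (simp add: formal_mult_def)

lemma formal_mult_add_right:
  "formal_mult R S M (add_mset q N) =
    image_mset (\<lambda>p. (fst p \<otimes>\<^bsub>R\<^esub> fst q, snd p \<otimes>\<^bsub>S\<^esub> snd q)) M + formal_mult R S M N"
  by (induction M) (auto simp: ac_simps)

lemma formal_mult_empty_right [simp]: "formal_mult R S M {#} = {#}"
  by (induction M) auto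

lemma (in ring) tsum_formal_mult:
  assumes "\<And>p. \<beta> p \<in> carrier R"
    and "\<And>p q. p \<in># M \<Longrightarrow> q \<in># N \<Longrightarrow> \<beta> (fst p \<otimes>\<^bsub>A\<^esub> fst q, snd p \<otimes>\<^bsub>S\<^esub> snd q) = \<beta> p \<otimes> \<beta> q"
  shows "tsum R \<beta> (formal_mult A S M N) = tsum R \<beta> M \<otimes> tsum R \<beta> N"
  using assms(2)
proof (induction M)
  case empty
  then show ?case using assms(1) tsum_closed[OF assms(1), where M = N] by simp
next
  case (add p M)
  have "tsum R \<beta> (image_mset (\<lambda>q. (fst p \<otimes>\<^bsub>A\<^esub> fst q, snd p \<otimes>\<^bsub>S\<^esub> snd q)) N) = \<beta> p \<otimes> tsum R \<beta> N"
    by (rule tsum_image_mult[OF assms(1) assms(1)]) (use add.prems in auto)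
  then show ?case
    using add assms(1) tsum_closed[OF assms(1)] by (simp add: tsum_union[OF assms(1)] l_distr)
qed

text \<open>The universal property of the tensor product: a biadditive balanced
  \<open>\<beta>\<close> has a value on each class. As \<open>\<beta>\<close> must be total with
  values in the carrier, the instances below are extended by zero.\<close>

lemma tensor_eq_tsum:
  assumes "ring T" "tensor_eq K f R g S M N"
    and "\<And>p. \<beta> p \<in> carrier T"
    and "\<And>b. b \<in> carrier S \<Longrightarrow> \<beta> (\<zero>\<^bsub>R\<^esub>, b) = \<zero>\<^bsub>T\<^esub>" "\<And>a. a \<in> carrier R \<Longrightarrow> \<beta> (a, \<zero>\<^bsub>S\<^esub>) = \<zero>\<^bsub>T\<^esub>"
    and "\<And>a a' b. a \<in> carrier R \<Longrightarrow> a' \<in> carrier R \<Longrightarrow> b \<in> carrier S \<Longrightarrow>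
      \<beta> (a \<oplus>\<^bsub>R\<^esub> a', b) = \<beta> (a, b) \<oplus>\<^bsub>T\<^esub> \<beta> (a', b)"
    and "\<And>a b b'. a \<in> carrier R \<Longrightarrow> b \<in> carrier S \<Longrightarrow> b' \<in> carrier S \<Longrightarrow>
      \<beta> (a, b \<oplus>\<^bsub>S\<^esub> b') = \<beta> (a, b) \<oplus>\<^bsub>T\<^esub> \<beta> (a, b')"
    and "\<And>c a b. c \<in> carrier K \<Longrightarrow> a \<in> carrier R \<Longrightarrow> b \<in> carrier S \<Longrightarrow>
      \<beta> (f c \<otimes>\<^bsub>R\<^esub> a, b) = \<beta> (a, g c \<otimes>\<^bsub>S\<^esub> b)"
  shows "tsum T \<beta> M = tsum T \<beta> N"
  using assms(2)
proof induction
  interpret T: ring T by fact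
  note [simp] = assms(3) T.tsum_add_mset[OF assms(3)] T.tsum_empty[OF assms(3)]
  {
    case (add M M' N N') then show ?case by (simp add: T.tsum_union[OF assms(3)])
  next
    case (zero_left b) then show ?case using assms(4) by simp
  next
    case (zero_right a) then show ?case using assms(5) by simp
  next
    case (add_left a a' b) then show ?case using assms(6) by (simp add: T.a_assoc)
  next
    case (add_right a b b') then show ?case using assms(7) by (simp add: T.a_assoc)
  next
    case (balanced c a b) then show ?case using assms(8) by simp
  }
qed simp_all

lemma tensor_eq_swap:
  assumes "tensor_eq K f R g S M N"
  shows "tensor_eq K g S f R (image_mset prod.swap M) (image_mset prod.swap N)"
  using assms
proof induction
  case (refl M)
  then show ?case by (intro tensor_eq.refl) auto
next
  case (sym M N)
  from sym.IH show ?case by (rule tensor_eq.sym)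
next
  case (trans M N P)
  from trans.IH show ?case by (rule tensor_eq.trans)
next
  case (add M M' N N')
  then show ?case using tensor_eq.add[OF add.IH] by simp
next
  case (balanced c a b)
  then show ?case using tensor_eq.sym[OF tensor_eq.balanced[of c K b S a R g f]] by simp
qed (auto intro: tensor_eq.intros)

text \<open>Only finitely many elements of \<open>R\<close> occur in a derivation, so an identity
  over an algebra of unknown dimension already holds over a small part of it.\<close>

lemma tensor_eq_finite_support_left:
  assumes "tensor_eq K f R g S M N"
  obtains Z where "finite Z" "Z \<subseteq> carrier R" "\<And>T. Z \<subseteq> T \<Longrightarrow> tensor_eq K f (R\<lparr>carrier := T\<rparr>) g S M N"
proof -
  obtain Z where Z: "finite Z" "Z \<subseteq> carrier R"
    "\<And>T. Z \<subseteq> T \<Longrightarrow> tensor_eq K g S f (R\<lparr>carrier := T\<rparr>) (image_mset prod.swap M) (image_mset prod.swap N)"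
    using tensor_eq_finite_support[OF tensor_eq_swap[OF assms]] by blast
  have "tensor_eq K f (R\<lparr>carrier := T\<rparr>) g S M N" if "Z \<subseteq> T" for T
    using tensor_eq_swap[OF Z(3)[OF that]] by (simp add: image_mset.compositionality)
  then show ?thesis using that Z by blast
qed

lemma tensor_eq_sum:
  assumes "\<And>q. q \<in># N \<Longrightarrow> tensor_eq K f R g S (F q) (G q)"
  shows "tensor_eq K f R g S (\<Sum>q\<in>#N. F q) (\<Sum>q\<in>#N. G q)"
  using assms
proof (induction N)
  case empty
  then show ?case by (simp add: tensor_eq.refl)
next
  case (add q N)
  then show ?case by (auto intro!: tensor_eq.add)
qed

lemma formal_mult_single:
  "formal_mult R S {#p#} N = (\<Sum>q\<in>#N. {#(fst p \<otimes>\<^bsub>R\<^esub> fst q, snd p \<otimes>\<^bsub>S\<^esub> snd q)#})"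
  by (induction N) (auto simp: formal_mult_add_right)

lemma formal_mult_closed:
  assumes "ring R" "ring S" "set_mset M \<subseteq> carrier R \<times> carrier S" "set_mset N \<subseteq> carrier R \<times> carrier S"
  shows "set_mset (formal_mult R S M N) \<subseteq> carrier R \<times> carrier S"
proof -
  interpret R: ring R by fact
  interpret S: ring S by fact
  have N: "fst q \<in> carrier R \<and> snd q \<in> carrier S" if "q \<in># N" for q
    using subsetD[OF assms(4) that] by (simp add: mem_Times_iff)
  show ?thesis using assms(3)
  proof (induction M)
    case (add p M)
    then have p: "fst p \<in> carrier R" "snd p \<in> carrier S" by auto
    have "(\<lambda>q. (fst p \<otimes>\<^bsub>R\<^esub> fst q, snd p \<otimes>\<^bsub>S\<^esub> snd q)) ` set_mset N \<subseteq> carrier R \<times> carrier S"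
      using N p by blast
    then show ?case using add by simp
  qed simp
qed

text \<open>Every rule of the congruence stays an instance of itself when multiplied by a pure
  tensor. Together with \<open>formal_mult_commute\<close> this makes the product of classes
  independent of representatives.\<close>

lemma formal_mult_respects_left:
  assumes "cring R" "cring S" "f \<in> carrier K \<rightarrow> carrier R" "g \<in> carrier K \<rightarrow> carrier S"
    and "tensor_eq K f R g S M M'" "set_mset N \<subseteq> carrier R \<times> carrier S"
  shows "tensor_eq K f R g S (formal_mult R S M N) (formal_mult R S M' N)"
  using assms(5)
proof induction
  interpret R: cring R by fact
  interpret S: cring S by fact
  have N: "fst q \<in> carrier R" "snd q \<in> carrier S" if "q \<in># N" for q
    using subsetD[OF assms(6) that] by (auto simp: mem_Times_iff)
  {
    case (refl M)
    then show ?case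
      by (intro tensor_eq.refl formal_mult_closed[OF R.ring_axioms S.ring_axioms _ assms(6)])
  next
    case (sym M M')
    from sym.IH show ?case by (rule tensor_eq.sym)
  next
    case (trans M M' M'')
    from trans.IH show ?case by (rule tensor_eq.trans)
  next
    case (add M M' P P')
    then show ?case by (simp add: formal_mult_union tensor_eq.add)
  next
    case (zero_left b)
    have "tensor_eq K f R g S (\<Sum>q\<in>#N. {#(\<zero>\<^bsub>R\<^esub> \<otimes>\<^bsub>R\<^esub> fst q, b \<otimes>\<^bsub>S\<^esub> snd q)#}) (\<Sum>q\<in>#N. {#})"
      by (rule tensor_eq_sum) (use N zero_left in \<open>auto intro!: tensor_eq.zero_left\<close>)
    then show ?case unfolding formal_mult_single by simp
  next
    case (zero_right a)
    have "tensor_eq K f R g S (\<Sum>q\<in>#N. {#(a \<otimes>\<^bsub>R\<^esub> fst q, \<zero>\<^bsub>S\<^esub> \<otimes>\<^bsub>S\<^esub> snd q)#}) (\<Sum>q\<in>#N. {#})"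
      by (rule tensor_eq_sum) (use N zero_right in \<open>auto intro!: tensor_eq.zero_right\<close>)
    then show ?case unfolding formal_mult_single by simp
  next
    case (add_left a a' b)
    have "tensor_eq K f R g S (\<Sum>q\<in>#N. {#((a \<oplus>\<^bsub>R\<^esub> a') \<otimes>\<^bsub>R\<^esub> fst q, b \<otimes>\<^bsub>S\<^esub> snd q)#})
        (\<Sum>q\<in>#N. {#(a \<otimes>\<^bsub>R\<^esub> fst q, b \<otimes>\<^bsub>S\<^esub> snd q), (a' \<otimes>\<^bsub>R\<^esub> fst q, b \<otimes>\<^bsub>S\<^esub> snd q)#})"
      by (rule tensor_eq_sum) (use N add_left in \<open>auto simp: R.l_distr intro!: tensor_eq.add_left\<close>)
    also have "(\<Sum>q\<in>#N. {#(a \<otimes>\<^bsub>R\<^esub> fst q, b \<otimes>\<^bsub>S\<^esub> snd q), (a' \<otimes>\<^bsub>R\<^esub> fst q, b \<otimes>\<^bsub>S\<^esub> snd q)#}) =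
        formal_mult R S {#(a, b), (a', b)#} N"
      by (induction N) auto
    finally show ?case unfolding formal_mult_single by simp
  next
    case (add_right a b b')
    have "tensor_eq K f R g S (\<Sum>q\<in>#N. {#(a \<otimes>\<^bsub>R\<^esub> fst q, (b \<oplus>\<^bsub>S\<^esub> b') \<otimes>\<^bsub>S\<^esub> snd q)#})
        (\<Sum>q\<in>#N. {#(a \<otimes>\<^bsub>R\<^esub> fst q, b \<otimes>\<^bsub>S\<^esub> snd q), (a \<otimes>\<^bsub>R\<^esub> fst q, b' \<otimes>\<^bsub>S\<^esub> snd q)#})"
      by (rule tensor_eq_sum) (use N add_right in \<open>auto simp: S.l_distr intro!: tensor_eq.add_right\<close>)
    also have "(\<Sum>q\<in>#N. {#(a \<otimes>\<^bsub>R\<^esub> fst q, b \<otimes>\<^bsub>S\<^esub> snd q), (a \<otimes>\<^bsub>R\<^esub> fst q, b' \<otimes>\<^bsub>S\<^esub> snd q)#}) =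
        formal_mult R S {#(a, b), (a, b')#} N"
      by (induction N) auto
    finally show ?case unfolding formal_mult_single by simp
  next
    case (balanced c a b)
    have fg: "f c \<in> carrier R" "g c \<in> carrier S" using assms(3,4) balanced by auto
    have "tensor_eq K f R g S {#((f c \<otimes>\<^bsub>R\<^esub> a) \<otimes>\<^bsub>R\<^esub> fst q, b \<otimes>\<^bsub>S\<^esub> snd q)#}
        {#(a \<otimes>\<^bsub>R\<^esub> fst q, (g c \<otimes>\<^bsub>S\<^esub> b) \<otimes>\<^bsub>S\<^esub> snd q)#}" if "q \<in># N" for q
      using tensor_eq.balanced[of c K "a \<otimes>\<^bsub>R\<^esub> fst q" R "b \<otimes>\<^bsub>S\<^esub> snd q" S f g] fg balanced N[OF that]
      by (simp add: R.m_assoc S.m_assoc)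
    then have "tensor_eq K f R g S (\<Sum>q\<in>#N. {#((f c \<otimes>\<^bsub>R\<^esub> a) \<otimes>\<^bsub>R\<^esub> fst q, b \<otimes>\<^bsub>S\<^esub> snd q)#})
        (\<Sum>q\<in>#N. {#(a \<otimes>\<^bsub>R\<^esub> fst q, (g c \<otimes>\<^bsub>S\<^esub> b) \<otimes>\<^bsub>S\<^esub> snd q)#})"
      by (rule tensor_eq_sum)
    then show ?case unfolding formal_mult_single by simp
  }
qed

lemma formal_mult_commute:
  assumes "cring R" "cring S" "set_mset M \<subseteq> carrier R \<times> carrier S" "set_mset N \<subseteq> carrier R \<times> carrier S"
  shows "formal_mult R S M N = formal_mult R S N M"
  using assms(3)
proof (induction M)
  case (add p M)
  interpret R: cring R by fact
  interpret S: cring S by fact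
  have "image_mset (\<lambda>q. (fst p \<otimes>\<^bsub>R\<^esub> fst q, snd p \<otimes>\<^bsub>S\<^esub> snd q)) N =
      image_mset (\<lambda>q. (fst q \<otimes>\<^bsub>R\<^esub> fst p, snd q \<otimes>\<^bsub>S\<^esub> snd p)) N"
  proof (rule image_mset_cong)
    fix q assume "q \<in># N"
    then have "q \<in> carrier R \<times> carrier S" "p \<in> carrier R \<times> carrier S" using add.prems assms(4) by auto
    then show "(fst p \<otimes>\<^bsub>R\<^esub> fst q, snd p \<otimes>\<^bsub>S\<^esub> snd q) = (fst q \<otimes>\<^bsub>R\<^esub> fst p, snd q \<otimes>\<^bsub>S\<^esub> snd p)"
      by (simp add: mem_Times_iff R.m_comm S.m_comm)
  qed
  then show ?case using add by (simp add: formal_mult_add_right)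
qed simp

locale tensor_setting =
  fixes K :: "('k, 'm) ring_scheme" and f :: "'k \<Rightarrow> 'r" and R :: "('r, 'n) ring_scheme"
    and g :: "'k \<Rightarrow> 's" and S :: "('s, 'p) ring_scheme"
  assumes R: "cring R" and S: "cring S"
    and f: "f \<in> carrier K \<rightarrow> carrier R" and g: "g \<in> carrier K \<rightarrow> carrier S"
begin

abbreviation cl where "cl \<equiv> tensor_class K f R g S"
abbreviation formal where "formal M \<equiv> set_mset M \<subseteq> carrier R \<times> carrier S"
abbreviation teq where "teq \<equiv> tensor_eq K f R g S"

lemma teq_formal: "teq M N \<Longrightarrow> formal M \<and> formal N"
proof (induction rule: tensor_eq.induct)
  case (balanced c a b)
  interpret R: cring R by (rule R)
  interpret S: cring S by (rule S)
  show ?case using balanced f g by (auto dest: funcset_mem)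
next
  case (zero_left b)
  interpret R: cring R by (rule R)
  show ?case using zero_left by simp
next
  case (zero_right b)
  interpret S: cring S by (rule S)
  show ?case using zero_right by simp
next
  case (add_left a a' b)
  interpret R: cring R by (rule R)
  show ?case using add_left by simp
next
  case (add_right a b b')
  interpret S: cring S by (rule S)
  show ?case using add_right by simp
qed auto

lemma cl_eq_iff: "formal M \<Longrightarrow> cl M = cl N \<longleftrightarrow> teq M N"
  by (rule tensor_class_eq_iff)

text \<open>The product in \<open>tensor\<close> is a union over all representatives; all of them
  give the same class, so one pair computes it.\<close>

lemma cl_mult:
  assumes "formal M" "formal N"
  shows "cl M \<otimes>\<^bsub>tensor K f R g S\<^esub> cl N = cl (formal_mult R S M N)"
proof -
  have rings: "ring R" "ring S" using R S by (auto simp: cring_def)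
  have "cl (formal_mult R S M' N') = cl (formal_mult R S M N)" if "M' \<in> cl M" "N' \<in> cl N" for M' N'
  proof -
    have t: "teq M M'" "teq N N'" using that by (auto simp: tensor_class_def)
    have o: "formal M'" "formal N'" using teq_formal t by auto
    have "teq (formal_mult R S M N) (formal_mult R S M' N)"
      by (rule formal_mult_respects_left[OF R S f g t(1) assms(2)])
    moreover have "teq (formal_mult R S N M') (formal_mult R S N' M')"
      by (rule formal_mult_respects_left[OF R S f g t(2) o(1)])
    ultimately have "teq (formal_mult R S M N) (formal_mult R S M' N')"
      using tensor_eq.trans formal_mult_commute[OF R S o(1) assms(2)] formal_mult_commute[OF R S o(1,2)]
      by metis
    then show ?thesis using cl_eq_iff[OF formal_mult_closed[OF rings assms]] by metis
  qed
  then have "(\<Union>M'\<in>cl M. \<Union>N'\<in>cl N. cl (formal_mult R S M' N')) = (\<Union>M'\<in>cl M. \<Union>N'\<in>cl N. cl (formal_mult R S M N))"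
    by (intro SUP_cong HOL.refl)
  also have "\<dots> = cl (formal_mult R S M N)"
  proof -
    have "M \<in> cl M" "N \<in> cl N" using assms by (auto simp: tensor_class_def intro: tensor_eq.refl)
    then have "cl M \<noteq> {}" "cl N \<noteq> {}" by auto
    then show ?thesis by simp
  qed
  finally show ?thesis by (simp add: tensor_def)
qed

lemma cl_add:
  assumes "formal M" "formal N"
  shows "cl M \<oplus>\<^bsub>tensor K f R g S\<^esub> cl N = cl (M + N)"
proof -
  have "cl (M' + N') = cl (M + N)" if "M' \<in> cl M" "N' \<in> cl N" for M' N'
  proof -
    have "teq (M + N) (M' + N')" using that by (auto simp: tensor_class_def intro: tensor_eq.add)
    moreover have "formal (M + N)" using assms by simp
    ultimately show ?thesis using cl_eq_iff by metis
  qed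
  then have "(\<Union>M'\<in>cl M. \<Union>N'\<in>cl N. cl (M' + N')) = (\<Union>M'\<in>cl M. \<Union>N'\<in>cl N. cl (M + N))"
    by (intro SUP_cong HOL.refl)
  also have "\<dots> = cl (M + N)"
  proof -
    have "M \<in> cl M" "N \<in> cl N" using assms by (auto simp: tensor_class_def intro: tensor_eq.refl)
    then have "cl M \<noteq> {}" "cl N \<noteq> {}" by auto
    then show ?thesis by simp
  qed
  finally show ?thesis by (simp add: tensor_def)
qed

lemma tensor_simps:
  "carrier (tensor K f R g S) = cl ` {M. formal M}"
  "\<one>\<^bsub>tensor K f R g S\<^esub> = cl {#(\<one>\<^bsub>R\<^esub>, \<one>\<^bsub>S\<^esub>)#}" "\<zero>\<^bsub>tensor K f R g S\<^esub> = cl {#}"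
  by (simp_all add: tensor_def)

end

lemma set_map2_subset:
  assumes "set xs \<subseteq> A" "set ys \<subseteq> A" "\<And>x y. x \<in> A \<Longrightarrow> y \<in> A \<Longrightarrow> h x y \<in> A"
  shows "set (map2 h xs ys) \<subseteq> A"
proof
  fix z assume "z \<in> set (map2 h xs ys)"
  then obtain x y where "(x, y) \<in> set (zip xs ys)" "z = h x y" by auto
  then show "z \<in> A" using assms set_zip_leftD[of x y xs ys] set_zip_rightD[of x y xs ys] by auto
qed

section \<open>Coordinates in a tensor product with a finite extension\<close>

context field
begin

lemma combine_unit:
  assumes "set us \<subseteq> carrier R" "i < length us"
  shows "combine (map (\<lambda>k. if k = i then \<one> else \<zero>) [0..<length us]) us = us ! i"
proof -
  let ?n = "length us - Suc i"
  have "map (\<lambda>k. if k = i then \<one> else \<zero>) [0..<length us] = replicate i \<zero> @ \<one> # replicate ?n \<zero>"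
    using assms(2) by (intro nth_equalityI) (auto simp: nth_append nth_Cons')
  then have "combine (map (\<lambda>k. if k = i then \<one> else \<zero>) [0..<length us]) us =
      combine (\<one> # replicate ?n \<zero>) (drop i us)"
    using combine_prepend_replicate[of "\<one> # replicate ?n \<zero>" us i] assms(1)
    by (simp add: set_replicate_conv_if)
  also have "drop i us = us ! i # drop (Suc i) us" using assms(2) by (rule Cons_nth_drop_Suc[symmetric])
  also have "combine (\<one> # replicate ?n \<zero>) \<dots> = \<one> \<otimes> us ! i \<oplus> \<zero>"
    using combine_replicate[of "drop (Suc i) us"] assms(1) set_drop_subset[of "Suc i" us] by auto
  also have "\<dots> = us ! i" using subsetD[OF assms(1) nth_mem[OF assms(2)]] by simp
  finally show ?thesis .
qed

text \<open>Extend \<open>us\<close> to a basis of \<open>T\<close> and take the coordinate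
  belonging to \<open>us ! j\<close>.\<close>

lemma dual_functional:
  assumes "finite_ext K T" "independent K us" "set us \<subseteq> T" "j < length us"
  obtains l where "\<And>a. a \<in> T \<Longrightarrow> l a \<in> K" "\<And>a b. a \<in> T \<Longrightarrow> b \<in> T \<Longrightarrow> l (a \<oplus> b) = l a \<oplus> l b"
    "\<And>c a. c \<in> K \<Longrightarrow> a \<in> T \<Longrightarrow> l (c \<otimes> a) = c \<otimes> l a"
    "\<And>i. i < length us \<Longrightarrow> l (us ! i) = (if i = j then \<one> else \<zero>)"
proof -
  note KT = finite_extD[OF assms(1)] and Kr = subringE[OF subfieldE(1)[OF finite_extD(1)[OF assms(1)]]]
  have "dimension (dim K T) K T" using finite_dimensionE[OF KT(1,4)] by (simp add: over_def)
  then obtain Vs where Vs: "independent K (Vs @ us)" "Span K (Vs @ us) = T"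
    using complete_base[OF KT(1) _ assms(2,3)] by blast
  define ws where "ws = Vs @ us"
  have wsR: "set ws \<subseteq> carrier R" using independent_in_carrier[OF Vs(1)] by (simp add: ws_def)
  note uniq = unique_decomposition[OF KT(1) Vs(1), folded ws_def, unfolded Vs(2)[folded ws_def]]
  define co where "co a = (THE Ks. set Ks \<subseteq> K \<and> length Ks = length ws \<and> a = combine Ks ws)" for a
  have co: "set (co a) \<subseteq> K" "length (co a) = length ws" "a = combine (co a) ws" if "a \<in> T" for a
    using theI'[OF uniq[OF that]] by (simp_all add: co_def)
  have coI: "co a = Ks" if "a \<in> T" "set Ks \<subseteq> K" "length Ks = length ws" "a = combine Ks ws" for a Ks
    unfolding co_def by (rule the1_equality[OF uniq[OF that(1)]]) (use that in simp)
  \<comment> \<open>The completing vectors \<open>Vs\<close> stand in front of \<open>us\<close> in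
    the basis, hence the shift.\<close>
  define m where "m = length Vs + j"
  have m: "m < length ws" using assms(4) by (simp add: m_def ws_def)
  note TT = subringE[OF subfieldE(1)[OF KT(2)]]
  show ?thesis
  proof (rule that[of "\<lambda>a. co a ! m"])
    show "co a ! m \<in> K" if "a \<in> T" for a using co(1,2)[OF that] m nth_mem by fastforce
    show "co (a \<oplus> b) ! m = co a ! m \<oplus> co b ! m" if a: "a \<in> T" and b: "b \<in> T" for a b
    proof -
      have R: "set (co a) \<subseteq> carrier R" "set (co b) \<subseteq> carrier R" using co(1) a b KT(6) by auto
      have "co (a \<oplus> b) = map2 (\<oplus>) (co a) (co b)"
      proof (rule coI)
        show "a \<oplus> b \<in> T" using TT(7) a b by simp
        show "set (map2 (\<oplus>) (co a) (co b)) \<subseteq> K"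
          using co(1)[OF a] co(1)[OF b] Kr(7) by (rule set_map2_subset)
        show "length (map2 (\<oplus>) (co a) (co b)) = length ws" using co(2) a b by simp
        show "a \<oplus> b = combine (map2 (\<oplus>) (co a) (co b)) ws"
          using combine_add[of "co a" ws "co b"] co(2,3) a b R wsR by simp
      qed
      then show ?thesis using co(2)[OF a] co(2)[OF b] m by simp
    qed
    show "co (c \<otimes> a) ! m = c \<otimes> co a ! m" if c: "c \<in> K" and a: "a \<in> T" for c a
    proof -
      have R: "set (co a) \<subseteq> carrier R" using co(1)[OF a] KT(6) by auto
      have "co (c \<otimes> a) = map ((\<otimes>) c) (co a)"
      proof (rule coI)
        show "c \<otimes> a \<in> T" using TT(6) c a KT(3) by auto
        show "set (map ((\<otimes>) c) (co a)) \<subseteq> K" using co(1)[OF a] c Kr(6) by auto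
        show "length (map ((\<otimes>) c) (co a)) = length ws" using co(2)[OF a] by simp
        have "combine (map ((\<otimes>) c) (co a)) ws = c \<otimes> combine (co a) ws"
          using combine_r_distr[OF R wsR] c KT(6) by auto
        then show "c \<otimes> a = combine (map ((\<otimes>) c) (co a)) ws" using co(3)[OF a] by simp
      qed
      then show ?thesis using co(2)[OF a] m by simp
    qed
    show "co (us ! i) ! m = (if i = j then \<one> else \<zero>)" if i: "i < length us" for i
    proof -
      let ?i = "length Vs + i"
      have wi: "ws ! ?i = us ! i" "?i < length ws" using i by (simp_all add: ws_def)
      have "co (us ! i) = map (\<lambda>k. if k = ?i then \<one> else \<zero>) [0..<length ws]"
      proof (rule coI)
        show "us ! i \<in> T" using assms(3) i by auto
        show "set (map (\<lambda>k. if k = ?i then \<one> else \<zero>) [0..<length ws]) \<subseteq> K" using Kr(2,3) by auto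
        show "us ! i = combine (map (\<lambda>k. if k = ?i then \<one> else \<zero>) [0..<length ws]) ws"
          using combine_unit[OF wsR wi(2)] wi(1) by simp
      qed simp
      then show ?thesis using m by (simp add: m_def)
    qed
  qed
qed

text \<open>The functional dual to \<open>us ! j\<close>, tensored with the identity of
  \<open>S\<close>, sends the tensor to its coefficient number \<open>j\<close>.\<close>

lemma tensor_coeffs_unique:
  assumes "finite_ext K T" "independent K us" "set us \<subseteq> T"
    and "cring S" "g \<in> ring_hom (R\<lparr>carrier := K\<rparr>) S"
    and "length ss = length us" "set ss \<subseteq> carrier S" "length ss' = length us" "set ss' \<subseteq> carrier S"
    and eq: "tensor_eq (R\<lparr>carrier := K\<rparr>) id (R\<lparr>carrier := T\<rparr>) g S (mset (zip us ss)) (mset (zip us ss'))"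
  shows "ss = ss'"
proof (rule nth_equalityI)
  interpret S: cring S by fact
  show "length ss = length ss'" using assms(6,8) by simp
  note KT = finite_extD[OF assms(1)] and TT = subringE[OF subfieldE(1)[OF finite_extD(2)[OF assms(1)]]]
  note Kr = subringE[OF subfieldE(1)[OF finite_extD(1)[OF assms(1)]]]
  interpret Kf: field "R\<lparr>carrier := K\<rparr>" by (rule subfield_iff(2)[OF KT(1)])
  interpret g: ring_hom_ring "R\<lparr>carrier := K\<rparr>" S g
    by (rule ring_hom_ringI2[OF Kf.ring_axioms S.ring_axioms assms(5)])
  have g0: "g \<zero> = \<zero>\<^bsub>S\<^esub>" and g1: "g \<one> = \<one>\<^bsub>S\<^esub>" using g.hom_zero g.hom_one by simp_all
  fix j assume "j < length ss"
  then have j: "j < length us" using assms(6) by simp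
  obtain l where l: "\<And>a. a \<in> T \<Longrightarrow> l a \<in> K" "\<And>a b. a \<in> T \<Longrightarrow> b \<in> T \<Longrightarrow> l (a \<oplus> b) = l a \<oplus> l b"
    "\<And>c a. c \<in> K \<Longrightarrow> a \<in> T \<Longrightarrow> l (c \<otimes> a) = c \<otimes> l a"
    "\<And>i. i < length us \<Longrightarrow> l (us ! i) = (if i = j then \<one> else \<zero>)"
    using dual_functional[OF assms(1-3) j] by blast
  define \<beta> where "\<beta> p = (if fst p \<in> T \<and> snd p \<in> carrier S then g (l (fst p)) \<otimes>\<^bsub>S\<^esub> snd p else \<zero>\<^bsub>S\<^esub>)" for p
  have gl: "g (l a) \<in> carrier S" if "a \<in> T" for a using l(1)[OF that] g.hom_closed by simp
  have \<beta>: "\<beta> p \<in> carrier S" for p using gl by (simp add: \<beta>_def)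
  have l0: "l \<zero> = \<zero>" using l(3)[of \<zero> \<zero>] l(1)[of \<zero>] Kr(2) TT(2) KT(6) by auto
  have eqs: "tsum S \<beta> (mset (zip us ss)) = tsum S \<beta> (mset (zip us ss'))"
  proof (rule tensor_eq_tsum[OF S.ring_axioms eq \<beta>])
    fix a a' b assume h: "a \<in> carrier (R\<lparr>carrier := T\<rparr>)" "a' \<in> carrier (R\<lparr>carrier := T\<rparr>)" "b \<in> carrier S"
    then have "g (l (a \<oplus> a')) = g (l a) \<oplus>\<^bsub>S\<^esub> g (l a')"
      using l(1)[of a] l(1)[of a'] l(2)[of a a'] g.hom_add[of "l a" "l a'"] by simp
    then show "\<beta> (a \<oplus>\<^bsub>R\<lparr>carrier := T\<rparr>\<^esub> a', b) = \<beta> (a, b) \<oplus>\<^bsub>S\<^esub> \<beta> (a', b)"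
      using h gl TT(7) by (simp add: \<beta>_def S.l_distr)
  next
    fix c a b assume h: "c \<in> carrier (R\<lparr>carrier := K\<rparr>)" "a \<in> carrier (R\<lparr>carrier := T\<rparr>)" "b \<in> carrier S"
    then have "g (l (c \<otimes> a)) = g c \<otimes>\<^bsub>S\<^esub> g (l a)"
      using l(1)[of a] l(3)[of c a] g.hom_mult[of c "l a"] by simp
    moreover have "c \<otimes> a \<in> T" using h TT(6) KT(3) by auto
    moreover have "g c \<in> carrier S" using h g.hom_closed by simp
    ultimately show "\<beta> (id c \<otimes>\<^bsub>R\<lparr>carrier := T\<rparr>\<^esub> a, b) = \<beta> (a, g c \<otimes>\<^bsub>S\<^esub> b)"
      using h gl by (simp add: \<beta>_def S.m_assoc S.m_lcomm)
  qed (use gl TT(2) l0 g0 in \<open>auto simp: \<beta>_def S.r_distr\<close>)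
  have val: "tsum S \<beta> (mset (zip us ts)) = ts ! j" if ts: "length ts = length us" "set ts \<subseteq> carrier S" for ts
  proof -
    have jt: "j < length ts" using j ts by simp
    have tj: "ts ! j \<in> carrier S" using ts(2) jt nth_mem by blast
    have uj: "us ! j \<in> T" using assms(3) j nth_mem by blast
    have "zip us ts = zip (take j us @ us ! j # drop (Suc j) us) (take j ts @ ts ! j # drop (Suc j) ts)"
      using id_take_nth_drop[OF j] id_take_nth_drop[OF jt] by simp
    also have "\<dots> = zip (take j us) (take j ts) @ (us ! j, ts ! j) # zip (drop (Suc j) us) (drop (Suc j) ts)"
      using ts(1) by simp
    finally have "mset (zip us ts) = add_mset (us ! j, ts ! j)
        (mset (zip (take j us) (take j ts)) + mset (zip (drop (Suc j) us) (drop (Suc j) ts)))"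
      by simp
    moreover have "\<beta> p = \<zero>\<^bsub>S\<^esub>"
      if "p \<in># mset (zip (take j us) (take j ts)) + mset (zip (drop (Suc j) us) (drop (Suc j) ts))" for p
    proof -
      have "p \<in> set (zip (take j us) (take j ts)) \<union> set (zip (drop (Suc j) us) (drop (Suc j) ts))"
        using that by auto
      then have "fst p \<in> set (take j us) \<union> set (drop (Suc j) us)"
        by (cases p) (auto dest: set_zip_leftD)
      then obtain i where "i < length us" "i \<noteq> j" "us ! i = fst p"
      proof (elim UnE)
        assume "fst p \<in> set (take j us)"
        then obtain i where "i < length (take j us)" "take j us ! i = fst p"
          unfolding in_set_conv_nth by blast
        then show thesis using j by (intro that[of i]) auto
      next
        assume "fst p \<in> set (drop (Suc j) us)"
        then obtain i where "i < length (drop (Suc j) us)" "drop (Suc j) us ! i = fst p"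
          unfolding in_set_conv_nth by blast
        then show thesis using j by (intro that[of "Suc j + i"]) auto
      qed
      then have "l (fst p) = \<zero>" using l(4)[of i] by simp
      then show ?thesis using g0 by (simp add: \<beta>_def)
    qed
    ultimately have "tsum S \<beta> (mset (zip us ts)) = \<beta> (us ! j, ts ! j) \<oplus>\<^bsub>S\<^esub> \<zero>\<^bsub>S\<^esub>"
      using S.tsum_add_mset[where \<beta> = \<beta>, OF \<beta>] S.tsum_zero[where \<beta> = \<beta>, OF \<beta>] by presburger
    also have "\<dots> = ts ! j" using l(4)[OF j] g1 tj uj by (simp add: \<beta>_def)
    finally show ?thesis .
  qed
  show "ss ! j = ss' ! j" using eqs val[OF assms(6,7)] val[OF assms(8,9)] by simp
qed

lemma tensor_zip_add:
  assumes "cring S" "set us \<subseteq> T" "length ss = length us" "length ss' = length us"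
    and "set ss \<subseteq> carrier S" "set ss' \<subseteq> carrier S"
  shows "tensor_eq KK f (R\<lparr>carrier := T\<rparr>) g S (mset (zip us ss) + mset (zip us ss'))
    (mset (zip us (map2 (\<oplus>\<^bsub>S\<^esub>) ss ss')))"
  using assms(3) assms(4)[symmetric] assms(2,5,6)
proof (induction ss us ss' rule: list_induct3)
  case Nil
  then show ?case by (simp add: tensor_eq.refl)
next
  case (Cons s ss u us s' ss')
  have "tensor_eq KK f (R\<lparr>carrier := T\<rparr>) g S {#(u, s), (u, s')#} {#(u, s \<oplus>\<^bsub>S\<^esub> s')#}"
    using Cons.prems by (intro tensor_eq.sym[OF tensor_eq.add_right]) auto
  from tensor_eq.add[OF this Cons.IH] Cons.prems show ?case by (simp add: ac_simps)
qed

lemma tensor_zip_zero: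
  assumes "set us \<subseteq> T"
  shows "tensor_eq KK f (R\<lparr>carrier := T\<rparr>) g S (mset (zip us (replicate (length us) \<zero>\<^bsub>S\<^esub>))) {#}"
  using assms
proof (induction us)
  case Nil
  then show ?case by (simp add: tensor_eq.refl)
next
  case (Cons u us)
  have "tensor_eq KK f (R\<lparr>carrier := T\<rparr>) g S {#(u, \<zero>\<^bsub>S\<^esub>)#} {#}"
    using Cons.prems by (intro tensor_eq.zero_right) auto
  from tensor_eq.add[OF this Cons.IH] Cons.prems show ?case by simp
qed

lemma tensor_combine:
  assumes "subfield K R" "subfield T R" "K \<subseteq> T" "cring S" "g \<in> ring_hom (R\<lparr>carrier := K\<rparr>) S"
    and "length ks = length us" "set ks \<subseteq> K" "set us \<subseteq> T" "s \<in> carrier S"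
  shows "combine ks us \<in> T \<and> tensor_eq (R\<lparr>carrier := K\<rparr>) id (R\<lparr>carrier := T\<rparr>) g S {#(combine ks us, s)#}
    (mset (zip us (map (\<lambda>k. g k \<otimes>\<^bsub>S\<^esub> s) ks)))"
  using assms(6-8)
proof (induction ks us rule: list_induct2)
  case Nil
  then show ?case
    using subringE(2)[OF subfieldE(1)[OF assms(2)]] tensor_eq.zero_left[of s S _ _ "R\<lparr>carrier := T\<rparr>"] assms(9) by simp
next
  case (Cons k ks u us)
  interpret S: cring S by fact
  note TT = subringE[OF subfieldE(1)[OF assms(2)]]
  have prems: "set ks \<subseteq> K" "set us \<subseteq> T" using Cons.prems by auto
  note IH = conjunct1[OF Cons.IH[OF prems]] conjunct2[OF Cons.IH[OF prems]]
  have ku: "k \<in> K" "u \<in> T" "k \<otimes> u \<in> T" using Cons.prems assms(3) TT(6) by auto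
  have "tensor_eq (R\<lparr>carrier := K\<rparr>) id (R\<lparr>carrier := T\<rparr>) g S {#(k \<otimes> u \<oplus> combine ks us, s)#}
      {#(k \<otimes> u, s), (combine ks us, s)#}"
    using tensor_eq.add_left[of "k \<otimes> u" "R\<lparr>carrier := T\<rparr>" "combine ks us" s S] ku IH assms(9) by simp
  also have "{#(k \<otimes> u, s), (combine ks us, s)#} = {#(k \<otimes> u, s)#} + {#(combine ks us, s)#}" by simp
  finally have 1: "tensor_eq (R\<lparr>carrier := K\<rparr>) id (R\<lparr>carrier := T\<rparr>) g S {#(k \<otimes> u \<oplus> combine ks us, s)#}
      ({#(k \<otimes> u, s)#} + {#(combine ks us, s)#})" .
  have "tensor_eq (R\<lparr>carrier := K\<rparr>) id (R\<lparr>carrier := T\<rparr>) g S {#(k \<otimes> u, s)#} {#(u, g k \<otimes>\<^bsub>S\<^esub> s)#}"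
    using tensor_eq.balanced[of k "R\<lparr>carrier := K\<rparr>" u "R\<lparr>carrier := T\<rparr>" s S id g] ku assms(9) by simp
  from tensor_eq.trans[OF 1 tensor_eq.add[OF this IH(2)]] show ?case
    using ku IH(1) TT(7) by simp
qed

text \<open>Expand each left factor in \<open>us\<close> and move the scalars across the tensor sign
  by balancing; the resulting sums are added coefficientwise.\<close>

lemma tensor_span:
  assumes "subfield K R" "subfield T R" "K \<subseteq> T" "cring S" "g \<in> ring_hom (R\<lparr>carrier := K\<rparr>) S"
    and "set us \<subseteq> carrier R" "Span K us = T" "set_mset M \<subseteq> T \<times> carrier S"
  shows "\<exists>ss. length ss = length us \<and> set ss \<subseteq> carrier S \<and>
    tensor_eq (R\<lparr>carrier := K\<rparr>) id (R\<lparr>carrier := T\<rparr>) g S M (mset (zip us ss))"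
  using assms(8)
proof (induction M)
  interpret S: cring S by fact
  have usT: "set us \<subseteq> T" using Span_base_incl[OF assms(1,6)] assms(7) by simp
  {
    case empty
    then show ?case
      using tensor_eq.sym[OF tensor_zip_zero[OF usT]]
      by (intro exI[of _ "replicate (length us) \<zero>\<^bsub>S\<^esub>"]) (auto simp: set_replicate_conv_if)
  next
    case (add p M)
    obtain a s where p: "p = (a, s)" by (cases p)
    have as: "a \<in> T" "s \<in> carrier S" using add.prems p by auto
    obtain ks where ks: "set ks \<subseteq> K" "length ks = length us" "a = combine ks us"
      using Span_mem_iff_length_version[OF assms(1,6)] as(1) assms(7) by blast
    obtain ss where ss: "length ss = length us" "set ss \<subseteq> carrier S"
      "tensor_eq (R\<lparr>carrier := K\<rparr>) id (R\<lparr>carrier := T\<rparr>) g S M (mset (zip us ss))"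
    proof -
      have "set_mset M \<subseteq> T \<times> carrier S" using add.prems by auto
      then show ?thesis using add.IH that by blast
    qed
    define ts where "ts = map (\<lambda>k. g k \<otimes>\<^bsub>S\<^esub> s) ks"
    have gk: "g k \<in> carrier S" if "k \<in> K" for k using assms(5) that by (auto simp: ring_hom_def)
    have ts: "length ts = length us" "set ts \<subseteq> carrier S" using ks as gk by (auto simp: ts_def)
    have "tensor_eq (R\<lparr>carrier := K\<rparr>) id (R\<lparr>carrier := T\<rparr>) g S {#p#} (mset (zip us ts))"
      using tensor_combine[OF assms(1-5) ks(2,1) usT as(2)] ks(3) p by (simp add: ts_def)
    from tensor_eq.trans[OF tensor_eq.add[OF this ss(3)] tensor_zip_add[OF assms(4) usT ts(1) ss(1) ts(2) ss(2)]]
    have eq: "tensor_eq (R\<lparr>carrier := K\<rparr>) id (R\<lparr>carrier := T\<rparr>) g S (add_mset p M) (mset (zip us (map2 (\<oplus>\<^bsub>S\<^esub>) ts ss)))"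
      by simp
    have cl: "set (map2 (\<oplus>\<^bsub>S\<^esub>) ts ss) \<subseteq> carrier S"
      using ts(2) ss(2) by (rule set_map2_subset) simp
    have len: "length (map2 (\<oplus>\<^bsub>S\<^esub>) ts ss) = length us" using ts(1) ss(1) by simp
    show ?case by (intro exI conjI) (rule len, rule cl, rule eq)
  }
qed

end

section \<open>Etale algebras inside a field\<close>

lemma RDirProd_replicate:
  assumes "ring C"
  defines "P \<equiv> \<lambda>n. RDirProd_list (replicate n C)"
  shows "carrier (P n) = {xs. length xs = n \<and> set xs \<subseteq> carrier C}"
    and "xs \<in> carrier (P n) \<Longrightarrow> ys \<in> carrier (P n) \<Longrightarrow> xs \<otimes>\<^bsub>P n\<^esub> ys = map2 (\<otimes>\<^bsub>C\<^esub>) xs ys"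
    and "xs \<in> carrier (P n) \<Longrightarrow> ys \<in> carrier (P n) \<Longrightarrow> xs \<oplus>\<^bsub>P n\<^esub> ys = map2 (\<oplus>\<^bsub>C\<^esub>) xs ys"
    and "\<one>\<^bsub>P n\<^esub> = replicate n \<one>\<^bsub>C\<^esub>" and "\<zero>\<^bsub>P n\<^esub> = replicate n \<zero>\<^bsub>C\<^esub>"
proof -
  have carr: "carrier (P n) = {xs. length xs = n \<and> set xs \<subseteq> carrier C}" for n
  proof (intro equalityI subsetI)
    fix xs assume "xs \<in> carrier (P n)"
    then show "xs \<in> {xs. length xs = n \<and> set xs \<subseteq> carrier C}"
      using RDirProd_list_carrier_mem[of xs "replicate n C"] by (auto simp: P_def in_set_conv_nth)
  next
    fix xs assume "xs \<in> {xs. length xs = n \<and> set xs \<subseteq> carrier C}"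
    then show "xs \<in> carrier (P n)"
      unfolding P_def by (intro RDirProd_list_carrier_memI) auto
  qed
  then show "carrier (P n) = {xs. length xs = n \<and> set xs \<subseteq> carrier C}" .
  have iso: "(\<lambda>(a, as). a # as) \<in> ring_hom (RDirProd C (P n)) (P (Suc n))" for n
    using RDirProd_list_iso1[of C "replicate n C"] by (simp add: P_def ring_iso_def)
  show "xs \<otimes>\<^bsub>P n\<^esub> ys = map2 (\<otimes>\<^bsub>C\<^esub>) xs ys" if "xs \<in> carrier (P n)" "ys \<in> carrier (P n)" for xs ys
    using that
  proof (induction n arbitrary: xs ys)
    case 0
    then show ?case using carr[of 0] by (simp add: P_def monoid.defs)
  next
    case (Suc n)
    then obtain a as b bs where eq: "xs = a # as" "ys = b # bs" and
      mem: "a \<in> carrier C" "b \<in> carrier C" "as \<in> carrier (P n)" "bs \<in> carrier (P n)"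
      using carr[of "Suc n"] carr[of n] by (auto simp: length_Suc_conv)
    have "xs \<otimes>\<^bsub>P (Suc n)\<^esub> ys = (a \<otimes>\<^bsub>C\<^esub> b) # (as \<otimes>\<^bsub>P n\<^esub> bs)"
      using ring_hom_mult[OF iso, of "(a, as)" n "(b, bs)"] mem
      by (simp add: eq RDirProd_def DirProd_def monoid.defs)
    then show ?case using Suc.IH[OF mem(3,4)] by (simp add: eq)
  qed
  show "xs \<oplus>\<^bsub>P n\<^esub> ys = map2 (\<oplus>\<^bsub>C\<^esub>) xs ys" if "xs \<in> carrier (P n)" "ys \<in> carrier (P n)" for xs ys
    using that
  proof (induction n arbitrary: xs ys)
    case 0
    then show ?case using carr[of 0] by (simp add: P_def monoid.defs)
  next
    case (Suc n)
    then obtain a as b bs where eq: "xs = a # as" "ys = b # bs" and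
      mem: "a \<in> carrier C" "b \<in> carrier C" "as \<in> carrier (P n)" "bs \<in> carrier (P n)"
      using carr[of "Suc n"] carr[of n] by (auto simp: length_Suc_conv)
    have "xs \<oplus>\<^bsub>P (Suc n)\<^esub> ys = (a \<oplus>\<^bsub>C\<^esub> b) # (as \<oplus>\<^bsub>P n\<^esub> bs)"
      using ring_hom_add[OF iso, of "(a, as)" n "(b, bs)"] mem
      by (simp add: eq RDirProd_def DirProd_def monoid.defs)
    then show ?case using Suc.IH[OF mem(3,4)] by (simp add: eq)
  qed
  show "\<one>\<^bsub>P n\<^esub> = replicate n \<one>\<^bsub>C\<^esub>" unfolding P_def RDirProd_list_one by (induction n) auto
  show "\<zero>\<^bsub>P n\<^esub> = replicate n \<zero>\<^bsub>C\<^esub>" unfolding P_def RDirProd_list_zero by (induction n) auto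
qed

section \<open>Linear dependence and polynomial interpolation\<close>

context field
begin

lemma combine_zero_right:
  assumes "set ks \<subseteq> carrier R" "\<And>u. u \<in> set us \<Longrightarrow> u = \<zero>"
  shows "combine ks us = \<zero>"
  using assms
proof (induction us arbitrary: ks)
  case Nil
  then show ?case by (cases ks) auto
next
  case (Cons u us)
  show ?case
  proof (cases ks)
    case Nil
    then show ?thesis by simp
  next
    case ks: (Cons a as)
    have "combine as us = \<zero>" by (rule Cons.IH) (use Cons.prems ks in auto)
    moreover have "a \<in> carrier R" "a \<otimes> u = \<zero>" using Cons.prems(1) Cons.prems(2)[of u] ks by simp_all
    ultimately show ?thesis using ks by simp
  qed
qed

lemma combine_map_minus:
  assumes "length cs = length zs" "set cs \<subseteq> carrier R" "c \<in> carrier R"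
    and "\<And>z. z \<in> set zs \<Longrightarrow> f z \<in> carrier R" "\<And>z. z \<in> set zs \<Longrightarrow> r z \<in> carrier R"
  shows "combine cs (map (\<lambda>z. f z \<ominus> r z \<otimes> c) zs) = combine cs (map f zs) \<ominus> combine cs (map r zs) \<otimes> c"
  using assms(1,2,4,5)
proof (induction cs zs rule: list_induct2)
  case Nil
  then show ?case using assms(3) by (simp add: minus_eq)
next
  case (Cons k cs z zs)
  have "combine cs (map f zs) \<in> carrier R" "combine cs (map r zs) \<in> carrier R"
    using Cons.prems by (auto intro!: combine_in_carrier)
  then show ?case using Cons assms(3) by simp algebra
qed

text \<open>Gaussian elimination on the last coordinate: if some vector \<open>p\<close> is nonzero
  there, subtracting multiples of \<open>p\<close> makes that coordinate vanish in all other
  vectors, and induction applies to these.\<close>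

lemma dependent_vectors:
  assumes "n < length vs" "\<And>v i. v \<in> set vs \<Longrightarrow> i < n \<Longrightarrow> v i \<in> carrier R"
  shows "\<exists>cs. length cs = length vs \<and> set cs \<subseteq> carrier R \<and> (\<exists>c\<in>set cs. c \<noteq> \<zero>) \<and>
    (\<forall>i<n. combine cs (map (\<lambda>v. v i) vs) = \<zero>)"
  using assms
proof (induction n arbitrary: vs)
  case 0
  then show ?case by (intro exI[of _ "replicate (length vs) \<one>"]) auto
next
  case (Suc n)
  show ?case
  proof (cases "\<forall>v\<in>set vs. v n = \<zero>")
    case True
    obtain cs where cs: "length cs = length vs" "set cs \<subseteq> carrier R" "\<exists>c\<in>set cs. c \<noteq> \<zero>"
      "\<forall>i<n. combine cs (map (\<lambda>v. v i) vs) = \<zero>" using Suc.IH[of vs] Suc.prems by auto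
    have "combine cs (map (\<lambda>v. v n) vs) = \<zero>"
      by (rule combine_zero_right[OF cs(2)]) (use True in auto)
    then show ?thesis using cs by (intro exI[of _ cs]) (auto simp: less_Suc_eq)
  next
    case False
    then obtain p where p: "p \<in> set vs" "p n \<noteq> \<zero>" by blast
    then obtain xs ys where vs: "vs = xs @ p # ys" by (metis split_list)
    have pR: "p i \<in> carrier R" if "i < Suc n" for i using Suc.prems(2)[OF p(1) that] .
    have ip: "inv (p n) \<in> carrier R" "inv (p n) \<otimes> p n = \<one>" using pR[of n] p(2) by (auto simp: field_Units)
    define r where "r v = v n \<otimes> inv (p n)" for v :: "nat \<Rightarrow> 'a"
    define zs where "zs = xs @ ys"
    have zR: "v i \<in> carrier R" if "v \<in> set zs" "i < Suc n" for v i
      using Suc.prems(2)[of v i] that by (auto simp: zs_def vs)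
    have rR: "r v \<in> carrier R" if "v \<in> set zs" for v using zR[OF that] ip by (simp add: r_def)
    have "\<exists>cs. length cs = length (map (\<lambda>v i. v i \<ominus> r v \<otimes> p i) zs) \<and> set cs \<subseteq> carrier R \<and> (\<exists>c\<in>set cs. c \<noteq> \<zero>) \<and>
      (\<forall>i<n. combine cs (map (\<lambda>v. v i) (map (\<lambda>v i. v i \<ominus> r v \<otimes> p i) zs)) = \<zero>)"
    proof (rule Suc.IH)
      show "n < length (map (\<lambda>v i. v i \<ominus> r v \<otimes> p i) zs)" using Suc.prems(1) by (simp add: zs_def vs)
      fix v i assume "v \<in> set (map (\<lambda>v i. v i \<ominus> r v \<otimes> p i) zs)" "i < n"
      then show "v i \<in> carrier R" using zR rR pR by auto
    qed
    then obtain cs where cs: "length cs = length zs" "set cs \<subseteq> carrier R" "\<exists>c\<in>set cs. c \<noteq> \<zero>"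
      "\<forall>i<n. combine cs (map (\<lambda>v. v i \<ominus> r v \<otimes> p i) zs) = \<zero>" by (auto simp: comp_def)
    \<comment> \<open>\<open>a\<close> collects the multiples of \<open>p\<close> that were
      subtracted, so \<open>p\<close> enters the final relation with coefficient
      \<open>\<ominus> a\<close>.\<close>
    define a where "a = combine cs (map r zs)"
    have aR: "a \<in> carrier R" unfolding a_def using cs(2) rR by (auto intro!: combine_in_carrier)
    have w0: "combine cs (map (\<lambda>v. v i \<ominus> r v \<otimes> p i) zs) = \<zero>" if "i < Suc n" for i
    proof (cases "i = n")
      case True
      have "v n \<ominus> r v \<otimes> p n = \<zero>" if "v \<in> set zs" for v
        using zR[OF that, of n] ip pR[of n] by (simp add: r_def m_assoc)
      then show ?thesis using True by (intro combine_zero_right[OF cs(2)]) auto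
    next
      case False
      then show ?thesis using cs(4) that by simp
    qed
    define as bs where "as = take (length xs) cs" and "bs = drop (length xs) cs"
    have cab: "cs = as @ bs" and len: "length as = length xs" "length bs = length ys"
      using cs(1) by (auto simp: as_def bs_def zs_def)
    have sets: "set as \<subseteq> carrier R" "set bs \<subseteq> carrier R" using cs(2) by (auto simp: cab)
    have "combine (as @ (\<ominus> a) # bs) (map (\<lambda>v. v i) vs) = \<zero>" if i: "i < Suc n" for i
    proof -
      have X: "set (map (\<lambda>v. v i) xs) \<subseteq> carrier R" "set (map (\<lambda>v. v i) ys) \<subseteq> carrier R"
        using zR i by (auto simp: zs_def)
      define A B where "A = combine as (map (\<lambda>v. v i) xs)" and "B = combine bs (map (\<lambda>v. v i) ys)"
      have AB: "A \<in> carrier R" "B \<in> carrier R" using X sets by (auto simp: A_def B_def)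
      have "combine (as @ (\<ominus> a) # bs) (map (\<lambda>v. v i) vs) = A \<oplus> ((\<ominus> a) \<otimes> p i \<oplus> B)"
        using combine_append[of as "map (\<lambda>v. v i) xs" "(\<ominus> a) # bs" "p i # map (\<lambda>v. v i) ys"]
          len X sets aR pR[OF i] by (simp add: vs A_def B_def)
      moreover have "A \<oplus> B = combine cs (map (\<lambda>v. v i) zs)"
        using combine_append[of as "map (\<lambda>v. v i) xs" bs "map (\<lambda>v. v i) ys"] len X sets
        by (simp add: cab zs_def A_def B_def)
      moreover have "combine cs (map (\<lambda>v. v i) zs) \<ominus> a \<otimes> p i = \<zero>"
        using combine_map_minus[OF cs(1,2) pR[OF i], of "\<lambda>v. v i" r] w0[OF i] zR i rR
        by (simp add: a_def)
      ultimately have "combine (as @ (\<ominus> a) # bs) (map (\<lambda>v. v i) vs) = A \<oplus> ((\<ominus> a) \<otimes> p i \<oplus> B)"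
        and "(A \<oplus> B) \<ominus> a \<otimes> p i = \<zero>" by simp_all
      moreover have "A \<oplus> ((\<ominus> a) \<otimes> p i \<oplus> B) = (A \<oplus> B) \<ominus> a \<otimes> p i"
        using AB aR pR[OF i] by algebra
      ultimately show ?thesis by simp
    qed
    then show ?thesis
      using cs(3) sets aR len
      by (intro exI[of _ "as @ (\<ominus> a) # bs"]) (auto simp: cab vs)
  qed
qed

lemma poly_eval_add:
  assumes "p \<in> carrier (poly_ring R)" "q \<in> carrier (poly_ring R)" "a \<in> carrier R"
  shows "eval (p \<oplus>\<^bsub>poly_ring R\<^esub> q) a = eval p a \<oplus> eval q a"
  using eval_poly_add[OF poly_carrier_set(2)[OF carrier_is_subring assms(1)]
      poly_carrier_set(2)[OF carrier_is_subring assms(2)] assms(3)] by (simp add: univ_poly_add)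

lemma poly_vanishing:
  assumes "finite S" "S \<subseteq> carrier R" "s \<in> carrier R" "s \<notin> S"
  shows "\<exists>q\<in>carrier (poly_ring R). (\<forall>r\<in>S. eval q r = \<zero>) \<and> eval q s \<noteq> \<zero>"
  using assms(1,2,4)
proof (induction S)
  case empty
  have "[\<one>] \<in> carrier (poly_ring R)" by (simp add: univ_poly_def polynomial_def)
  then show ?case using assms(3) by (intro bexI[of _ "[\<one>]"]) auto
next
  case (insert r S)
  interpret UP: cring "poly_ring R" by (rule univ_poly_is_cring[OF carrier_is_subring])
  obtain q where q: "q \<in> carrier (poly_ring R)" "\<forall>r\<in>S. eval q r = \<zero>" "eval q s \<noteq> \<zero>"
    using insert by auto
  have r: "r \<in> carrier R" "r \<noteq> s" using insert.prems by auto
  have lin: "[\<one>, \<ominus> r] \<in> carrier (poly_ring R)" using r by (simp add: univ_poly_def polynomial_def)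
  have ev: "eval [\<one>, \<ominus> r] x = x \<ominus> r" if "x \<in> carrier R" for x using that r by (simp add: minus_eq)
  have qR: "eval q x \<in> carrier R" if "x \<in> carrier R" for x
    using poly_carrier_set(2)[OF carrier_is_subring q(1)] that by (rule eval_in_carrier)
  note m = poly_eval_mult[OF carrier_is_subring lin q(1)]
  have "eval ([\<one>, \<ominus> r] \<otimes>\<^bsub>poly_ring R\<^esub> q) s \<noteq> \<zero>"
  proof -
    have ne: "s \<ominus> r \<noteq> \<zero>" "s \<ominus> r \<in> carrier R" using r assms(3) by simp_all
    have "eval ([\<one>, \<ominus> r] \<otimes>\<^bsub>poly_ring R\<^esub> q) s = (s \<ominus> r) \<otimes> eval q s"
      by (simp only: m[OF assms(3)] ev[OF assms(3)])
    then show ?thesis using integral[OF _ ne(2) qR[OF assms(3)]] ne(1) q(3) by auto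
  qed
  moreover have "eval ([\<one>, \<ominus> r] \<otimes>\<^bsub>poly_ring R\<^esub> q) x = \<zero>" if "x \<in> insert r S" for x
  proof -
    have xR: "x \<in> carrier R" using that insert.prems by auto
    have "eval ([\<one>, \<ominus> r] \<otimes>\<^bsub>poly_ring R\<^esub> q) x = (x \<ominus> r) \<otimes> eval q x"
      by (simp only: m[OF xR] ev[OF xR])
    moreover have "x \<ominus> r = \<zero> \<or> eval q x = \<zero>" using that q(2) r(1) by (auto simp: r_right_minus_eq)
    moreover have "x \<ominus> r \<in> carrier R" using xR r(1) by simp
    ultimately show ?thesis using qR[OF xR] by (metis l_null r_null)
  qed
  ultimately show ?case using UP.m_closed[OF lin q(1)] by blast
qed

text \<open>Points are added one at a time, correcting by a multiple of a polynomial that vanishes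
  at the earlier points and not at the new one.\<close>

lemma poly_interpolation:
  assumes "finite S" "S \<subseteq> carrier R" "\<And>r. r \<in> S \<Longrightarrow> t r \<in> carrier R"
  shows "\<exists>p\<in>carrier (poly_ring R). \<forall>r\<in>S. eval p r = t r"
  using assms
proof (induction S)
  case empty
  then show ?case by (intro bexI[of _ "[]"]) (auto simp: univ_poly_def polynomial_def)
next
  case (insert s S)
  interpret UP: cring "poly_ring R" by (rule univ_poly_is_cring[OF carrier_is_subring])
  obtain p where p: "p \<in> carrier (poly_ring R)" "\<forall>r\<in>S. eval p r = t r" using insert by auto
  have s: "s \<in> carrier R" "t s \<in> carrier R" using insert.prems by auto
  obtain q where q: "q \<in> carrier (poly_ring R)" "\<forall>r\<in>S. eval q r = \<zero>" "eval q s \<noteq> \<zero>"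
    using poly_vanishing[OF insert.hyps(1) _ s(1) insert.hyps(2)] insert.prems by auto
  have ps: "eval p s \<in> carrier R"
    by (rule eval_in_carrier[OF poly_carrier_set(2)[OF carrier_is_subring p(1)] s(1)])
  have qs: "eval q s \<in> carrier R"
    by (rule eval_in_carrier[OF poly_carrier_set(2)[OF carrier_is_subring q(1)] s(1)])
  define k where "k = (t s \<ominus> eval p s) \<otimes> inv (eval q s)"
  have iq: "inv (eval q s) \<in> carrier R" "inv (eval q s) \<otimes> eval q s = \<one>" using qs q(3) by (auto simp: field_Units)
  have k: "k \<in> carrier R" "k \<otimes> eval q s = t s \<ominus> eval p s" using ps s iq qs by (simp_all add: k_def m_assoc)
  show ?case
  \<comment> \<open>The list \<open>[k]\<close> is a constant polynomial only for nonzero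
    \<open>k\<close>; zero is the empty list.\<close>
  proof (cases "k = \<zero>")
    case True
    then have "t s \<ominus> eval p s = \<zero>" using k(2) qs by simp
    then have "eval p s = t s" using ps s by simp
    then show ?thesis using p by blast
  next
    case False
    have kp: "[k] \<in> carrier (poly_ring R)" using False k(1) by (simp add: univ_poly_def polynomial_def)
    have ev: "eval (p \<oplus>\<^bsub>poly_ring R\<^esub> ([k] \<otimes>\<^bsub>poly_ring R\<^esub> q)) x = eval p x \<oplus> k \<otimes> eval q x"
      if "x \<in> carrier R" for x
      using poly_eval_add[OF p(1) UP.m_closed[OF kp q(1)] that]
        poly_eval_mult[OF carrier_is_subring kp q(1) that] k(1) by simp
    have "eval p s \<oplus> (t s \<ominus> eval p s) = t s" using ps s by algebra
    then have "eval (p \<oplus>\<^bsub>poly_ring R\<^esub> ([k] \<otimes>\<^bsub>poly_ring R\<^esub> q)) s = t s" using ev[OF s(1)] k(2) by simp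
    moreover have "eval (p \<oplus>\<^bsub>poly_ring R\<^esub> ([k] \<otimes>\<^bsub>poly_ring R\<^esub> q)) x = t x" if "x \<in> S" for x
      using ev[of x] p(2) q(2) that insert.prems k(1) by auto
    ultimately show ?thesis using UP.a_closed[OF p(1) UP.m_closed[OF kp q(1)]] by blast
  qed
qed

lemma combine_minus:
  assumes "length xs = length us" "length ys = length us"
    and "set xs \<subseteq> carrier R" "set ys \<subseteq> carrier R" "set us \<subseteq> carrier R"
  shows "combine (map2 (\<lambda>x y. x \<ominus> y) xs ys) us = combine xs us \<ominus> combine ys us"
  using assms(1) assms(2)[symmetric] assms(3-)
proof (induction xs us ys rule: list_induct3)
  case Nil
  then show ?case by (simp add: minus_eq)
next
  case (Cons x xs u us y ys)
  define A B where "A = combine xs us" and "B = combine ys us"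
  have "A \<in> carrier R" "B \<in> carrier R" "x \<in> carrier R" "y \<in> carrier R" "u \<in> carrier R"
    using Cons.prems by (auto simp: A_def B_def)
  then have "(x \<ominus> y) \<otimes> u \<oplus> (A \<ominus> B) = (x \<otimes> u \<oplus> A) \<ominus> (y \<otimes> u \<oplus> B)" by algebra
  then show ?case using Cons by (simp add: A_def B_def)
qed

text \<open>The difference has \<open>n\<close> distinct roots but degree below \<open>n\<close>.
  The lists are coefficient vectors of fixed length and may begin with zeros, so the difference is
  normalized before its roots are counted.\<close>

lemma eval_determines_list:
  assumes "distinct rs" "set rs \<subseteq> carrier R" "length rs = n" "length xs = n" "length ys = n"
    and "set xs \<subseteq> carrier R" "set ys \<subseteq> carrier R" "\<And>r. r \<in> set rs \<Longrightarrow> eval xs r = eval ys r"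
  shows "xs = ys"
proof -
  define ds where "ds = map2 (\<lambda>x y. x \<ominus> y) xs ys"
  have lds: "length ds = n" using assms by (simp add: ds_def)
  have dsR: "set ds \<subseteq> carrier R" unfolding ds_def using assms(6,7) by (rule set_map2_subset) simp
  have ev: "eval ds r = \<zero>" if r: "r \<in> set rs" for r
  proof -
    have rR: "r \<in> carrier R" using r assms(2) by auto
    have "eval ds r = combine ds (exp_base r n)" using combine_eq_eval[of ds r] lds by simp
    also have "\<dots> = combine xs (exp_base r n) \<ominus> combine ys (exp_base r n)"
      unfolding ds_def using exp_base_closed[OF rR] assms by (intro combine_minus) (auto simp: exp_base_def)
    also have "\<dots> = eval xs r \<ominus> eval ys r"
      using combine_eq_eval[of xs r] combine_eq_eval[of ys r] assms(4,5) by simp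
    also have "\<dots> = \<zero>" using assms(8)[OF r] eval_in_carrier[OF assms(7) rR] by simp
    finally show ?thesis .
  qed
  have nd: "normalize ds \<in> carrier (poly_ring R)"
    using normalize_gives_polynomial[OF dsR] by (simp add: univ_poly_carrier)
  have "normalize ds = []"
  proof (rule ccontr)
    assume ne: "normalize ds \<noteq> []"
    have "set rs \<subseteq> {y \<in> carrier R. eval (normalize ds) y = \<zero>}"
      using ev eval_normalize[OF dsR] assms(2) by auto
    from card_mono[OF finite_roots(1)[OF nd ne] this]
    have "n \<le> degree (normalize ds)"
      using finite_roots(2)[OF nd ne] distinct_card[OF assms(1)] assms(3) by simp
    moreover have "length (normalize ds) \<le> n" using normalize_length_le[of ds] lds by simp
    moreover have "0 < length (normalize ds)" using ne by simp
    ultimately show False by linarith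
  qed
  then have ds0: "ds = replicate n \<zero>" using normalize_trick[of ds] lds by simp
  show ?thesis
  proof (rule nth_equalityI)
    show "length xs = length ys" using assms by simp
    fix i assume i: "i < length xs"
    have "ds ! i = xs ! i \<ominus> ys ! i" using i assms(4,5) by (simp add: ds_def)
    then have "xs ! i \<ominus> ys ! i = \<zero>" using ds0 i assms(4) by simp
    moreover have "xs ! i \<in> carrier R" "ys ! i \<in> carrier R"
      using i assms(4-7) nth_mem by (metis subsetD)+
    ultimately show "xs ! i = ys ! i" by simp
  qed
qed

end

section \<open>Core extensions and sigma-separability\<close>

context difference_field
begin

lemma base_rings:
  assumes "base K"
  shows "field (R\<lparr>carrier := K\<rparr>)" "sigma_field (R\<lparr>carrier := K\<rparr>) \<phi>" "\<phi> \<in> ring_hom (R\<lparr>carrier := K\<rparr>) (R\<lparr>carrier := K\<rparr>)"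
proof -
  note K = baseD[OF assms]
  show f: "field (R\<lparr>carrier := K\<rparr>)" by (rule subfield_iff(2)[OF K(3)])
  show h: "\<phi> \<in> ring_hom (R\<lparr>carrier := K\<rparr>) (R\<lparr>carrier := K\<rparr>)"
    using phi_hom K(2,4) by (auto simp: ring_hom_def subset_iff)
  show "sigma_field (R\<lparr>carrier := K\<rparr>) \<phi>"
    using f h by (simp add: sigma_field_def sigma_ring_def field_def domain_def)
qed

text \<open>The elementary form of a strongly sigma-etale subalgebra: finiteness stands for etale
  and \<open>K(\<phi> A) = A\<close> for sigma-separable.\<close>

definition core_ext :: "'a set \<Rightarrow> 'a set \<Rightarrow> bool"
  where "core_ext K A \<longleftrightarrow> finite_ext K A \<and> join K (\<phi> ` A) = A"

lemma core_ext_stable: "core_ext K A \<Longrightarrow> \<phi> ` A \<subseteq> A"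
  using join_upper(2)[where T = K and S = "\<phi> ` A"] by (auto simp: core_ext_def)

text \<open>The images \<open>map \<phi> us\<close> span \<open>A\<close> by
  \<open>translate_Span\<close>, and there are exactly as many of them as the dimension.\<close>

lemma core_ext_basis:
  assumes "base K" "core_ext K A"
  obtains us where "set us \<subseteq> carrier R" "independent K us" "Span K us = A"
    "independent K (map \<phi> us)" "Span K (map \<phi> us) = A"
proof -
  note K = baseD[OF assms(1)]
  have A: "finite_ext K A" "join K (\<phi> ` A) = A" using assms(2) by (auto simp: core_ext_def)
  note KA = finite_extD[OF A(1)]
  obtain us where us: "set us \<subseteq> carrier R" "independent K us" "length us = dim K A" "Span K us = A"
    using exists_base[OF KA(1) finite_dimensionE[OF KA(1,4)]] by (auto simp: over_def)
  have sp: "Span K (map \<phi> us) = A"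
    using translate_Span[OF A(1) phi_hom K(3,2) us(1,4)] A(2) by simp
  have ui: "set (map \<phi> us) \<subseteq> carrier R" using us(1) phi_closed by auto
  have "independent K (map \<phi> us)"
    by (rule independent_if_dim_Span[OF K(3) ui]) (simp add: sp us(3))
  then show ?thesis using that us sp by blast
qed

text \<open>
  Both \<open>us\<close> and \<open>\<phi> us\<close> are bases of \<open>A\<close>, so on \<open>A \<otimes> K'\<close> the endomorphism acts on coordinates
  through the injective map of \<open>K'\<close>.
\<close>

lemma core_ext_sigma_separable:
  assumes "base K" "core_ext K A"
  shows "sigma_separable (R\<lparr>carrier := K\<rparr>) \<phi> id (R\<lparr>carrier := A\<rparr>) \<phi>"
  unfolding sigma_separable_def
proof (intro allI impI, elim conjE)
  fix K' :: "'a list ring" and \<kappa>' and g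
  assume K': "sigma_field K' \<kappa>'" and g: "g \<in> sigma_hom (R\<lparr>carrier := K\<rparr>) \<phi> K' \<kappa>'"
  note K = baseD[OF assms(1)] and KR = base_rings[OF assms(1)]
  have A: "finite_ext K A" using assms(2) by (auto simp: core_ext_def)
  note KA = finite_extD[OF A]
  note phiA = core_ext_stable[OF assms(2)]
  have fK': "field K'" and hK': "\<kappa>' \<in> ring_hom K' K'" using K' by (auto simp: sigma_field_def sigma_ring_def)
  interpret K': field K' by (rule fK')
  interpret KK: field "R\<lparr>carrier := K\<rparr>" by (rule KR(1))
  interpret AA: field "R\<lparr>carrier := A\<rparr>" by (rule subfield_iff(2)[OF KA(2)])
  have gh: "g \<in> ring_hom (R\<lparr>carrier := K\<rparr>) K'" and ge: "\<forall>c\<in>K. \<kappa>' (g c) = g (\<phi> c)"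
    using g by (auto simp: sigma_hom_def)
  have idh: "id \<in> ring_hom (R\<lparr>carrier := K\<rparr>) (R\<lparr>carrier := A\<rparr>)" using KA(3) by (auto simp: ring_hom_def)
  have phA: "\<phi> \<in> ring_hom (R\<lparr>carrier := A\<rparr>) (R\<lparr>carrier := A\<rparr>)"
    using phi_hom phiA KA(5) by (auto simp: ring_hom_def subset_iff)
  have inj: "inj_on \<kappa>' (carrier K')" by (rule non_trivial_field_hom_is_inj[OF hK' fK' fK'])
  obtain us where us: "set us \<subseteq> carrier R" "independent K us" "Span K us = A"
    "independent K (map \<phi> us)" "Span K (map \<phi> us) = A" by (rule core_ext_basis[OF assms])
  have usA: "set us \<subseteq> A" using Span_base_incl[OF K(3) us(1)] us(3) by simp
  let ?teq = "tensor_eq (R\<lparr>carrier := K\<rparr>) id (R\<lparr>carrier := A\<rparr>) g K'"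
  have im: "?teq (image_mset (map_prod \<phi> \<kappa>') M) (image_mset (map_prod \<phi> \<kappa>') N)" if "?teq M N" for M N
    by (rule tensor_eq_image[OF that AA.ring_axioms K'.ring_axioms _ _ _ phA hK', where \<kappa> = \<phi>])
      (use idh gh KR(3) ge ring_hom_zero[OF phA AA.ring_axioms AA.ring_axioms]
        ring_hom_zero[OF hK' K'.ring_axioms K'.ring_axioms] in \<open>auto simp: ring_hom_def\<close>)
  show "inj_on (tensor_map (R\<lparr>carrier := K\<rparr>) id (R\<lparr>carrier := A\<rparr>) g K' \<phi> \<kappa>')
      (carrier (tensor (R\<lparr>carrier := K\<rparr>) id (R\<lparr>carrier := A\<rparr>) g K'))"
  proof (subst inj_on_tensor_map_iff[OF AA.ring_axioms K'.ring_axioms idh gh KR(3) phA hK'])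
    show "\<forall>c\<in>carrier (R\<lparr>carrier := K\<rparr>). \<phi> (id c) = id (\<phi> c)" by simp
    show "\<forall>c\<in>carrier (R\<lparr>carrier := K\<rparr>). \<kappa>' (g c) = g (\<phi> c)" using ge by simp
    show "\<forall>M N. set_mset M \<subseteq> carrier (R\<lparr>carrier := A\<rparr>) \<times> carrier K' \<longrightarrow>
      set_mset N \<subseteq> carrier (R\<lparr>carrier := A\<rparr>) \<times> carrier K' \<longrightarrow>
      ?teq (image_mset (map_prod \<phi> \<kappa>') M) (image_mset (map_prod \<phi> \<kappa>') N) \<longrightarrow> ?teq M N"
    proof (intro allI impI)
      fix M N
      assume MN: "set_mset M \<subseteq> carrier (R\<lparr>carrier := A\<rparr>) \<times> carrier K'"
        "set_mset N \<subseteq> carrier (R\<lparr>carrier := A\<rparr>) \<times> carrier K'"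
        and eq: "?teq (image_mset (map_prod \<phi> \<kappa>') M) (image_mset (map_prod \<phi> \<kappa>') N)"
      note span = tensor_span[OF K(3) KA(2,3) K'.cring_axioms gh us(1,3)]
      obtain ss where ss: "length ss = length us" "set ss \<subseteq> carrier K'" "?teq M (mset (zip us ss))"
        using span[of M] MN(1) by auto
      obtain ts where ts: "length ts = length us" "set ts \<subseteq> carrier K'" "?teq N (mset (zip us ts))"
        using span[of N] MN(2) by auto
      have zip: "image_mset (map_prod \<phi> \<kappa>') (mset (zip us xs)) = mset (zip (map \<phi> us) (map \<kappa>' xs))" for xs
        by (simp add: zip_map_map map_prod_def)
      have "?teq (mset (zip (map \<phi> us) (map \<kappa>' ss))) (mset (zip (map \<phi> us) (map \<kappa>' ts)))"
        using tensor_eq.trans[OF tensor_eq.sym[OF im[OF ss(3)]] tensor_eq.trans[OF eq im[OF ts(3)]]]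
        unfolding zip .
      then have "map \<kappa>' ss = map \<kappa>' ts"
        using ss(1,2) ts(1,2) subset_trans[OF image_mono[OF usA] phiA] hK'
        by (intro tensor_coeffs_unique[OF A us(4) _ K'.cring_axioms gh]) (auto simp: ring_hom_def)
      then have "ss = ts"
        using inj ss(2) ts(2) by (metis inj_on_map_eq_map inj_on_subset le_sup_iff)
      then show "?teq M N" using tensor_eq.trans[OF ss(3)] tensor_eq.sym[OF ts(3)] by (simp del: id_apply)
    qed
  qed
qed

text \<open>
  Conversely, injectivity for the extension \<open>\<phi> : K \<rightarrow> K\<close> says that \<open>\<phi>\<close> preserves linear
  independence over \<open>K\<close>, since it maps \<open>u \<otimes> k\<close> to \<open>\<phi> u \<otimes> \<phi> k = k \<phi> u \<otimes> 1\<close>.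
\<close>

lemma core_ext_if_sigma_separable:
  assumes "base K" "finite_ext K A" "\<phi> ` A \<subseteq> A"
    and sep: "sigma_separable (R\<lparr>carrier := K\<rparr>) \<phi> id (R\<lparr>carrier := A\<rparr>) \<phi>"
  shows "core_ext K A"
proof -
  note K = baseD[OF assms(1)] and KR = base_rings[OF assms(1)] and KA = finite_extD[OF assms(2)]
  interpret KK: field "R\<lparr>carrier := K\<rparr>" by (rule KR(1))
  interpret AA: field "R\<lparr>carrier := A\<rparr>" by (rule subfield_iff(2)[OF KA(2)])
  have idh: "id \<in> ring_hom (R\<lparr>carrier := K\<rparr>) (R\<lparr>carrier := A\<rparr>)" using KA(3) by (auto simp: ring_hom_def)
  have phA: "\<phi> \<in> ring_hom (R\<lparr>carrier := A\<rparr>) (R\<lparr>carrier := A\<rparr>)"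
    using phi_hom assms(3) KA(5) by (auto simp: ring_hom_def subset_iff)
  have sA: "sigma_ring (R\<lparr>carrier := A\<rparr>) \<phi>" using phA AA.cring_axioms by (simp add: sigma_ring_def)
  let ?KR = "R\<lparr>carrier := K\<rparr>" and ?AR = "R\<lparr>carrier := A\<rparr>"
  let ?teq = "tensor_eq ?KR id ?AR \<phi> ?KR"
  \<comment> \<open>The extension field is \<open>K\<close> itself with structure map
    \<open>\<phi>\<close>. It is carried by the element type of \<open>R\<close> and not by lists,
    hence the transfer through \<open>sigma_separable_any_type\<close>.\<close>
  have inj: "inj_on (tensor_map ?KR id ?AR \<phi> ?KR \<phi> \<phi>) (carrier (tensor ?KR id ?AR \<phi> ?KR))"
  proof (rule sigma_separable_any_type[OF sep KR(2) sA _ KR(2)])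
    show "id \<in> sigma_hom ?KR \<phi> ?AR \<phi>" using idh by (simp add: sigma_hom_def)
    show "\<phi> \<in> sigma_hom ?KR \<phi> ?KR \<phi>" using KR(3) by (simp add: sigma_hom_def)
  qed
  have inj': "?teq M N"
    if "set_mset M \<subseteq> A \<times> K" "set_mset N \<subseteq> A \<times> K"
      "?teq (image_mset (map_prod \<phi> \<phi>) M) (image_mset (map_prod \<phi> \<phi>) N)" for M N
    using inj that
    by (subst (asm) inj_on_tensor_map_iff[OF AA.ring_axioms KK.ring_axioms idh KR(3,3) phA KR(3)]) simp_all
  obtain us where us: "set us \<subseteq> carrier R" "independent K us" "length us = dim K A" "Span K us = A"
    using exists_base[OF KA(1) finite_dimensionE[OF KA(1,4)]] by (auto simp: over_def)
  have usA: "set us \<subseteq> A" using Span_base_incl[OF K(3) us(1)] us(4) by simp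
  have pu: "set (map \<phi> us) \<subseteq> A" using usA assms(3) by auto
  have puR: "set (map \<phi> us) \<subseteq> carrier R" using pu KA(5) by auto
  have "independent K (map \<phi> us)"
  proof (rule ccontr)
    assume "\<not> ?thesis"
    then obtain ks where ks: "length ks = length us" "combine ks (map \<phi> us) = \<zero>" "set ks \<subseteq> K" "set ks \<noteq> {\<zero>}"
      using dependent_imp_non_trivial_combine[OF K(3) puR] by auto
    have one: "\<one> \<in> K" using subringE(3)[OF subfieldE(1)[OF K(3)]] .
    have move: "?teq (mset (zip (map \<phi> vs) (map \<phi> cs))) {#(combine cs (map \<phi> vs), \<one>)#} \<and> combine cs (map \<phi> vs) \<in> A"
      if "length cs = length vs" "set vs \<subseteq> A" "set cs \<subseteq> K" for cs vs
      using that
    proof (induction cs vs rule: list_induct2)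
      case Nil
      then show ?case
        using tensor_eq.sym[OF tensor_eq.zero_left[of \<one> ?KR ?KR id ?AR \<phi>]] one
          subringE(2)[OF subfieldE(1)[OF KA(2)]] by (simp del: id_apply)
    next
      case (Cons c cs v vs)
      note AAp = subringE[OF subfieldE(1)[OF KA(2)]]
      have mem: "c \<in> K" "\<phi> v \<in> A" "c \<otimes> \<phi> v \<in> A" "\<phi> c \<in> K"
        using Cons.prems assms(3) AAp(6) KA(3) K(2) by auto
      have prems: "set vs \<subseteq> A" "set cs \<subseteq> K" using Cons.prems by auto
      note IH = conjunct1[OF Cons.IH[OF prems]] conjunct2[OF Cons.IH[OF prems]]
      have 1: "?teq {#(\<phi> v, \<phi> c)#} {#(c \<otimes> \<phi> v, \<one>)#}"
        using tensor_eq.sym[OF tensor_eq.balanced[of c ?KR "\<phi> v" ?AR \<one> ?KR id \<phi>]] mem one K(4) by auto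
      have 2: "?teq {#(c \<otimes> \<phi> v, \<one>), (combine cs (map \<phi> vs), \<one>)#} {#(c \<otimes> \<phi> v \<oplus> combine cs (map \<phi> vs), \<one>)#}"
        using tensor_eq.sym[OF tensor_eq.add_left[of "c \<otimes> \<phi> v" ?AR "combine cs (map \<phi> vs)" \<one> ?KR ?KR id \<phi>]]
          mem one IH(2) by simp
      have "?teq (mset (zip (map \<phi> (v # vs)) (map \<phi> (c # cs)))) {#(c \<otimes> \<phi> v, \<one>), (combine cs (map \<phi> vs), \<one>)#}"
        using tensor_eq.add[OF 1 IH(1)] by (simp add: add_mset_commute del: id_apply)
      from tensor_eq.trans[OF this 2] show ?case using mem IH(2) AAp(7) by (simp del: id_apply)
    qed
    have "?teq (mset (zip (map \<phi> us) (map \<phi> ks))) {#(\<zero>, \<one>)#}"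
      using move[OF ks(1) usA ks(3)] ks(2) by (simp del: combine.simps)
    moreover have "?teq {#(\<zero>, \<one>)#} {#}" using tensor_eq.zero_left[of \<one> ?KR ?KR id ?AR \<phi>] one by simp
    ultimately have "?teq (mset (zip (map \<phi> us) (map \<phi> ks))) {#}" by (rule tensor_eq.trans)
    moreover have "image_mset (map_prod \<phi> \<phi>) (mset (zip us ks)) = mset (zip (map \<phi> us) (map \<phi> ks))"
      by (simp add: zip_map_map map_prod_def)
    moreover have "set_mset (mset (zip us ks)) \<subseteq> A \<times> K"
      using usA ks(3) by (auto dest: set_zip_leftD set_zip_rightD)
    ultimately have "?teq (mset (zip us ks)) {#}" using inj'[of "mset (zip us ks)" "{#}"] by simp
    then have "?teq (mset (zip us ks)) (mset (zip us (replicate (length us) \<zero>)))"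
      using tensor_eq.trans[OF _ tensor_eq.sym[OF tensor_zip_zero[OF usA, of ?KR id \<phi> ?KR]]] by simp
    then have "ks = replicate (length us) \<zero>"
      using ks(1,3) subringE(2)[OF subfieldE(1)[OF K(3)]]
      by (intro tensor_coeffs_unique[OF assms(2) us(2) usA KK.cring_axioms KR(3)]) (auto simp: set_replicate_conv_if)
    moreover have "us \<noteq> []" using us(3) finite_ext_dim_pos[OF assms(2)] by auto
    ultimately show False using ks(4) by (simp add: set_replicate_conv_if)
  qed
  then have "Span K (map \<phi> us) = A"
    using independent_length_eq_dimension[OF K(3) _ _ pu, of "dim K A"] us(3)
      finite_dimensionE[OF KA(1,4)] by (simp add: over_def)
  then show ?thesis
    using translate_Span[OF assms(2) phi_hom K(3,2) us(1,4)] assms(2) by (simp add: core_ext_def)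
qed

section \<open>Etale subalgebras of a Galois extension are its finite subextensions\<close>

lemma finite_dimension_if_bounded:
  assumes "subfield K R" "subalgebra K A R"
    and bound: "\<And>us. independent K us \<Longrightarrow> set us \<subseteq> A \<Longrightarrow> length us \<le> n"
  shows "finite_dimension K A"
proof -
  have AR: "A \<subseteq> carrier R" using subalgebra_in_carrier[OF assms(2)] .
  have "\<exists>us. (independent K us \<and> set us \<subseteq> A) \<and>
      (\<forall>vs. independent K vs \<and> set vs \<subseteq> A \<longrightarrow> length vs \<le> length us)"
    by (rule ex_has_greatest_nat[of _ "[]" _ "Suc n"]) (use bound in \<open>auto simp: less_Suc_eq_le\<close>)
  then obtain us where us: "independent K us" "set us \<subseteq> A"
    and max: "\<And>vs. independent K vs \<Longrightarrow> set vs \<subseteq> A \<Longrightarrow> length vs \<le> length us" by blast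
  have "Span K us = A"
  proof (rule subset_antisym)
    show "Span K us \<subseteq> A" by (rule subalgebra_Span_incl[OF assms(1,2) us(2)])
    show "A \<subseteq> Span K us"
    proof (rule subsetI, rule ccontr)
      fix v assume v: "v \<in> A" "v \<notin> Span K us"
      then have "independent K (v # us)" using AR us(1) by (intro li_Cons) auto
      then have "length (v # us) \<le> length us" using v(1) us(2) by (intro max) simp_all
      then show False by simp
    qed
  qed
  then show ?thesis using Span_finite_dimension[OF assms(1), of us] us(2) AR by auto
qed

text \<open>More than \<open>n\<close> vectors of \<open>C^n\<close> are dependent, so with more
  than \<open>n\<close> elements in \<open>us\<close> some tensor of \<open>us\<close> with
  coefficients \<open>cs\<close>, not all zero, has image zero and hence vanishes in
  \<open>A \<otimes> C\<close>. \<open>A\<close> is not yet known to be finite over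
  \<open>K\<close>, so this identity is moved to a finite extension \<open>E\<close> that contains
  the elements used by its derivation; there the coefficients are unique.\<close>

lemma independent_length_le_etale:
  fixes C :: "('c, 'd) ring_scheme"
  assumes "subfield K R" "subring A R" "K \<subseteq> A" "\<And>x. x \<in> A \<Longrightarrow> (algebraic over K) x"
    and "field C" "c \<in> ring_hom (R\<lparr>carrier := K\<rparr>) C"
    and h: "h \<in> ring_iso (tensor (R\<lparr>carrier := K\<rparr>) id (R\<lparr>carrier := A\<rparr>) c C) (RDirProd_list (replicate n C))"
    and hc: "\<And>a. a \<in> carrier C \<Longrightarrow>
      h (tensor_class (R\<lparr>carrier := K\<rparr>) id (R\<lparr>carrier := A\<rparr>) c C {# (\<one>, a) #}) = replicate n a"
    and us: "independent K us" "set us \<subseteq> A"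
  shows "length us \<le> n"
proof (rule ccontr)
  assume "\<not> length us \<le> n"
  then have len: "n < length us" by simp
  interpret C: field C by fact
  note As = subringE[OF assms(2)]
  have cA: "cring (R\<lparr>carrier := A\<rparr>)"
    using subcringI'[OF assms(2)] subcring_iff[OF As(1)] by simp
  have cK: "c x \<in> carrier C" if "x \<in> K" for x using assms(6) that by (auto simp: ring_hom_def)
  interpret T: tensor_setting "R\<lparr>carrier := K\<rparr>" id "R\<lparr>carrier := A\<rparr>" c C
  proof (rule tensor_setting.intro)
    show "cring (R\<lparr>carrier := A\<rparr>)" "cring C" by (rule cA, rule C.cring_axioms)
    show "id \<in> carrier (R\<lparr>carrier := K\<rparr>) \<rightarrow> carrier (R\<lparr>carrier := A\<rparr>)" using assms(3) by auto
    show "c \<in> carrier (R\<lparr>carrier := K\<rparr>) \<rightarrow> carrier C" using cK by auto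
  qed
  let ?T = "tensor (R\<lparr>carrier := K\<rparr>) id (R\<lparr>carrier := A\<rparr>) c C"
  note P = RDirProd_replicate[OF C.ring_axioms]
  have hh: "h \<in> ring_hom ?T (RDirProd_list (replicate n C))" and inj: "inj_on h (carrier ?T)"
    using h by (auto simp: ring_iso_def bij_betw_def)
  have hcl: "h (T.cl M) \<in> carrier (RDirProd_list (replicate n C))" if "T.formal M" for M
    using ring_hom_closed[OF hh] that by (simp add: T.tensor_simps)
  have clc: "T.cl M \<in> carrier ?T" if "T.formal M" for M using that by (simp add: T.tensor_simps)
  define v where "v u i = h (T.cl {#(u, \<one>\<^bsub>C\<^esub>)#}) ! i" for u i
  have vl: "length (h (T.cl {#(u, \<one>\<^bsub>C\<^esub>)#})) = n" "set (h (T.cl {#(u, \<one>\<^bsub>C\<^esub>)#})) \<subseteq> carrier C" if "u \<in> A" for u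
    using hcl[of "{#(u, \<one>\<^bsub>C\<^esub>)#}"] that by (auto simp: P(1))
  have vC: "v u i \<in> carrier C" if "u \<in> A" "i < n" for u i
    using vl[OF that(1)] that(2) nth_mem unfolding v_def by blast
  have zero: "h (T.cl {#}) = replicate n \<zero>\<^bsub>C\<^esub>"
  proof -
    have "T.teq {#(\<one>, \<zero>\<^bsub>C\<^esub>)#} {#}" using As(3) by (intro tensor_eq.zero_right) simp
    then have "T.cl {#(\<one>, \<zero>\<^bsub>C\<^esub>)#} = T.cl {#}" using As(3) by (subst T.cl_eq_iff) simp_all
    then show ?thesis using hc[of "\<zero>\<^bsub>C\<^esub>"] by simp
  qed
  have form: "T.formal (mset (zip ws cs))" if "set ws \<subseteq> A" "set cs \<subseteq> carrier C" for ws cs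
    using that by (auto dest: set_zip_leftD set_zip_rightD)
  have val: "h (T.cl (mset (zip ws cs))) = map (\<lambda>i. C.combine cs (map (\<lambda>u. v u i) ws)) [0..<n]"
    if "length cs = length ws" "set cs \<subseteq> carrier C" "set ws \<subseteq> A" for cs ws
    using that
  proof (induction cs ws rule: list_induct2)
    case Nil
    then show ?case using zero by (simp add: map_replicate_const del: id_apply)
  next
    case (Cons s cs u ws)
    have mem: "s \<in> carrier C" "u \<in> A" "set cs \<subseteq> carrier C" "set ws \<subseteq> A" using Cons.prems by auto
    have f: "T.formal {#(u, \<one>\<^bsub>C\<^esub>)#}" "T.formal {#(\<one>, s)#}" "T.formal {#(u, s)#}" using mem As(3) by simp_all
    have "u \<in> carrier R" using mem As(1) by auto
    then have split: "T.cl {#(u, s)#} = T.cl {#(u, \<one>\<^bsub>C\<^esub>)#} \<otimes>\<^bsub>?T\<^esub> T.cl {#(\<one>, s)#}"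
      using T.cl_mult[OF f(1,2)] mem by (simp del: id_apply)
    have 1: "h (T.cl {#(u, s)#}) = map2 (\<otimes>\<^bsub>C\<^esub>) (h (T.cl {#(u, \<one>\<^bsub>C\<^esub>)#})) (replicate n s)"
      unfolding split ring_hom_mult[OF hh clc[OF f(1)] clc[OF f(2)]]
        P(2)[OF hcl[OF f(1)] hcl[OF f(2)], unfolded hc[OF mem(1)]] hc[OF mem(1)] ..
    have "h (T.cl (mset (zip (u # ws) (s # cs)))) = h (T.cl {#(u, s)#} \<oplus>\<^bsub>?T\<^esub> T.cl (mset (zip ws cs)))"
      using T.cl_add[OF f(3) form[OF mem(4,3)]] by (simp del: id_apply)
    also have "\<dots> = map2 (\<oplus>\<^bsub>C\<^esub>) (h (T.cl {#(u, s)#})) (h (T.cl (mset (zip ws cs))))"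
      unfolding ring_hom_add[OF hh clc[OF f(3)] clc[OF form[OF mem(4,3)]]]
        P(3)[OF hcl[OF f(3)] hcl[OF form[OF mem(4,3)]]] ..
    finally have eq: "h (T.cl (mset (zip (u # ws) (s # cs)))) =
      map2 (\<oplus>\<^bsub>C\<^esub>) (map2 (\<otimes>\<^bsub>C\<^esub>) (h (T.cl {#(u, \<one>\<^bsub>C\<^esub>)#})) (replicate n s))
        (map (\<lambda>i. C.combine cs (map (\<lambda>u. v u i) ws)) [0..<n])"
      unfolding 1 Cons.IH[OF mem(3,4)] .
    show ?case unfolding eq
    proof (rule nth_equalityI)
      fix i assume "i < length (map2 (\<oplus>\<^bsub>C\<^esub>) (map2 (\<otimes>\<^bsub>C\<^esub>) (h (T.cl {#(u, \<one>\<^bsub>C\<^esub>)#})) (replicate n s))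
        (map (\<lambda>i. C.combine cs (map (\<lambda>u. v u i) ws)) [0..<n]))"
      then have i: "i < n" by simp
      then show "map2 (\<oplus>\<^bsub>C\<^esub>) (map2 (\<otimes>\<^bsub>C\<^esub>) (h (T.cl {#(u, \<one>\<^bsub>C\<^esub>)#})) (replicate n s))
        (map (\<lambda>i. C.combine cs (map (\<lambda>u. v u i) ws)) [0..<n]) ! i =
        map (\<lambda>i. C.combine (s # cs) (map (\<lambda>u. v u i) (u # ws))) [0..<n] ! i"
        using vl(1)[OF mem(2)] vC[OF mem(2) i] mem(1) by (simp add: v_def[symmetric] C.m_comm)
    qed (simp add: vl(1)[OF mem(2)])
  qed
  have "\<exists>cs. length cs = length (map v us) \<and> set cs \<subseteq> carrier C \<and> (\<exists>c\<in>set cs. c \<noteq> \<zero>\<^bsub>C\<^esub>) \<and>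
    (\<forall>i<n. C.combine cs (map (\<lambda>v. v i) (map v us)) = \<zero>\<^bsub>C\<^esub>)"
    by (rule C.dependent_vectors) (use len vC us(2) in auto)
  then obtain cs where cs: "length cs = length us" "set cs \<subseteq> carrier C" "\<exists>c\<in>set cs. c \<noteq> \<zero>\<^bsub>C\<^esub>"
    "\<forall>i<n. C.combine cs (map (\<lambda>u. v u i) us) = \<zero>\<^bsub>C\<^esub>"
    by (auto simp: comp_def)
  have "h (T.cl (mset (zip us cs))) = h (T.cl {#})"
    unfolding val[OF cs(1,2) us(2)] zero by (rule nth_equalityI) (use cs(4) in simp_all)
  then have "T.cl (mset (zip us cs)) = T.cl {#}"
    using inj_onD[OF inj _ clc[OF form[OF us(2) cs(2)]] clc[of "{#}"]] by (simp del: id_apply)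
  then have "T.teq (mset (zip us cs)) {#}" using T.cl_eq_iff[OF form[OF us(2) cs(2)]] by (simp del: id_apply)
  then obtain Z where Z: "finite Z" "Z \<subseteq> A"
    "\<And>T. Z \<subseteq> T \<Longrightarrow> tensor_eq (R\<lparr>carrier := K\<rparr>) id (R\<lparr>carrier := T\<rparr>) c C (mset (zip us cs)) {#}"
    by (rule tensor_eq_finite_support_left) (simp del: id_apply)
  define E where "E = join K (Z \<union> set us)"
  have E: "finite_ext K E" unfolding E_def
    by (rule finite_ext_adjoin[OF assms(1)]) (use Z us(2) As(1) assms(4) in auto)
  have ZE: "Z \<union> set us \<subseteq> E" unfolding E_def by (rule join_upper(2))
  have t: "tensor_eq (R\<lparr>carrier := K\<rparr>) id (R\<lparr>carrier := E\<rparr>) c C (mset (zip us cs))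
      (mset (zip us (replicate (length us) \<zero>\<^bsub>C\<^esub>)))"
    using tensor_eq.trans[OF Z(3) tensor_eq.sym[OF tensor_zip_zero]] ZE by blast
  have "cs = replicate (length us) \<zero>\<^bsub>C\<^esub>"
    by (rule tensor_coeffs_unique[OF E us(1) _ C.cring_axioms assms(6) cs(1,2) _ _ t]) (use ZE in auto)
  then show False using cs(3) by (auto simp: set_replicate_conv_if split: if_splits)
qed

lemma finite_ext_if_etale:
  assumes "subfield K R" "subring A R" "K \<subseteq> A" "\<And>x. x \<in> A \<Longrightarrow> (algebraic over K) x"
    and "etale_algebra (R\<lparr>carrier := K\<rparr>) id (R\<lparr>carrier := A\<rparr>)"
  shows "finite_ext K A"
proof -
  interpret KK: field "R\<lparr>carrier := K\<rparr>" by (rule subfield_iff(2)[OF assms(1)])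
  let ?C = "KK.alg_closure" and ?c = "KK.indexed_const"
  obtain n h where h: "h \<in> ring_iso (tensor (R\<lparr>carrier := K\<rparr>) id (R\<lparr>carrier := A\<rparr>) ?c ?C) (RDirProd_list (replicate n ?C))"
    "\<forall>a\<in>carrier ?C. h (tensor_class (R\<lparr>carrier := K\<rparr>) id (R\<lparr>carrier := A\<rparr>) ?c ?C {# (\<one>, a) #}) = replicate n a"
    using assms(5) unfolding etale_algebra_def Let_def by auto
  have fC: "field ?C" using KK.alg_closureE(1) by (simp add: algebraic_closure_def)
  have sub: "subalgebra K A R"
    using assms(2,3) subringE(6)[OF assms(2)]
    by (auto simp: subalgebra_def subalgebra_axioms_def subring_def)
  have fd: "finite_dimension K A"
    by (rule finite_dimension_if_bounded[OF assms(1) sub,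
          OF independent_length_le_etale[OF assms(1-4) fC KK.alg_closureE(2) h(1)]]) (use h(2) in auto)
  then show ?thesis
    using assms(1,3) finite_dimension_subring_is_subfield[OF assms(1,2,3) fd] by (simp add: finite_ext_def)
qed

lemma map_hom_poly:
  fixes C :: "('c, 'd) ring_scheme"
  assumes "subfield J R" "\<theta> \<in> ring_hom (R\<lparr>carrier := J\<rparr>) C" "field C" "p \<in> carrier (J[X])"
  shows "map \<theta> p \<in> carrier (poly_ring C)"
proof -
  have "p \<in> carrier (poly_ring (R\<lparr>carrier := J\<rparr>))"
    using assms(4) univ_poly_consistent[OF subfieldE(1)[OF assms(1)]] by simp
  then show ?thesis using polynomial_hom[OF assms(2) subfield_iff(2)[OF assms(1)] assms(3)] by simp
qed

lemma hom_eval: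
  fixes C :: "('c, 'd) ring_scheme"
  assumes "subfield J R" "\<theta> \<in> ring_hom (R\<lparr>carrier := J\<rparr>) C" "field C" "set p \<subseteq> J" "x \<in> J"
  shows "\<theta> (eval p x) = ring.eval C (map \<theta> p) (\<theta> x)"
proof -
  interpret J: field "R\<lparr>carrier := J\<rparr>" by (rule subfield_iff(2)[OF assms(1)])
  interpret C: field C by fact
  interpret h: ring_hom_ring "R\<lparr>carrier := J\<rparr>" C \<theta>
    by (rule ring_hom_ringI2[OF J.ring_axioms C.ring_axioms assms(2)])
  show ?thesis using h.eval_hom'[of x p] assms(4,5) subfieldE(1)[OF assms(1)] by simp
qed

lemma hom_extend_closed:
  fixes C :: "('c, 'd) ring_scheme"
  assumes "algebraically_closed C" "subfield J R" "\<theta> \<in> ring_hom (R\<lparr>carrier := J\<rparr>) C"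
    and "finite S" "S \<subseteq> carrier R" "\<And>s. s \<in> S \<Longrightarrow> (algebraic over J) s"
  shows "\<exists>\<eta>. \<eta> \<in> ring_hom (R\<lparr>carrier := join J S\<rparr>) C \<and> (\<forall>a\<in>J. \<eta> a = \<theta> a)"
  using assms(4-6)
proof (induction S)
  case empty
  have "join J {} = J" using join_absorb(1)[OF assms(2), of "{}"] by simp
  then show ?case using assms(3) by auto
next
  case (insert s S)
  interpret C: algebraically_closed C by fact
  note JR = subfieldE(3)[OF assms(2)]
  have s: "s \<in> carrier R" and S: "S \<subseteq> carrier R" using insert.prems by auto
  obtain \<eta> where \<eta>: "\<eta> \<in> ring_hom (R\<lparr>carrier := join J S\<rparr>) C" "\<forall>a\<in>J. \<eta> a = \<theta> a"
    using insert.IH insert.prems by blast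
  define J2 where "J2 = join J S"
  have J2: "subfield J2 R" unfolding J2_def by (rule join_subfield[OF JR S])
  have JJ2: "J \<subseteq> J2" unfolding J2_def by (rule join_upper(1))
  have alg: "(algebraic over J2) s"
    using algebraic_mono[OF JJ2] insert.prems(2)[of s] by (simp add: over_def)
  note I = Irr_props[OF J2 s alg]
  have \<eta>2: "\<eta> \<in> ring_hom (R\<lparr>carrier := J2\<rparr>) C" using \<eta>(1) by (simp add: J2_def)
  have p: "map \<eta> (Irr J2 s) \<in> carrier (poly_ring C)"
    by (rule map_hom_poly[OF J2 \<eta>2 C.field_axioms I(1)])
  have "size (C.roots (map \<eta> (Irr J2 s))) \<ge> 1"
    using C.roots_over_carrier[OF p] I(5) by (simp add: C.splitted_def)
  then obtain z where "z \<in># C.roots (map \<eta> (Irr J2 s))"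
    by (metis multiset_nonemptyE not_one_le_zero size_empty)
  then have z: "z \<in> carrier C" "C.eval (map \<eta> (Irr J2 s)) z = \<zero>\<^bsub>C\<^esub>"
    using C.roots_mem_iff_is_root[OF p] by (auto simp: C.is_root_def)
  obtain \<eta>' where \<eta>': "\<eta>' \<in> ring_hom (R\<lparr>carrier := join J2 {s}\<rparr>) C" "\<And>a. a \<in> J2 \<Longrightarrow> \<eta>' a = \<eta> a"
    by (rule hom_extend[OF J2 \<eta>2 C.field_axioms s alg z]) blast
  have "join J2 {s} = join J (insert s S)"
    unfolding J2_def using join_join[OF JR S, of "{s}"] s by simp
  then show ?case
    using \<eta>' \<eta>(2) JJ2 by (intro exI[of _ \<eta>']) auto
qed

text \<open>Extending \<open>c\<close> to the field generated by the conjugates of \<open>x\<close>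
  embeds these conjugates into \<open>C\<close> as roots, so the count known in \<open>R\<close> is
  reached in \<open>C\<close>; the degree bounds it from above.\<close>

lemma card_roots_Irr:
  fixes C :: "('c, 'd) ring_scheme"
  assumes "galois_over K" "algebraically_closed C" "c \<in> ring_hom (R\<lparr>carrier := K\<rparr>) C" "x \<in> carrier R"
  shows "finite {y \<in> carrier C. ring.eval C (map c (Irr K x)) y = \<zero>\<^bsub>C\<^esub>}"
    and "card {y \<in> carrier C. ring.eval C (map c (Irr K x)) y = \<zero>\<^bsub>C\<^esub>} = degree (Irr K x)"
proof -
  interpret C: algebraically_closed C by fact
  note K = galois_overD[OF assms(1)]
  note I = Irr_props[OF K(1) assms(4) K(3)[OF assms(4)]]
  note cf = conj_finite[OF K(1) assms(4) K(3)[OF assms(4)]]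
  have p: "map c (Irr K x) \<in> carrier (poly_ring C)" "map c (Irr K x) \<noteq> []"
    using map_hom_poly[OF K(1) assms(3) C.field_axioms I(1)] I(3) by simp_all
  show fin: "finite {y \<in> carrier C. C.eval (map c (Irr K x)) y = \<zero>\<^bsub>C\<^esub>}" by (rule C.finite_roots(1)[OF p])
  obtain \<eta> where \<eta>: "\<eta> \<in> ring_hom (R\<lparr>carrier := join K (conj K x)\<rparr>) C" "\<forall>a\<in>K. \<eta> a = c a"
    using hom_extend_closed[OF assms(2) K(1) assms(3) cf(1,4)] K(3) cf(4) by blast
  define N' where "N' = join K (conj K x)"
  have N: "subfield N' R" unfolding N'_def by (rule join_subfield[OF K(2) cf(4)])
  interpret N: field "R\<lparr>carrier := N'\<rparr>" by (rule subfield_iff(2)[OF N])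
  have \<eta>N: "\<eta> \<in> ring_hom (R\<lparr>carrier := N'\<rparr>) C" using \<eta>(1) by (simp add: N'_def)
  have inj: "inj_on \<eta> N'"
    using non_trivial_field_hom_is_inj[OF \<eta>N N.field_axioms C.field_axioms] by simp
  have cN: "conj K x \<subseteq> N'" and KN: "K \<subseteq> N'" unfolding N'_def by (rule join_upper(2), rule join_upper(1))
  have Kset: "set (Irr K x) \<subseteq> K" by (rule poly_carrier_set(1)[OF subfieldE(1)[OF K(1)] I(1)])
  interpret h: ring_hom_ring "R\<lparr>carrier := N'\<rparr>" C \<eta>
    by (rule ring_hom_ringI2[OF N.ring_axioms C.ring_axioms \<eta>N])
  have "\<eta> ` conj K x \<subseteq> {y \<in> carrier C. C.eval (map c (Irr K x)) y = \<zero>\<^bsub>C\<^esub>}"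
  proof
    fix y assume "y \<in> \<eta> ` conj K x"
    then obtain z where z: "z \<in> conj K x" "y = \<eta> z" by blast
    have zN: "z \<in> N'" using z(1) cN by auto
    have mc: "map c (Irr K x) = map \<eta> (Irr K x)" using Kset \<eta>(2) by auto
    have "C.eval (map c (Irr K x)) y = \<eta> (eval (Irr K x) z)"
      unfolding mc z(2) using hom_eval[OF N \<eta>N C.field_axioms subset_trans[OF Kset KN] zN] by simp
    also have "\<dots> = \<zero>\<^bsub>C\<^esub>" using z(1) h.hom_zero by (simp add: conj_def)
    finally show "y \<in> {y \<in> carrier C. C.eval (map c (Irr K x)) y = \<zero>\<^bsub>C\<^esub>}"
      using h.hom_closed[of z] zN z(2) by simp
  qed
  from card_mono[OF fin this] have "degree (Irr K x) \<le> card {y \<in> carrier C. C.eval (map c (Irr K x)) y = \<zero>\<^bsub>C\<^esub>}"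
    using card_image[OF inj_on_subset[OF inj cN]] K(4)[OF assms(4)] by simp
  then show "card {y \<in> carrier C. C.eval (map c (Irr K x)) y = \<zero>\<^bsub>C\<^esub>} = degree (Irr K x)"
    using C.finite_roots(2)[OF p] by simp
qed

text \<open>
  With \<open>A = K(a)\<close>, an element of \<open>A \<otimes> C\<close> is a polynomial in \<open>a\<close> of degree less than \<open>[A : K]\<close>
  with coefficients in \<open>C\<close>; it is sent to its values at the roots in \<open>C\<close> of the minimal polynomial of \<open>a\<close>.
\<close>

lemma etale_iso:
  fixes C :: "('c, 'd) ring_scheme"
  assumes "galois_over K" "finite_ext K A" "algebraically_closed C" "c \<in> ring_hom (R\<lparr>carrier := K\<rparr>) C"
  shows "\<exists>n h. h \<in> ring_iso (tensor (R\<lparr>carrier := K\<rparr>) id (R\<lparr>carrier := A\<rparr>) c C) (RDirProd_list (replicate n C)) \<and>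
    (\<forall>s\<in>carrier C. h (tensor_class (R\<lparr>carrier := K\<rparr>) id (R\<lparr>carrier := A\<rparr>) c C {# (\<one>, s) #}) = replicate n s)"
proof -
  interpret C: algebraically_closed C by fact
  note K = galois_overD[OF assms(1)] and KA = finite_extD[OF assms(2)]
  note As = subringE[OF subfieldE(1)[OF KA(2)]]
  obtain a where a: "a \<in> A" "join K {a} = A" using primitive_element[OF assms(1,2)] by blast
  have aR: "a \<in> carrier R" using a(1) KA(5) by auto
  note alg = K(3)[OF aR]
  define n where "n = degree (Irr K a)"
  define V where "V = {y \<in> carrier C. C.eval (map c (Irr K a)) y = \<zero>\<^bsub>C\<^esub>}"
  have V: "finite V" "card V = n"
    using card_roots_Irr[OF assms(1,3,4) aR] by (simp_all add: V_def n_def)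
  obtain rs where "set rs = V" "distinct rs" using finite_distinct_list[OF V(1)] by blast
  then have rs: "set rs = V" "distinct rs" "length rs = n" using V(2) distinct_card by fastforce+
  have VC: "V \<subseteq> carrier C" by (auto simp: V_def)
  interpret AA: field "R\<lparr>carrier := A\<rparr>" by (rule subfield_iff(2)[OF KA(2)])
  have cK: "c x \<in> carrier C" if "x \<in> K" for x using assms(4) that by (auto simp: ring_hom_def)
  interpret T: tensor_setting "R\<lparr>carrier := K\<rparr>" id "R\<lparr>carrier := A\<rparr>" c C
  proof (rule tensor_setting.intro)
    show "cring (R\<lparr>carrier := A\<rparr>)" "cring C" by (rule AA.cring_axioms, rule C.cring_axioms)
    show "id \<in> carrier (R\<lparr>carrier := K\<rparr>) \<rightarrow> carrier (R\<lparr>carrier := A\<rparr>)" using KA(3) by auto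
    show "c \<in> carrier (R\<lparr>carrier := K\<rparr>) \<rightarrow> carrier C" using cK by auto
  qed
  let ?T = "tensor (R\<lparr>carrier := K\<rparr>) id (R\<lparr>carrier := A\<rparr>) c C" and ?P = "RDirProd_list (replicate n C)"
  note P = RDirProd_replicate[OF C.ring_axioms, where n = n]
  have "\<exists>\<theta>. \<theta> \<in> ring_hom (R\<lparr>carrier := A\<rparr>) C \<and> \<theta> a = r \<and> (\<forall>k\<in>K. \<theta> k = c k)" if "r \<in> V" for r
  proof -
    have r: "r \<in> carrier C" "C.eval (map c (Irr K a)) r = \<zero>\<^bsub>C\<^esub>" using that by (auto simp: V_def)
    show ?thesis using hom_extend[OF K(1) assms(4) C.field_axioms aR alg r] a(2) by metis
  qed
  then obtain \<theta> where \<theta>: "\<And>r. r \<in> V \<Longrightarrow> \<theta> r \<in> ring_hom (R\<lparr>carrier := A\<rparr>) C" "\<And>r. r \<in> V \<Longrightarrow> \<theta> r a = r"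
    "\<And>r k. r \<in> V \<Longrightarrow> k \<in> K \<Longrightarrow> \<theta> r k = c k" by metis
  have h: "ring_hom_ring (R\<lparr>carrier := A\<rparr>) C (\<theta> r)" if "r \<in> V" for r
    by (rule ring_hom_ringI2[OF AA.ring_axioms C.ring_axioms \<theta>(1)[OF that]])
  define \<beta> where "\<beta> r p = (if r \<in> V \<and> fst p \<in> A \<and> snd p \<in> carrier C then \<theta> r (fst p) \<otimes>\<^bsub>C\<^esub> snd p else \<zero>\<^bsub>C\<^esub>)" for r p
  have \<theta>C: "\<theta> r x \<in> carrier C" if "r \<in> V" "x \<in> A" for r x
    using ring_hom_closed[OF \<theta>(1)[OF that(1)]] that(2) by simp
  have \<beta>C: "\<beta> r p \<in> carrier C" for r p using \<theta>C by (simp add: \<beta>_def)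
  have \<theta>0: "\<theta> r \<zero> = \<zero>\<^bsub>C\<^esub>" if "r \<in> V" for r
  proof -
    interpret h: ring_hom_ring "R\<lparr>carrier := A\<rparr>" C "\<theta> r" by (rule h[OF that])
    show ?thesis using h.hom_zero by simp
  qed
  have \<theta>1: "\<theta> r \<one> = \<one>\<^bsub>C\<^esub>" if "r \<in> V" for r using ring_hom_one[OF \<theta>(1)[OF that]] by simp
  have \<theta>m: "\<theta> r (x \<otimes> y) = \<theta> r x \<otimes>\<^bsub>C\<^esub> \<theta> r y" if "r \<in> V" "x \<in> A" "y \<in> A" for r x y
    using ring_hom_mult[OF \<theta>(1)[OF that(1)], of x y] that(2,3) by simp
  have \<theta>a: "\<theta> r (x \<oplus> y) = \<theta> r x \<oplus>\<^bsub>C\<^esub> \<theta> r y" if "r \<in> V" "x \<in> A" "y \<in> A" for r x y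
    using ring_hom_add[OF \<theta>(1)[OF that(1)], of x y] that(2,3) by simp
  have wd: "tsum C (\<beta> r) M = tsum C (\<beta> r) N" if r: "r \<in> V" and eq: "T.teq M N" for r M N
  proof (rule tensor_eq_tsum[OF C.ring_axioms eq \<beta>C])
    fix x y s assume *: "x \<in> carrier (R\<lparr>carrier := A\<rparr>)" "y \<in> carrier (R\<lparr>carrier := A\<rparr>)" "s \<in> carrier C"
    then show "\<beta> r (x \<oplus>\<^bsub>R\<lparr>carrier := A\<rparr>\<^esub> y, s) = \<beta> r (x, s) \<oplus>\<^bsub>C\<^esub> \<beta> r (y, s)"
      using r As(7) \<theta>a \<theta>C by (simp add: \<beta>_def C.l_distr)
  next
    fix k x s assume *: "k \<in> carrier (R\<lparr>carrier := K\<rparr>)" "x \<in> carrier (R\<lparr>carrier := A\<rparr>)" "s \<in> carrier C"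
    then have kA: "k \<in> A" using KA(3) by auto
    have "\<theta> r (k \<otimes> x) = c k \<otimes>\<^bsub>C\<^esub> \<theta> r x" using \<theta>m[OF r kA] \<theta>(3)[OF r] * by simp
    then show "\<beta> r (id k \<otimes>\<^bsub>R\<lparr>carrier := A\<rparr>\<^esub> x, s) = \<beta> r (x, c k \<otimes>\<^bsub>C\<^esub> s)"
      using r As(6) kA \<theta>C cK * by (simp add: \<beta>_def C.m_assoc C.m_lcomm)
  qed (use r \<theta>C As(2) \<theta>0 in \<open>auto simp: \<beta>_def C.r_distr\<close>)
  \<comment> \<open>\<open>H\<close> lists the values at the roots in the order \<open>rs\<close>,
    computed on a representative chosen by \<open>SOME\<close>; \<open>wd\<close> shows that the
    choice does not matter.\<close>
  define H where "H U = map (\<lambda>r. tsum C (\<beta> r) (SOME M. M \<in> U)) rs" for U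
  have Hcl: "H (T.cl M) = map (\<lambda>r. tsum C (\<beta> r) M) rs" if "T.formal M" for M
  proof -
    have "M \<in> T.cl M" unfolding tensor_class_def using tensor_eq.refl[OF that] by (rule CollectI)
    then have "(SOME N. N \<in> T.cl M) \<in> T.cl M" by (rule someI)
    then have "T.teq M (SOME N. N \<in> T.cl M)" by (simp add: tensor_class_def)
    then show ?thesis unfolding H_def using wd rs(1) by simp
  qed
  have mem: "map (\<lambda>r. tsum C (\<beta> r) M) rs \<in> carrier ?P" for M
    using C.tsum_closed[OF \<beta>C] rs(3) by (auto simp: P(1))
  have rep: "\<exists>M. T.formal M \<and> U = T.cl M" if "U \<in> carrier ?T" for U using that by (auto simp: T.tensor_simps)
  have ev: "tsum C (\<beta> r) (mset (zip (exp_base a (length ss)) ss)) = C.eval ss r"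
    if "r \<in> V" "set ss \<subseteq> carrier C" for r ss
    using that(2)
  proof (induction ss)
    case Nil
    then show ?case using C.tsum_empty[where \<beta> = "\<beta> r", OF \<beta>C] by (simp add: exp_base_def)
  next
    case (Cons s ss)
    have pow: "a [^] i \<in> A \<and> \<theta> r (a [^] i) = r [^]\<^bsub>C\<^esub> i" for i :: nat
    proof (induction i)
      case 0
      then show ?case using As(3) \<theta>1[OF that(1)] by simp
    next
      case (Suc i)
      then show ?case using As(6) a(1) \<theta>m[OF that(1), of "a [^] i" a] \<theta>(2)[OF that(1)] by simp
    qed
    have rC: "r [^]\<^bsub>C\<^esub> length ss \<in> carrier C" using that(1) VC by auto
    have "\<beta> r (a [^] length ss, s) = s \<otimes>\<^bsub>C\<^esub> r [^]\<^bsub>C\<^esub> length ss"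
      using pow[of "length ss"] that(1) Cons.prems C.m_comm[OF rC] by (simp add: \<beta>_def)
    moreover have "exp_base a (length (s # ss)) = a [^] length ss # exp_base a (length ss)"
      by (simp add: exp_base_def)
    ultimately show ?case
      using C.tsum_add_mset[where \<beta> = "\<beta> r", OF \<beta>C] Cons by simp
  qed
  have ebA: "set (exp_base a m) \<subseteq> A" for m
  proof -
    have "a [^] i \<in> A" for i :: nat by (induction i) (use As(3,6) a(1) in auto)
    then show ?thesis by (auto simp: exp_base_def)
  qed
  have form: "T.formal (mset (zip (exp_base a m) ss))" if "set ss \<subseteq> carrier C" for m ss
    using subsetD[OF ebA] that by (auto dest: set_zip_leftD set_zip_rightD)
  have iso: "H \<in> ring_iso ?T ?P"
  proof (rule ring_iso_memI)
    fix U assume "U \<in> carrier ?T"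
    then obtain M where M: "T.formal M" "U = T.cl M" using rep by blast
    show "H U \<in> carrier ?P" unfolding M(2) Hcl[OF M(1)] by (rule mem)
    fix W assume "W \<in> carrier ?T"
    then obtain N where N: "T.formal N" "W = T.cl N" using rep by blast
    have mult: "tsum C (\<beta> r) (formal_mult (R\<lparr>carrier := A\<rparr>) C M N) = tsum C (\<beta> r) M \<otimes>\<^bsub>C\<^esub> tsum C (\<beta> r) N" if r: "r \<in> V" for r
    proof (rule C.tsum_formal_mult[OF \<beta>C])
      fix p q assume "p \<in># M" "q \<in># N"
      then have pq: "fst p \<in> A" "snd p \<in> carrier C" "fst q \<in> A" "snd q \<in> carrier C"
        using subsetD[OF M(1)] subsetD[OF N(1)] by (auto simp: mem_Times_iff)
      then show "\<beta> r (fst p \<otimes>\<^bsub>R\<lparr>carrier := A\<rparr>\<^esub> fst q, snd p \<otimes>\<^bsub>C\<^esub> snd q) = \<beta> r p \<otimes>\<^bsub>C\<^esub> \<beta> r q"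
        using r As(6) \<theta>m \<theta>C by (simp add: \<beta>_def C.m_assoc C.m_lcomm)
    qed
    have f: "T.formal (formal_mult (R\<lparr>carrier := A\<rparr>) C M N)"
      by (rule formal_mult_closed[OF AA.ring_axioms C.ring_axioms M(1) N(1)])
    show "H (U \<otimes>\<^bsub>?T\<^esub> W) = H U \<otimes>\<^bsub>?P\<^esub> H W"
      unfolding M(2) N(2) T.cl_mult[OF M(1) N(1)] Hcl[OF M(1)] Hcl[OF N(1)] Hcl[OF f] P(2)[OF mem mem]
      using mult rs(1) by (auto intro!: nth_equalityI)
    have f2: "T.formal (M + N)" using M(1) N(1) by simp
    show "H (U \<oplus>\<^bsub>?T\<^esub> W) = H U \<oplus>\<^bsub>?P\<^esub> H W"
      unfolding M(2) N(2) T.cl_add[OF M(1) N(1)] Hcl[OF M(1)] Hcl[OF N(1)] Hcl[OF f2] P(3)[OF mem mem]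
      using C.tsum_union[where \<beta> = "\<beta> _", OF \<beta>C] by (auto intro!: nth_equalityI)
  next
    have f: "T.formal {#(\<one>, \<one>\<^bsub>C\<^esub>)#}" using As(3) by simp
    have "H (T.cl {#(\<one>, \<one>\<^bsub>C\<^esub>)#}) = replicate n \<one>\<^bsub>C\<^esub>"
      unfolding Hcl[OF f] using As(3) \<theta>1 rs(1,3) C.tsum_add_mset[where \<beta> = "\<beta> _", OF \<beta>C] C.tsum_empty[where \<beta> = "\<beta> _", OF \<beta>C]
      by (intro nth_equalityI) (auto simp: \<beta>_def)
    then show "H \<one>\<^bsub>?T\<^esub> = \<one>\<^bsub>?P\<^esub>" unfolding T.tensor_simps P(4) by (simp del: id_apply)
  next
    show "bij_betw H (carrier ?T) (carrier ?P)"
      unfolding bij_betw_def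
    proof (intro conjI inj_onI)
      fix U W assume U: "U \<in> carrier ?T" and W: "W \<in> carrier ?T" and eq: "H U = H W"
      obtain M where M: "T.formal M" "U = T.cl M" using rep U by blast
      obtain N where N: "T.formal N" "W = T.cl N" using rep W by blast
      \<comment> \<open>Injectivity: both classes are given by coefficient lists of length
        \<open>n\<close> in the powers of \<open>a\<close>, and the values at \<open>n\<close>
        distinct roots determine such a list.\<close>
      have Sp: "Span K (exp_base a n) = A"
        using Span_exp_base[OF K(1) aR alg] simple_extension_eq_join[OF K(1) aR alg] a(2) by (simp add: n_def)
      note span = tensor_span[OF K(1) KA(2,3) C.cring_axioms assms(4) exp_base_closed[OF aR] Sp]
      have le: "length (exp_base a n) = n" by (simp add: exp_base_def)
      obtain ss where ss: "length ss = n" "set ss \<subseteq> carrier C" "T.teq M (mset (zip (exp_base a n) ss))"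
        using span[of M] M(1) unfolding le by auto
      obtain ts where ts: "length ts = n" "set ts \<subseteq> carrier C" "T.teq N (mset (zip (exp_base a n) ts))"
        using span[of N] N(1) unfolding le by auto
      have "C.eval ss r = C.eval ts r" if r: "r \<in> V" for r
      proof -
        have "tsum C (\<beta> r) M = tsum C (\<beta> r) N" using eq r rs(1) unfolding M(2) N(2) Hcl[OF M(1)] Hcl[OF N(1)] by simp
        then show ?thesis
          using ev[OF r ss(2)] ev[OF r ts(2)] wd[OF r ss(3)] wd[OF r ts(3)] ss(1) ts(1) by simp
      qed
      then have "ss = ts"
        by (intro C.eval_determines_list[OF rs(2) _ rs(3) ss(1) ts(1) ss(2) ts(2)]) (use rs(1) VC in auto)
      then have "T.teq M N" using tensor_eq.trans[OF ss(3)] tensor_eq.sym[OF ts(3)] by (simp del: id_apply)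
      then show "U = W" unfolding M(2) N(2) T.cl_eq_iff[OF M(1)] .
    next
      show "H ` carrier ?T = carrier ?P"
      proof (rule equalityI; rule subsetI)
        fix t assume "t \<in> H ` carrier ?T"
        then obtain U where U: "U \<in> carrier ?T" "t = H U" by blast
        obtain M where M: "T.formal M" "U = T.cl M" using rep[OF U(1)] by blast
        show "t \<in> carrier ?P" unfolding U(2) M(2) Hcl[OF M(1)] by (rule mem)
      next
        fix t assume "t \<in> carrier ?P"
        then have t: "length t = n" "set t \<subseteq> carrier C" by (auto simp: P(1))
        \<comment> \<open>Surjectivity by interpolation: \<open>g\<close> assigns to each root the
          entry of \<open>t\<close> in its position.\<close>
        define g where "g r = the (map_of (zip rs t) r)" for r
        have g: "g (rs ! i) = t ! i" if "i < n" for i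
          using map_of_zip_nth[of rs t i] rs(2,3) t(1) that by (simp add: g_def)
        have gC: "g r \<in> carrier C" if "r \<in> V" for r
          using that g t rs(1,3) nth_mem by (metis in_set_conv_nth subsetD)
        obtain p where p: "p \<in> carrier (poly_ring C)" "\<forall>r\<in>V. C.eval p r = g r"
          using C.poly_interpolation[OF V(1) VC, of g] gC by blast
        have pC: "set p \<subseteq> carrier C" by (rule C.poly_carrier_set(2)[OF C.carrier_is_subring p(1)])
        define M where "M = mset (zip (exp_base a (length p)) p)"
        have M: "T.formal M" unfolding M_def by (rule form[OF pC])
        have "H (T.cl M) = t"
          unfolding Hcl[OF M] unfolding M_def
        proof (rule nth_equalityI)
          fix i assume "i < length (map (\<lambda>r. tsum C (\<beta> r) (mset (zip (exp_base a (length p)) p))) rs)"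
          then have i: "i < n" "rs ! i \<in> V" using rs(1,3) by auto
          then show "map (\<lambda>r. tsum C (\<beta> r) (mset (zip (exp_base a (length p)) p))) rs ! i = t ! i"
            using ev[OF i(2) pC] p(2) g[OF i(1)] rs(3) by simp
        qed (simp add: rs(3) t(1))
        moreover have "T.cl M \<in> carrier ?T" using M by (auto simp: T.tensor_simps)
        ultimately show "t \<in> H ` carrier ?T" by blast
      qed
    qed
  qed
  moreover have "H (T.cl {#(\<one>, s)#}) = replicate n s" if s: "s \<in> carrier C" for s
  proof -
    have f: "T.formal {#(\<one>, s)#}" using As(3) s by simp
    show ?thesis
      unfolding Hcl[OF f] using As(3) \<theta>1 rs(1,3) s C.tsum_add_mset[where \<beta> = "\<beta> _", OF \<beta>C] C.tsum_empty[where \<beta> = "\<beta> _", OF \<beta>C]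
      by (intro nth_equalityI) (auto simp: \<beta>_def)
  qed
  ultimately show ?thesis by blast
qed

lemma etale_if_finite_ext:
  assumes "galois_over K" "finite_ext K A"
  shows "etale_algebra (R\<lparr>carrier := K\<rparr>) id (R\<lparr>carrier := A\<rparr>)"
proof -
  interpret KK: field "R\<lparr>carrier := K\<rparr>" by (rule subfield_iff(2)[OF galois_overD(1)[OF assms(1)]])
  interpret C: algebraic_closure "KK.alg_closure" "KK.indexed_const ` carrier (R\<lparr>carrier := K\<rparr>)"
    by (rule KK.alg_closureE(1))
  show ?thesis
    using etale_iso[OF assms C.algebraically_closed_axioms KK.alg_closureE(2)]
    by (simp add: etale_algebra_def)
qed

end

section \<open>The strong core\<close>

context difference_field
begin

lemma core_ext_finite: "core_ext K A \<Longrightarrow> finite_ext K A"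
  by (simp add: core_ext_def)

lemma core_ext_join:
  assumes "core_ext K A" "core_ext K B"
  shows "core_ext K (join A B)"
  unfolding core_ext_def
proof
  note KA = finite_extD[OF core_ext_finite[OF assms(1)]] and KB = finite_extD[OF core_ext_finite[OF assms(2)]]
  have sub: "subfield (join A B) R" by (rule join_subfield[OF KA(5) KB(5)])
  show "finite_ext K (join A B)"
    by (rule finite_ext_trans(1)[OF core_ext_finite[OF assms(1)]
          finite_ext_join(1)[OF core_ext_finite[OF assms(2)] KA(2,3)]])
  have up: "\<phi> ` A \<subseteq> \<phi> ` join A B" "\<phi> ` B \<subseteq> \<phi> ` join A B"
    by (rule image_mono[OF join_upper(1)], rule image_mono[OF join_upper(2)])
  have im: "\<phi> ` join A B \<subseteq> join A B"
  proof -
    have "\<phi> ` join A B = generate_field R (\<phi> ` (A \<union> B))"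
      using hom_generate_field[OF phi_hom, of "A \<union> B"] KA(5) KB(5) by simp
    also have "\<dots> \<subseteq> join A B"
      using core_ext_stable[OF assms(1)] core_ext_stable[OF assms(2)]
      by (intro generate_field_mono) blast
    finally show ?thesis .
  qed
  have sub': "subfield (join K (\<phi> ` join A B)) R"
    by (rule join_subfield[OF KA(6) subset_trans[OF im subfieldE(3)[OF sub]]])
  show "join K (\<phi> ` join A B) = join A B"
  proof (rule subset_antisym)
    show "join K (\<phi> ` join A B) \<subseteq> join A B"
      by (rule join_least[OF sub subset_trans[OF KA(3) join_upper(1)] im])
    have "join K (\<phi> ` A) \<subseteq> join K (\<phi> ` join A B)" "join K (\<phi> ` B) \<subseteq> join K (\<phi> ` join A B)"
      by (rule generate_field_mono[OF Un_mono[OF subset_refl up(1)]], rule generate_field_mono[OF Un_mono[OF subset_refl up(2)]])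
    then have "A \<subseteq> join K (\<phi> ` join A B)" "B \<subseteq> join K (\<phi> ` join A B)"
      using assms by (simp_all add: core_ext_def)
    then show "join A B \<subseteq> join K (\<phi> ` join A B)" by (rule join_least[OF sub'])
  qed
qed

definition core :: "'a set \<Rightarrow> 'a set"
  where "core K = \<Union>{A. core_ext K A}"

text \<open>An etale subalgebra is a finite extension because all of \<open>R\<close> is algebraic
  over \<open>K\<close>, and for finite extensions stable under \<open>\<phi>\<close>
  sigma-separability amounts to \<open>core_ext\<close>. So the two families whose unions are
  compared agree member by member.\<close>

lemma strong_core_eq:
  assumes "base K"
  shows "strong_core R \<phi> K (carrier R) = core K"
proof -
  note K = baseD[OF assms]
  have "(subring A R \<and> K \<subseteq> A \<and> A \<subseteq> carrier R \<and> \<phi> ` A \<subseteq> A \<and>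
         strongly_sigma_etale (R\<lparr>carrier := K\<rparr>) \<phi> id (R\<lparr>carrier := A\<rparr>) \<phi>) \<longleftrightarrow> core_ext K A" for A
  proof
    assume *: "subring A R \<and> K \<subseteq> A \<and> A \<subseteq> carrier R \<and> \<phi> ` A \<subseteq> A \<and>
         strongly_sigma_etale (R\<lparr>carrier := K\<rparr>) \<phi> id (R\<lparr>carrier := A\<rparr>) \<phi>"
    then have A: "subring A R" "K \<subseteq> A" "A \<subseteq> carrier R" "\<phi> ` A \<subseteq> A"
      "sigma_separable (R\<lparr>carrier := K\<rparr>) \<phi> id (R\<lparr>carrier := A\<rparr>) \<phi>"
      "etale_algebra (R\<lparr>carrier := K\<rparr>) id (R\<lparr>carrier := A\<rparr>)"
      unfolding strongly_sigma_etale_def by blast+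
    have "finite_ext K A"
      by (rule finite_ext_if_etale[OF K(3) A(1,2) _ A(6)]) (use A(3) galois_overD(3)[OF K(1)] in blast)
    then show "core_ext K A" by (rule core_ext_if_sigma_separable[OF assms _ A(4,5)])
  next
    assume A: "core_ext K A"
    note KA = finite_extD[OF core_ext_finite[OF A]]
    show "subring A R \<and> K \<subseteq> A \<and> A \<subseteq> carrier R \<and> \<phi> ` A \<subseteq> A \<and>
         strongly_sigma_etale (R\<lparr>carrier := K\<rparr>) \<phi> id (R\<lparr>carrier := A\<rparr>) \<phi>"
      unfolding strongly_sigma_etale_def
      by (intro conjI subfieldE(1)[OF KA(2)] KA(3,5) core_ext_stable[OF A]
          core_ext_sigma_separable[OF assms A] etale_if_finite_ext[OF K(1) core_ext_finite[OF A]])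
  qed
  then show ?thesis by (simp only: strong_core_def core_def)
qed

lemma core_ext_refl:
  assumes "base K"
  shows "core_ext K K"
  using finite_ext_refl(1) join_absorb(1) baseD[OF assms] by (simp add: core_ext_def)

lemma core_ext_in_core: "core_ext K A \<Longrightarrow> A \<subseteq> core K"
  by (auto simp: core_def)

text \<open>Composita make the core extensions a directed family, so finitely many elements of the
  core can be treated inside one finite extension.\<close>

lemma core_directed:
  assumes "base K" "finite T" "T \<subseteq> core K"
  shows "\<exists>A. core_ext K A \<and> T \<subseteq> A"
  using assms(2,3)
proof (induction T)
  case empty
  then show ?case using core_ext_refl[OF assms(1)] by blast
next
  case (insert t T)
  then obtain A B where AB: "core_ext K A" "T \<subseteq> A" "core_ext K B" "t \<in> B" by (auto simp: core_def)
  have "T \<subseteq> join A B" "t \<in> join A B"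
    using AB(2,4) join_upper(1)[where T = A and S = B] join_upper(2)[where T = A and S = B] by blast+
  then show ?case using core_ext_join[OF AB(1,3)] by blast
qed

lemma core_base:
  assumes "base K"
  shows "base (core K)" "K \<subseteq> core K"
proof -
  note K = baseD[OF assms]
  show KU: "K \<subseteq> core K" by (rule core_ext_in_core[OF core_ext_refl[OF assms]])
  have UR: "core K \<subseteq> carrier R"
    using finite_extD(5)[OF core_ext_finite] by (auto simp: core_def)
  have "generate_field R (core K) \<subseteq> core K"
  proof
    fix x assume "x \<in> generate_field R (core K)"
    then obtain T where T: "finite T" "T \<subseteq> core K" "x \<in> generate_field R T"
      using generate_field_finitary by blast
    then obtain A where A: "core_ext K A" "T \<subseteq> A" using core_directed[OF assms] by blast
    note KA = finite_extD[OF core_ext_finite[OF A(1)]]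
    have "generate_field R T \<subseteq> A"
      by (rule generate_field_min_subfield1[OF subset_trans[OF A(2) KA(5)] KA(2) A(2)])
    then show "x \<in> core K" using T(3) core_ext_in_core[OF A(1)] by blast
  qed
  moreover have "core K \<subseteq> generate_field R (core K)" by (auto intro: generate_field.incl)
  ultimately have "core K = generate_field R (core K)" by blast
  then have sub: "subfield (core K) R" using generate_field_is_subfield[OF UR] by simp
  have "\<phi> ` core K \<subseteq> core K" using core_ext_stable unfolding core_def by blast
  then show "base (core K)" using galois_over_mono[OF K(1) sub KU] by (simp add: base_def)
qed

text \<open>Only finitely many elements of the core occur in the expressions for \<open>Z\<close>,
  and one core extension contains them.\<close>

lemma core_join_finitary:
  assumes "base K" "finite Z" "Z \<subseteq> join (core K) Y"
  shows "\<exists>A. core_ext K A \<and> Z \<subseteq> join A Y"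
  using assms(2,3)
proof (induction Z)
  case empty
  then show ?case using core_ext_refl[OF assms(1)] by blast
next
  case (insert x Z)
  then obtain A where A: "core_ext K A" "Z \<subseteq> join A Y" by blast
  obtain T where T: "finite T" "T \<subseteq> core K \<union> Y" "x \<in> generate_field R T"
    using generate_field_finitary[of x "core K \<union> Y"] insert.prems by auto
  obtain B where B: "core_ext K B" "T \<inter> core K \<subseteq> B"
    using core_directed[OF assms(1), of "T \<inter> core K"] T(1) by auto
  have "join A Y \<subseteq> join (join A B) Y"
    by (intro generate_field_mono Un_mono join_upper(1) subset_refl)
  moreover have "generate_field R T \<subseteq> join B Y" using T(2) B(2) by (intro generate_field_mono) blast
  moreover have "join B Y \<subseteq> join (join A B) Y"
    by (intro generate_field_mono Un_mono join_upper(2) subset_refl)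
  ultimately have "insert x Z \<subseteq> join (join A B) Y" using A(2) T(3) by blast
  then show ?case using core_ext_join[OF A(1) B(1)] by blast
qed

text \<open>An extension \<open>M\<close> as in the definition of coreless descends to an extension of \<open>K\<close> by finitely many elements.\<close>

lemma coreless_core:
  assumes "base K"
  shows "coreless (core K)"
  unfolding coreless_def
proof (intro allI impI)
  fix M assume M: "finite_ext (core K) M" "join (core K) (\<phi> ` M) = M"
  note K = baseD[OF assms] and U = baseD[OF core_base(1)[OF assms]]
  note UM = finite_extD[OF M(1)]
  obtain S where S: "finite S" "S \<subseteq> M" "join (core K) S = M" by (rule finite_ext_generators[OF M(1)])
  have SR: "S \<subseteq> carrier R" using S(2) UM(5) by blast
  have "join (core K) (\<phi> ` S) = M"
    using join_hom_join[OF U(3) phi_hom U(2,4) SR] S(3) M(2) by simp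
  \<comment> \<open>\<open>A\<close> is chosen so that \<open>S\<close> lies in
    \<open>A(\<phi> S)\<close>, and \<open>B\<close> below so that \<open>\<phi> S\<close> lies in
    \<open>B(S)\<close>. Over the compositum \<open>D\<close> of both, these inclusions say that
    \<open>D(S)\<close> is itself a core extension of \<open>K\<close>.\<close>
  then obtain A where A: "core_ext K A" "S \<subseteq> join A (\<phi> ` S)"
    using core_join_finitary[OF assms S(1), of "\<phi> ` S"] S(2) by auto
  have "\<phi> ` M \<subseteq> M" using join_upper(2)[where T = "core K" and S = "\<phi> ` M"] M(2) by simp
  then have "\<phi> ` S \<subseteq> join (core K) S" using S(2,3) by blast
  then obtain B where B: "core_ext K B" "\<phi> ` S \<subseteq> join B S"
    using core_join_finitary[OF assms finite_imageI[OF S(1)]] by blast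
  define D where "D = join A B"
  have D: "core_ext K D" unfolding D_def by (rule core_ext_join[OF A(1) B(1)])
  have AD: "A \<subseteq> D" "B \<subseteq> D" unfolding D_def by (rule join_upper(1), rule join_upper(2))
  have SD: "S \<subseteq> join D (\<phi> ` S)"
    by (rule subset_trans[OF A(2)]) (intro generate_field_mono Un_mono AD(1) subset_refl)
  have pSD: "\<phi> ` S \<subseteq> join D S"
    by (rule subset_trans[OF B(2)]) (intro generate_field_mono Un_mono AD(2) subset_refl)
  note KD = finite_extD[OF core_ext_finite[OF D]]
  have sub: "subfield (join D S) R" by (rule join_subfield[OF KD(5) SR])
  have "finite_ext D (join D S)"
    by (rule finite_ext_adjoin[OF KD(2) S(1) SR])
      (use galois_overD(3)[OF galois_over_mono[OF K(1) KD(2,3)]] SR in blast)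
  then have fin: "finite_ext K (join D S)" by (rule finite_ext_trans(1)[OF core_ext_finite[OF D]])
  have im: "\<phi> ` join D S \<subseteq> join D S"
  proof -
    have "\<phi> ` join D S = generate_field R (\<phi> ` (D \<union> S))"
      using hom_generate_field[OF phi_hom, of "D \<union> S"] KD(5) SR by simp
    also have "\<dots> \<subseteq> join D S"
    proof (rule generate_field_min_subfield1[OF _ sub])
      show "\<phi> ` (D \<union> S) \<subseteq> carrier R" using phi_closed KD(5) SR by blast
      show "\<phi> ` (D \<union> S) \<subseteq> join D S"
        unfolding image_Un
        by (rule Un_least[OF subset_trans[OF core_ext_stable[OF D] join_upper(1)] pSD])
    qed
    finally show ?thesis .
  qed
  have "join K (\<phi> ` join D S) = join D S"
  proof (rule subset_antisym)
    show "join K (\<phi> ` join D S) \<subseteq> join D S"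
      by (rule join_least[OF sub subset_trans[OF KD(3) join_upper(1)] im])
    have sub': "subfield (join K (\<phi> ` join D S)) R"
      by (rule join_subfield[OF KD(6) subset_trans[OF im subfieldE(3)[OF sub]]])
    have "join K (\<phi> ` D) \<subseteq> join K (\<phi> ` join D S)"
      by (intro generate_field_mono Un_mono subset_refl image_mono join_upper(1))
    then have D': "D \<subseteq> join K (\<phi> ` join D S)" using D by (simp add: core_ext_def)
    have "\<phi> ` S \<subseteq> join K (\<phi> ` join D S)"
      by (rule subset_trans[OF image_mono[OF join_upper(2)] join_upper(2)])
    then have "S \<subseteq> join K (\<phi> ` join D S)" by (rule subset_trans[OF SD join_least[OF sub' D']])
    then show "join D S \<subseteq> join K (\<phi> ` join D S)" by (rule join_least[OF sub' D'])
  qed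
  then have "core_ext K (join D S)" using fin by (simp add: core_ext_def)
  then have "S \<subseteq> core K" by (rule subset_trans[OF join_upper(2) core_ext_in_core])
  then show "M = core K" using join_absorb(1)[OF U(3)] S(3) by simp
qed

end

theorem theorem2p9:
  fixes L :: "('a, 'm) ring_scheme" and \<phi> :: "'a \<Rightarrow> 'a" and K :: "'a set"
  assumes "sigma_field L \<phi>"
    and "sigma_subfield L \<phi> K"
    and "finitely_sigma_generated L \<phi> K (carrier L)"
    and "galois_extension L K (carrier L)"
  shows "\<exists>(n :: nat) (F :: nat \<Rightarrow> 'a set).
    (\<forall>i\<le>n. sigma_subfield L \<phi> (F i) \<and> K \<subseteq> F i) \<and>
    (\<forall>i<n. F i \<subseteq> F (Suc i)) \<and>
    F 0 = strong_core L \<phi> K (carrier L) \<and>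
    (\<forall>i<n. benign L \<phi> (F i) (F (Suc i))) \<and>
    sigma_radicial \<phi> (F n) (carrier L)"
proof -
  interpret difference_field L \<phi>
    using assms(1) by (simp add: sigma_field_def sigma_ring_def difference_field_def difference_field_axioms_def)
  \<comment> \<open>The ambient field of the locale is \<open>L\<close> itself, so the Galois
    hypothesis is exactly what makes \<open>K\<close> a base.\<close>
  have K: "base K"
    using galois_over_if_galois_extension[OF _ assms(4)] assms(2) by (simp add: base_def sigma_subfield_def)
  note U = core_base[OF K]
  obtain F0 where F0: "finite F0" "F0 \<subseteq> carrier L" "carrier L = sigma_gen L \<phi> K F0"
    using assms(3) unfolding finitely_sigma_generated_def by blast
  \<comment> \<open>The same finite set generates \<open>L\<close> over the larger field
    \<open>core K\<close>, where the decomposition theorem applies.\<close>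
  have "sigma_gen L \<phi> K F0 \<subseteq> sigma_gen L \<phi> (core K) F0"
    unfolding sigma_gen_def by (intro generate_field_mono Un_mono U(2) subset_refl)
  then have "carrier L \<subseteq> sigma_gen L \<phi> (core K) F0" using F0(3) by simp
  then obtain n F where "decomposition (core K) (carrier L) n F"
    using decomposition_of_finitely_generated[OF U(1) coreless_core[OF K] F0(1,2)] by blast
  then have F: "F 0 = core K" "\<forall>i\<le>n. base (F i) \<and> core K \<subseteq> F i"
    "\<forall>i<n. F i \<subseteq> F (Suc i) \<and> benign L \<phi> (F i) (F (Suc i))" "sigma_radicial \<phi> (F n) (carrier L)"
    unfolding decomposition_def by blast+
  have "sigma_subfield L \<phi> (F i) \<and> K \<subseteq> F i" if "i \<le> n" for i
    using F(2) that baseD(2,3)[of "F i"] U(2) unfolding sigma_subfield_def by blast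
  then show ?thesis
    using F strong_core_eq[OF K] by (intro exI[of _ n] exI[of _ F]) simp
qed

end
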